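(* Let $\{u^\varepsilon\}$ be a bounded sequence in $H^1(\Omega)$ that converges weakly to $u$ in $H^1(\Omega)$. Then: (i) the sequence $\{u^\varepsilon\}$ converges locally-periodic two-scale to $u$ (regarded as a function of $(x,y)$ independent of $y$); (ii) there exist a subsequence of $\{\nabla u^\varepsilon\}$, denoted again by $\{\nabla u^\varepsilon\}$, and a function $u_1\in L^2(\Omega;H^1_{\mathrm{per}}(Y_x)/\mathbb R)$ such that $\nabla u^\varepsilon\to\nabla u+\nabla_yu_1$ in the locally-periodic two-scale sense (componentwise) as $\varepsilon\to0$.
   Context: Setting. $\Omega\subset\mathbb R^d$ is a bounded Lipschitz domain; $Y=[0,1]^d$; $r\in(0,1)$ is fixed; $\varepsilon>0$ runs through a sequence tending to $0$. For each $x\in\mathbb R^d$ an invertible matrix $D_x:=D(x)\in\mathbb R^{d\times d}$ with inverse $D_x^{-1}:=D^{-1}(x)$ is given, with $D,D^{-1}\in \mathrm{Lip}(\mathbb R^d;\mathbb R^{d\times d})$ and $0<D_1\le|\det D(x)|\le D_2<\infty$ for all $x\in\overline\Omega$. Put $Y_x=D_xY$. Function spaces. The subscript "per" on a space over $Y$ means $Y$-periodic (functions are extended periodically to $\mathbb R^d$). $\psi\in L^2(\Omega;C_{\mathrm{per}}(Y_x))$ means $\psi(x,y)=\tilde\psi(x,D_x^{-1}y)$ with $\tilde\psi\in L^2(\Omega;C_{\mathrm{per}}(Y))$; $\tilde\psi$ is called the function corresponding to $\psi$. Likewise, $L^2(\Omega;L^2(Y_x))$ and $L^2(\Omega;H^1_{\mathrm{per}}(Y_x)/\mathbb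 R)$ consist of the functions $u(x,y)=\tilde u(x,D_x^{-1}y)$ with $\tilde u\in L^2(\Omega;L^2(Y))$, respectively $\tilde u\in L^2(\Omega;H^1_{\mathrm{per}}(Y)/\mathbb R)$. Covering. For each $\varepsilon$, $\{\Omega_n^\varepsilon\}_{1\le n\le N_\varepsilon}$ is a family of open non-intersecting cubes of side $\varepsilon^r$ with $\Omega\subset\bigcup_{n=1}^{N_\varepsilon}\overline{\Omega_n^\varepsilon}$ and $\Omega_n^\varepsilon\cap\Omega\neq\emptyset$. Points $x_n^\varepsilon\in\Omega_n^\varepsilon\cap\Omega$ are arbitrarily chosen and fixed, and $\tilde x_n^\varepsilon$ is either an arbitrarily chosen fixed point of $\Omega_n^\varepsilon\cap\Omega$ or $\tilde x_n^\varepsilon=D_{x_n^\varepsilon}\varepsilon k$ with some $k\in\mathbb Z^d$ (in which case, by periodicity, $\tilde x_n^\varepsilon$ may be omitted from the formula below). Locally-periodic approximation. For $x\in\Omega$, $$(\mathcal L^\varepsilon\psi)(x)=\sum_{n=1}^{N_\varepsilon}\tilde\psi\Big(x,\frac{D_{x_n^\varepsilon}^{-1}(x-\tilde x_n^\varepsilon)}{\varepsilon}\Big)\chi_{\Omega_n^\varepsilon}(x),$$ where $\chi_A$ is the characteristic function of $A$. Locally-periodic two-scale (l-t-s) convergence. A sequence $\{u^\varepsilon\}\subset L^2(\Omega)$ converges locally-periodic two-scale to $u\in L^2(\Omega;L^2(Y_x))$ as $\varepsilon\to0$ if for every $\psi\in L^2(\Omega;C_{\mathrm{per}}(Y_x))$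 $$\lim_{\varepsilon\to0}\int_\Omega u^\varepsilon(x)\,\mathcal L^\varepsilon\psi(x)\,dx=\int_\Omega\frac1{|Y_x|}\int_{Y_x}u(x,y)\psi(x,y)\,dy\,dx.$$ *)

theory Defs
  imports "HOL-Analysis.Analysis"
begin

definition bounded_lipschitz_domain :: "(real^'d) set \<Rightarrow> bool" where
  "bounded_lipschitz_domain \<Omega> \<longleftrightarrow>
     open \<Omega> \<and> connected \<Omega> \<and> \<Omega> \<noteq> {} \<and> bounded \<Omega> \<and>
     (\<forall>p\<in>frontier \<Omega>. \<exists>e \<gamma> L \<rho>. norm e = 1 \<and> \<rho> > 0 \<and> L-lipschitz_on {z. z \<bullet> e = 0} \<gamma> \<and>
        \<Omega> \<inter> ball p \<rho> = {x \<in> ball p \<rho>. \<gamma> (x - (x \<bullet> e) *\<^sub>R e) < x \<bullet> e})"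

definition partial_deriv :: "'d \<Rightarrow> (real^'d \<Rightarrow> real) \<Rightarrow> real^'d \<Rightarrow> real" where
  "partial_deriv i \<phi> x = frechet_derivative \<phi> (at x) (axis i 1)"

primrec C_k :: "nat \<Rightarrow> (real^'d \<Rightarrow> real) \<Rightarrow> bool" where
  "C_k 0 \<phi> \<longleftrightarrow> continuous_on UNIV \<phi>"
| "C_k (Suc k) \<phi> \<longleftrightarrow> \<phi> differentiable_on UNIV \<and> (\<forall>i. C_k k (partial_deriv i \<phi>))"

definition test_functions :: "(real^'d) set \<Rightarrow> (real^'d \<Rightarrow> real) set" where
  "test_functions S =
     {\<phi>. (\<forall>k. C_k k \<phi>) \<and> (\<exists>K. compact K \<and> K \<subseteq> S \<and> (\<forall>x. x \<notin> K \<longrightarrow> \<phi> x = 0))}"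

definition has_weak_gradient ::
    "(real^'d) set \<Rightarrow> (real^'d \<Rightarrow> real) \<Rightarrow> (real^'d \<Rightarrow> real^'d) \<Rightarrow> bool" where
  "has_weak_gradient S v g \<longleftrightarrow>
     (\<forall>K. compact K \<and> K \<subseteq> S \<longrightarrow> v absolutely_integrable_on K \<and> g absolutely_integrable_on K) \<and>
     (\<forall>\<phi>\<in>test_functions S. \<forall>i.
        (LINT x|lebesgue_on S. v x * partial_deriv i \<phi> x) =
        - (LINT x|lebesgue_on S. g x $ i * \<phi> x))"

text \<open>Weak gradients are determined up to null sets only; the following picks a representative.\<close>
definition weak_gradient ::
    "(real^'d) set \<Rightarrow> (real^'d \<Rightarrow> real) \<Rightarrow> real^'d \<Rightarrow> real^'d" where
  "weak_gradient S v = (SOME g. has_weak_gradient S v g)"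

text \<open>Elements of \<open>L\<^sup>2\<close> and \<open>H\<^sup>1\<close> are represented by functions, without passing to
  classes modulo equality almost everywhere; the norms below are thus seminorms.\<close>
definition L2 :: "(real^'d) set \<Rightarrow> (real^'d \<Rightarrow> 'b::euclidean_space) set" where
  "L2 S = {f. f \<in> borel_measurable (lebesgue_on S) \<and>
              integrable (lebesgue_on S) (\<lambda>x. (norm (f x))\<^sup>2)}"

definition L2_norm :: "(real^'d) set \<Rightarrow> (real^'d \<Rightarrow> 'b::euclidean_space) \<Rightarrow> real" where
  "L2_norm S f = sqrt (LINT x|lebesgue_on S. (norm (f x))\<^sup>2)"

definition H1 :: "(real^'d) set \<Rightarrow> (real^'d \<Rightarrow> real) set" where
  "H1 S = {v. v \<in> L2 S \<and> (\<exists>g. has_weak_gradient S v g \<and> g \<in> L2 S)}"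

definition H1_norm :: "(real^'d) set \<Rightarrow> (real^'d \<Rightarrow> real) \<Rightarrow> real" where
  "H1_norm S v = sqrt ((L2_norm S v)\<^sup>2 + (L2_norm S (weak_gradient S v))\<^sup>2)"

text \<open>Bounded functionals respect equality almost everywhere, hence descend to the space of classes.\<close>
definition H1_dual :: "(real^'d) set \<Rightarrow> ((real^'d \<Rightarrow> real) \<Rightarrow> real) set" where
  "H1_dual S = {l. (\<forall>v\<in>H1 S. \<forall>w\<in>H1 S. l (\<lambda>x. v x + w x) = l v + l w) \<and>
                   (\<forall>v\<in>H1 S. \<forall>c. l (\<lambda>x. c * v x) = c * l v) \<and>
                   (\<exists>B. \<forall>v\<in>H1 S. \<bar>l v\<bar> \<le> B * H1_norm S v)}"

definition H1_weakly_converges ::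
    "(real^'d) set \<Rightarrow> (nat \<Rightarrow> real^'d \<Rightarrow> real) \<Rightarrow> (real^'d \<Rightarrow> real) \<Rightarrow> bool" where
  "H1_weakly_converges S v w \<longleftrightarrow>
     (\<forall>k. v k \<in> H1 S) \<and> w \<in> H1 S \<and> (\<forall>l\<in>H1_dual S. (\<lambda>k. l (v k)) \<longlonglongrightarrow> l w)"

definition integer_vector :: "real^'d \<Rightarrow> bool" where
  "integer_vector m \<longleftrightarrow> (\<forall>i. m $ i \<in> \<int>)"

definition unit_cell :: "(real^'d) set" where
  "unit_cell = cbox 0 1"

definition periodic :: "(real^'d \<Rightarrow> real) \<Rightarrow> bool" where
  "periodic f \<longleftrightarrow> (\<forall>m y. integer_vector m \<longrightarrow> f (y + m) = f y)"

definition C_per :: "(real^'d \<Rightarrow> real) set" where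
  "C_per = {f. continuous_on UNIV f \<and> periodic f}"

definition sup_norm :: "(real^'d \<Rightarrow> real) \<Rightarrow> real" where
  "sup_norm f = (SUP y\<in>unit_cell. \<bar>f y\<bar>)"

text \<open>The weak gradient is taken on the whole space, so that traces on opposite faces
  of the cell agree.\<close>
definition H1_per :: "(real^'d \<Rightarrow> real) set" where
  "H1_per = {v. periodic v \<and> v \<in> L2 unit_cell \<and>
                (\<exists>g. has_weak_gradient UNIV v g \<and> g \<in> L2 unit_cell)}"

definition H1_per_norm :: "(real^'d \<Rightarrow> real) \<Rightarrow> real" where
  "H1_per_norm v =
     sqrt ((L2_norm unit_cell v)\<^sup>2 + (L2_norm unit_cell (weak_gradient UNIV v))\<^sup>2)"

text \<open>The quotient norm of \<open>H\<^sup>1\<^sub>p\<^sub>e\<^sub>r(Y)/\<real>\<close>.\<close>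
definition H1_per_quotient_norm :: "(real^'d \<Rightarrow> real) \<Rightarrow> real" where
  "H1_per_quotient_norm v = (INF c. H1_per_norm (\<lambda>y. v y - c))"

text \<open>The Bochner space \<open>L\<^sup>2(M; V)\<close> for a space \<open>V\<close> of functions with seminorm \<open>p\<close>, where elements
  of \<open>V\<close> at \<open>p\<close>-distance 0 are identified: strong measurability means almost everywhere
  approximation by \<open>V\<close>-valued simple functions.\<close>
definition L2_bochner ::
    "'a measure \<Rightarrow> ('c \<Rightarrow> real) set \<Rightarrow> (('c \<Rightarrow> real) \<Rightarrow> real) \<Rightarrow> ('a \<Rightarrow> 'c \<Rightarrow> real) set" where
  "L2_bochner M V p =
     {f. (\<forall>x\<in>space M. f x \<in> V) \<and>
         (\<exists>s. (\<forall>j. simple_function M (s j) \<and> (\<forall>x\<in>space M. s j x \<in> V)) \<and>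
              (AE x in M. (\<lambda>j. p (\<lambda>y. s j x y - f x y)) \<longlonglongrightarrow> 0)) \<and>
         integrable M (\<lambda>x. (p (f x))\<^sup>2)}"

definition L2_C_per :: "(real^'d) set \<Rightarrow> (real^'d \<Rightarrow> real^'d \<Rightarrow> real) set" where
  "L2_C_per \<Omega> = L2_bochner (lebesgue_on \<Omega>) C_per sup_norm"

definition L2_L2 :: "(real^'d) set \<Rightarrow> (real^'d \<Rightarrow> real^'d \<Rightarrow> real) set" where
  "L2_L2 \<Omega> = L2_bochner (lebesgue_on \<Omega>) (L2 unit_cell) (L2_norm unit_cell)"

definition L2_H1_per_quotient :: "(real^'d) set \<Rightarrow> (real^'d \<Rightarrow> real^'d \<Rightarrow> real) set" where
  "L2_H1_per_quotient \<Omega> = L2_bochner (lebesgue_on \<Omega>) H1_per H1_per_quotient_norm"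

definition cell :: "(real^'d \<Rightarrow> real^'d^'d) \<Rightarrow> real^'d \<Rightarrow> (real^'d) set" where
  "cell D x = (\<lambda>y. D x *v y) ` unit_cell"

text \<open>The function \<open>\<psi>(x,y)\<close> to which \<open>f\<close> corresponds.\<close>
definition on_cells ::
    "(real^'d \<Rightarrow> real^'d^'d) \<Rightarrow> (real^'d \<Rightarrow> real^'d \<Rightarrow> real) \<Rightarrow> real^'d \<Rightarrow> real^'d \<Rightarrow> real" where
  "on_cells D f x y = f x (matrix_inv (D x) *v y)"

text \<open>\<open>L\<^sup>2(\<Omega>; L\<^sup>2(Y\<^sub>x))\<close>; the values of \<open>w x\<close> outside the cell at \<open>x\<close> are irrelevant.\<close>
definition L2_L2_cells ::
    "(real^'d) set \<Rightarrow> (real^'d \<Rightarrow> real^'d^'d) \<Rightarrow> (real^'d \<Rightarrow> real^'d \<Rightarrow> real) set" where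
  "L2_L2_cells \<Omega> D = {w. \<exists>f\<in>L2_L2 \<Omega>. \<forall>x\<in>\<Omega>. \<forall>y\<in>cell D x. w x y = on_cells D f x y}"

text \<open>Cubes of arbitrary orientation.\<close>
definition open_cube :: "real \<Rightarrow> (real^'d) set \<Rightarrow> bool" where
  "open_cube s Q \<longleftrightarrow> (\<exists>a A. orthogonal_matrix A \<and> Q = (\<lambda>y. a + A *v y) ` box 0 (vec s))"

definition cube_covering :: "(real^'d) set \<Rightarrow> real \<Rightarrow> nat \<Rightarrow> (nat \<Rightarrow> (real^'d) set) \<Rightarrow> bool" where
  "cube_covering \<Omega> s N Q \<longleftrightarrow>
     (\<forall>n\<in>{1..N}. open_cube s (Q n) \<and> Q n \<inter> \<Omega> \<noteq> {}) \<and>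
     disjoint_family_on Q {1..N} \<and>
     \<Omega> \<subseteq> (\<Union>n\<in>{1..N}. closure (Q n))"

text \<open>The argument \<open>f\<close> is the function corresponding to \<open>\<psi>\<close>; \<open>p n\<close> and \<open>q n\<close> are the points of
  evaluation of \<open>D\<close> and the shifts, respectively.\<close>
definition lp_approx ::
    "(real^'d \<Rightarrow> real^'d^'d) \<Rightarrow> real \<Rightarrow> nat \<Rightarrow> (nat \<Rightarrow> (real^'d) set) \<Rightarrow>
     (nat \<Rightarrow> real^'d) \<Rightarrow> (nat \<Rightarrow> real^'d) \<Rightarrow> (real^'d \<Rightarrow> real^'d \<Rightarrow> real) \<Rightarrow> real^'d \<Rightarrow> real" where
  "lp_approx D \<epsilon> N Q p q f x =
     (\<Sum>n=1..N. f x ((1 / \<epsilon>) *\<^sub>R (matrix_inv (D (p n)) *v (x - q n))) * indicator (Q n) x)"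

text \<open>Here \<open>L k\<close> is the locally-periodic approximation operator at the \<open>k\<close>-th scale,
  acting on corresponding functions.\<close>
definition lts_converges ::
    "(real^'d) set \<Rightarrow> (real^'d \<Rightarrow> real^'d^'d) \<Rightarrow>
     (nat \<Rightarrow> (real^'d \<Rightarrow> real^'d \<Rightarrow> real) \<Rightarrow> real^'d \<Rightarrow> real) \<Rightarrow>
     (nat \<Rightarrow> real^'d \<Rightarrow> real) \<Rightarrow> (real^'d \<Rightarrow> real^'d \<Rightarrow> real) \<Rightarrow> bool" where
  "lts_converges \<Omega> D L v w \<longleftrightarrow>
     (\<forall>k. v k \<in> L2 \<Omega>) \<and> w \<in> L2_L2_cells \<Omega> D \<and>
     (\<forall>f\<in>L2_C_per \<Omega>.
        (\<lambda>k. LINT x|lebesgue_on \<Omega>. v k x * L k f x) \<longlonglongrightarrow>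
        (LINT x|lebesgue_on \<Omega>. 1 / measure lebesgue (cell D x) *
           (LINT y|lebesgue_on (cell D x). w x y * on_cells D f x y)))"

end

(*
  Fourier analysis in the fast variable. On each cube the operator L freezes D, so a plane wave
  cos (2 pi m . y + theta) becomes an oscillating function with wave vector of order 1 / eps.
  Integrating by parts on cubes of side eps powr r (r < 1), such a function times a sequence
  bounded in H^1 tends weakly to 0 if m is not 0, and so does the part of D^T grad u^eps
  orthogonal to m. Hence only the components of D^T grad u^eps along the wave vectors survive.
  Their weak limits, along a diagonal subsequence, satisfy Bessel's inequality and are the
  Fourier coefficients of the corrector. Trigonometric polynomials are dense in C_per(Y), which
  reduces two-scale convergence to these limits.
*)
theory Submission
  imports Defs "HOL-Real_Asymp.Real_Asymp" "HOL-Library.Diagonal_Subsequence"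
begin

text \<open>The test functions jump across cube faces, and there are about eps^(-rd) cubes, so
  integrating by parts over the domain would leave surface terms on all of them. Smooth cutoffs that
  give up a small fixed fraction of every cube avoid this. The integration by parts then takes the
  form of a translation: moving a plane wave by half its wavelength, a vector of length O(eps),
  reverses its sign, while moving the sequence by the same vector costs only that length times its
  gradient. The gradient has no derivative of its own to spend. In a direction orthogonal to the
  wave vector, where the wave is constant, it is first traded for a difference quotient of the
  sequence. Replacing D by its value at one point of the cube costs O(eps^r), because D is
  Lipschitz. Each plane-wave potential has its gradient along its wave vector, so the surviving
  components add up to a gradient in z = D^(-1) y; the chain rule back to y contributes the factor
  D^(-T), which undoes the D^T. Square summability of the coefficients is what makes the series of
  potentials converge in the periodic H^1 space.\<close>

abbreviation leb :: "'a::euclidean_space set \<Rightarrow> 'a measure" where "leb S \<equiv> lebesgue_on S"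

abbreviation (input) tends_to :: "(nat \<Rightarrow> 'a::topological_space) \<Rightarrow> 'a \<Rightarrow> bool" ("(_ ~~> _)" [60, 60] 60)
  where "X ~~> c \<equiv> X \<longlonglongrightarrow> c"

lemmas intble_add = Bochner_Integration.integrable_add
  and intble_bound = Bochner_Integration.integrable_bound
  and intble_cong = Bochner_Integration.integrable_cong
  and intble_diff = Bochner_Integration.integrable_diff
  and intble_sum = Bochner_Integration.integrable_sum
  and LINT_add = Bochner_Integration.integral_add
  and LINT_cong = Bochner_Integration.integral_cong
  and LINT_diff = Bochner_Integration.integral_diff
  and LINT_mono = Bochner_Integration.integral_mono
  and LINT_sum = Bochner_Integration.integral_sum
  and norm_nth = Finite_Cartesian_Product.norm_nth_le

section \<open>Square-integrable functions\<close>

text \<open>Stated over an arbitrary measure and for vector values: the arguments run over open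
  sets, the domain and the cell alike, and later over pairs of a function and its gradient.\<close>

definition sq_int :: "'a measure => ('a => 'b::euclidean_space) => bool" where
 "sq_int M f \<longleftrightarrow> f : borel_measurable M & integrable M (%x. (norm (f x))\<^sup>2)"

definition norm2 :: "'a measure => ('a => 'b::euclidean_space) => real" where
 "norm2 M f = sqrt (LINT x|M. (norm (f x))\<^sup>2)"

lemma sq_int_measurable: "sq_int M f ==> f : borel_measurable M"
 by (simp add: sq_int_def)

lemma sq_int_integrable: "sq_int M f ==> integrable M (%x. (norm (f x))\<^sup>2)"
 by (simp add: sq_int_def)

lemma norm2_nonneg [simp]: "0 <= norm2 M f"
 by (simp add: norm2_def)

lemma norm2_power2: "(norm2 M f)\<^sup>2 = (LINT x|M. (norm (f x))\<^sup>2)"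
 by (simp add: norm2_def)

lemma L2_iff: "f : L2 S \<longleftrightarrow> sq_int (leb S) f"
 by (simp add: L2_def sq_int_def)

lemma L2_norm_eq: "L2_norm S f = norm2 (leb S) f"
 by (simp add: L2_norm_def norm2_def)

lemma sq_int_zero [simp]: "sq_int M (%x. 0)"
 by (simp add: sq_int_def)

lemma sq_int_bound:
 assumes "sq_int M g" and f: "f : borel_measurable M"
  and "AE x in M. norm (f x) <= c * norm (g x)"
 shows "sq_int M f"
proof -
 have "integrable M (%x. (norm (f x))\<^sup>2)"
 proof (rule intble_bound[where f="%x. c\<^sup>2 * (norm (g x))\<^sup>2"])
  show "integrable M (%x. c\<^sup>2 * (norm (g x))\<^sup>2)"
   using assms(1) by (simp add: sq_int_def)
  show "(%x. (norm (f x))\<^sup>2) : borel_measurable M" using f by measurable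
  show "AE x in M. norm ((norm (f x))\<^sup>2) <= norm (c\<^sup>2 * (norm (g x))\<^sup>2)"
   using assms(3) by eventually_elim (simp add: power_mult_distrib[symmetric] power_mono)
 qed
 then show ?thesis using f by (simp add: sq_int_def)
qed

lemma sq_int_scaleR: "sq_int M f ==> sq_int M (%x. c *\<^sub>R f x)"
 by (rule sq_int_bound[where c="\<bar>c\<bar>" and g=f]) (auto simp: sq_int_def)

lemma sq_int_mult: "sq_int M f ==> sq_int M (%x. c * f x)" for f :: "'a => real"
 using sq_int_scaleR[of M f c] by simp

lemma sq_int_minus: "sq_int M f ==> sq_int M (%x. - f x)"
 using sq_int_scaleR[of M f "-1"] by simp

lemma sq_int_norm: "sq_int M f ==> sq_int M (%x. norm (f x))"
 by (rule sq_int_bound[where c=1 and g=f]) (auto simp: sq_int_def)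

lemma sq_int_inner_integrable:
 fixes f g :: "'a => 'b::euclidean_space"
 assumes "sq_int M f" "sq_int M g"
 shows "integrable M (%x. f x \<bullet> g x)"
proof (rule intble_bound[where f="%x. (norm (f x))\<^sup>2 + (norm (g x))\<^sup>2"])
 show "integrable M (%x. (norm (f x))\<^sup>2 + (norm (g x))\<^sup>2)"
  using assms by (simp add: sq_int_def)
 show "(%x. f x \<bullet> g x) : borel_measurable M"
  using assms by (simp add: sq_int_def borel_measurable_inner)
 show "AE x in M. norm (f x \<bullet> g x) <= norm ((norm (f x))\<^sup>2 + (norm (g x))\<^sup>2)"
 proof (intro AE_I2)
  fix x
  have "\<bar>f x \<bullet> g x\<bar> <= norm (f x) * norm (g x)" by (rule Cauchy_Schwarz_ineq2)
  also have "... <= (norm (f x))\<^sup>2 + (norm (g x))\<^sup>2"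
   using sum_squares_bound[of "norm (f x)" "norm (g x)"] mult_nonneg_nonneg[OF norm_ge_zero[of "f x"] norm_ge_zero[of "g x"]]
   by linarith
  finally show "norm (f x \<bullet> g x) <= norm ((norm (f x))\<^sup>2 + (norm (g x))\<^sup>2)" by simp
 qed
qed

lemma sq_mult_int:
 fixes f g :: "'a => real"
 assumes "sq_int M f" "sq_int M g"
 shows "integrable M (%x. f x * g x)"
 using sq_int_inner_integrable[OF assms] by simp

lemma sq_int_add:
 assumes "sq_int M f" "sq_int M g"
 shows "sq_int M (%x. f x + g x)"
proof -
 have "(norm (f x + g x))\<^sup>2 = (norm (f x))\<^sup>2 + 2 * (f x \<bullet> g x) + (norm (g x))\<^sup>2" for x
  by (simp add: power2_norm_eq_inner inner_simps inner_commute)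
 then have "integrable M (%x. (norm (f x + g x))\<^sup>2)"
  using sq_int_inner_integrable[OF assms] assms by (simp add: sq_int_def)
 then show ?thesis using assms by (simp add: sq_int_def borel_measurable_add)
qed

lemma sq_int_diff:
 assumes "sq_int M f" "sq_int M g"
 shows "sq_int M (%x. f x - g x)"
 using sq_int_add[OF assms(1) sq_int_minus[OF assms(2)]] by simp

lemma sq_int_sum:
 assumes "!!i. i : I ==> sq_int M (f i)"
 shows "sq_int M (%x. \<Sum>i\<in>I. f i x)"
 using assms by (induction I rule: infinite_finite_induct) (auto intro: sq_int_add)

lemma sq_int_cong_AE:
 assumes "sq_int M f" "g : borel_measurable M" "AE x in M. f x = g x"
 shows "sq_int M g"
 using assms(1,2) by (rule sq_int_bound[where c=1]) (use assms(3) in \<open>auto simp: eq_commute\<close>)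

lemma norm2_cong_AE:
 assumes "f : borel_measurable M" "g : borel_measurable M" "AE x in M. f x = g x"
 shows "norm2 M f = norm2 M g"
 unfolding norm2_def
 by (rule arg_cong[where f=sqrt], rule integral_cong_AE) (use assms in auto)

lemma norm2_mono:
 assumes "sq_int M g" "f : borel_measurable M" "AE x in M. norm (f x) <= norm (g x)"
 shows "norm2 M f <= norm2 M g"
proof -
 have "sq_int M f"
  using sq_int_bound[where c=1] assms by simp
 then show ?thesis
  unfolding norm2_def using assms
  by (intro real_sqrt_le_mono integral_mono_AE) (auto simp: sq_int_def elim: eventually_mono intro: power_mono)
qed

lemma norm2_scaleR: "norm2 M (%x. c *\<^sub>R f x) = \<bar>c\<bar> * norm2 M f"
 by (simp add: norm2_def power_mult_distrib real_sqrt_mult)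

lemma norm2_minus: "norm2 M (%x. - f x) = norm2 M f"
 by (simp add: norm2_def)

lemma norm2_minus_commute: "norm2 M (%x. f x - g x) = norm2 M (%x. g x - f x)"
 by (simp add: norm2_def norm_minus_commute)

lemma Cauchy_Schwarz_integral:
 fixes f g :: "'a => 'b::euclidean_space"
 assumes f: "sq_int M f" and g: "sq_int M g"
 shows "\<bar>LINT x|M. f x \<bullet> g x\<bar> <= norm2 M f * norm2 M g"
proof -
 let ?A = "LINT x|M. (norm (f x))\<^sup>2" and ?B = "LINT x|M. f x \<bullet> g x"
  and ?C = "LINT x|M. (norm (g x))\<^sup>2"
 note int = sq_int_integrable[OF f] sq_int_integrable[OF g] sq_int_inner_integrable[OF f g]
 have quad: "0 <= ?A + 2 * t * ?B + t\<^sup>2 * ?C" for t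
 proof -
  have "0 <= (LINT x|M. (norm (f x + t *\<^sub>R g x))\<^sup>2)" by simp
  also have "... = (LINT x|M. (norm (f x))\<^sup>2 + (2 * t) * (f x \<bullet> g x) + t\<^sup>2 * (norm (g x))\<^sup>2)"
   by (intro LINT_cong refl)
    (simp only: power2_norm_eq_inner, simp add: inner_simps inner_commute power2_eq_square algebra_simps)
  also have "... = ?A + 2 * t * ?B + t\<^sup>2 * ?C" using int by simp
  finally show ?thesis .
 qed
 have C: "?C >= 0" and A: "?A >= 0" by simp_all
 have "?B\<^sup>2 <= ?A * ?C"
 proof (cases "?C = 0")
  case True
  have "?B = 0"
  proof (rule ccontr)
   assume "?B ~= 0"
   then show False
    using quad[of "- (?A + 1) / (2 * ?B)"] True by (simp add: field_simps)
  qed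
  then show ?thesis using True by simp
 next
  case False
  then have "?C > 0" using C by linarith
  then show ?thesis
   using quad[of "- ?B / ?C"] by (simp add: field_simps power2_eq_square)
 qed
 then have "sqrt (?B\<^sup>2) <= sqrt (?A * ?C)" by (rule real_sqrt_le_mono)
 then show ?thesis by (simp add: norm2_def real_sqrt_mult)
qed

lemma Cauchy_Schwarz_integral_real:
 fixes f g :: "'a => real"
 assumes f: "sq_int M f" and g: "sq_int M g"
 shows "\<bar>LINT x|M. f x * g x\<bar> <= norm2 M f * norm2 M g"
 using Cauchy_Schwarz_integral[OF assms] by (simp add: mult.commute)

lemma norm2_triangle:
 assumes f: "sq_int M f" and g: "sq_int M g"
 shows "norm2 M (%x. f x + g x) <= norm2 M f + norm2 M g"
proof (rule power2_le_imp_le)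
 have "(norm2 M (%x. f x + g x))\<^sup>2 =
   (LINT x|M. (norm (f x))\<^sup>2 + 2 * (f x \<bullet> g x) + (norm (g x))\<^sup>2)"
  unfolding norm2_power2
  by (intro LINT_cong refl)
   (simp add: power2_norm_eq_inner inner_simps inner_commute)
 also have "... = (norm2 M f)\<^sup>2 + 2 * (LINT x|M. f x \<bullet> g x) + (norm2 M g)\<^sup>2"
  using sq_int_inner_integrable[OF f g] f g by (simp add: sq_int_def norm2_power2)
 also have "... <= (norm2 M f + norm2 M g)\<^sup>2"
  using Cauchy_Schwarz_integral[OF f g] by (simp add: power2_sum)
 finally show "(norm2 M (%x. f x + g x))\<^sup>2 <= (norm2 M f + norm2 M g)\<^sup>2" .
qed simp

lemma norm2_diff_ge:
 assumes f: "sq_int M f" and g: "sq_int M g"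
 shows "\<bar>norm2 M f - norm2 M g\<bar> <= norm2 M (%x. f x - g x)"
 using norm2_triangle[OF sq_int_diff[OF f g] g] norm2_triangle[OF sq_int_diff[OF g f] f]
 by (simp add: norm2_minus_commute[of M f g])

lemma sq_int_const: "finite_measure M ==> sq_int M (%x. c)"
 by (simp add: sq_int_def finite_measure.integrable_const)

lemma sq_int_integrable_finite:
 assumes "finite_measure M" "sq_int M f"
 shows "integrable M f"
proof (rule intble_bound[where f="%x. 1 + (norm (f x))\<^sup>2"])
 interpret finite_measure M by fact
 show "integrable M (%x. 1 + (norm (f x))\<^sup>2)" using assms by (simp add: sq_int_def)
 show "f : borel_measurable M" using assms by (simp add: sq_int_def)
 have "t <= 1 + t\<^sup>2" for t :: real
  using zero_le_power2[of "2 * t - 1"] by (simp add: power2_diff algebra_simps power2_eq_square)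
 then show "AE x in M. norm (f x) <= norm (1 + (norm (f x))\<^sup>2)" by simp
qed

lemma sq_int_bounded_mult:
 assumes "sq_int M f" "a : borel_measurable M" "!!x. x : space M ==> \<bar>a x\<bar> <= c"
 shows "sq_int M (%x. a x *\<^sub>R f x)"
proof (rule sq_int_bound[OF assms(1), where c=c])
 show "(%x. a x *\<^sub>R f x) : borel_measurable M"
  using assms by (intro borel_measurable_scaleR) (auto simp: sq_int_def)
 show "AE x in M. norm (a x *\<^sub>R f x) <= c * norm (f x)"
  using assms(3) by (auto intro!: AE_I2 mult_right_mono)
qed

lemma sq_int_bounded_times:
 fixes f :: "'a => real"
 assumes "sq_int M f" "a : borel_measurable M" "!!x. x : space M ==> \<bar>a x\<bar> <= c"
 shows "sq_int M (%x. a x * f x)"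
 using sq_int_bounded_mult[OF assms] by simp

lemma sq_int_bounded:
 fixes f :: "'a => 'b::euclidean_space"
 assumes "finite_measure M" "f : borel_measurable M" "!!x. x : space M ==> norm (f x) <= c"
 shows "sq_int M f"
 by (rule sq_int_bound[OF sq_int_const[OF assms(1), of "1::real"] assms(2), of c]) (use assms in auto)

lemma sq_int_Pair:
 "sq_int M (%x. (f x, g x)) \<longleftrightarrow> sq_int M f & sq_int M g"
proof
 assume *: "sq_int M (%x. (f x, g x))"
 then have m: "(%x. (f x, g x)) : borel_measurable M" by (simp add: sq_int_def)
 have "f : borel_measurable M"
  using borel_measurable_continuous_on[OF continuous_on_fst[OF continuous_on_id] m] by simp
 moreover have "g : borel_measurable M"
  using borel_measurable_continuous_on[OF continuous_on_snd[OF continuous_on_id] m] by simp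
 ultimately show "sq_int M f & sq_int M g"
  using sq_int_bound[OF *, of f 1] sq_int_bound[OF *, of g 1] by (simp add: norm_fst_le norm_snd_le)
next
 assume *: "sq_int M f & sq_int M g"
 then show "sq_int M (%x. (f x, g x))" by (simp add: sq_int_def norm_Pair borel_measurable_Pair)
qed

lemma norm2_Pair:
 assumes "sq_int M f" "sq_int M g"
 shows "norm2 M (%x. (f x, g x)) = sqrt ((norm2 M f)\<^sup>2 + (norm2 M g)\<^sup>2)"
 using assms by (simp add: norm2_power2) (simp add: norm2_def norm_Pair sq_int_def)

text \<open>The weight forces \<open>d j\<close> below a multiple of (1 / sqrt 2)^j. In
  \<open>L2_complete\<close> this turns a bound on squared increments into absolute convergence of
  the telescoping series.\<close>

lemma summable_norm_if_weighted_square_summable: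
 fixes d :: "nat => real"
 assumes "!!j. 0 <= d j" "!!j. 2^j * (d j)\<^sup>2 <= K"
 shows "summable d"
proof (rule summable_comparison_test)
 let ?q = "1 / sqrt 2"
 have "norm (d j) <= sqrt K * ?q ^ j" for j
 proof -
  have "(d j)\<^sup>2 <= K * (1/2)^j"
   using assms(2)[of j] by (simp add: field_simps)
  then have "sqrt ((d j)\<^sup>2) <= sqrt (K * (1/2)^j)" by (rule real_sqrt_le_mono)
  then show ?thesis
   using assms(1)[of j] by (simp add: real_sqrt_mult real_sqrt_power real_sqrt_divide)
 qed
 then show "\<exists>N. \<forall>n\<ge>N. norm (d n) <= sqrt K * ?q ^ n" by blast
 show "summable (%n. sqrt K * ?q ^ n)"
  by (intro summable_mult summable_geometric) auto
qed

lemma Cauchy_fast_subsequence: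
 fixes P :: "nat => nat => real"
 assumes "!!e. e > 0 ==> \<exists>N. \<forall>m\<ge>N. \<forall>n\<ge>N. P m n < e"
 obtains ph :: "nat => nat" where "strict_mono ph"
  "!!j m n. m >= ph j ==> n >= ph j ==> P m n < (1/2)^j"
proof -
 have "\<forall>j. \<exists>N. \<forall>m\<ge>N. \<forall>n\<ge>N. P m n < (1/2)^j" using assms by simp
 then obtain N where N: "!!j m n. m >= N j ==> n >= N j ==> P m n < (1/2)^j" by metis
 \<comment> \<open>Summing the thresholds keeps \<open>ph j\<close> above \<open>N j\<close>; the
   extra \<open>j\<close> makes \<open>ph\<close> strictly increasing.\<close>
 define ph where "ph j = (\<Sum>i\<le>j. N i) + j" for j
 have "strict_mono ph" by (rule strict_monoI_Suc) (simp add: ph_def)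
 moreover have "N j <= ph j" for j
  using member_le_sum[of j "{..j}" N] by (simp add: ph_def)
 ultimately show thesis using that N by (meson le_trans)
qed

text \<open>Fatou's lemma for the squared norms. It gives integrability of the limit and the norm
  bound at once.\<close>

lemma square_integral_liminf:
 fixes f :: "nat => 'a => 'b::euclidean_space"
 assumes f: "!!j. sq_int M (f j)" and g: "g : borel_measurable M"
  and lim: "AE x in M. (%j. f j x) ~~> g x"
  and bd: "\<forall>\<^sub>F j in sequentially. norm2 M (f j) <= C"
 shows "sq_int M g & norm2 M g <= C"
proof -
 obtain j0 where "norm2 M (f j0) <= C" using bd by (auto simp: eventually_sequentially)
 then have C: "0 <= C" using norm2_nonneg[of M "f j0"] by linarith
 have "(\<integral>\<^sup>+x. ennreal ((norm (g x))\<^sup>2) \<partial>M) = (\<integral>\<^sup>+x. liminf (%j. ennreal ((norm (f j x))\<^sup>2)) \<partial>M)"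
 proof (rule nn_integral_cong_AE, use lim in eventually_elim)
  fix x assume "(%j. f j x) ~~> g x"
  then have "(%j. ennreal ((norm (f j x))\<^sup>2)) ~~> ennreal ((norm (g x))\<^sup>2)"
   by (intro tendsto_intros)
  then show "ennreal ((norm (g x))\<^sup>2) = liminf (%j. ennreal ((norm (f j x))\<^sup>2))"
   using lim_imp_Liminf[OF sequentially_bot] by metis
 qed
 also have "... <= liminf (%j. \<integral>\<^sup>+x. ennreal ((norm (f j x))\<^sup>2) \<partial>M)"
  by (rule nn_integral_liminf) (use f in \<open>auto simp: sq_int_def intro: borel_measurable_integrable\<close>)
 also have "... <= ennreal (C\<^sup>2)"
 proof -
  have "\<forall>\<^sub>F j in sequentially. (\<integral>\<^sup>+x. ennreal ((norm (f j x))\<^sup>2) \<partial>M) <= ennreal (C\<^sup>2)"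
   using bd
  proof eventually_elim
   fix j assume "norm2 M (f j) <= C"
   then have "(norm2 M (f j))\<^sup>2 <= C\<^sup>2" by (simp add: power_mono)
   then show "(\<integral>\<^sup>+x. ennreal ((norm (f j x))\<^sup>2) \<partial>M) <= ennreal (C\<^sup>2)"
    using f[of j] by (simp add: nn_integral_eq_integral sq_int_def norm2_power2)
  qed
  then have "liminf (%j. \<integral>\<^sup>+x. ennreal ((norm (f j x))\<^sup>2) \<partial>M) <= liminf (%j. ennreal (C\<^sup>2))"
   by (rule Liminf_mono)
  then show ?thesis by (simp add: Liminf_const)
 qed
 finally have le: "(\<integral>\<^sup>+x. ennreal ((norm (g x))\<^sup>2) \<partial>M) <= ennreal (C\<^sup>2)" .
 then have "integrable M (%x. (norm (g x))\<^sup>2)"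
  using g by (intro integrableI_bounded) (auto intro: le_less_trans)
 moreover from this have "(norm2 M g)\<^sup>2 <= C\<^sup>2"
  using le by (simp add: nn_integral_eq_integral norm2_power2)
 ultimately show ?thesis
  using g C power2_le_imp_le[of "norm2 M g" C] by (simp add: sq_int_def)
qed

text \<open>Defining the limit pointwise along a subsequence, everywhere and not only almost everywhere,
  lets it inherit invariances of the sequence such as periodicity.\<close>
theorem L2_complete:
 fixes f :: "nat => 'a => 'b::euclidean_space"
 assumes f: "!!j. sq_int M (f j)"
  and Cauchy: "!!e. e > 0 ==> \<exists>N. \<forall>m\<ge>N. \<forall>n\<ge>N. norm2 M (%x. f m x - f n x) < e"
 obtains ph :: "nat => nat" where "strict_mono ph" "sq_int M (%x. lim (%j. f (ph j) x))"
  "(%n. norm2 M (%x. f n x - lim (%j. f (ph j) x))) ~~> 0"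
proof -
 obtain ph where ph: "strict_mono ph"
  "!!j m n. m >= ph j ==> n >= ph j ==> norm2 M (%x. f m x - f n x) < (1/2)^j"
  using Cauchy_fast_subsequence[of "%m n. norm2 M (%x. f m x - f n x)"] Cauchy by blast
 define d where "d j x = norm (f (ph (Suc j)) x - f (ph j) x)" for j x
 define F where "F x = lim (%j. f (ph j) x)" for x
 have fm [measurable]: "f j : borel_measurable M" for j using f by (simp add: sq_int_def)
 have Fm [measurable]: "F : borel_measurable M" unfolding F_def by measurable
 have dm [measurable]: "d j : borel_measurable M" for j unfolding d_def by measurable
 have sqd: "sq_int M (%x. f m x - f n x)" for m n by (rule sq_int_diff[OF f f])
 have di: "integrable M (%x. (d j x)\<^sup>2)" for j
  using sqd[of "ph (Suc j)" "ph j"] unfolding d_def sq_int_def by auto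
 \<comment> \<open>The squared increments integrate to at most 4^(-j). Weighted by 2^j these
   integrals are still summable, so the weighted series is finite almost everywhere and the
   subsequence converges there.\<close>
 have db: "(LINT x|M. (d j x)\<^sup>2) <= (1/4)^j" for j
 proof -
  have "norm2 M (%x. f (ph (Suc j)) x - f (ph j) x) <= (1/2)^j"
   using ph(2)[of j "ph (Suc j)" "ph j"] strict_mono_leD[OF ph(1), of j "Suc j"] by (simp add: less_imp_le)
  then have "(norm2 M (%x. f (ph (Suc j)) x - f (ph j) x))\<^sup>2 <= ((1/2)^j)\<^sup>2"
   by (rule power_mono) simp
  also have "((1/2)^j)\<^sup>2 = (1/4::real)^j"
   by (simp add: power2_eq_square power_mult_distrib[symmetric])
  finally show ?thesis by (simp add: norm2_power2 d_def)
 qed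
 have "(\<integral>\<^sup>+x. (\<Sum>j. ennreal (2^j * (d j x)\<^sup>2)) \<partial>M) = (\<Sum>j. \<integral>\<^sup>+x. ennreal (2^j * (d j x)\<^sup>2) \<partial>M)"
  by (rule nn_integral_suminf) measurable
 also have "... <= (\<Sum>j. ennreal ((1/2)^j))"
 proof (rule suminf_le)
  fix j
  have "(\<integral>\<^sup>+x. ennreal (2^j * (d j x)\<^sup>2) \<partial>M) = ennreal (LINT x|M. 2^j * (d j x)\<^sup>2)"
   using di[of j] by (intro nn_integral_eq_integral) auto
  also have "... = ennreal (2^j * (LINT x|M. (d j x)\<^sup>2))" by simp
  also have "... <= ennreal (2^j * (1/4)^j)"
   using db[of j] by (intro ennreal_leI mult_left_mono) auto
  also have "2^j * (1/4::real)^j = (1/2)^j" by (simp add: power_mult_distrib[symmetric])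
  finally show "(\<integral>\<^sup>+x. ennreal (2^j * (d j x)\<^sup>2) \<partial>M) <= ennreal ((1/2)^j)" .
 qed auto
 also have "... = ennreal (\<Sum>j. (1/2)^j)"
  by (rule suminf_ennreal2) (auto intro: summable_geometric)
 also have "... < \<infinity>" by simp
 finally have "(\<integral>\<^sup>+x. (\<Sum>j. ennreal (2^j * (d j x)\<^sup>2)) \<partial>M) ~= \<infinity>" by simp
 then have "AE x in M. (\<Sum>j. ennreal (2^j * (d j x)\<^sup>2)) ~= \<infinity>"
  by (intro nn_integral_PInf_AE) measurable
 then have conv: "AE x in M. (%j. f (ph j) x) ~~> F x"
 proof eventually_elim
  fix x assume fin: "(\<Sum>j. ennreal (2^j * (d j x)\<^sup>2)) ~= \<infinity>"
  have s: "summable (%j. 2^j * (d j x)\<^sup>2)"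
   by (rule summable_suminf_not_top) (use fin in auto)
  have "2^j * (d j x)\<^sup>2 <= (\<Sum>j. 2^j * (d j x)\<^sup>2)" for j
   using sum_le_suminf[OF s, of "{j}"] by simp
  then have "summable (%j. d j x)"
   by (rule summable_norm_if_weighted_square_summable[rotated]) (simp add: d_def)
  then have "summable (%j. f (ph (Suc j)) x - f (ph j) x)"
   unfolding d_def by (rule summable_norm_cancel)
  then have "convergent (%n. \<Sum>j<n. f (ph (Suc j)) x - f (ph j) x)"
   by (simp add: summable_iff_convergent)
  then have "convergent (%n. f (ph n) x - f (ph 0) x)"
   using sum_lessThan_telescope[of "%n. f (ph n) x"] by simp
  then have "convergent (%n. f (ph n) x)"
   using convergent_add[OF _ convergent_const, of "%n. f (ph n) x - f (ph 0) x" "f (ph 0) x"] by simp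
  then show "(%j. f (ph j) x) ~~> F x"
   unfolding F_def by (simp add: convergent_LIMSEQ_iff)
 qed
 \<comment> \<open>Fatou is applied along the subsequence with \<open>n\<close> fixed. This yields
   convergence in norm of the whole sequence, not only of the subsequence.\<close>
 have key: "sq_int M (%x. f n x - F x) & norm2 M (%x. f n x - F x) <= (1/2)^i" if "n >= ph i" for n i
 proof (rule square_integral_liminf[where f="%j x. f n x - f (ph j) x"])
  show "AE x in M. (%j. f n x - f (ph j) x) ~~> f n x - F x"
   using conv by eventually_elim (intro tendsto_intros)
  show "\<forall>\<^sub>F j in sequentially. norm2 M (%x. f n x - f (ph j) x) <= (1/2)^i"
   unfolding eventually_sequentially
  proof (intro exI[of _ i] allI impI)
   fix j assume "i <= j"
   then have "ph i <= ph j" using ph(1) by (simp add: strict_mono_less_eq)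
   then show "norm2 M (%x. f n x - f (ph j) x) <= (1/2)^i"
    using ph(2)[of i n "ph j"] that by simp
  qed
 qed (use sqd in auto)
 have "sq_int M (%x. f (ph 0) x - (f (ph 0) x - F x))"
  by (intro sq_int_diff f conjunct1[OF key[of 0 "ph 0"]]) simp
 then have "sq_int M F" by simp
 moreover have "(%n. norm2 M (%x. f n x - F x)) ~~> 0"
 proof (rule LIMSEQ_I)
  fix e :: real assume "e > 0"
  then obtain i where i: "(1/2::real)^i < e" using real_arch_pow_inv[of e "1/2"] by auto
  then show "\<exists>N. \<forall>n\<ge>N. norm (norm2 M (%x. f n x - F x) - 0) < e"
   using key by (intro exI[of _ "ph i"]) (auto intro: le_less_trans)
 qed
 ultimately show thesis using that ph(1) unfolding F_def by blast
qed

text \<open>A quadratic polynomial that vanishes at 0 and is nonnegative everywhere has slope 0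
  there.\<close>

lemma linear_term_vanishes:
 fixes P R :: real
 assumes quad: "!!t. 0 <= 2 * t * P + t\<^sup>2 * R" and R: "0 <= R"
 shows "P = 0"
proof (rule ccontr)
 assume "P ~= 0"
 \<comment> \<open>Any positive \<open>s\<close> with \<open>s * R < 2\<close> gives the
   contradiction at \<open>t = - s * P\<close>; this one needs no case distinction on
   \<open>R = 0\<close>.\<close>
 define s where "s = 1 / (R + 1)"
 have s: "0 < s" "s * R <= 1" using R by (simp_all add: s_def field_simps)
 have "0 <= s * P\<^sup>2 * (s * R - 2)"
  using quad[of "- s * P"] by (simp add: power2_eq_square algebra_simps)
 moreover have "0 < s * P\<^sup>2" using s \<open>P ~= 0\<close> by simp
 ultimately show False using s(2) by (simp add: zero_le_mult_iff)
qed

text \<open>The representing function is the minimiser of the quadratic functional \<open>J\<close>,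
  and the representation is its Euler-Lagrange equation. Boundedness of \<open>l\<close> keeps
  \<open>J\<close> bounded below, and completeness provides the minimiser.\<close>

theorem L2_Riesz:
 fixes l :: "('a => real) => real"
 assumes add: "!!a b. sq_int M a ==> sq_int M b ==> l (%x. a x + b x) = l a + l b"
  and scale: "!!a c. sq_int M a ==> l (%x. c * a x) = c * l a"
  and bound: "!!a. sq_int M a ==> \<bar>l a\<bar> <= C * norm2 M a"
 obtains c where "sq_int M c" "!!a. sq_int M a ==> l a = (LINT x|M. c x * a x)"
proof -
 define J where "J a = (norm2 M a)\<^sup>2 - 2 * l a" for a
 have Jlow: "J a >= - C\<^sup>2" if "sq_int M a" for a
 proof -
  have "l a <= C * norm2 M a" using bound[OF that] by simp
  then have "J a >= (norm2 M a)\<^sup>2 - 2 * (C * norm2 M a)" unfolding J_def by linarith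
  then show ?thesis using zero_le_power2[of "norm2 M a - C"] by (simp add: power2_diff algebra_simps)
 qed
 define mu where "mu = (INF a\<in>{a. sq_int M a}. J a)"
 have bdd: "bdd_below (J ` {a. sq_int M a})" using Jlow by (intro bdd_belowI2[where m="- C\<^sup>2"]) simp
 have mu: "mu <= J a" if "sq_int M a" for a
  unfolding mu_def using that by (intro cINF_lower bdd) auto
 have "\<exists>a. sq_int M a & J a < mu + 1 / real (Suc j)" for j
 proof -
  have "(INF a\<in>{a. sq_int M a}. J a) < mu + 1 / real (Suc j)" unfolding mu_def by simp
  then show ?thesis using cINF_less_iff[OF _ bdd] sq_int_zero by blast
 qed
 then obtain a where a: "!!j. sq_int M (a j)" "!!j. J (a j) < mu + 1 / real (Suc j)" by metis
 \<comment> \<open>Parallelogram law. The linear parts of \<open>J\<close> cancel, so the distance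
   of two almost minimal functions is controlled by how far each is from the infimum; minimising
   sequences are therefore Cauchy.\<close>
 have par: "(norm2 M (%x. b x - c x))\<^sup>2 = 2 * J b + 2 * J c - 4 * J (%x. (1/2) * (b x + c x))"
  if "sq_int M b" "sq_int M c" for b c
 proof -
  note int = sq_int_integrable[OF that(1)] sq_int_integrable[OF that(2)] sq_mult_int[OF that]
  have 1: "(norm2 M (%x. b x - c x))\<^sup>2 =
    (LINT x|M. (norm (b x))\<^sup>2 - 2 * (b x * c x) + (norm (c x))\<^sup>2)"
   unfolding norm2_power2
   by (intro LINT_cong refl) (simp add: power2_diff algebra_simps)
  have 2: "(norm2 M (%x. (1/2) * (b x + c x)))\<^sup>2 =
    (LINT x|M. (1/4) * ((norm (b x))\<^sup>2 + 2 * (b x * c x) + (norm (c x))\<^sup>2))"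
   unfolding norm2_power2
   by (intro LINT_cong refl) (simp add: power2_sum power_divide algebra_simps)
  have 3: "l (%x. (1/2) * (b x + c x)) = (1/2) * (l b + l c)"
   using that by (simp only: scale[OF sq_int_add] add)
  show ?thesis
   unfolding J_def 1 2 3 using int by (simp add: norm2_power2) (simp add: field_simps)
 qed
 have Cauchy: "\<exists>N. \<forall>m\<ge>N. \<forall>n\<ge>N. norm2 M (%x. a m x - a n x) < e" if e: "e > 0" for e
 proof -
  obtain N where N: "1 / real (Suc N) < e\<^sup>2 / 4"
   using nat_approx_posE[of "e\<^sup>2/4"] e by auto
  have "norm2 M (%x. a m x - a n x) < e" if mn: "m >= N" "n >= N" for m n
  proof (rule power2_less_imp_less)
   have j: "1 / real (Suc i) < e\<^sup>2 / 4" if "i >= N" for i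
   proof -
    have "1 / real (Suc i) <= 1 / real (Suc N)" using that by (intro frac_le) auto
    then show ?thesis using N by simp
   qed
   have "(norm2 M (%x. a m x - a n x))\<^sup>2 <= 2 * J (a m) + 2 * J (a n) - 4 * mu"
    unfolding par[OF a(1) a(1)]
    using mu[OF sq_int_mult[OF sq_int_add[OF a(1)[of m] a(1)[of n]], of "1/2"]] by simp
   also have "... < e\<^sup>2" using a(2)[of m] a(2)[of n] j[OF mn(1)] j[OF mn(2)] by linarith
   finally show "(norm2 M (%x. a m x - a n x))\<^sup>2 < e\<^sup>2" .
  qed (use e in simp)
  then show ?thesis by blast
 qed
 obtain c where c: "sq_int M c" and lim: "(%n. norm2 M (%x. a n x - c x)) ~~> 0"
  using L2_complete[OF a(1) Cauchy] by metis
 have nlim: "(%n. norm2 M (a n)) ~~> norm2 M c"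
 proof (rule Lim_transform2)
  show "(%n. norm2 M c) ~~> norm2 M c" by simp
  show "(%n. norm2 M c - norm2 M (a n)) ~~> 0"
   by (rule Lim_null_comparison[OF _ lim], rule always_eventually)
    (use norm2_diff_ge[OF c a(1)] in \<open>simp add: norm2_minus_commute[of M c]\<close>)
 qed
 have llim: "(%n. l (a n)) ~~> l c"
 proof (rule Lim_transform2)
  show "(%n. l c) ~~> l c" by simp
  show "(%n. l c - l (a n)) ~~> 0"
  proof (rule Lim_null_comparison)
   show "(%n. C * norm2 M (%x. a n x - c x)) ~~> 0"
    using tendsto_mult_right_zero[OF lim] by simp
   have "norm (l c - l (a n)) <= C * norm2 M (%x. a n x - c x)" for n
   proof -
    have "l (%x. a n x - c x) = l (a n) - l c"
     using add[OF a(1)[of n] sq_int_minus[OF c]] scale[OF c, of "-1"] by simp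
    then show ?thesis using bound[OF sq_int_diff[OF a(1)[of n] c]] by (simp add: abs_minus_commute)
   qed
   then show "\<forall>\<^sub>F n in sequentially. norm (l c - l (a n)) <= C * norm2 M (%x. a n x - c x)" by simp
  qed
 qed
 have "(%n. J (a n)) ~~> J c" unfolding J_def by (intro tendsto_intros nlim llim)
 moreover have "(%n. mu + 1 / real (Suc n)) ~~> mu + 0"
  by (intro tendsto_add tendsto_const LIMSEQ_Suc lim_1_over_n)
 ultimately have "J c <= mu + 0" using a(2) by (intro LIMSEQ_le) (auto intro: less_imp_le)
 then have min: "J c <= J b" if "sq_int M b" for b using mu[OF that] by simp
 have "l b = (LINT x|M. c x * b x)" if b: "sq_int M b" for b
 proof -
  let ?P = "(LINT x|M. c x * b x) - l b"
  have quad: "0 <= 2 * t * ?P + t\<^sup>2 * (norm2 M b)\<^sup>2" for t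
  proof -
   have 1: "(norm2 M (%x. c x + t * b x))\<^sup>2 =
     (LINT x|M. (norm (c x))\<^sup>2 + (2 * t) * (c x * b x) + t\<^sup>2 * (norm (b x))\<^sup>2)"
    unfolding norm2_power2
    by (intro LINT_cong refl) (simp add: power2_sum power_mult_distrib algebra_simps)
   have 2: "l (%x. c x + t * b x) = l c + t * l b"
    using add[OF c sq_int_mult[OF b]] scale[OF b] by simp
   have "J c <= J (%x. c x + t * b x)" by (intro min sq_int_add c sq_int_mult b)
   then show ?thesis
    unfolding J_def 1 2
    using sq_int_integrable[OF c] sq_int_integrable[OF b] sq_mult_int[OF c b]
    by (simp add: norm2_power2) (simp add: algebra_simps)
  qed
  have "?P = 0" by (rule linear_term_vanishes[OF quad]) simp
  then show ?thesis by simp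
 qed
 then show thesis using that c by blast
qed

section \<open>Smooth functions\<close>

lemma partial_deriv_eq: "(ph has_derivative ph') (at x) ==> partial_deriv i ph x = ph' (axis i 1)"
 unfolding partial_deriv_def by (metis frechet_derivative_at)

lemma C_k_SucI:
 assumes "!!x. (ph has_derivative ph' x) (at x)" "!!i. C_k k (%x. ph' x (axis i 1))"
 shows "C_k (Suc k) ph"
proof -
 have "partial_deriv i ph = (%x. ph' x (axis i 1))" for i
  using partial_deriv_eq[OF assms(1)] by auto
 moreover have "ph differentiable_on UNIV"
  using assms(1) by (auto simp: differentiable_on_def differentiable_def)
 ultimately show ?thesis using assms(2) by simp
qed

lemma C_k_SucD:
 assumes "C_k (Suc k) ph"
 shows "(ph has_derivative frechet_derivative ph (at x)) (at x)" "C_k k (partial_deriv i ph)"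
 using assms by (auto simp: differentiable_on_def frechet_derivative_works)

lemma C_k_pred: "C_k (Suc k) ph ==> C_k k ph"
proof (induction k arbitrary: ph)
 case 0
 then show ?case by (simp add: differentiable_imp_continuous_on)
next
 case (Suc k)
 then show ?case by simp
qed

lemma C_k_const: "C_k k (%x. c)"
proof (induction k arbitrary: c)
 case (Suc k)
 show ?case by (rule C_k_SucI[where ph'="%x h. 0"]) (auto intro: Suc)
qed simp

lemma C_k_add: "C_k k f ==> C_k k g ==> C_k k (%x. f x + g x)"
proof (induction k arbitrary: f g)
 case 0
 then show ?case by (auto intro: continuous_intros)
next
 case (Suc k)
 note d = C_k_SucD(1)[OF Suc.prems(1)] C_k_SucD(1)[OF Suc.prems(2)]
 show ?case
  by (rule C_k_SucI[OF has_derivative_add[OF d]])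
   (use Suc in \<open>auto simp: partial_deriv_def[symmetric]\<close>)
qed

lemma C_k_mult: "C_k k f ==> C_k k g ==> C_k k (%x. f x * g x)"
proof (induction k arbitrary: f g)
 case 0
 then show ?case by (auto intro: continuous_intros)
next
 case (Suc k)
 note d = C_k_SucD(1)[OF Suc.prems(1)] C_k_SucD(1)[OF Suc.prems(2)]
 show ?case
 proof (rule C_k_SucI[OF has_derivative_mult[OF d]])
  fix i
  have "C_k k (%x. f x * partial_deriv i g x + partial_deriv i f x * g x)"
   by (intro C_k_add Suc.IH C_k_pred[OF Suc.prems(1)] C_k_pred[OF Suc.prems(2)]
     C_k_SucD(2)[OF Suc.prems(1)] C_k_SucD(2)[OF Suc.prems(2)])
  then show "C_k k (%x. f x * frechet_derivative g (at x) (axis i 1) + frechet_derivative f (at x) (axis i 1) * g x)"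
   by (simp add: partial_deriv_def)
 qed
qed

lemma C_k_sum: "(!!i. i : I ==> C_k k (f i)) ==> C_k k (%x. \<Sum>i\<in>I. f i x)"
 by (induction I rule: infinite_finite_induct) (auto intro: C_k_add C_k_const)

lemma C_k_prod: "(!!i. i : I ==> C_k k (f i)) ==> C_k k (%x. \<Prod>i\<in>I. f i x)"
 by (induction I rule: infinite_finite_induct) (auto intro: C_k_mult C_k_const)

lemma axis_expand: "(v :: real^'d) = (\<Sum>i\<in>UNIV. v $ i *\<^sub>R axis i 1)"
 using basis_expansion[of v] by (simp add: scalar_mult_eq_scaleR)

lemma linear_axis_expand: "linear f ==> f (v :: real^'d) = (\<Sum>i\<in>UNIV. v $ i *\<^sub>R f (axis i 1))"
 by (subst axis_expand[of v]) (simp add: linear_sum linear_scale)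

lemma has_derivative_partial:
 assumes "C_k (Suc k) ph"
 shows "(ph has_derivative (%h. \<Sum>i\<in>UNIV. h $ i * partial_deriv i ph x)) (at x)"
proof -
 note d = C_k_SucD(1)[OF assms, of x]
 have "frechet_derivative ph (at x) = (%h. \<Sum>i\<in>UNIV. h $ i * partial_deriv i ph x)"
  by (rule ext, subst linear_axis_expand[OF has_derivative_linear[OF d]]) (simp add: partial_deriv_def)
 with d show ?thesis by simp
qed

lemma partial_deriv_affine:
 fixes ph :: "real^'n => real" and B :: "real^'d^'n"
 assumes "C_k (Suc k) ph"
 shows "partial_deriv i (%x. ph (B *v x + b)) x = (\<Sum>j\<in>UNIV. B $ j $ i * partial_deriv j ph (B *v x + b))"
  and "(%x. ph (B *v x + b)) differentiable at x"
proof -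
 have 1: "((%x. B *v x + b) has_derivative (%h. B *v h)) (at x)"
  by (auto intro!: derivative_eq_intros bounded_linear_imp_has_derivative)
 note d = has_derivative_compose[OF 1 has_derivative_partial[OF assms]]
 show "(%x. ph (B *v x + b)) differentiable at x" using d by (auto simp: differentiable_def)
 show "partial_deriv i (%x. ph (B *v x + b)) x = (\<Sum>j\<in>UNIV. B $ j $ i * partial_deriv j ph (B *v x + b))"
  unfolding partial_deriv_eq[OF d] by (simp add: matrix_vector_mul_component inner_axis)
qed

lemma C_k_affine:
 fixes ph :: "real^'n => real" and B :: "real^'d^'n"
 shows "C_k k ph ==> C_k k (%x. ph (B *v x + b))"
proof (induction k arbitrary: ph)
 case 0
 have "continuous_on UNIV (%x. B *v x + b)"
  by (intro continuous_on_add continuous_on_const linear_continuous_on matrix_vector_mul_bounded_linear)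
 then show ?case using 0 continuous_on_compose2[of UNIV ph] by auto
next
 case (Suc k)
 have "partial_deriv i (%x. ph (B *v x + b)) =
   (%x. \<Sum>j\<in>UNIV. B $ j $ i * partial_deriv j ph (B *v x + b))" for i
  by (rule ext) (rule partial_deriv_affine(1)[OF Suc.prems])
 moreover have "C_k k (%x. \<Sum>j\<in>UNIV. B $ j $ i * partial_deriv j ph (B *v x + b))" for i
  by (intro C_k_sum C_k_mult[OF C_k_const] Suc.IH[OF C_k_SucD(2)[OF Suc.prems]])
 ultimately show ?case
  using partial_deriv_affine(2)[OF Suc.prems, of B b] by (simp add: differentiable_on_def)
qed

lemma C_k_inner: "C_k k (%x. a \<bullet> x + c)"
proof (cases k)
 case 0
 then show ?thesis by (auto intro!: continuous_intros)
next
 case (Suc j)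
 have "((%x. a \<bullet> x + c) has_derivative (%h. a \<bullet> h)) (at x)" for x
  by (auto intro!: derivative_eq_intros)
 then show ?thesis unfolding Suc by (rule C_k_SucI) (rule C_k_const)
qed

text \<open>One-dimensional counterpart of \<open>C_k\<close>. The derivative is existentially
  quantified, so that closure properties only have to exhibit a formula for it.\<close>

primrec C_k_real :: "nat => (real => real) => bool" where
 "C_k_real 0 g \<longleftrightarrow> continuous_on UNIV g"
| "C_k_real (Suc k) g \<longleftrightarrow> (\<exists>g'. (\<forall>t. (g has_real_derivative g' t) (at t)) & C_k_real k g')"

lemma C_k_compose_real: "C_k_real k g ==> C_k k f ==> C_k k (%x. g (f x))"
proof (induction k arbitrary: f g)
 case 0
 then show ?case by (auto intro: continuous_on_compose2)
next
 case (Suc k)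
 obtain g' where g': "!!t. (g has_real_derivative g' t) (at t)" "C_k_real k g'"
  using Suc.prems(1) by auto
 have d: "((%x. g (f x)) has_derivative (%h. g' (f x) * frechet_derivative f (at x) h)) (at x)" for x
  using has_derivative_compose[OF C_k_SucD(1)[OF Suc.prems(2)] g'(1)[unfolded has_field_derivative_def]]
  by simp
 show ?case
 proof (rule C_k_SucI[OF d])
  fix i
  have "C_k k (%x. g' (f x) * partial_deriv i f x)"
   by (rule C_k_mult[OF Suc.IH[OF g'(2) C_k_pred[OF Suc.prems(2)]] C_k_SucD(2)[OF Suc.prems(2)]])
  then show "C_k k (%x. g' (f x) * frechet_derivative f (at x) (axis i 1))"
   by (simp add: partial_deriv_def)
 qed
qed

lemma C_k_real_add: "C_k_real k f ==> C_k_real k g ==> C_k_real k (%x. f x + g x)"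
proof (induction k arbitrary: f g)
 case 0
 then show ?case by (auto intro: continuous_intros)
next
 case (Suc k)
 then obtain f' g' where "!!t. (f has_real_derivative f' t) (at t)" "C_k_real k f'"
   "!!t. (g has_real_derivative g' t) (at t)" "C_k_real k g'" by auto
 then show ?case using Suc.IH by (auto intro!: exI[of _ "%t. f' t + g' t"] DERIV_add)
qed

lemma C_k_real_cmult: "C_k_real k f ==> C_k_real k (%x. c * f x)"
proof (induction k arbitrary: f)
 case 0
 then show ?case by (auto intro: continuous_intros)
next
 case (Suc k)
 then obtain f' where "!!t. (f has_real_derivative f' t) (at t)" "C_k_real k f'" by auto
 then show ?case using Suc.IH by (auto intro!: exI[of _ "%t. c * f' t"] DERIV_cmult)
qed

text \<open>Differentiation adds pi/2 to the phase, so with a general phase the induction stays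
  within cosines.\<close>

lemma C_k_real_cos: "C_k_real k (%t. cos (t + c))"
proof (induction k arbitrary: c)
 case 0
 then show ?case by (auto intro!: continuous_intros)
next
 case (Suc k)
 have "((%t. cos (t + c)) has_real_derivative cos (t + (c + pi/2))) (at t)" for t
  by (auto intro!: derivative_eq_intros simp: cos_add sin_add)
 then show ?case using Suc by (auto intro!: exI[of _ "%t. cos (t + (c + pi/2))"])
qed

lemma C_k_cos: "C_k k (%x. cos (a \<bullet> x + c))"
 using C_k_compose_real[OF C_k_real_cos[of k 0] C_k_inner[of k a c]] by simp

section \<open>Bump functions\<close>

definition exp_flat :: "nat => real => real" where
 "exp_flat m t = (if t > 0 then exp (- 1 / t) / t ^ m else 0)"

text \<open>Substitute s = 1 / t: the exponential beats every power at infinity.\<close>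

lemma exp_flat_tendsto: "((%t. exp (- 1 / t) / t ^ m) \<longlongrightarrow> 0) (at_right (0::real))"
proof -
 have "((%s::real. s ^ m / exp s) \<longlongrightarrow> 0) at_top" by (rule tendsto_power_div_exp_0)
 then have "((%t::real. inverse t ^ m / exp (inverse t)) \<longlongrightarrow> 0) (at_right 0)"
  by (rule filterlim_compose) (rule filterlim_inverse_at_top_right)
 then show ?thesis
  by (rule Lim_transform_eventually)
   (simp add: eventually_at_filter exp_minus divide_inverse power_inverse mult.commute)
qed

text \<open>The functions t^(-m) exp(-1/t), extended by 0, are closed under differentiation up to
  linear combinations. The index \<open>m\<close> exists for this reason: smoothness of all of them
  follows by one induction.\<close>

lemma DERIV_exp_flat:
 "(exp_flat m has_real_derivative (exp_flat (m + 2) t + (- real m) * exp_flat (Suc m) t)) (at t)"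
proof -
 consider "t > 0" | "t < 0" | "t = 0" by linarith
 then show ?thesis
 proof cases
  case 1
  have "((%t. exp (- 1 / t) / t ^ m) has_real_derivative
    (exp (- 1 / t) * (1 / t\<^sup>2) * t ^ m - exp (- 1 / t) * (real m * t ^ (m - 1))) / (t ^ m * t ^ m)) (at t)"
   using 1 by (auto intro!: derivative_eq_intros simp: power2_eq_square)
  also have "(exp (- 1 / t) * (1 / t\<^sup>2) * t ^ m - exp (- 1 / t) * (real m * t ^ (m - 1))) / (t ^ m * t ^ m)
    = exp_flat (m + 2) t + (- real m) * exp_flat (Suc m) t"
  \<comment> \<open>The exponent \<open>m - 1\<close> is a truncated subtraction, so
    \<open>m = 0\<close> is separate.\<close>
  proof (cases m)
   case 0
   then show ?thesis using 1 by (simp add: exp_flat_def power2_eq_square)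
  next
   case (Suc n)
   define a where "a = t ^ n"
   have "a ~= 0" "t ~= 0" using 1 by (auto simp: a_def)
   then have "(exp (- 1 / t) * (1 / (t * t)) * (t * a) - exp (- 1 / t) * (c * a)) / (t * a * (t * a))
     = exp (- 1 / t) / (t * (t * (t * a))) + - c * (exp (- 1 / t) / (t * (t * a)))" for c
    by (simp add: divide_simps) (simp add: algebra_simps)
   from this[of "real (Suc n)"] show ?thesis
    unfolding Suc
    by (simp only: exp_flat_def a_def power2_eq_square power_Suc add_2_eq_Suc' diff_Suc_1 1 if_True)
  qed
  finally have "((%t. exp (- 1 / t) / t ^ m) has_real_derivative
    exp_flat (m + 2) t + (- real m) * exp_flat (Suc m) t) (at t)" .
  moreover have ev: "\<forall>\<^sub>F s in nhds t. exp (- 1 / s) / s ^ m = exp_flat m s"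
   using eventually_nhds_in_open[of "{0<..}" t] 1 by (auto simp: exp_flat_def elim!: eventually_mono)
  ultimately show ?thesis using DERIV_cong_ev[OF refl ev refl] by simp
 next
  case 2
  have "((%t. 0) has_real_derivative 0) (at t)" by simp
  moreover have "0 = exp_flat (m + 2) t + (- real m) * exp_flat (Suc m) t"
   using 2 by (simp add: exp_flat_def)
  moreover have ev: "\<forall>\<^sub>F s in nhds t. 0 = exp_flat m s"
   using eventually_nhds_in_open[of "{..<0}" t] 2 by (auto simp: exp_flat_def elim!: eventually_mono)
  ultimately show ?thesis using DERIV_cong_ev[OF refl ev refl] by simp
 next
  \<comment> \<open>At 0 the right difference quotient is \<open>exp_flat (Suc m)\<close>, which
    tends to 0; the left one vanishes identically.\<close>
  case 3
  have "((%h. (exp_flat m (0 + h) - exp_flat m 0) / h) \<longlongrightarrow> 0) (at 0)"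
  proof (rule filterlim_split_at)
   show "((%h. (exp_flat m (0 + h) - exp_flat m 0) / h) \<longlongrightarrow> 0) (at_left 0)"
    by (rule tendsto_eventually) (simp add: exp_flat_def eventually_at_filter)
   show "((%h. (exp_flat m (0 + h) - exp_flat m 0) / h) \<longlongrightarrow> 0) (at_right 0)"
    by (rule Lim_transform_eventually[OF exp_flat_tendsto[of "Suc m"]])
     (simp add: exp_flat_def eventually_at_filter)
  qed
  then show ?thesis using 3 by (simp add: DERIV_def exp_flat_def)
 qed
qed

lemma C_k_real_exp_flat: "C_k_real k (exp_flat m)"
proof (induction k arbitrary: m)
 case 0
 have "isCont (exp_flat m) t" for t by (rule DERIV_isCont[OF DERIV_exp_flat])
 then show ?case by (simp add: continuous_at_imp_continuous_on)
next
 case (Suc k)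
 show ?case
  unfolding C_k_real.simps
  using DERIV_exp_flat[of m] C_k_real_add[OF Suc[of "m + 2"] C_k_real_cmult[OF Suc[of "Suc m"], of "- real m"]]
  by (intro exI[of _ "%t. exp_flat (m + 2) t + (- real m) * exp_flat (Suc m) t"]) simp
qed

definition bump_factor :: "real => real" where
 "bump_factor = exp_flat 0"

lemma bump_factor_eq: "bump_factor t = (if t > 0 then exp (- 1 / t) else 0)"
 by (simp add: bump_factor_def exp_flat_def)

lemma bump_factor_bounds: "0 <= bump_factor t" "bump_factor t <= 1"
 by (auto simp: bump_factor_eq)

text \<open>The shift by 1 inside the factors makes them vanish within 1 / (j + 1) of the faces. The
  support is thus compact in the open box, while the growing slope drives the values to 1
  inside.\<close>

definition bump :: "real^'d => real^'d => nat => real^'d => real" where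
 "bump a b j x = (\<Prod>i\<in>UNIV. bump_factor (real (Suc j) * (x $ i - a $ i) - 1) * bump_factor (real (Suc j) * (b $ i - x $ i) - 1))"

lemma C_k_bump: "C_k k (bump a b j)"
proof -
 have *: "(%x. bump a b j x) = (%x. \<Prod>i\<in>UNIV.
   bump_factor ((real (Suc j) *\<^sub>R axis i 1) \<bullet> x + (- real (Suc j) * a $ i - 1)) *
   bump_factor (((- real (Suc j)) *\<^sub>R axis i 1) \<bullet> x + (real (Suc j) * b $ i - 1)))"
  unfolding bump_def by (intro ext prod.cong refl) (simp add: inner_axis' algebra_simps)
 show ?thesis
  unfolding * bump_factor_def
  by (intro C_k_prod C_k_mult C_k_compose_real[OF C_k_real_exp_flat C_k_inner])
qed

lemma bump_bounds: "0 <= bump a b j x" "bump a b j x <= 1"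
 unfolding bump_def by (auto intro!: prod_nonneg prod_le_1 mult_le_one simp: bump_factor_bounds)

lemma bump_eq_0:
 assumes "x ~: cbox (\<chi> i. a $ i + 1 / real (Suc j)) (\<chi> i. b $ i - 1 / real (Suc j))"
 shows "bump a b j x = 0"
proof -
 obtain i where "x $ i < a $ i + 1 / real (Suc j) \<or> b $ i - 1 / real (Suc j) < x $ i"
  using assms by (auto simp: mem_box_cart not_le)
 then have "real (Suc j) * (x $ i - a $ i) - 1 <= 0 \<or> real (Suc j) * (b $ i - x $ i) - 1 <= 0"
  by (simp add: field_simps) linarith
 then have "bump_factor (real (Suc j) * (x $ i - a $ i) - 1) * bump_factor (real (Suc j) * (b $ i - x $ i) - 1) = 0"
  by (auto simp: bump_factor_eq)
 then show ?thesis unfolding bump_def by (intro prod_zero) auto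
qed

lemma bump_factor_tendsto:
 assumes "0 < c"
 shows "(%j. bump_factor (real (Suc j) * c - 1)) ~~> 1"
proof -
 have *: "filterlim (%j. real (Suc j) * c - 1) at_top sequentially"
  using assms by real_asymp
 have "((%t. exp (- 1 / t)) \<longlongrightarrow> exp 0) (at_top :: real filter)"
  by (intro tendsto_exp) real_asymp
 then have "(bump_factor \<longlongrightarrow> exp 0) at_top"
  by (rule Lim_transform_eventually)
   (auto simp: bump_factor_eq intro: eventually_mono[OF eventually_gt_at_top[of 0]])
 then show ?thesis using filterlim_compose[OF _ *] by simp
qed

lemma bump_tendsto: fixes x :: "real^'d" shows "(%j. bump a b j x) ~~> indicator (box a b) x"
proof (cases "x : box a b")
 case True
 have "(%j. bump a b j x) ~~> (\<Prod>i\<in>(UNIV :: 'd set). 1 * 1)"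
  unfolding bump_def
  by (rule Limits.tendsto_prod, rule tendsto_mult; rule bump_factor_tendsto)
   (use True in \<open>auto simp: mem_box_cart\<close>)
 then show ?thesis using True by simp
next
 case False
 then obtain i where i: "x $ i <= a $ i \<or> b $ i <= x $ i" by (auto simp: mem_box_cart not_less)
 have "bump a b j x = 0" for j
 proof (rule bump_eq_0)
  have "0 < 1 / real (Suc j)" by simp
  with i have "\<not> (a $ i + 1 / real (Suc j) <= x $ i & x $ i <= b $ i - 1 / real (Suc j))"
   by linarith
  then show "x ~: cbox (\<chi> i. a $ i + 1 / real (Suc j)) (\<chi> i. b $ i - 1 / real (Suc j))"
   by (auto simp: mem_box_cart simp del: of_nat_Suc)
 qed
 then show ?thesis using False by simp
qed

definition smooth :: "(real^'d => real) => bool" where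
 "smooth ph \<longleftrightarrow> (\<forall>k. C_k k ph)"

lemma smooth_partial_deriv: "smooth ph ==> smooth (partial_deriv i ph)"
 unfolding smooth_def using C_k_SucD(2) by blast

lemma smooth_mult: "smooth f ==> smooth g ==> smooth (%x. f x * g x)"
 by (simp add: smooth_def C_k_mult)

lemma smooth_affine: "smooth ph ==> smooth (%x. ph (B *v x + b))"
 by (simp add: smooth_def C_k_affine)

lemma smooth_shift: "smooth ph ==> smooth (%x. ph (x - h))"
 using smooth_affine[of ph "mat 1" "- h"] by simp

lemma smooth_continuous: "smooth ph ==> continuous_on UNIV ph"
 unfolding smooth_def using C_k.simps(1) by blast

lemma smooth_has_derivative:
 "smooth ph ==> (ph has_derivative (%h. \<Sum>i\<in>UNIV. h $ i * partial_deriv i ph x)) (at x)"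
 unfolding smooth_def using has_derivative_partial by blast

lemma partial_deriv_shift:
 assumes "smooth ph"
 shows "partial_deriv i (%x. ph (x - h)) x = partial_deriv i ph (x - h)"
proof (rule trans[OF partial_deriv_eq])
 show "((%x. ph (x - h)) has_derivative (%v. \<Sum>i\<in>UNIV. v $ i * partial_deriv i ph (x - h))) (at x)"
  by (rule has_derivative_compose[OF _ smooth_has_derivative[OF assms], of "%x. x - h" "%v. v"])
   (auto intro!: derivative_eq_intros)
qed (simp add: axis_def if_distrib[where f="%c. c * _"] cong: if_cong)

lemma partial_deriv_mult:
 assumes "smooth f" "smooth g"
 shows "partial_deriv i (%x. f x * g x) x = f x * partial_deriv i g x + partial_deriv i f x * g x"
 unfolding partial_deriv_eq[OF has_derivative_mult[OF smooth_has_derivative[OF assms(1)] smooth_has_derivative[OF assms(2)]]]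
 by (simp add: axis_def if_distrib[where f="%c. c * _"] cong: if_cong)

lemma partial_deriv_zero_off_compact:
 assumes "compact K" "!!x. x ~: K ==> ph x = 0" "x ~: K"
 shows "partial_deriv i ph x = 0"
proof -
 have "((%x. 0) has_derivative (%h. 0)) (at x)" by simp
 moreover have "open (- K)" using assms(1) by (simp add: compact_imp_closed open_Compl)
 ultimately have "(ph has_derivative (%h. 0)) (at x)"
  by (rule has_derivative_transform_within_open[where s="- K"]) (use assms in auto)
 then show ?thesis by (simp add: partial_deriv_eq)
qed

lemma continuous_bounded_compact_support:
 fixes f :: "real^'d => real"
 assumes "continuous_on UNIV f" "compact K" "!!x. x ~: K ==> f x = 0"
 obtains B where "B > 0" "!!x. \<bar>f x\<bar> <= B"
proof -
 have "bounded (f ` K)"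
  using assms by (intro compact_imp_bounded compact_continuous_image) (auto intro: continuous_on_subset)
 then obtain B where "B > 0" "!!x. x : K ==> \<bar>f x\<bar> <= B" by (auto simp: bounded_pos)
 then show thesis using that[of B] assms(3) by (metis abs_zero less_imp_le)
qed

text \<open>The Lipschitz bound dominates the difference quotients when translates are
  differentiated under the integral sign.\<close>

lemma smooth_Lipschitz_compact_support:
 assumes "smooth ph" "compact K" "!!x. x ~: K ==> ph x = 0"
 obtains M where "M > 0" "!!x y. \<bar>ph x - ph y\<bar> <= M * norm (x - y)"
proof -
 have "\<exists>B>0. \<forall>x. \<bar>partial_deriv i ph x\<bar> <= B" for i
  using continuous_bounded_compact_support[OF smooth_continuous[OF smooth_partial_deriv[OF assms(1)]] assms(2)
    partial_deriv_zero_off_compact[OF assms(2,3)]] by metis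
 then obtain B where B: "!!i. B i > 0" "!!i x. \<bar>partial_deriv i ph x\<bar> <= B i" by metis
 let ?M = "\<Sum>i\<in>UNIV. B i"
 have "norm (ph x - ph y) <= ?M * norm (x - y)" for x y
 proof (rule differentiable_bound[where S=UNIV])
  fix z
  show "(ph has_derivative (%h. \<Sum>i\<in>UNIV. h $ i * partial_deriv i ph z)) (at z within UNIV)"
   using smooth_has_derivative[OF assms(1)] by simp
  show "onorm (%h. \<Sum>i\<in>UNIV. h $ i * partial_deriv i ph z) <= ?M"
  proof (rule onorm_bound)
   fix h :: "real^'a"
   have "norm (\<Sum>i\<in>UNIV. h $ i * partial_deriv i ph z) <= (\<Sum>i\<in>UNIV. norm h * B i)"
    by (rule order_trans[OF norm_sum], rule sum_mono)
     (auto simp: abs_mult intro!: mult_mono component_le_norm_cart B(2))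
   then show "norm (\<Sum>i\<in>UNIV. h $ i * partial_deriv i ph z) <= ?M * norm h"
    by (simp add: sum_distrib_left mult.commute)
  qed (use B(1) in \<open>auto intro: sum_nonneg less_imp_le\<close>)
 qed auto
 moreover have "?M > 0" using B(1) by (intro sum_pos) auto
 ultimately show thesis using that[of ?M] by simp
qed

section \<open>Weak gradients\<close>

lemma test_functions_iff:
 "ph : test_functions S \<longleftrightarrow> smooth ph & (\<exists>K. compact K & K \<subseteq> S & (\<forall>x. x ~: K --> ph x = 0))"
 by (simp add: test_functions_def smooth_def)

lemma compact_in_sets_lebesgue: "compact K ==> K : sets lebesgue"
 by (simp add: compact_imp_closed borel_closed)

lemma open_in_sets_lebesgue: "open K ==> K : sets lebesgue"
 by (simp add: borel_open)

lemma integrable_lebesgue_on_iff: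
 fixes f :: "'a::euclidean_space => 'b::{banach, second_countable_topology}"
 shows "S : sets lebesgue ==> integrable (leb S) f \<longleftrightarrow> integrable lebesgue (%x. indicator S x *\<^sub>R f x)"
 by (simp add: integrable_restrict_space)

lemma integral_lebesgue_on_eq:
 fixes f :: "'a::euclidean_space => 'b::{banach, second_countable_topology}"
 shows "S : sets lebesgue ==> (LINT x|leb S. f x) = (LINT x|lebesgue. indicator S x *\<^sub>R f x)"
 by (simp add: integral_restrict_space)

lemma integrable_compact_support_bound:
 fixes v :: "real^'d => real"
 assumes S: "S : sets lebesgue" and K: "compact K" "K \<subseteq> S" and v: "v absolutely_integrable_on K"
 shows "integrable (leb S) (%x. indicator K x * \<bar>v x\<bar>)"
proof -
 have "integrable lebesgue (%x. indicator K x *\<^sub>R \<bar>v x\<bar>)"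
  using absolutely_integrable_abs[OF v] by (simp add: set_integrable_def)
 moreover have "indicator S x *\<^sub>R (indicator K x * \<bar>v x\<bar>) = indicator K x *\<^sub>R \<bar>v x\<bar>" for x
  using K(2) by (auto simp: indicator_def)
 ultimately show ?thesis unfolding integrable_lebesgue_on_iff[OF S] by (simp only:)
qed

lemma integrable_times_compact_support:
 fixes v ps :: "real^'d => real"
 assumes S: "S : sets lebesgue" and K: "compact K" "K \<subseteq> S" and v: "v absolutely_integrable_on K"
  and ps: "continuous_on UNIV ps" "!!x. x ~: K ==> ps x = 0"
 shows "integrable (leb S) (%x. v x * ps x)"
proof -
 obtain B where B: "!!x. \<bar>ps x\<bar> <= B"
  using continuous_bounded_compact_support[OF ps(1) K(1) ps(2)] by metis
 have i: "integrable lebesgue (%x. indicator K x *\<^sub>R v x)"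
  using v by (simp add: set_integrable_def)
 have m: "ps : borel_measurable lebesgue"
  using borel_measurable_continuous_onI[OF ps(1)] by (simp add: measurable_completion)
 have "integrable lebesgue (%x. (indicator K x *\<^sub>R v x) * ps x)"
 proof (rule intble_bound)
  show "integrable lebesgue (%x. B * norm (indicator K x *\<^sub>R v x))"
   using i by (intro integrable_mult_right integrable_norm)
  show "(%x. (indicator K x *\<^sub>R v x) * ps x) : borel_measurable lebesgue"
   by (intro borel_measurable_times borel_measurable_integrable[OF i] m)
  show "AE x in lebesgue. norm ((indicator K x *\<^sub>R v x) * ps x) <= norm (B * norm (indicator K x *\<^sub>R v x))"
  proof (rule AE_I2)
   fix x
   have "0 <= B" using B[of x] by linarith
   have "norm ((indicator K x *\<^sub>R v x) * ps x) = norm (indicator K x *\<^sub>R v x) * \<bar>ps x\<bar>"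
    by (simp add: abs_mult)
   also have "... <= norm (indicator K x *\<^sub>R v x) * B" by (intro mult_left_mono B) simp
   finally show "norm ((indicator K x *\<^sub>R v x) * ps x) <= norm (B * norm (indicator K x *\<^sub>R v x))"
    using \<open>0 <= B\<close> by (simp add: abs_mult mult.commute)
  qed
 qed
 moreover have "(indicator K x *\<^sub>R v x) * ps x = indicator S x *\<^sub>R (v x * ps x)" for x
  using K(2) ps(2)[of x] by (auto simp: indicator_def)
 ultimately show ?thesis unfolding integrable_lebesgue_on_iff[OF S] by (simp only:)
qed

lemma test_function_integrable:
 fixes v :: "real^'d => real"
 assumes "open S" "ph : test_functions S"
  and v: "!!K. compact K ==> K \<subseteq> S ==> v absolutely_integrable_on K"
 shows "integrable (leb S) (%x. v x * ph x)"
  and "integrable (leb S) (%x. v x * partial_deriv i ph x)"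
proof -
 from assms(2) obtain K where *: "smooth ph" "compact K" "K \<subseteq> S" "!!x. x ~: K ==> ph x = 0"
  by (auto simp: test_functions_iff)
 note S = open_in_sets_lebesgue[OF assms(1)]
 show "integrable (leb S) (%x. v x * ph x)"
  by (rule integrable_times_compact_support[OF S *(2,3) v[OF *(2,3)] smooth_continuous[OF *(1)] *(4)])
 show "integrable (leb S) (%x. v x * partial_deriv i ph x)"
  by (rule integrable_times_compact_support[OF S *(2,3) v[OF *(2,3)]
     smooth_continuous[OF smooth_partial_deriv[OF *(1)]] partial_deriv_zero_off_compact[OF *(2,4)]])
qed

lemma has_weak_gradientD:
 assumes "has_weak_gradient S v g"
 shows "!!K. compact K ==> K \<subseteq> S ==> v absolutely_integrable_on K"
  and "!!K. compact K ==> K \<subseteq> S ==> g absolutely_integrable_on K"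
  and "!!K. compact K ==> K \<subseteq> S ==> (%x. g x $ i) absolutely_integrable_on K"
  and "!!ph i. ph : test_functions S ==>
   (LINT x|leb S. v x * partial_deriv i ph x) = - (LINT x|leb S. g x $ i * ph x)"
proof -
 show *: "g absolutely_integrable_on K" if "compact K" "K \<subseteq> S" for K
  using assms that by (simp add: has_weak_gradient_def)
 show "(%x. g x $ i) absolutely_integrable_on K" if "compact K" "K \<subseteq> S" for K
  using absolutely_integrable_component[OF *[OF that], of "axis i 1"] by (simp add: inner_axis)
qed (use assms in \<open>auto simp: has_weak_gradient_def\<close>)

text \<open>The derivative is one-sided at the end points, since beyond them the translates of the
  support may leave the set.\<close>
lemma has_derivative_integral_translates:
 fixes u :: "real^'d => real"
 assumes S: "open S" and u: "!!K. compact K ==> K \<subseteq> S ==> u absolutely_integrable_on K"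
  and ph: "smooth ph" and K: "compact K" "!!x. x ~: K ==> ph x = 0"
   "!!x t. x : K ==> 0 <= t ==> t <= 1 ==> x + t *\<^sub>R h : S"
  and t: "t : {0..1}"
 shows "((%t. LINT x|leb S. u x * ph (x - t *\<^sub>R h)) has_real_derivative
   - (LINT x|leb S. u x * (\<Sum>i\<in>UNIV. h $ i * partial_deriv i ph (x - t *\<^sub>R h)))) (at t within {0..1})"
  and "(%x. ph (x - t *\<^sub>R h)) : test_functions S"
proof -
 \<comment> \<open>The compact set swept out by the moving support. All difference quotients vanish
   outside it, so local integrability of \<open>u\<close> suffices for dominated
   convergence.\<close>
 define K1 where "K1 = (%(t,x). x + t *\<^sub>R h) ` ({0..1} \<times> K)"
 have K1: "compact K1" "K1 \<subseteq> S"
  unfolding K1_def using K(3)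
  by (auto intro!: compact_continuous_image compact_Times K(1) continuous_intros simp: case_prod_unfold)
 have off: "ph (x - s *\<^sub>R h) = 0" if "x ~: K1" "s : {0..1}" for x s
 proof (rule ccontr)
  assume "ph (x - s *\<^sub>R h) ~= 0"
  then have "x - s *\<^sub>R h : K" using K(2) by blast
  then have "x : K1" using that(2) unfolding K1_def by (intro image_eqI[of _ _ "(s, x - s *\<^sub>R h)"]) auto
  then show False using that(1) by simp
 qed
 note sm = smooth_shift[OF ph]
 have test: "(%x. ph (x - s *\<^sub>R h)) : test_functions S" if "s : {0..1}" for s
  using sm K1 off that by (auto simp: test_functions_iff)
 show "(%x. ph (x - t *\<^sub>R h)) : test_functions S" by (rule test[OF t])
 note int = test_function_integrable(1)[OF S test u]
 obtain M where M: "M > 0" "!!x y. \<bar>ph x - ph y\<bar> <= M * norm (x - y)"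
  using smooth_Lipschitz_compact_support[OF ph K(1,2)] by blast
 have line: "((%s. ph (x - s *\<^sub>R h)) has_real_derivative
   - (\<Sum>i\<in>UNIV. h $ i * partial_deriv i ph (x - t *\<^sub>R h))) (at t)" for x
 proof -
  have "((%s. x - s *\<^sub>R h) has_derivative (%s. - (s *\<^sub>R h))) (at t)"
   by (auto intro!: derivative_eq_intros)
  from has_derivative_compose[OF this smooth_has_derivative[OF ph]]
  show ?thesis
   unfolding has_field_derivative_def
   by (rule has_derivative_eq_rhs) (auto simp: sum_distrib_left sum_negf mult_ac intro!: sum.cong)
 qed
 show "((%t. LINT x|leb S. u x * ph (x - t *\<^sub>R h)) has_real_derivative
   - (LINT x|leb S. u x * (\<Sum>i\<in>UNIV. h $ i * partial_deriv i ph (x - t *\<^sub>R h)))) (at t within {0..1})"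
  unfolding has_field_derivative_iff tendsto_at_iff_sequentially
 proof (intro allI impI)
  fix X :: "nat => real" assume X: "\<forall>n. X n : {0..1} - {t}" and Xt: "X ~~> t"
  let ?F = "%n x. u x * ((ph (x - X n *\<^sub>R h) - ph (x - t *\<^sub>R h)) / (X n - t))"
  have Fi: "integrable (leb S) (?F n)" for n
  proof -
   have "integrable (leb S) (%x. (1 / (X n - t)) * (u x * ph (x - X n *\<^sub>R h) - u x * ph (x - t *\<^sub>R h)))"
    using int[of "X n"] int[OF t] X by (intro integrable_mult_right intble_diff) auto
   then show ?thesis by (rule back_subst[of "integrable _"]) (auto simp: field_simps)
  qed
  have eq: "(LINT x|leb S. ?F n x) =
    ((LINT x|leb S. u x * ph (x - X n *\<^sub>R h)) - (LINT x|leb S. u x * ph (x - t *\<^sub>R h))) / (X n - t)" for n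
  proof -
   have "(LINT x|leb S. ?F n x) =
     (LINT x|leb S. (1 / (X n - t)) * (u x * ph (x - X n *\<^sub>R h) - u x * ph (x - t *\<^sub>R h)))"
    by (intro LINT_cong refl) (auto simp: field_simps)
   also have "... = (1 / (X n - t)) * ((LINT x|leb S. u x * ph (x - X n *\<^sub>R h)) - (LINT x|leb S. u x * ph (x - t *\<^sub>R h)))"
    using int[of "X n"] int[OF t] X by (simp add: LINT_diff)
   finally show ?thesis by simp
  qed
  have "(%n. LINT x|leb S. ?F n x) ~~>
    (LINT x|leb S. u x * (- (\<Sum>i\<in>UNIV. h $ i * partial_deriv i ph (x - t *\<^sub>R h))))"
  proof (rule integral_dominated_convergence[where w="%x. (M * norm h) * (indicator K1 x * \<bar>u x\<bar>)"])
   show "(%x. u x * (- (\<Sum>i\<in>UNIV. h $ i * partial_deriv i ph (x - t *\<^sub>R h)))) : borel_measurable (leb S)"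
   proof -
    have "(%x. - (\<Sum>i\<in>UNIV. h $ i * (u x * partial_deriv i (%x. ph (x - t *\<^sub>R h)) x))) : borel_measurable (leb S)"
     by (intro borel_measurable_uminus borel_measurable_sum borel_measurable_times borel_measurable_const
       borel_measurable_integrable[OF test_function_integrable(2)[OF S test[OF t] u]])
    then show ?thesis
     by (rule back_subst[of "%f. f : _"])
      (auto simp: partial_deriv_shift[OF ph] sum_distrib_left mult_ac)
   qed
   show "?F n : borel_measurable (leb S)" for n by (rule borel_measurable_integrable[OF Fi])
   show "integrable (leb S) (%x. (M * norm h) * (indicator K1 x * \<bar>u x\<bar>))"
    by (intro integrable_mult_right integrable_compact_support_bound open_in_sets_lebesgue S K1 u)
   show "AE x in leb S. (%n. ?F n x) ~~> u x * (- (\<Sum>i\<in>UNIV. h $ i * partial_deriv i ph (x - t *\<^sub>R h)))"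
   proof (rule AE_I2)
    fix x
    have "((%s. (ph (x - s *\<^sub>R h) - ph (x - t *\<^sub>R h)) / (s - t)) \<longlongrightarrow>
      - (\<Sum>i\<in>UNIV. h $ i * partial_deriv i ph (x - t *\<^sub>R h))) (at t)"
     using line[of x] by (simp add: has_field_derivative_iff)
    then have "(%n. (ph (x - X n *\<^sub>R h) - ph (x - t *\<^sub>R h)) / (X n - t)) ~~>
      - (\<Sum>i\<in>UNIV. h $ i * partial_deriv i ph (x - t *\<^sub>R h))"
     using X Xt by (auto simp: tendsto_at_iff_sequentially o_def)
    then show "(%n. ?F n x) ~~> u x * (- (\<Sum>i\<in>UNIV. h $ i * partial_deriv i ph (x - t *\<^sub>R h)))"
     by (intro tendsto_mult tendsto_const)
   qed
   show "AE x in leb S. norm (?F n x) <= (M * norm h) * (indicator K1 x * \<bar>u x\<bar>)" for n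
   proof (rule AE_I2)
    fix x
    have Xn: "X n : {0..1}" "X n ~= t" using X by auto
    show "norm (?F n x) <= (M * norm h) * (indicator K1 x * \<bar>u x\<bar>)"
    proof (cases "x : K1")
     case False
     then show ?thesis using off[OF False Xn(1)] off[OF False t] by simp
    next
     case True
     have "\<bar>ph (x - X n *\<^sub>R h) - ph (x - t *\<^sub>R h)\<bar> <= M * norm ((x - X n *\<^sub>R h) - (x - t *\<^sub>R h))"
      by (rule M(2))
     also have "(x - X n *\<^sub>R h) - (x - t *\<^sub>R h) = (t - X n) *\<^sub>R h" by (simp add: algebra_simps)
     finally have "\<bar>ph (x - X n *\<^sub>R h) - ph (x - t *\<^sub>R h)\<bar> <= M * norm h * \<bar>X n - t\<bar>"
      by (simp add: abs_minus_commute mult_ac)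
     then have "\<bar>(ph (x - X n *\<^sub>R h) - ph (x - t *\<^sub>R h)) / (X n - t)\<bar> <= M * norm h"
      using Xn(2) by (simp add: abs_divide divide_le_eq)
     then have "\<bar>u x\<bar> * \<bar>(ph (x - X n *\<^sub>R h) - ph (x - t *\<^sub>R h)) / (X n - t)\<bar> <= \<bar>u x\<bar> * (M * norm h)"
      by (rule mult_left_mono) simp
     then show ?thesis using True by (simp add: abs_mult mult_ac)
    qed
   qed
  qed
  moreover have "(LINT x|leb S. u x * (- A x)) = - (LINT x|leb S. u x * A x)" for A
   by simp
  ultimately show "((%s. ((LINT x|leb S. u x * ph (x - s *\<^sub>R h)) -
    (LINT x|leb S. u x * ph (x - t *\<^sub>R h))) / (s - t)) \<circ> X) ~~>
    - (LINT x|leb S. u x * (\<Sum>i\<in>UNIV. h $ i * partial_deriv i ph (x - t *\<^sub>R h)))"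
   by (simp only: eq o_def)
 qed
qed

text \<open>Mean value theorem in the length of the translation. The derivative of the integral
  falls on the test function and is moved to \<open>u\<close> by the definition of the weak
  gradient. This is the form in which integration by parts is used on the cubes.\<close>

lemma weak_gradient_translate:
 fixes u :: "real^'d => real"
 assumes S: "open S" and wg: "has_weak_gradient S u g"
  and ph: "smooth ph" and K: "compact K" "!!x. x ~: K ==> ph x = 0"
   "!!x t. x : K ==> 0 <= t ==> t <= 1 ==> x + t *\<^sub>R h : S"
 obtains t where "0 < t" "t < 1"
  "(LINT x|leb S. u x * ph (x - h)) - (LINT x|leb S. u x * ph x) =
   (LINT x|leb S. (g x \<bullet> h) * ph (x - t *\<^sub>R h))"
proof -
 have d: "((%t. LINT x|leb S. u x * ph (x - t *\<^sub>R h)) has_real_derivative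
   - (LINT x|leb S. u x * (\<Sum>i\<in>UNIV. h $ i * partial_deriv i ph (x - t *\<^sub>R h)))) (at t within {0..1})"
  "(%x. ph (x - t *\<^sub>R h)) : test_functions S" if "t : {0..1}" for t
  using has_derivative_integral_translates[OF S has_weak_gradientD(1)[OF wg] ph K(1), of h t] K(2,3) that
  by blast+
 have eq: "- (LINT x|leb S. u x * (\<Sum>i\<in>UNIV. h $ i * partial_deriv i ph (x - t *\<^sub>R h))) =
   (LINT x|leb S. (g x \<bullet> h) * ph (x - t *\<^sub>R h))" if t: "t : {0..1}" for t
 proof -
  note test = d(2)[OF t]
  have "(LINT x|leb S. u x * (\<Sum>i\<in>UNIV. h $ i * partial_deriv i ph (x - t *\<^sub>R h))) =
    (LINT x|leb S. (\<Sum>i\<in>UNIV. h $ i * (u x * partial_deriv i (%x. ph (x - t *\<^sub>R h)) x)))"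
   by (simp add: partial_deriv_shift[OF ph] sum_distrib_left mult_ac)
  also have "... = (\<Sum>i\<in>UNIV. h $ i * (LINT x|leb S. u x * partial_deriv i (%x. ph (x - t *\<^sub>R h)) x))"
   using test_function_integrable(2)[OF S test has_weak_gradientD(1)[OF wg]]
   by (subst LINT_sum) auto
  also have "... = - (\<Sum>i\<in>UNIV. h $ i * (LINT x|leb S. g x $ i * ph (x - t *\<^sub>R h)))"
   by (simp add: has_weak_gradientD(4)[OF wg test] sum_negf)
  also have "(\<Sum>i\<in>UNIV. h $ i * (LINT x|leb S. g x $ i * ph (x - t *\<^sub>R h))) =
    (LINT x|leb S. (\<Sum>i\<in>UNIV. h $ i * (g x $ i * ph (x - t *\<^sub>R h))))"
   using test_function_integrable(1)[OF S test has_weak_gradientD(3)[OF wg]]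
   by (subst LINT_sum) auto
  also have "... = (LINT x|leb S. (g x \<bullet> h) * ph (x - t *\<^sub>R h))"
   by (simp add: inner_vec_def sum_distrib_left sum_distrib_right mult_ac)
  finally show ?thesis by simp
 qed
 obtain t where t: "t : {0<..<1}"
  "(LINT x|leb S. u x * ph (x - 1 *\<^sub>R h)) - (LINT x|leb S. u x * ph (x - 0 *\<^sub>R h)) =
   - (LINT x|leb S. u x * (\<Sum>i\<in>UNIV. h $ i * partial_deriv i ph (x - t *\<^sub>R h))) * (1 - 0)"
  using mvt_simple[of 0 1 "%t. LINT x|leb S. u x * ph (x - t *\<^sub>R h)"
    "%t. (*) (- (LINT x|leb S. u x * (\<Sum>i\<in>UNIV. h $ i * partial_deriv i ph (x - t *\<^sub>R h))))"]
   d(1)[unfolded has_field_derivative_def] by auto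
 then show thesis using that[of t] eq[of t] by auto
qed

lemma integral_lebesgue_translate:
 fixes ph :: "'a::euclidean_space => real"
 assumes "continuous_on UNIV ph"
 shows "(LINT x|lebesgue. ph (x - v)) = (LINT x|lebesgue. ph x)"
proof -
 have m: "ph : borel_measurable borel"
  by (rule borel_measurable_continuous_onI[OF assms])
 have "(LINT x|lborel. ph x) = (LINT x|distr lborel borel (%x. - v + x). ph x)"
  by (simp only: lborel_distr_plus)
 also have "... = (LINT x|lborel. ph (- v + x))" by (rule integral_distr) (use m in auto)
 finally have "(LINT x|lborel. ph x) = (LINT x|lborel. ph (x - v))" by simp
 moreover have "(%x. ph (x - v)) : borel_measurable lborel" "ph : borel_measurable lborel"
  using m by auto
 ultimately show ?thesis by (simp add: integral_completion)
qed

text \<open>By translation invariance the integral of a translate is constant in the shift; its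
  derivative, computed under the integral sign, is the integral in question up to sign.\<close>

lemma integral_partial_deriv_eq_0:
 fixes ph :: "real^'d => real"
 assumes ph: "smooth ph" and K: "compact K" "!!x. x ~: K ==> ph x = 0"
 shows "(LINT x|lebesgue. partial_deriv i ph x) = 0"
proof -
 let ?h = "axis i 1 :: real^'d"
 have one: "(%x. 1 :: real) absolutely_integrable_on L" if "compact L" for L :: "(real^'d) set"
  using that by (intro absolutely_integrable_on_const) (simp add: lmeasurable_compact)
 have "((%t. LINT x|leb UNIV. 1 * ph (x - t *\<^sub>R ?h)) has_real_derivative
   - (LINT x|leb UNIV. 1 * (\<Sum>j\<in>UNIV. ?h $ j * partial_deriv j ph (x - 0 *\<^sub>R ?h)))) (at 0 within {0..1})"
  by (rule has_derivative_integral_translates(1)[OF open_UNIV one ph K]) auto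
 moreover have "(LINT x|leb UNIV. 1 * ph (x - v)) = (LINT x|leb UNIV. 1 * ph x)" for v
  using integral_lebesgue_translate[OF smooth_continuous[OF ph], of v] by (simp add: lebesgue_on_UNIV_eq)
 ultimately have "((%t. LINT x|leb UNIV. 1 * ph x) has_real_derivative
   - (LINT x|leb UNIV. 1 * (\<Sum>j\<in>UNIV. ?h $ j * partial_deriv j ph x))) (at 0 within {0..1})"
  by simp
 moreover have "((%t. LINT x|leb UNIV. 1 * ph x) has_real_derivative 0) (at (0::real) within {0..1})"
  by simp
 ultimately have "- (LINT x|leb UNIV. 1 * (\<Sum>j\<in>UNIV. ?h $ j * partial_deriv j ph x)) = 0"
  unfolding has_field_derivative_iff at_within_Icc_at_right[OF zero_less_one]
  by (rule tendsto_unique[OF trivial_limit_at_right_real])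
 moreover have "(\<Sum>j\<in>UNIV. ?h $ j * partial_deriv j ph x) = partial_deriv i ph x" for x
  by (simp add: axis_def if_distrib[where f="%c. c * _"] cong: if_cong)
 ultimately show ?thesis by (simp add: lebesgue_on_UNIV_eq)
qed

section \<open>Linear changes of variables\<close>

text \<open>Uniqueness of Haar measure. The product \<open>f x * g (x + y)\<close> is integrated in
  both orders over \<open>mu\<close> and Lebesgue measure, and invariance moves the shift from
  \<open>g\<close> to \<open>f\<close>; the auxiliary \<open>g\<close> is the indicator of the unit
  box. It identifies the image of Lebesgue measure under a matrix without computing a
  determinant.\<close>

lemma translation_invariant_measure:
 fixes mu :: "'a::euclidean_space measure" and f :: "'a => ennreal"
 assumes sets [measurable_cong]: "sets mu = sets borel" and sf: "sigma_finite_measure mu"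
  and inv: "!!t. distr mu borel (%x. t + x) = mu"
  and f [measurable]: "f : borel_measurable borel"
 shows "(\<integral>\<^sup>+x. f x \<partial>mu) = emeasure mu (box 0 One) * (\<integral>\<^sup>+x. f x \<partial>lborel)"
proof -
 interpret mu: sigma_finite_measure mu by fact
 interpret pair_sigma_finite mu lborel ..
 define g :: "'a => ennreal" where "g = indicator (box 0 One)"
 have g [measurable]: "g : borel_measurable borel" unfolding g_def by measurable
 have plus: "(\<integral>\<^sup>+y. g (x + y) \<partial>lborel) = (\<integral>\<^sup>+y. g y \<partial>lborel)" for x
 proof -
  have "(\<integral>\<^sup>+y. g y \<partial>lborel) = (\<integral>\<^sup>+y. g y \<partial>distr lborel borel (%y. x + y))"
   by (simp only: lborel_distr_plus)
  then show ?thesis by (simp add: nn_integral_distr)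
 qed
 have minus: "(\<integral>\<^sup>+y. f (x - y) \<partial>lborel) = (\<integral>\<^sup>+y. f y \<partial>lborel)" for x
 proof -
  have "(%y. x + (\<Sum>j\<in>Basis. (- 1 * (y \<bullet> j)) *\<^sub>R j)) = (%y. x - y)"
   by (simp add: sum_negf euclidean_representation)
  then have "lborel = distr lborel borel (%y. x - y)"
   using lborel_affine_euclidean[of "%_. - 1" x] by (simp add: density_1)
  then have "(\<integral>\<^sup>+y. f y \<partial>lborel) = (\<integral>\<^sup>+y. f y \<partial>distr lborel borel (%y. x - y))"
   by simp
  also have "... = (\<integral>\<^sup>+y. f (x - y) \<partial>lborel)" by (simp add: nn_integral_distr)
  finally show ?thesis by simp
 qed
 have shift: "(\<integral>\<^sup>+x. f x * g (x + y) \<partial>mu) = (\<integral>\<^sup>+x. f (x - y) * g x \<partial>mu)" for y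
 proof -
  have "(\<integral>\<^sup>+x. f x * g (x + y) \<partial>mu) = (\<integral>\<^sup>+x. f x * g (x + y) \<partial>distr mu borel (%x. - y + x))"
   by (simp only: inv)
  also have "... = (\<integral>\<^sup>+x. f (- y + x) * g (- y + x + y) \<partial>mu)" by (rule nn_integral_distr) measurable
  finally show ?thesis by simp
 qed
 have "(\<integral>\<^sup>+x. f x \<partial>mu) * (\<integral>\<^sup>+y. g y \<partial>lborel) = (\<integral>\<^sup>+x. f x * (\<integral>\<^sup>+y. g y \<partial>lborel) \<partial>mu)"
  by (rule nn_integral_multc[symmetric]) measurable
 also have "... = (\<integral>\<^sup>+x. (\<integral>\<^sup>+y. f x * g (x + y) \<partial>lborel) \<partial>mu)"
  by (simp add: nn_integral_cmult plus)
 also have "... = (\<integral>\<^sup>+y. (\<integral>\<^sup>+x. f x * g (x + y) \<partial>mu) \<partial>lborel)"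
  by (rule Fubini'[symmetric]) measurable
 also have "... = (\<integral>\<^sup>+y. (\<integral>\<^sup>+x. f (x - y) * g x \<partial>mu) \<partial>lborel)" by (simp only: shift)
 also have "... = (\<integral>\<^sup>+x. (\<integral>\<^sup>+y. f (x - y) * g x \<partial>lborel) \<partial>mu)"
  by (rule Fubini') measurable
 also have "... = (\<integral>\<^sup>+x. (\<integral>\<^sup>+y. f y \<partial>lborel) * g x \<partial>mu)"
  by (simp add: nn_integral_multc minus)
 also have "... = (\<integral>\<^sup>+y. f y \<partial>lborel) * (\<integral>\<^sup>+x. g x \<partial>mu)"
  by (rule nn_integral_cmult) measurable
 finally show ?thesis by (simp add: g_def sets mult.commute)
qed

lemma matrix_inv_mult:
 fixes A :: "real^'d^'d"
 assumes "invertible A"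
 shows "A ** matrix_inv A = mat 1" "matrix_inv A ** A = mat 1"
 using someI_ex[OF assms[unfolded invertible_def]] by (simp_all add: matrix_inv_def)

lemma matrix_inv_cancel:
 fixes A :: "real^'d^'d"
 assumes "invertible A"
 shows "matrix_inv A *v (A *v x) = x" "A *v (matrix_inv A *v x) = x"
 using matrix_inv_mult[OF assms] by (simp_all add: matrix_vector_mul_assoc)

lemma borel_measurable_matrix_vector_mult [measurable]: "(*v) A : borel_measurable borel" for A :: "real^'d^'n"
 by (intro borel_measurable_continuous_onI linear_continuous_on matrix_vector_mul_bounded_linear)

text \<open>The image measure is translation invariant because a shift by t after A is A after a
  shift by A^(-1) t. Images of balls witness sigma-finiteness.\<close>

lemma distr_lborel_matrix:
 fixes A :: "real^'d^'d"
 assumes A: "invertible A"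
 obtains k :: real where "k > 0" "distr lborel borel ((*v) A) = density lborel (%_. ennreal k)"
proof -
 let ?mu = "distr lborel borel ((*v) A)"
 let ?C = "%n. (*v) A ` cball (0::real^'d) (real n)"
 have cptA: "compact (?C n)" for n
  by (intro compact_continuous_image linear_continuous_on matrix_vector_mul_bounded_linear) simp
 have C [measurable]: "?C n : sets borel" for n
  using cptA by (simp add: borel_compact)
 have vim: "(*v) A -` ?C n = cball 0 (real n)" for n
  using matrix_inv_cancel(1)[OF A] by (auto simp: image_iff) (metis mem_cball_0)
 have muC: "emeasure ?mu (?C n) = emeasure lborel (cball (0::real^'d) (real n))" for n
  by (subst emeasure_distr) (auto simp: vim)
 have sf: "sigma_finite_measure ?mu"
 proof
  show "\<exists>B. countable B & B \<subseteq> sets ?mu & \<Union> B = space ?mu & (\<forall>a\<in>B. emeasure ?mu a ~= \<infinity>)"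
  proof (intro exI[of _ "range ?C"] conjI)
   have "x : \<Union> (range ?C)" for x
   proof -
    obtain n where "norm (matrix_inv A *v x) <= real n" using real_arch_simple by blast
    then have "x : ?C n" using matrix_inv_cancel(2)[OF A, of x]
     by (intro image_eqI[of _ _ "matrix_inv A *v x"]) auto
    then show ?thesis by blast
   qed
   then show "\<Union> (range ?C) = space ?mu" by auto
   show "\<forall>a\<in>range ?C. emeasure ?mu a ~= \<infinity>"
    using emeasure_lborel_cball_finite by (auto simp: muC less_top[symmetric])
  qed (use C in auto)
 qed
 have inv: "distr ?mu borel (%x. t + x) = ?mu" for t
 proof -
  have "distr ?mu borel (%x. t + x) = distr lborel borel (%x. t + A *v x)"
   by (subst distr_distr) (auto simp: o_def)
  also have "(%x. t + A *v x) = (%x. A *v (matrix_inv A *v t + x))"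
   by (simp add: matrix_vector_right_distrib matrix_inv_cancel(2)[OF A])
  also have "distr lborel borel (%x. A *v (matrix_inv A *v t + x)) =
    distr (distr lborel borel (%x. matrix_inv A *v t + x)) borel ((*v) A)"
   by (subst distr_distr) (auto simp: o_def)
  finally show ?thesis by (simp only: lborel_distr_plus)
 qed
 define k where "k = emeasure ?mu (box 0 One)"
 have key: "emeasure ?mu B = k * emeasure lborel B" if "B : sets borel" for B
  using translation_invariant_measure[OF _ sf inv, of "indicator B"] that by (simp add: k_def)
 \<comment> \<open>The image of the unit ball has the measure of the ball, which is positive and
   finite; hence \<open>k\<close> is neither 0 nor infinite.\<close>
 have "k * emeasure lborel (?C 1) = emeasure lborel (cball (0::real^'d) 1)"
  using key[OF C[of 1]] muC[of 1] by simp
 moreover have "emeasure lborel (cball (0::real^'d) 1) ~= 0" "emeasure lborel (cball (0::real^'d) 1) ~= \<infinity>"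
  using emeasure_lborel_cball_finite[of 0 1] by (auto simp: emeasure_cball less_top[symmetric] less_imp_neq[OF unit_ball_vol_pos, symmetric])
 ultimately have "k ~= 0" "k ~= \<infinity>" by (auto simp: ennreal_top_mult split: if_splits)
 then have k: "enn2real k > 0" "ennreal (enn2real k) = k"
  by (auto simp: enn2real_positive_iff less_top[symmetric] zero_less_iff_neq_zero)
 show thesis
 proof (rule that[OF k(1)])
  show "?mu = density lborel (%_. ennreal (enn2real k))"
   unfolding k(2) by (rule measure_eqI) (auto simp: key emeasure_density nn_integral_cmult_indicator)
 qed
qed

text \<open>The completions of both sides agree because positivity of \<open>k\<close> makes their
  null sets the same; this also gives Lebesgue measurability of the linear map.\<close>

lemma distr_lebesgue_matrix:
 fixes A :: "real^'d^'d"
 assumes A: "invertible A"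
 obtains k :: real where "k > 0" "distr lebesgue lebesgue ((*v) A) = density lebesgue (%_. ennreal k)"
  "(*v) A : lebesgue \<rightarrow>\<^sub>M lebesgue"
proof -
 obtain k where k: "k > 0" "distr lborel borel ((*v) A) = density lborel (%_. ennreal k)"
  using distr_lborel_matrix[OF A] .
 have d: "distr lebesgue lborel ((*v) A) = distr lborel borel ((*v) A)"
  by (simp add: distr_completion cong: distr_cong)
 have "emeasure (distr lebesgue lborel ((*v) A)) B = 0 \<longleftrightarrow> emeasure lborel B = 0" if "B : sets borel" for B
  using that k(1) by (simp add: d k(2) emeasure_density nn_integral_cmult_indicator)
 then have eq: "null_sets lborel = null_sets (distr lebesgue lborel ((*v) A))"
  by (auto simp: null_sets_def)
 have m: "(*v) A : lebesgue \<rightarrow>\<^sub>M lebesgue"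
  by (simp add: completion.measurable_completion2 eq measurable_completion)
 have "density lebesgue (%_. ennreal k) = completion (density lborel (%_. ennreal k))"
  using k(1) by (auto intro!: always_eventually completion_density_eq[symmetric])
 also have "... = completion (distr lebesgue lborel ((*v) A))" by (simp only: d k(2))
 also have "... = distr lebesgue lebesgue ((*v) A)"
  by (subst completion.completion_distr_eq) (auto simp: eq measurable_completion)
 finally show thesis using that[OF k(1) _ m] by simp
qed

lemma invertible_matrix_inv: "invertible A ==> invertible (matrix_inv (A :: real^'d^'d))"
 using matrix_inv_mult unfolding invertible_def by blast

lemma matrix_image_eq_vimage:
 fixes A :: "real^'d^'d"
 assumes "invertible A"
 shows "(*v) A ` S = (*v) (matrix_inv A) -` S"
 using matrix_inv_cancel[OF assms] by (auto simp: image_iff) metis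

lemma sets_lebesgue_matrix_image:
 fixes A :: "real^'d^'d"
 assumes A: "invertible A" and S: "S : sets lebesgue"
 shows "(*v) A ` S : sets lebesgue"
proof -
 have "(*v) (matrix_inv A) : lebesgue \<rightarrow>\<^sub>M lebesgue"
  using distr_lebesgue_matrix[OF invertible_matrix_inv[OF A]] by blast
 from measurable_sets[OF this S] show ?thesis by (simp add: matrix_image_eq_vimage[OF A])
qed

lemma integral_matrix_distr:
 fixes A :: "real^'d^'d" and F :: "real^'d => 'b::{banach, second_countable_topology}"
 assumes A: "invertible A"
  and k: "k > 0" "distr lebesgue lebesgue ((*v) A) = density lebesgue (%_. ennreal k)"
   "(*v) A : lebesgue \<rightarrow>\<^sub>M lebesgue"
  and S: "S : sets lebesgue" and F: "integrable (leb S) (%x. F (A *v x))"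
 shows "integrable (leb ((*v) A ` S)) F &
   (LINT x|leb S. F (A *v x)) = k *\<^sub>R (LINT y|leb ((*v) A ` S). F y)"
proof -
 have inv: "(*v) (matrix_inv A) : lebesgue \<rightarrow>\<^sub>M lebesgue"
  using distr_lebesgue_matrix[OF invertible_matrix_inv[OF A]] by blast
 note AS = sets_lebesgue_matrix_image[OF A S]
 define G where "G y = indicator ((*v) A ` S) y *\<^sub>R F y" for y
 have ind: "indicator ((*v) A ` S) (A *v x) = (indicator S x :: real)" for x
  using matrix_inv_cancel(1)[OF A] by (auto simp: indicator_def) metis
 have GA: "(%x. G (A *v x)) = (%x. indicator S x *\<^sub>R F (A *v x))"
  by (simp add: G_def ind)
 have Gi: "integrable lebesgue (%x. G (A *v x))"
  using F unfolding GA integrable_lebesgue_on_iff[OF S] .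
 have "(%y. G (A *v (matrix_inv A *v y))) : borel_measurable lebesgue"
  by (rule measurable_compose[OF inv borel_measurable_integrable[OF Gi]])
 then have Gm: "G : borel_measurable lebesgue" by (simp add: matrix_inv_cancel(2)[OF A])
 have "integrable (distr lebesgue lebesgue ((*v) A)) G"
  using Gi integrable_distr_eq[OF k(3) Gm] by simp
 then have "integrable lebesgue (%y. k *\<^sub>R G y)"
  unfolding k(2) using k(1) Gm by (subst (asm) integrable_density) auto
 then have "integrable lebesgue (%y. (1 / k) *\<^sub>R (k *\<^sub>R G y))" by (rule integrable_scaleR_right)
 then have 1: "integrable lebesgue G" using k(1) by simp
 have "(LINT x|lebesgue. G (A *v x)) = (LINT y|distr lebesgue lebesgue ((*v) A). G y)"
  by (rule integral_distr[OF k(3) Gm, symmetric])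
 also have "... = k *\<^sub>R (LINT y|lebesgue. G y)"
  unfolding k(2) using k(1) Gm by (subst integral_density) auto
 finally have "(LINT x|lebesgue. G (A *v x)) = k *\<^sub>R (LINT y|lebesgue. G y)" .
 then show ?thesis
  using 1 unfolding integrable_lebesgue_on_iff[OF AS] integral_lebesgue_on_eq[OF AS] integral_lebesgue_on_eq[OF S]
   GA G_def[symmetric] by simp
qed

lemma measure_lebesgue_on_integral: "S : sets lebesgue ==> (LINT x|leb S. 1) = measure lebesgue S"
 by (simp add: measure_restrict_space)

lemma measure_unit_cell: "measure lebesgue (unit_cell :: (real^'d) set) = 1"
 using content_cbox_cart[of "0 :: real^'d" 1] by (simp add: unit_cell_def interval_ne_empty_cart)

lemma unit_cell_lmeasurable: "unit_cell : lmeasurable"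
 by (simp add: unit_cell_def)

text \<open>The constant is found by inserting the unit cell with integrand 1. It is thus the
  measure of the transformed cell, the very quantity by which the two-scale limit is
  normalised.\<close>

lemma integral_matrix_image:
 fixes A :: "real^'d^'d" and F :: "real^'d => 'b::{banach, second_countable_topology}"
 assumes A: "invertible A" and S: "S : sets lebesgue"
  and F: "integrable (leb S) (%x. F (A *v x))"
 shows "integrable (leb ((*v) A ` S)) F"
  and "(LINT y|leb ((*v) A ` S). F y) =
   measure lebesgue ((*v) A ` unit_cell) *\<^sub>R (LINT x|leb S. F (A *v x))"
  and "0 < measure lebesgue ((*v) A ` unit_cell)"
proof -
 obtain k where k: "k > 0" "distr lebesgue lebesgue ((*v) A) = density lebesgue (%_. ennreal k)"
  "(*v) A : lebesgue \<rightarrow>\<^sub>M lebesgue"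
  using distr_lebesgue_matrix[OF A] .
 interpret finite_measure "leb (unit_cell :: (real^'d) set)"
  by (rule finite_measure_lebesgue_on[OF unit_cell_lmeasurable])
 have cell: "unit_cell : sets (lebesgue :: (real^'d) measure)"
  using unit_cell_lmeasurable by (rule fmeasurableD)
 have "1 = k * measure lebesgue ((*v) A ` unit_cell)"
  using integral_matrix_distr[OF A k cell, of "%x. 1 :: real"]
  by (simp add: measure_restrict_space cell sets_lebesgue_matrix_image[OF A cell] measure_unit_cell)
 then have m: "measure lebesgue ((*v) A ` unit_cell) = 1 / k" using k(1) by (simp add: field_simps)
 show "0 < measure lebesgue ((*v) A ` unit_cell)" unfolding m using k(1) by simp
 show "integrable (leb ((*v) A ` S)) F"
  and "(LINT y|leb ((*v) A ` S). F y) =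
   measure lebesgue ((*v) A ` unit_cell) *\<^sub>R (LINT x|leb S. F (A *v x))"
  using integral_matrix_distr[OF A k S F] k(1) unfolding m by simp_all
qed

lemma continuous_lebesgue_measurable:
 fixes f :: "'a::euclidean_space => 'b::topological_space"
 shows "continuous_on UNIV f ==> f : borel_measurable lebesgue"
 by (intro measurable_completion) (simp add: borel_measurable_continuous_onI)

section \<open>Approximation of open sets by test functions and the du Bois-Reymond lemma\<close>

lemma open_Union_boxes:
 fixes U :: "(real^'d) set"
 assumes "open U"
 obtains a b :: "nat => real^'d" where "U = (\<Union>n. box (a n) (b n))"
proof -
 obtain \<D> where \<D>: "countable \<D>" "!!X. X : \<D> ==> \<exists>a b. X = box a b" "\<Union>\<D> = U"
  using open_countable_Union_open_box[OF assms] by metis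
 \<comment> \<open>An empty box is added so that the countable family is nonempty and can be
   enumerated.\<close>
 let ?E = "insert (box 0 0) \<D>"
 have E: "countable ?E" "?E ~= {}" using \<D>(1) by auto
 have "\<exists>a b. from_nat_into ?E n = box a b" for n
  using from_nat_into[OF E(2), of n] \<D>(2) by blast
 then obtain a b where ab: "!!n. from_nat_into ?E n = box (a n) (b n)" by metis
 have "(\<Union>n. box (a n) (b n)) = \<Union> ?E"
  using range_from_nat_into[OF E(2,1)] by (metis (no_types, lifting) SUP_cong ab)
 also have "... = U" using \<D>(3) by simp
 finally show thesis using that by blast
qed

lemma test_functions_approx_open:
 fixes U :: "(real^'d) set"
 assumes "open U"
 obtains ph :: "nat => real^'d => real" where "!!j. ph j : test_functions U"
  "!!j x. 0 <= ph j x" "!!j x. ph j x <= 1" "!!x. (%j. ph j x) ~~> indicator U x"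
proof -
 obtain a b :: "nat => real^'d" where U: "U = (\<Union>n. box (a n) (b n))" using open_Union_boxes[OF assms] .
 \<comment> \<open>A smooth union of the first \<open>j\<close> boxes: close to 1 as soon as one of
   the bumps is, and 0 where all of them vanish.\<close>
 define ph where "ph j x = 1 - (\<Prod>n<j. 1 - bump (a n) (b n) j x)" for j :: nat and x
 have bb: "0 <= 1 - bump (a n) (b n) j x" "1 - bump (a n) (b n) j x <= 1" for n j x
  using bump_bounds[where a="a n" and b="b n" and j=j and x=x] by auto
 show thesis
 proof (rule that)
  show "ph j : test_functions U" for j
  proof -
   let ?K = "%n. cbox (\<chi> i. a n $ i + 1 / real (Suc j)) (\<chi> i. b n $ i - 1 / real (Suc j))"
   have "C_k k (%x. 1 + (- 1) * (\<Prod>n<j. 1 + (- 1) * bump (a n) (b n) j x))" for k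
    by (intro C_k_add C_k_mult C_k_prod C_k_const C_k_bump)
   then have "smooth (ph j)" by (simp add: smooth_def ph_def[abs_def])
   moreover have "compact (\<Union>n<j. ?K n)" by (intro compact_UN) auto
   moreover have "?K n \<subseteq> box (a n) (b n)" for n
   proof
    fix x assume x: "x : ?K n"
    have p: "0 < 1 / real (Suc j)" by simp
    have "a n $ i < x $ i & x $ i < b n $ i" for i
    proof -
     have "a n $ i + 1 / real (Suc j) <= x $ i" "x $ i <= b n $ i - 1 / real (Suc j)"
      using x by (auto simp: mem_box_cart simp del: of_nat_Suc)
     then show ?thesis using p by linarith
    qed
    then show "x : box (a n) (b n)" by (simp add: mem_box_cart)
   qed
   then have "(\<Union>n<j. ?K n) \<subseteq> U" unfolding U by blast
   moreover have "ph j x = 0" if "x ~: (\<Union>n<j. ?K n)" for x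
    using that by (simp add: ph_def bump_eq_0 del: of_nat_Suc)
   ultimately show ?thesis unfolding test_functions_iff by blast
  qed
  show "0 <= ph j x" "ph j x <= 1" for j x
   using bb by (auto simp: ph_def intro!: prod_nonneg prod_le_1)
  show "(%j. ph j x) ~~> indicator U x" for x
  proof (cases "x : U")
   case True
   then obtain n where n: "x : box (a n) (b n)" unfolding U by blast
   have "(%j. ph j x) ~~> 1"
   proof (rule tendsto_sandwich)
    show "\<forall>\<^sub>F j in sequentially. bump (a n) (b n) j x <= ph j x"
     using eventually_gt_at_top[of n]
    proof eventually_elim
     fix j assume "n < j"
     then have "(\<Prod>m<j. 1 - bump (a m) (b m) j x) =
       (1 - bump (a n) (b n) j x) * (\<Prod>m\<in>{..<j} - {n}. 1 - bump (a m) (b m) j x)"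
      by (simp add: prod.remove)
     also have "... <= (1 - bump (a n) (b n) j x) * 1"
      using bb by (intro mult_left_mono prod_le_1) auto
     finally show "bump (a n) (b n) j x <= ph j x" by (simp add: ph_def)
    qed
    show "\<forall>\<^sub>F j in sequentially. ph j x <= 1"
     using bb by (auto simp: ph_def intro!: prod_nonneg always_eventually)
    show "(%j. bump (a n) (b n) j x) ~~> 1" using bump_tendsto[of "a n" "b n" x] n by simp
   qed auto
   then show ?thesis using True by simp
  next
   case False
   have "bump (a n) (b n) j x = 0" for n j
   proof (rule bump_eq_0)
    have x: "x ~: box (a n) (b n)" using False unfolding U by blast
    then obtain i where i: "x $ i <= a n $ i \<or> b n $ i <= x $ i" by (auto simp: mem_box_cart not_less)
    have "0 < 1 / real (Suc j)" by simp
    with i have "\<not> (a n $ i + 1 / real (Suc j) <= x $ i & x $ i <= b n $ i - 1 / real (Suc j))"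
     by linarith
    then show "x ~: cbox (\<chi> i. a n $ i + 1 / real (Suc j)) (\<chi> i. b n $ i - 1 / real (Suc j))"
     by (auto simp: mem_box_cart simp del: of_nat_Suc)
   qed
   then have "ph j x = 0" for j by (simp add: ph_def)
   then show ?thesis using False by simp
  qed
 qed
qed

lemma test_functions_mono: "ph : test_functions U ==> U \<subseteq> S ==> ph : test_functions S"
 unfolding test_functions_iff by blast

text \<open>Approximating indicators by test functions, \<open>H\<close> has integral 0 over every
  open subset of \<open>V\<close>. The part of \<open>V\<close> where \<open>H\<close> is positive
  is a G_delta up to a null set, hence a limit of open sets, so the integral of \<open>H\<close>
  over it vanishes too.\<close>

lemma du_Bois_Reymond_nonpos:
 fixes H :: "real^'d => real"
 assumes S: "open S" and loc: "!!K. compact K ==> K \<subseteq> S ==> H absolutely_integrable_on K"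
  and zero: "!!ph. ph : test_functions S ==> (LINT x|leb S. H x * ph x) = 0"
  and K: "compact K" "K \<subseteq> S" "open V" "V \<subseteq> K"
 shows "AE x in lebesgue. x : V --> H x <= 0"
proof -
 define G where "G x = indicator K x * H x" for x
 have Gi: "integrable lebesgue G"
  using loc[OF K(1,2)] by (simp add: set_integrable_def G_def[abs_def])
 note Gm = borel_measurable_integrable[OF Gi]
 have open0: "(LINT x|lebesgue. indicator U x * G x) = 0" if U: "open U" "U \<subseteq> V" for U
 proof -
  obtain ph where ph: "!!j. ph j : test_functions U"
   "!!j x. 0 <= ph j x" "!!j x. ph j x <= 1" "!!x. (%j. ph j x) ~~> indicator U x"
   using test_functions_approx_open[OF U(1)] by metis
  have phm: "ph j : borel_measurable lebesgue" for j
   using ph(1)[of j] by (auto simp: test_functions_iff intro: continuous_lebesgue_measurable smooth_continuous)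
  have "(%j. LINT x|lebesgue. ph j x * G x) ~~> (LINT x|lebesgue. indicator U x * G x)"
  proof (rule integral_dominated_convergence[where w="%x. norm (G x)"])
   show "(%x. indicator U x * G x) : borel_measurable lebesgue"
    using Gm open_in_sets_lebesgue[OF U(1)] by (intro borel_measurable_times borel_measurable_indicator)
   show "(%x. ph j x * G x) : borel_measurable lebesgue" for j
    by (intro borel_measurable_times Gm phm)
   show "AE x in lebesgue. (%j. ph j x * G x) ~~> indicator U x * G x"
    by (intro AE_I2 tendsto_mult tendsto_const ph(4))
   show "AE x in lebesgue. norm (ph j x * G x) <= norm (G x)" for j
    using ph(2,3)[of j] by (intro AE_I2) (simp add: abs_mult mult_left_le_one_le)
  qed (use Gi in simp)
  moreover have "(LINT x|lebesgue. ph j x * G x) = 0" for j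
  proof -
   obtain L where L: "compact L" "L \<subseteq> U" "!!x. x ~: L ==> ph j x = 0"
    using ph(1)[of j] unfolding test_functions_iff by blast
   have eq: "ph j x * G x = indicator S x *\<^sub>R (H x * ph j x)" for x
    using L(3)[of x] L(2) U(2) K by (auto simp: G_def indicator_def)
   have "(LINT x|lebesgue. ph j x * G x) = (LINT x|leb S. H x * ph j x)"
    unfolding integral_lebesgue_on_eq[OF open_in_sets_lebesgue[OF S]] eq ..
   also have "... = 0" using U(2) K by (intro zero test_functions_mono[OF ph(1)]) auto
   finally show ?thesis .
  qed
  ultimately show ?thesis by (simp only: LIMSEQ_const_iff)
 qed
 define A where "A = {x : V. G x > 0}"
 have "A = V \<inter> {x : space lebesgue. G x > 0}" by (auto simp: A_def)
 then have A: "A : sets lebesgue"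
  using open_in_sets_lebesgue[OF K(3)] Gm by simp
 obtain C T where C: "gdelta C" "T : null_sets lebesgue" "A \<union> T = C"
  using lebesgue_set_almost_gdelta[OF A] by metis
 obtain F :: "nat => _" where F: "!!n. open (F n)" "C = \<Inter> (range F)"
  using C(1) by (auto elim!: gdelta.cases)
 \<comment> \<open>Finite intersections keep the sets open; they decrease to
   \<open>V \<inter> C\<close>, which differs from \<open>A\<close> by a null set only.\<close>
 define W where "W n = V \<inter> (\<Inter>i\<le>n. F i)" for n
 have W: "open (W n)" "W n \<subseteq> V" for n
  using F(1) K(3) by (auto simp: W_def intro!: open_Int open_INT)
 have "(%n. LINT x|lebesgue. indicator (W n) x * G x) ~~> (LINT x|lebesgue. indicator (V \<inter> C) x * G x)"
 proof (rule integral_dominated_convergence[where w="%x. norm (G x)"])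
  have VC: "V \<inter> C : sets lebesgue"
   using A C(2,3) open_in_sets_lebesgue[OF K(3)] by (auto dest: null_setsD2)
  show "(%x. indicator (V \<inter> C) x * G x) : borel_measurable lebesgue"
   by (intro borel_measurable_times borel_measurable_indicator VC Gm)
  show "(%x. indicator (W n) x * G x) : borel_measurable lebesgue" for n
   by (intro borel_measurable_times borel_measurable_indicator open_in_sets_lebesgue W Gm)
  show "AE x in lebesgue. (%n. indicator (W n) x * G x) ~~> indicator (V \<inter> C) x * G x"
  proof (intro AE_I2 tendsto_mult tendsto_const)
   fix x
   show "(%n. indicator (W n) x :: real) ~~> indicator (V \<inter> C) x"
   proof (cases "x : V \<inter> C")
    case True
    then have "x : W n" for n by (auto simp: W_def F(2))
    then show ?thesis using True by simp
   next
    case False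
    show ?thesis
    proof (cases "x : V")
     case True
     then obtain i where "x ~: F i" using False F(2) by auto
     then have "\<forall>n\<ge>i. x ~: W n" by (auto simp: W_def)
     then show ?thesis using False
      by (intro tendsto_eventually) (auto simp: eventually_sequentially indicator_def)
    next
     case False
     then have "x ~: W n" for n by (auto simp: W_def)
     then show ?thesis using False by simp
    qed
   qed
  qed
  show "AE x in lebesgue. norm (indicator (W n) x * G x) <= norm (G x)" for n
   by (intro AE_I2) (auto simp: indicator_def)
 qed (use Gi in simp)
 then have "(LINT x|lebesgue. indicator (V \<inter> C) x * G x) = 0"
  by (simp only: open0[OF W] LIMSEQ_const_iff)
 moreover have "(LINT x|lebesgue. indicator (V \<inter> C) x * G x) = (LINT x|lebesgue. indicator A x * G x)"
 proof (rule integral_cong_AE)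
  show "AE x in lebesgue. indicator (V \<inter> C) x * G x = indicator A x * G x"
   using AE_not_in[OF C(2)] by eventually_elim (use C(3) in \<open>auto simp: indicator_def A_def\<close>)
  have "V \<inter> C : sets lebesgue"
   using A C(2,3) open_in_sets_lebesgue[OF K(3)] by (auto dest: null_setsD2)
  then show "(%x. indicator (V \<inter> C) x * G x) : borel_measurable lebesgue"
   by (intro borel_measurable_times borel_measurable_indicator Gm)
  show "(%x. indicator A x * G x) : borel_measurable lebesgue"
   by (intro borel_measurable_times borel_measurable_indicator Gm A)
 qed
 ultimately have int0: "(LINT x|lebesgue. indicator A x * G x) = 0" by simp
 have "AE x in lebesgue. indicator A x * G x = 0"
 proof (subst integral_nonneg_eq_0_iff_AE[symmetric])
  show "integrable lebesgue (%x. indicator A x * G x)"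
   using integrable_mult_indicator[OF A Gi] by simp
 qed (use int0 in \<open>auto simp: A_def indicator_def\<close>)
 then show ?thesis
 proof eventually_elim
  fix x assume "indicator A x * G x = 0"
  then show "x : V --> H x <= 0" using K(4) by (auto simp: A_def G_def indicator_def not_less split: if_splits)
 qed
qed

text \<open>The one-sided version is applied to \<open>H\<close> and to its negative on balls with
  closure in \<open>S\<close>; by Lindelof, countably many of them cover \<open>S\<close>.\<close>

theorem du_Bois_Reymond:
 fixes H :: "real^'d => real"
 assumes S: "open S" and loc: "!!K. compact K ==> K \<subseteq> S ==> H absolutely_integrable_on K"
  and zero: "!!ph. ph : test_functions S ==> (LINT x|leb S. H x * ph x) = 0"
 shows "AE x in lebesgue. x : S --> H x = 0"
proof -
 have ball: "AE x in lebesgue. x : ball c e --> H x = 0" if "cball c e \<subseteq> S" for c e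
 proof -
  have 1: "AE x in lebesgue. x : ball c e --> H x <= 0"
   by (rule du_Bois_Reymond_nonpos[OF S loc zero compact_cball that]) auto
  have 2: "AE x in lebesgue. x : ball c e --> - H x <= 0"
  proof (rule du_Bois_Reymond_nonpos[OF S _ _ compact_cball that])
   show "(%x. - H x) absolutely_integrable_on K" if "compact K" "K \<subseteq> S" for K
    using absolutely_integrable_scaleR_left[OF loc[OF that], of "-1"] by simp
  qed (auto simp: zero)
  show ?thesis using 1 2 by eventually_elim auto
 qed
 define \<F> where "\<F> = {ball c e | c e. cball c e \<subseteq> S}"
 obtain \<F>' where F': "\<F>' \<subseteq> \<F>" "countable \<F>'" "\<Union>\<F>' = \<Union>\<F>"
  using Lindelof[of \<F>] by (auto simp: \<F>_def)
 have "S \<subseteq> \<Union>\<F>"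
 proof
  fix x assume "x : S"
  then obtain e where "e > 0" "cball x e \<subseteq> S" using S by (auto simp: open_contains_cball)
  then show "x : \<Union>\<F>" by (auto simp: \<F>_def intro!: exI[of _ "ball x e"] exI[of _ x] exI[of _ e])
 qed
 moreover have "AE x in lebesgue. \<forall>B\<in>\<F>'. x : B --> H x = 0"
  using F'(1) ball by (intro AE_ball_countable'[OF _ F'(2)]) (auto simp: \<F>_def)
 ultimately show ?thesis using F'(3) by (auto elim!: eventually_mono)
qed

text \<open>This makes the arbitrary choice in \<open>weak_gradient\<close> harmless: every gradient
  found by hand agrees with it almost everywhere.\<close>

theorem weak_gradient_unique:
 assumes S: "open S" and 1: "has_weak_gradient S v g" and 2: "has_weak_gradient S v g'"
 shows "AE x in lebesgue. x : S --> g x = g' x"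
proof -
 have "AE x in lebesgue. x : S --> g x $ i - g' x $ i = 0" for i
 proof (rule du_Bois_Reymond[OF S])
  show "(%x. g x $ i - g' x $ i) absolutely_integrable_on K" if "compact K" "K \<subseteq> S" for K
   by (intro set_integral_diff has_weak_gradientD(3)[OF 1] has_weak_gradientD(3)[OF 2] that)
  fix ph assume ph: "ph : test_functions S"
  have "(LINT x|leb S. (g x $ i - g' x $ i) * ph x) =
    (LINT x|leb S. g x $ i * ph x) - (LINT x|leb S. g' x $ i * ph x)"
   using test_function_integrable(1)[OF S ph has_weak_gradientD(3)[OF 1]]
    test_function_integrable(1)[OF S ph has_weak_gradientD(3)[OF 2]]
   by (simp add: left_diff_distrib LINT_diff)
  also have "... = 0"
   using has_weak_gradientD(4)[OF 1 ph, of i] has_weak_gradientD(4)[OF 2 ph, of i] by simp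
  finally show "(LINT x|leb S. (g x $ i - g' x $ i) * ph x) = 0" .
 qed
 then have "AE x in lebesgue. \<forall>i. x : S --> g x $ i - g' x $ i = 0"
  by (intro AE_all_countable[THEN iffD2] allI)
 then show ?thesis by eventually_elim (auto simp: vec_eq_iff)
qed

lemma has_weak_gradient_weak_gradient:
 "has_weak_gradient S v g ==> has_weak_gradient S v (weak_gradient S v)"
 using someI[of "has_weak_gradient S v" g] by (simp add: weak_gradient_def)

lemma weak_gradient_AE:
 "open S ==> has_weak_gradient S v g ==> AE x in lebesgue. x : S --> weak_gradient S v x = g x"
 by (rule weak_gradient_unique[OF _ has_weak_gradient_weak_gradient])

lemma AE_lebesgue_on: "S : sets lebesgue ==> (AE x in leb S. P x) \<longleftrightarrow> (AE x in lebesgue. x : S --> P x)"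
 by (simp add: AE_restrict_space_iff)

section \<open>Operations on weak gradients\<close>

lemma has_weak_gradient_add:
 assumes S: "open S" and 1: "has_weak_gradient S v g" and 2: "has_weak_gradient S w h"
 shows "has_weak_gradient S (%x. v x + w x) (%x. g x + h x)"
 unfolding has_weak_gradient_def
proof (intro conjI ballI allI impI)
 fix K assume K: "compact K & K \<subseteq> S"
 show "(%x. v x + w x) absolutely_integrable_on K" "(%x. g x + h x) absolutely_integrable_on K"
  using K has_weak_gradientD(1,2)[OF 1] has_weak_gradientD(1,2)[OF 2] by (auto intro: set_integral_add)
next
 fix ph i assume ph: "ph : test_functions S"
 show "(LINT x|leb S. (v x + w x) * partial_deriv i ph x) = - (LINT x|leb S. (g x + h x) $ i * ph x)"
  using has_weak_gradientD(4)[OF 1 ph, of i] has_weak_gradientD(4)[OF 2 ph, of i]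
   test_function_integrable(1)[OF S ph has_weak_gradientD(3)[OF 1]]
   test_function_integrable(1)[OF S ph has_weak_gradientD(3)[OF 2]]
   test_function_integrable(2)[OF S ph has_weak_gradientD(1)[OF 1]]
   test_function_integrable(2)[OF S ph has_weak_gradientD(1)[OF 2]]
  by (simp add: distrib_right LINT_add)
qed

lemma has_weak_gradient_cmult:
 assumes "has_weak_gradient S v g"
 shows "has_weak_gradient S (%x. c * v x) (%x. c *\<^sub>R g x)"
 unfolding has_weak_gradient_def
proof (intro conjI ballI allI impI)
 fix K assume K: "compact K & K \<subseteq> S"
 show "(%x. c * v x) absolutely_integrable_on K" "(%x. c *\<^sub>R g x) absolutely_integrable_on K"
  using absolutely_integrable_scaleR_left[OF has_weak_gradientD(1)[OF assms conjunct1[OF K] conjunct2[OF K]], of c]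
   absolutely_integrable_scaleR_left[OF has_weak_gradientD(2)[OF assms conjunct1[OF K] conjunct2[OF K]], of c]
  by simp_all
next
 fix ph i assume ph: "ph : test_functions S"
 show "(LINT x|leb S. c * v x * partial_deriv i ph x) = - (LINT x|leb S. (c *\<^sub>R g x) $ i * ph x)"
  using has_weak_gradientD(4)[OF assms ph, of i] by (simp add: mult.assoc)
qed

lemma continuous_absolutely_integrable_compact:
 fixes f :: "'a::euclidean_space => 'b::euclidean_space"
 assumes f: "continuous_on UNIV f" and K: "compact K"
 shows "f absolutely_integrable_on K"
proof -
 obtain B where B: "!!x. x : K ==> norm (f x) <= B"
  using compact_imp_bounded[OF compact_continuous_image[OF continuous_on_subset[OF f] K]] by (auto simp: bounded_iff)
 show ?thesis
 proof (rule measurable_bounded_by_integrable_imp_absolutely_integrable[where g="%x. B"])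
  show "f : borel_measurable (leb K)"
   by (rule measurable_restrict_space1[OF continuous_lebesgue_measurable[OF f]])
  show "(%x. B) integrable_on K"
   using absolutely_integrable_on_const[OF lmeasurable_compact[OF K], of B]
   by (rule set_lebesgue_integral_eq_integral)
 qed (use B K in \<open>auto simp: compact_in_sets_lebesgue\<close>)
qed

text \<open>The product with a test function has compact support, so its derivative integrates to 0;
  the product rule does the rest.\<close>

lemma smooth_has_weak_gradient:
 fixes v :: "real^'d => real"
 assumes v: "smooth v"
 shows "has_weak_gradient UNIV v (%x. \<chi> i. partial_deriv i v x)"
 unfolding has_weak_gradient_def
proof (intro conjI ballI allI impI)
 fix K :: "(real^'d) set" assume K: "compact K & K \<subseteq> UNIV"
 then show "v absolutely_integrable_on K"
  by (intro continuous_absolutely_integrable_compact smooth_continuous v) auto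
 show "(%x. \<chi> i. partial_deriv i v x) absolutely_integrable_on K"
  using K by (intro continuous_absolutely_integrable_compact continuous_on_vec_lambda smooth_continuous
    smooth_partial_deriv v) auto
next
 fix ph :: "real^'d => real" and i assume ph: "ph : test_functions UNIV"
 then obtain K where K: "smooth ph" "compact K" "!!x. x ~: K ==> ph x = 0" by (auto simp: test_functions_iff)
 have 1: "integrable (leb UNIV) (%x. v x * partial_deriv i ph x)"
  using v by (intro test_function_integrable(2)[OF open_UNIV ph] continuous_absolutely_integrable_compact smooth_continuous)
 have 2: "integrable (leb UNIV) (%x. partial_deriv i v x * ph x)"
  using v by (intro test_function_integrable(1)[OF open_UNIV ph] continuous_absolutely_integrable_compact
    smooth_continuous smooth_partial_deriv)
 have "0 = (LINT x|lebesgue. partial_deriv i (%x. v x * ph x) x)"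
  by (rule integral_partial_deriv_eq_0[symmetric, OF smooth_mult[OF v K(1)] K(2)]) (simp add: K(3))
 also have "... = (LINT x|leb UNIV. v x * partial_deriv i ph x + partial_deriv i v x * ph x)"
  by (simp add: partial_deriv_mult[OF v K(1)] lebesgue_on_UNIV_eq)
 also have "... = (LINT x|leb UNIV. v x * partial_deriv i ph x) + (LINT x|leb UNIV. partial_deriv i v x * ph x)"
  by (rule LINT_add[OF 1 2])
 finally show "(LINT x|leb UNIV. v x * partial_deriv i ph x) =
   - (LINT x|leb UNIV. (\<chi> i. partial_deriv i v x) $ i * ph x)" by simp
qed

lemma has_weak_gradient_subset:
 assumes S: "open S" "S \<subseteq> T" "T : sets lebesgue" and wg: "has_weak_gradient T v g"
 shows "has_weak_gradient S v g"
 unfolding has_weak_gradient_def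
proof (intro conjI ballI allI impI)
 fix K assume K: "compact K & K \<subseteq> S"
 then show "v absolutely_integrable_on K" "g absolutely_integrable_on K"
  using has_weak_gradientD(1,2)[OF wg, of K] S(2) by auto
next
 fix ph i assume ph: "ph : test_functions S"
 then obtain K where K: "smooth ph" "compact K" "K \<subseteq> S" "!!x. x ~: K ==> ph x = 0" by (auto simp: test_functions_iff)
 have d0: "partial_deriv i ph x = 0" if "x ~: S" for x
  using partial_deriv_zero_off_compact[of K ph x i] K that by blast
 have ph0: "ph x = 0" if "x ~: S" for x using that K(3,4) by blast
 have "(LINT x|leb S. v x * partial_deriv i ph x) = (LINT x|leb T. v x * partial_deriv i ph x)"
  unfolding integral_lebesgue_on_eq[OF open_in_sets_lebesgue[OF S(1)]] integral_lebesgue_on_eq[OF S(3)]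
  using S(2) d0 by (intro LINT_cong) (auto simp: indicator_def)
 also have "... = - (LINT x|leb T. g x $ i * ph x)"
  by (rule has_weak_gradientD(4)[OF wg test_functions_mono[OF ph S(2)]])
 also have "(LINT x|leb T. g x $ i * ph x) = (LINT x|leb S. g x $ i * ph x)"
  unfolding integral_lebesgue_on_eq[OF open_in_sets_lebesgue[OF S(1)]] integral_lebesgue_on_eq[OF S(3)]
  using S(2) ph0 by (intro LINT_cong) (auto simp: indicator_def)
 finally show "(LINT x|leb S. v x * partial_deriv i ph x) = - (LINT x|leb S. g x $ i * ph x)" .
qed

lemma smooth_const: "smooth (%x. c)"
 by (simp add: smooth_def C_k_const)

lemma has_weak_gradient_const: "has_weak_gradient UNIV (%x. c) (%x. 0)"
proof -
 have "partial_deriv i (%x. c) x = 0" for i and x :: "real^'a"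
  by (rule partial_deriv_eq) simp
 then have "(%x :: real^'a. \<chi> i. partial_deriv i (%x. c) x) = (%x. 0)"
  by (simp add: fun_eq_iff vec_eq_iff)
 then show ?thesis using smooth_has_weak_gradient[OF smooth_const[of c]] by metis
qed

lemma integral_compact_support_le:
 fixes v ps :: "real^'d => real"
 assumes S: "S : sets lebesgue" and K: "compact K" "K \<subseteq> S" and v: "v absolutely_integrable_on K"
  and ps: "continuous_on UNIV ps" "!!x. x ~: K ==> ps x = 0" "!!x. \<bar>ps x\<bar> <= B"
 shows "\<bar>LINT x|leb S. v x * ps x\<bar> <= B * (LINT x|leb K. \<bar>v x\<bar>)"
proof -
 have "norm (LINT x|leb S. v x * ps x) <= (LINT x|leb S. B * (indicator K x * \<bar>v x\<bar>))"
 proof (rule order_trans[OF Bochner_Integration.integral_norm_bound LINT_mono])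
  show "integrable (leb S) (%x. norm (v x * ps x))"
   by (intro integrable_norm integrable_times_compact_support[OF S K v ps(1,2)])
  show "integrable (leb S) (%x. B * (indicator K x * \<bar>v x\<bar>))"
   by (intro integrable_mult_right integrable_compact_support_bound[OF S K v])
  fix x
  show "norm (v x * ps x) <= B * (indicator K x * \<bar>v x\<bar>)"
   using ps(2,3)[of x] by (cases "x : K") (simp_all add: abs_mult mult.commute mult_right_mono)
 qed
 also have "... = B * (LINT x|leb S. indicator K x * \<bar>v x\<bar>)" by simp
 also have "(LINT x|leb S. indicator K x * \<bar>v x\<bar>) = (LINT x|leb K. \<bar>v x\<bar>)"
  unfolding integral_lebesgue_on_eq[OF S] integral_lebesgue_on_eq[OF compact_in_sets_lebesgue[OF K(1)]]
  using K(2) by (intro LINT_cong) (auto simp: indicator_def)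
 finally show ?thesis by simp
qed

text \<open>Local convergence in mean passes to the limit in the defining identity, because a test
  function and its derivatives are bounded with compact support. It is meant for the partial sums of
  a Fourier series.\<close>

lemma has_weak_gradient_limit:
 fixes v :: "nat => real^'d => real"
 assumes S: "open S" and wg: "!!m. has_weak_gradient S (v m) (g m)"
  and w: "!!K. compact K ==> K \<subseteq> S ==> w absolutely_integrable_on K"
   "!!K. compact K ==> K \<subseteq> S ==> h absolutely_integrable_on K"
  and lim: "!!K. compact K ==> K \<subseteq> S ==> (%m. LINT x|leb K. \<bar>v m x - w x\<bar>) ~~> 0"
   "!!K i. compact K ==> K \<subseteq> S ==> (%m. LINT x|leb K. \<bar>g m x $ i - h x $ i\<bar>) ~~> 0"
 shows "has_weak_gradient S w h"
 unfolding has_weak_gradient_def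
proof (intro conjI ballI allI impI)
 fix ph i assume ph: "ph : test_functions S"
 then obtain K where K: "smooth ph" "compact K" "K \<subseteq> S" "!!x. x ~: K ==> ph x = 0" by (auto simp: test_functions_iff)
 have hi: "(%x. h x $ i) absolutely_integrable_on K" if "compact K" "K \<subseteq> S" for K
  using absolutely_integrable_component[OF w(2)[OF that], of "axis i 1"] by (simp add: inner_axis)
 have conv: "(%m. LINT x|leb S. a m x * ps x) ~~> (LINT x|leb S. b x * ps x)"
  if a: "!!m. a m absolutely_integrable_on K" and b: "b absolutely_integrable_on K"
   and ps: "continuous_on UNIV ps" "!!x. x ~: K ==> ps x = 0"
   and l: "(%m. LINT x|leb K. \<bar>a m x - b x\<bar>) ~~> 0" for a b and ps :: "real^'d => real"
 proof -
  obtain B where B: "!!x. \<bar>ps x\<bar> <= B"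
   using continuous_bounded_compact_support[OF ps(1) K(2) ps(2)] by metis
  note Sl = open_in_sets_lebesgue[OF S]
  have "(%m. (LINT x|leb S. a m x * ps x) - (LINT x|leb S. b x * ps x)) ~~> 0"
  proof (rule Lim_null_comparison)
   show "(%m. B * (LINT x|leb K. \<bar>a m x - b x\<bar>)) ~~> 0"
    using tendsto_mult_right_zero[OF l] by simp
   show "\<forall>\<^sub>F m in sequentially. norm ((LINT x|leb S. a m x * ps x) - (LINT x|leb S. b x * ps x))
     <= B * (LINT x|leb K. \<bar>a m x - b x\<bar>)"
   proof (intro always_eventually allI)
    fix m
    have "(LINT x|leb S. a m x * ps x) - (LINT x|leb S. b x * ps x) =
      (LINT x|leb S. (a m x - b x) * ps x)"
     using integrable_times_compact_support[OF Sl K(2,3) a ps] integrable_times_compact_support[OF Sl K(2,3) b ps]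
     by (simp add: left_diff_distrib LINT_diff)
    then show "norm ((LINT x|leb S. a m x * ps x) - (LINT x|leb S. b x * ps x))
      <= B * (LINT x|leb K. \<bar>a m x - b x\<bar>)"
     using integral_compact_support_le[OF Sl K(2,3) set_integral_diff(1)[OF a b] ps B] by simp
   qed
  qed
  then show ?thesis by (simp add: LIM_zero_iff)
 qed
 have "(%m. LINT x|leb S. v m x * partial_deriv i ph x) ~~> (LINT x|leb S. w x * partial_deriv i ph x)"
  by (rule conv[OF has_weak_gradientD(1)[OF wg K(2,3)] w(1)[OF K(2,3)] smooth_continuous[OF smooth_partial_deriv[OF K(1)]]
     partial_deriv_zero_off_compact[OF K(2,4)] lim(1)[OF K(2,3)]])
 moreover have "(%m. LINT x|leb S. g m x $ i * ph x) ~~> (LINT x|leb S. h x $ i * ph x)"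
  by (rule conv[OF has_weak_gradientD(3)[OF wg K(2,3)] hi[OF K(2,3)] smooth_continuous[OF K(1)] K(4) lim(2)[OF K(2,3)]])
 then have "(%m. LINT x|leb S. v m x * partial_deriv i ph x) ~~> - (LINT x|leb S. h x $ i * ph x)"
  unfolding has_weak_gradientD(4)[OF wg ph] by (rule tendsto_minus)
 ultimately show "(LINT x|leb S. w x * partial_deriv i ph x) = - (LINT x|leb S. h x $ i * ph x)"
  by (rule LIMSEQ_unique)
qed (use w in auto)

text \<open>Chain rule, obtained by pulling the test function back along \<open>A\<close>. It is the
  source of the factor D^(-T) in the y-gradient of the corrector.\<close>

lemma has_weak_gradient_linear:
 fixes A :: "real^'d^'d"
 assumes A: "invertible A" and wg: "has_weak_gradient UNIV v g"
 shows "has_weak_gradient UNIV (%y. v (matrix_inv A *v y)) (%y. transpose (matrix_inv A) *v g (matrix_inv A *v y))"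
 unfolding has_weak_gradient_def
proof (intro conjI ballI allI impI)
 let ?B = "matrix_inv A"
 fix K :: "(real^'d) set" assume K: "compact K & K \<subseteq> UNIV"
 define K' where "K' = (*v) ?B ` K"
 have K': "compact K'"
  unfolding K'_def using K by (intro compact_continuous_image linear_continuous_on matrix_vector_mul_bounded_linear) auto
 have AK: "(*v) A ` K' = K" unfolding K'_def by (simp add: image_image matrix_inv_cancel[OF A])
 have *: "(%y. f (?B *v y)) absolutely_integrable_on K" if "f absolutely_integrable_on K'"
  for f :: "real^'d => 'b::euclidean_space"
 proof -
  have "integrable (leb K') f"
   using that K' by (simp add: set_integrable_def integrable_lebesgue_on_iff compact_in_sets_lebesgue)
  then have "integrable (leb ((*v) A ` K')) (%y. f (?B *v y))"
   by (intro integral_matrix_image(1)[OF A compact_in_sets_lebesgue[OF K']]) (simp add: matrix_inv_cancel[OF A])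
  then show ?thesis
   using K by (simp add: AK set_integrable_def integrable_lebesgue_on_iff compact_in_sets_lebesgue)
 qed
 show "(%y. v (?B *v y)) absolutely_integrable_on K"
  using has_weak_gradientD(1)[OF wg K'] by (intro *) auto
 have "(%y. g (?B *v y)) absolutely_integrable_on K"
  using has_weak_gradientD(2)[OF wg K'] by (intro *) auto
 from absolutely_integrable_linear[OF this matrix_vector_mul_bounded_linear[of "transpose ?B"]]
 show "(%y. transpose ?B *v g (?B *v y)) absolutely_integrable_on K" by (simp add: o_def)
next
 let ?B = "matrix_inv A"
 fix ph :: "real^'d => real" and i assume ph: "ph : test_functions UNIV"
 then obtain K where K: "smooth ph" "compact K" "!!x. x ~: K ==> ph x = 0" by (auto simp: test_functions_iff)
 define ps where "ps x = ph (A *v x)" for x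
 have sm: "smooth ps" using smooth_affine[OF K(1), of A 0] by (simp add: ps_def[abs_def])
 have test: "ps : test_functions UNIV"
  unfolding test_functions_iff
 proof (intro conjI sm exI[of _ "(*v) ?B ` K"])
  show "compact ((*v) ?B ` K)"
   using K(2) by (intro compact_continuous_image linear_continuous_on matrix_vector_mul_bounded_linear) auto
  show "\<forall>x. x ~: (*v) ?B ` K --> ps x = 0"
  proof (intro allI impI)
   fix x assume x: "x ~: (*v) ?B ` K"
   have "A *v x ~: K"
   proof
    assume "A *v x : K"
    then have "?B *v (A *v x) : (*v) ?B ` K" by (rule imageI)
    then show False using x by (simp add: matrix_inv_cancel[OF A])
   qed
   then show "ps x = 0" by (simp add: ps_def K(3))
  qed
 qed simp
 have d: "partial_deriv j ps x = (\<Sum>l\<in>UNIV. A $ l $ j * partial_deriv l ph (A *v x))" for j x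
  using partial_deriv_affine(1)[of 0 ph j A 0 x] K(1) unfolding smooth_def ps_def[abs_def] by (simp del: C_k.simps)
 \<comment> \<open>Summation against a column of the inverse undoes the chain rule \<open>d\<close>
   and isolates one derivative of \<open>ph\<close>.\<close>
 have inv: "(\<Sum>j\<in>UNIV. ?B $ j $ i * partial_deriv j ps x) = partial_deriv i ph (A *v x)" for x
 proof -
  have "(\<Sum>j\<in>UNIV. ?B $ j $ i * partial_deriv j ps x) =
    (\<Sum>l\<in>UNIV. (\<Sum>j\<in>UNIV. A $ l $ j * ?B $ j $ i) * partial_deriv l ph (A *v x))"
   unfolding d sum_distrib_left sum_distrib_right by (subst sum.swap) (simp add: mult_ac)
  also have "... = (\<Sum>l\<in>UNIV. (A ** ?B) $ l $ i * partial_deriv l ph (A *v x))"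
   by (simp add: matrix_matrix_mult_def)
  also have "... = partial_deriv i ph (A *v x)"
   by (simp add: matrix_inv_mult[OF A] mat_def if_distrib[where f="%c. c * _"] cong: if_cong)
  finally show ?thesis .
 qed
 note U = open_UNIV
 have UL: "(UNIV :: (real^'d) set) : sets lebesgue" by simp
 let ?s = "measure lebesgue ((*v) A ` unit_cell)"
 have AU: "(*v) A ` UNIV = UNIV"
  using matrix_inv_cancel(2)[OF A] by (metis surjI)
 note i1 = test_function_integrable(2)[OF U test has_weak_gradientD(1)[OF wg]]
 note i2 = test_function_integrable(1)[OF U test has_weak_gradientD(3)[OF wg]]
 have I1: "integrable (leb UNIV) (%x. (\<Sum>j\<in>UNIV. ?B $ j $ i * (v x * partial_deriv j ps x)))"
  by (intro intble_sum integrable_mult_right i1) auto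
 have I2: "integrable (leb UNIV) (%x. (\<Sum>j\<in>UNIV. ?B $ j $ i * (g x $ j * ps x)))"
  by (intro intble_sum integrable_mult_right i2) auto
 have e1: "(\<Sum>j\<in>UNIV. ?B $ j $ i * (v x * partial_deriv j ps x)) = v (?B *v (A *v x)) * partial_deriv i ph (A *v x)" for x
  by (simp add: inv[symmetric] sum_distrib_left mult_ac matrix_inv_cancel[OF A])
 have e2: "(\<Sum>j\<in>UNIV. ?B $ j $ i * (g x $ j * ps x)) = (transpose ?B *v g (?B *v (A *v x))) $ i * ph (A *v x)" for x
 proof -
  have "(transpose ?B *v z) $ i = (\<Sum>j\<in>UNIV. ?B $ j $ i * z $ j)" for z
   by (simp add: matrix_vector_mult_def transpose_def)
  then show ?thesis by (simp add: sum_distrib_left sum_distrib_right mult_ac matrix_inv_cancel[OF A] ps_def)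
 qed
 have "(LINT y|leb UNIV. v (?B *v y) * partial_deriv i ph y) =
   ?s * (LINT x|leb UNIV. (\<Sum>j\<in>UNIV. ?B $ j $ i * (v x * partial_deriv j ps x)))"
  using integral_matrix_image(2)[OF A UL, of "%y. v (?B *v y) * partial_deriv i ph y"] I1
  unfolding e1 AU by simp
 also have "... = ?s * (\<Sum>j\<in>UNIV. ?B $ j $ i * (LINT x|leb UNIV. v x * partial_deriv j ps x))"
  using i1 by (subst LINT_sum) auto
 also have "... = - (?s * (\<Sum>j\<in>UNIV. ?B $ j $ i * (LINT x|leb UNIV. g x $ j * ps x)))"
  by (simp add: has_weak_gradientD(4)[OF wg test] sum_negf)
 also have "(\<Sum>j\<in>UNIV. ?B $ j $ i * (LINT x|leb UNIV. g x $ j * ps x)) =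
   (LINT x|leb UNIV. (\<Sum>j\<in>UNIV. ?B $ j $ i * (g x $ j * ps x)))"
  using i2 by (subst LINT_sum) auto
 also have "?s * ... = (LINT y|leb UNIV. (transpose ?B *v g (?B *v y)) $ i * ph y)"
  using integral_matrix_image(2)[OF A UL, of "%y. (transpose ?B *v g (?B *v y)) $ i * ph y"] I2
  unfolding e2 AU by simp
 finally show "(LINT y|leb UNIV. v (?B *v y) * partial_deriv i ph y) =
   - (LINT y|leb UNIV. (transpose ?B *v g (?B *v y)) $ i * ph y)" .
qed

section \<open>Cubes and cutoff functions\<close>

text \<open>Rotation and scaling are merged into one similarity of the unit box, so constructions on
  that box carry over to cubes of any size and orientation.\<close>

lemma open_cube_affine:
 fixes Q :: "(real^'d) set"
 assumes "open_cube s Q" "0 < s"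
 obtains a :: "real^'d" and B :: "real^'d^'d" where "invertible B" "!!y. norm (B *v y) = s * norm y"
  "!!y. norm (matrix_inv B *v y) = norm y / s" "Q = (%y. a + B *v y) ` box 0 1"
proof -
 obtain a A where A: "orthogonal_matrix A" and Q: "Q = (%y. a + A *v y) ` box 0 (vec s)"
  using assms(1) unfolding open_cube_def by blast
 have "orthogonal_transformation ((*v) A)"
  using A by (simp add: orthogonal_transformation_matrix)
 then have nA: "norm (A *v y) = norm y" for y by (rule orthogonal_transformation_norm)
 define B where "B = s *\<^sub>R A"
 have BA: "B *v y = s *\<^sub>R (A *v y)" for y by (simp add: B_def scaleR_matrix_vector_assoc)
 have nB: "norm (B *v y) = s * norm y" for y using assms(2) by (simp add: BA nA)
 have "inj ((*v) B)"
 proof (rule injI)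
  fix x y assume "B *v x = B *v y"
  then have "norm (B *v (x - y)) = 0" by (simp add: matrix_vector_mult_diff_distrib)
  then show "x = y" using assms(2) by (simp add: nB)
 qed
 then have inv: "invertible B"
  by (simp add: invertible_left_inverse matrix_left_invertible_injective)
 have "norm (matrix_inv B *v y) = norm y / s" for y
  using nB[of "matrix_inv B *v y"] assms(2) by (simp add: matrix_inv_cancel[OF inv] field_simps)
 moreover have "Q = (%y. a + B *v y) ` box 0 1"
 proof -
  have "box 0 (vec s) = (%y. s *\<^sub>R y) ` box (0 :: real^'d) 1"
  proof (intro equalityI subsetI)
   fix x :: "real^'d" assume x: "x : box 0 (vec s)"
   have "(1 / s) *\<^sub>R x : box 0 1" using x assms(2) by (auto simp: mem_box_cart field_simps)
   then show "x : (%y. s *\<^sub>R y) ` box 0 1"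
    using assms(2) by (intro image_eqI[of _ _ "(1 / s) *\<^sub>R x"]) auto
  qed (use assms(2) in \<open>auto simp: mem_box_cart\<close>)
  then show ?thesis
   unfolding Q by (auto simp: image_image BA matrix_vector_mult_scaleR)
 qed
 ultimately show thesis using that[OF inv nB] by blast
qed

lemma open_cube_facts:
 fixes Q :: "(real^'d) set"
 assumes "open_cube s Q" "0 < s"
 shows "open Q" "convex Q" "Q : lmeasurable" "!!x y. x : Q ==> y : Q ==> dist x y <= s * real CARD('d)"
  and "!!x y. x : closure Q ==> y : closure Q ==> dist x y <= s * real CARD('d)"
proof -
 obtain a and B :: "real^'d^'d" where B: "invertible B" "!!y. norm (B *v y) = s * norm y" "Q = (%y. a + B *v y) ` box 0 1"
  using open_cube_affine[OF assms] by metis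
 have "Q = (%x. matrix_inv B *v (x - a)) -` box 0 1"
 proof (intro equalityI subsetI)
  fix x assume "x : (%x. matrix_inv B *v (x - a)) -` box 0 1"
  then show "x : Q" unfolding B(3)
   by (intro image_eqI[of _ _ "matrix_inv B *v (x - a)"]) (auto simp: matrix_inv_cancel[OF B(1)])
 qed (auto simp: B(3) matrix_inv_cancel[OF B(1)])
 moreover have "continuous_on UNIV (%x. matrix_inv B *v (x - a))"
  unfolding matrix_vector_mult_diff_distrib
  by (intro continuous_on_diff continuous_on_const linear_continuous_on matrix_vector_mul_bounded_linear)
 ultimately show "open Q" by (auto intro: open_vimage)
 have "Q = (+) a ` ((*v) B ` box 0 1)" by (auto simp: B(3))
 moreover have "convex ((*v) B ` box 0 1)" by (rule convex_linear_image) simp_all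
 ultimately show "convex Q" using convex_translation by metis
 show d: "dist x y <= s * real CARD('d)" if xy: "x : Q" "y : Q" for x y
 proof -
  obtain x' y' where *: "x' : box 0 1" "y' : box 0 1" "x = a + B *v x'" "y = a + B *v y'"
   using xy by (auto simp: B(3))
  have "\<bar>(x' - y') $ i\<bar> <= 1" for i
  proof -
   have "0 < x' $ i" "x' $ i < 1" "0 < y' $ i" "y' $ i < 1" using *(1,2) by (auto simp: mem_box_cart)
   then show ?thesis by simp
  qed
  \<comment> \<open>The norm is estimated by the sum of the coordinates, whence the factor d in
    place of sqrt d.\<close>
  then have "norm (x' - y') <= (\<Sum>i\<in>(UNIV :: 'd set). 1)"
   by (intro order_trans[OF norm_le_l1_cart] sum_mono)
  then have "norm (B *v (x' - y')) <= s * real CARD('d)" using assms(2) by (simp add: B(2))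
  then show ?thesis by (simp add: *(3,4) dist_norm matrix_vector_mult_diff_distrib)
 qed
 then have "bounded Q" unfolding bounded_two_points by blast
 then show "Q : lmeasurable" using \<open>open Q\<close> by (rule lmeasurable_open)
 show "dist x y <= s * real CARD('d)" if "x : closure Q" "y : closure Q" for x y
 proof -
  have "closed {z. dist (fst z) (snd z) <= s * real CARD('d)}"
   by (intro closed_Collect_le continuous_intros)
  then have "closure (Q \<times> Q) \<subseteq> {z. dist (fst z) (snd z) <= s * real CARD('d)}"
   using d by (intro closure_minimal) auto
  then show ?thesis using that by (auto simp: closure_Times)
 qed
qed

section \<open>Cutoff functions inside a cube\<close>

lemma not_in_translation:
 fixes h :: "'a::ab_group_add"
 assumes "x ~: (+) h ` L"
 shows "x - h ~: L"
proof
 assume "x - h : L"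
 then have "h + (x - h) : (+) h ` L" by (rule imageI)
 then show False using assms by simp
qed

text \<open>A cut-off function whose translates by vectors of length at most \<open>\<rho>\<close> all live in \<open>Q\<close> and
  fill it up to a set of relative measure \<open>\<delta>\<^sup>2\<close>.\<close>
definition cutoff :: "(real^'d) set => real => real => (real^'d => real) => bool" where
 "cutoff Q \<rho> de b \<longleftrightarrow> smooth b & (\<forall>x. 0 <= b x & b x <= 1) &
   (\<exists>K. compact K & (\<forall>x. x ~: K --> b x = 0) & (\<forall>x\<in>K. \<forall>h. norm h <= \<rho> --> x + h : Q)) &
   (\<forall>h. norm h <= \<rho> --> (LINT x|leb Q. 1 - b (x - h)) <= de\<^sup>2 * measure lebesgue Q)"

lemma measure_unit_box: "measure lebesgue (box 0 (1 :: real^'d)) = 1"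
 using measure_unit_cell[where 'd='d] unfolding unit_cell_def
 by (simp add: measure_lborel_box_eq measure_lborel_cbox_eq)

lemma integral_bump_tendsto:
 "(%j. LINT x|lebesgue. bump 0 (1 :: real^'d) j x) ~~> 1"
proof -
 have "(%j. LINT x|lebesgue. bump 0 (1 :: real^'d) j x) ~~> (LINT x|lebesgue. indicator (box 0 (1 :: real^'d)) x)"
 proof (rule integral_dominated_convergence[where w="indicator (cbox 0 1)"])
  show "bump 0 (1 :: real^'d) j : borel_measurable lebesgue" for j
   by (intro continuous_lebesgue_measurable smooth_continuous) (simp add: smooth_def C_k_bump)
  show "integrable lebesgue (indicator (cbox 0 (1 :: real^'d)) :: _ => real)"
   using lmeasurable_cbox[of 0 "1 :: real^'d"] by (simp add: fmeasurable_def)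
  show "AE x in lebesgue. norm (bump 0 (1 :: real^'d) j x) <= indicator (cbox 0 1) x" for j
  proof (rule AE_I2)
   fix x :: "real^'d"
   show "norm (bump 0 1 j x) <= indicator (cbox 0 1) x"
   proof (cases "x : cbox 0 1")
    case False
    have "x ~: cbox (\<chi> i. (0 :: real^'d) $ i + 1 / real (Suc j)) (\<chi> i. (1 :: real^'d) $ i - 1 / real (Suc j))"
    proof
     assume "x : cbox (\<chi> i. (0 :: real^'d) $ i + 1 / real (Suc j)) (\<chi> i. (1 :: real^'d) $ i - 1 / real (Suc j))"
     then have "1 / real (Suc j) <= x $ i & x $ i <= 1 - 1 / real (Suc j)" for i
      by (auto simp: mem_box_cart simp del: of_nat_Suc)
     moreover have "0 < 1 / real (Suc j)" by simp
     ultimately have "0 <= x $ i & x $ i <= 1" for i by (smt (verit))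
     then show False using False by (simp add: mem_box_cart)
    qed
    then show ?thesis using False by (simp add: bump_eq_0 del: of_nat_Suc)
   qed (use bump_bounds[of 0 1 j x] in auto)
  qed
 qed (auto simp: bump_tendsto intro!: borel_measurable_indicator)
 moreover have "measure lebesgue (box 0 (1 :: real^'d)) = 1"
  by (rule measure_unit_box)
 ultimately show ?thesis by simp
qed

text \<open>One bump on the unit box, transported by similarities, serves all cubes. Therefore
  \<open>ka\<close> depends on the tolerance \<open>de\<close> alone, and the admissible shifts are
  a fixed fraction of the side.\<close>

lemma open_cube_cutoff:
 assumes "0 < de"
 obtains ka where "0 < ka"
  "!!s (Q :: (real^'d) set). 0 < s ==> open_cube s Q ==> \<exists>b. cutoff Q (ka * s) de b"
proof -
 have "\<forall>\<^sub>F j in sequentially. 1 - de\<^sup>2 < (LINT x|lebesgue. bump 0 (1 :: real^'d) j x)"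
  by (rule order_tendstoD(1)[OF integral_bump_tendsto]) (use assms in simp)
 then obtain j where j: "1 - de\<^sup>2 < (LINT x|lebesgue. bump 0 (1 :: real^'d) j x)"
  by (auto simp: eventually_sequentially)
 \<comment> \<open>The bump vanishes within \<open>p\<close> of the faces. Half of this margin,
   scaled by the side, is granted to the shifts, so shifted supports stay strictly inside.\<close>
 define p where "p = 1 / real (Suc j)"
 have p: "p > 0" by (simp add: p_def)
 let ?be = "bump 0 (1 :: real^'d) j"
 have smbe: "smooth ?be" by (simp add: smooth_def C_k_bump)
 let ?K = "cbox (\<chi> i. (0 :: real^'d) $ i + p) (\<chi> i. (1 :: real^'d) $ i - p)"
 have "\<exists>b. cutoff Q (p / 2 * s) de b" if s: "0 < s" "open_cube s Q" for s and Q :: "(real^'d) set"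
 proof -
  obtain a and B :: "real^'d^'d" where B: "invertible B" "!!y. norm (B *v y) = s * norm y"
   "!!y. norm (matrix_inv B *v y) = norm y / s" "Q = (%y. a + B *v y) ` box 0 1"
   using open_cube_affine[OF s(2,1)] by metis
  define b where "b x = ?be (matrix_inv B *v (x - a))" for x
  have "(%x. ?be (matrix_inv B *v x + - (matrix_inv B *v a))) = b"
   by (simp add: b_def fun_eq_iff matrix_vector_mult_diff_distrib)
  then have smb: "smooth b" using smooth_affine[OF smbe] by metis
  have K0: "?be y = 0" if "y ~: ?K" for y by (rule bump_eq_0) (use that in \<open>simp add: p_def\<close>)
  have Kin: "y + v : box 0 1" if "y : ?K" "norm v <= p / 2" for y v
   unfolding mem_box_cart
  proof (intro allI)
   fix i
   have "\<bar>v $ i\<bar> <= p / 2" using component_le_norm_cart[of v i] that(2) by linarith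
   moreover have "p <= y $ i" "y $ i <= 1 - p" using that(1) by (auto simp: mem_box_cart)
   ultimately show "(0 :: real^'d) $ i < (y + v) $ i & (y + v) $ i < (1 :: real^'d) $ i"
    using p unfolding vector_add_component zero_index one_index by linarith
  qed
  let ?L = "(%y. a + B *v y) ` ?K"
  have L: "compact ?L"
   by (intro compact_continuous_image continuous_on_add continuous_on_const linear_continuous_on
     matrix_vector_mul_bounded_linear) simp
  have L0: "b x = 0" if "x ~: ?L" for x
  proof -
   have "matrix_inv B *v (x - a) ~: ?K"
   proof
    assume "matrix_inv B *v (x - a) : ?K"
    then have "a + B *v (matrix_inv B *v (x - a)) : ?L" by (rule imageI)
    then show False using that by (simp add: matrix_inv_cancel[OF B(1)])
   qed
   then show ?thesis unfolding b_def by (rule K0)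
  qed
  have Lin: "x + h : Q" if x: "x : ?L" and h: "norm h <= p / 2 * s" for x h
  proof -
   obtain y where y: "y : ?K" "x = a + B *v y" using x by blast
   have "norm (matrix_inv B *v h) <= p / 2" using h s(1) by (simp add: B(3) field_simps)
   from Kin[OF y(1) this] have "a + B *v (y + matrix_inv B *v h) : Q" unfolding B(4) by (rule imageI)
   then show ?thesis by (simp add: y(2) matrix_vector_right_distrib matrix_inv_cancel[OF B(1)] add.assoc)
  qed
  let ?m = "measure lebesgue ((*v) B ` unit_cell)"
  have UL: "(UNIV :: (real^'d) set) : sets lebesgue" by simp
  have BU: "(*v) B ` UNIV = UNIV" using matrix_inv_cancel(2)[OF B(1)] by (metis surjI)
  have bei: "integrable lebesgue ?be"
  proof -
   have "integrable (leb UNIV) (%x. 1 * ?be x)"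
    by (rule integrable_times_compact_support[OF UL compact_cbox[of "\<chi> i. (0 :: real^'d) $ i + p" "\<chi> i. (1 :: real^'d) $ i - p"]])
     (auto intro!: continuous_absolutely_integrable_compact smooth_continuous smbe K0)
   then show ?thesis by (simp add: lebesgue_on_UNIV_eq)
  qed
  have intb: "(LINT x|lebesgue. b x) = ?m * (LINT x|lebesgue. ?be x)"
  proof -
   have "(LINT x|lebesgue. b x) = (LINT x|lebesgue. b (x - (- a)))"
    by (rule integral_lebesgue_translate[symmetric, OF smooth_continuous[OF smb]])
   also have "... = (LINT y|leb ((*v) B ` UNIV). ?be (matrix_inv B *v y))"
    by (simp add: b_def BU lebesgue_on_UNIV_eq)
   also have "... = ?m * (LINT x|lebesgue. ?be x)"
    using integral_matrix_image(2)[OF B(1) UL, of "%y. ?be (matrix_inv B *v y)"] bei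
    by (simp add: matrix_inv_cancel[OF B(1)] lebesgue_on_UNIV_eq)
   finally show ?thesis .
  qed
  have mQ: "measure lebesgue Q = ?m"
  proof -
   have Qi: "Q = (+) a ` ((*v) B ` box 0 1)" by (auto simp: B(4))
   have bx: "box 0 (1 :: real^'d) : lmeasurable" by simp
   have "measure lebesgue Q = measure lebesgue ((*v) B ` box 0 1)"
    unfolding Qi by (rule measure_translation)
   also have "... = (LINT y|leb ((*v) B ` box 0 1). 1)"
    by (intro measure_lebesgue_on_integral[symmetric] sets_lebesgue_matrix_image B(1)) simp
   also have "... = ?m * (LINT x|leb (box 0 (1 :: real^'d)). 1)"
    using integral_matrix_image(2)[where F="%_. 1 :: real", OF B(1) fmeasurableD[OF bx]
      finite_measure.integrable_const[OF finite_measure_lebesgue_on[OF bx]]]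
    by (simp only: real_scaleR_def)
   also have "(LINT x|leb (box 0 (1 :: real^'d)). 1) = (1 :: real)"
    using measure_lebesgue_on_integral[OF fmeasurableD[OF bx]] measure_unit_box by simp
   finally show ?thesis by simp
  qed
  have Q: "Q : lmeasurable" by (rule open_cube_facts(3)[OF s(2,1)])
  note Qs = fmeasurableD[OF Q]
  \<comment> \<open>A translate that remains inside \<open>Q\<close> keeps its full integral, so the
    loss does not depend on the shift.\<close>
  have small: "(LINT x|leb Q. 1 - b (x - h)) <= de\<^sup>2 * measure lebesgue Q" if h: "norm h <= p / 2 * s" for h
  proof -
   have off: "b (x - h) = 0" if "x ~: Q" for x
    using L0[of "x - h"] Lin[of "x - h" h] h that by (cases "x - h : ?L") auto
   have smh: "smooth (%x. b (x - h))" by (rule smooth_shift[OF smb])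
   have "bounded ?L" using L by (rule compact_imp_bounded)
   have int: "integrable lebesgue (%x. b (x - h))"
   proof -
    have Lh: "compact ((+) h ` ?L)" by (rule compact_translation[OF L])
    have z: "b (x - h) = 0" if "x ~: (+) h ` ?L" for x
     by (rule L0[OF not_in_translation[OF that]])
    have "integrable (leb UNIV) (%x. 1 * b (x - h))"
     by (rule integrable_times_compact_support[OF UL Lh subset_UNIV
        continuous_absolutely_integrable_compact[OF continuous_on_const Lh] smooth_continuous[OF smh] z])
    then show ?thesis by (simp add: lebesgue_on_UNIV_eq)
   qed
   have ie: "indicator Q x *\<^sub>R b (x - h) = b (x - h)" for x using off[of x] by (auto simp: indicator_def)
   have "(LINT x|leb Q. b (x - h)) = (LINT x|lebesgue. b (x - h))"
    unfolding integral_lebesgue_on_eq[OF Qs] ie ..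
   also have "... = (LINT x|lebesgue. b x)" by (rule integral_lebesgue_translate[OF smooth_continuous[OF smb]])
   finally have "(LINT x|leb Q. b (x - h)) = measure lebesgue Q * (LINT x|lebesgue. ?be x)"
    unfolding intb mQ .
   moreover have "integrable (leb Q) (%x. b (x - h))"
    unfolding integrable_lebesgue_on_iff[OF Qs] ie by (rule int)
   ultimately have "(LINT x|leb Q. 1 - b (x - h)) = measure lebesgue Q - measure lebesgue Q * (LINT x|lebesgue. ?be x)"
    using LINT_diff[where f="%_. 1 :: real",
      OF finite_measure.integrable_const[OF finite_measure_lebesgue_on[OF Q]]]
     measure_lebesgue_on_integral[OF Qs]
    by metis
   also have "... = measure lebesgue Q * (1 - (LINT x|lebesgue. ?be x))" by (simp add: algebra_simps)
   also have "... <= measure lebesgue Q * de\<^sup>2" using j by (intro mult_left_mono) auto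
   finally show ?thesis by (simp add: mult.commute)
  qed
  show ?thesis
   unfolding cutoff_def
   by (intro exI[of _ b] conjI allI exI[of _ ?L] impI ballI smb L L0 Lin small)
    (auto simp: b_def bump_bounds)
 qed
 then show thesis using that[of "p / 2"] p by simp
qed

lemma cutoffD:
 assumes "cutoff Q \<rho> de b"
 shows "smooth b" "0 <= b x" "b x <= 1"
  "\<exists>K. compact K & (\<forall>x. x ~: K --> b x = 0) & (\<forall>x\<in>K. \<forall>h. norm h <= \<rho> --> x + h : Q)"
  "norm h <= \<rho> ==> (LINT x|leb Q. 1 - b (x - h)) <= de\<^sup>2 * measure lebesgue Q"
 using assms by (auto simp: cutoff_def)

lemma continuous_borel:
 fixes f :: "'a::euclidean_space => 'b::topological_space"
 shows "continuous_on UNIV f ==> f : borel_measurable (leb S)"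
 by (intro measurable_restrict_space1 continuous_lebesgue_measurable)

text \<open>Young's inequality with weight \<open>de\<close>: for y = 1 - b one has |F| y <= de/2
  F^2 + y^2 / (2 de). As 0 <= y <= 1, the square is at most y, whose integral is at most de^2 times
  the measure of \<open>Q\<close>. Hence the square in the definition of
  \<open>cutoff\<close>.\<close>

lemma cutoff_approx:
 fixes F e b :: "real^'d => real"
 assumes Q: "Q : lmeasurable" and c: "cutoff Q \<rho> de b" and de: "0 < de" and h: "norm h <= \<rho>"
  and F: "sq_int (leb Q) F" and e: "continuous_on UNIV e" "!!x. \<bar>e x\<bar> <= 1"
 shows "\<bar>(LINT x|leb Q. F x * e x) - (LINT x|leb Q. F x * (e x * b (x - h)))\<bar>
  <= de / 2 * ((LINT x|leb Q. (F x)\<^sup>2) + measure lebesgue Q)"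
proof -
 interpret finite_measure "leb Q" by (rule finite_measure_lebesgue_on[OF Q])
 have ch: "continuous_on UNIV (%x. b (x - h))" by (intro smooth_continuous smooth_shift cutoffD(1)[OF c])
 note em = continuous_borel[OF e(1), of Q] and bm = continuous_borel[OF ch, of Q]
 have F2: "integrable (leb Q) (%x. (F x)\<^sup>2)" using sq_int_integrable[OF F] by simp
 have eb: "\<bar>e x * b (x - h)\<bar> <= 1" for x
  using e(2)[of x] cutoffD(2,3)[OF c, of "x - h"] by (auto simp: abs_mult intro!: mult_le_one)
 have i1: "integrable (leb Q) (%x. F x * e x)"
  using sq_mult_int[OF F sq_int_bounded[OF finite_measure_axioms em]] e(2) by auto
 have i2: "integrable (leb Q) (%x. F x * (e x * b (x - h)))"
  using sq_mult_int[OF F sq_int_bounded[OF finite_measure_axioms borel_measurable_times[OF em bm]]] eb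
  by auto
 have i3: "integrable (leb Q) (%x. 1 - b (x - h))"
  using sq_int_integrable_finite[OF finite_measure_axioms, OF sq_int_bounded[OF finite_measure_axioms, of "%x. 1 - b (x - h)" 1]]
   cutoffD(2,3)[OF c] bm by auto
 have "(LINT x|leb Q. F x * e x) - (LINT x|leb Q. F x * (e x * b (x - h))) =
   (LINT x|leb Q. F x * e x - F x * (e x * b (x - h)))"
  using i1 i2 by simp
 also have "\<bar>...\<bar> <= (LINT x|leb Q. de / 2 * (F x)\<^sup>2 + 1 / (2 * de) * (1 - b (x - h)))"
 proof -
  have "norm (LINT x|leb Q. F x * e x - F x * (e x * b (x - h))) <=
    (LINT x|leb Q. de / 2 * (F x)\<^sup>2 + 1 / (2 * de) * (1 - b (x - h)))"
  proof (rule order_trans[OF Bochner_Integration.integral_norm_bound LINT_mono])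
   show "integrable (leb Q) (%x. norm (F x * e x - F x * (e x * b (x - h))))"
    by (intro integrable_norm intble_diff i1 i2)
   show "integrable (leb Q) (%x. de / 2 * (F x)\<^sup>2 + 1 / (2 * de) * (1 - b (x - h)))"
    by (intro intble_add integrable_mult_right F2 i3)
   fix x
   define y where "y = 1 - b (x - h)"
   have y: "0 <= y" "y <= 1" using cutoffD(2,3)[OF c, of "x - h"] by (auto simp: y_def)
   have "norm (F x * e x - F x * (e x * b (x - h))) = \<bar>F x\<bar> * \<bar>e x\<bar> * y"
   proof -
    have "F x * e x - F x * (e x * b (x - h)) = F x * e x * y" by (simp add: y_def algebra_simps)
    then show ?thesis using y(1) by (simp add: abs_mult)
   qed
   also have "... <= \<bar>F x\<bar> * 1 * y" using e(2) y by (intro mult_right_mono mult_left_mono) auto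
   also have "\<bar>F x\<bar> * 1 * y <= de / 2 * (F x)\<^sup>2 + 1 / (2 * de) * y\<^sup>2"
    using zero_le_power2[of "de * \<bar>F x\<bar> - y"] de by (simp add: power2_diff power_mult_distrib field_simps power2_eq_square)
   also have "... <= de / 2 * (F x)\<^sup>2 + 1 / (2 * de) * y"
    using y de by (intro add_left_mono mult_left_mono) (auto simp: power2_eq_square mult_left_le)
   finally show "norm (F x * e x - F x * (e x * b (x - h))) <= de / 2 * (F x)\<^sup>2 + 1 / (2 * de) * (1 - b (x - h))"
    by (simp only: y_def)
  qed
  then show ?thesis by simp
 qed
 also have "... = de / 2 * (LINT x|leb Q. (F x)\<^sup>2) + 1 / (2 * de) * (LINT x|leb Q. 1 - b (x - h))"
  by (simp only: LINT_add[OF integrable_mult_right[OF F2] integrable_mult_right[OF i3]]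
    integral_mult_right_zero)
 also have "... <= de / 2 * (LINT x|leb Q. (F x)\<^sup>2) + 1 / (2 * de) * (de\<^sup>2 * measure lebesgue Q)"
  using de by (intro add_left_mono mult_left_mono cutoffD(5)[OF c h]) auto
 also have "... = de / 2 * ((LINT x|leb Q. (F x)\<^sup>2) + measure lebesgue Q)"
  using de by (simp add: power2_eq_square field_simps)
 finally show ?thesis .
qed

section \<open>Oscillation estimates on a single cube\<close>

lemma sq_int_inner_const: "sq_int M g ==> sq_int M (%x. g x \<bullet> h)"
 by (rule sq_int_bound[where g=g and c="norm h"])
  (auto simp: sq_int_def mult.commute[of "norm h"] intro!: Cauchy_Schwarz_ineq2 AE_I2 borel_measurable_inner)

lemma integral_inner_bound:
 assumes "finite_measure M" "sq_int M g" "ps : borel_measurable M" "!!x. \<bar>ps x\<bar> <= 1"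
 shows "\<bar>LINT x|M. (g x \<bullet> h) * ps x\<bar> <= norm h * (LINT x|M. norm (g x))"
proof -
 have "norm (LINT x|M. (g x \<bullet> h) * ps x) <= (LINT x|M. norm h * norm (g x))"
 proof (rule order_trans[OF Bochner_Integration.integral_norm_bound LINT_mono])
  show "integrable M (%x. norm ((g x \<bullet> h) * ps x))"
   using sq_mult_int[OF sq_int_inner_const[OF assms(2)] sq_int_bounded[OF assms(1,3)]] assms(4)
   by (intro integrable_norm) auto
  show "integrable M (%x. norm h * norm (g x))"
   by (intro integrable_mult_right integrable_norm sq_int_integrable_finite assms)
  fix x
  have "\<bar>g x \<bullet> h\<bar> * \<bar>ps x\<bar> <= (norm (g x) * norm h) * 1"
   by (intro mult_mono Cauchy_Schwarz_ineq2 assms(4)) auto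
  then show "norm ((g x \<bullet> h) * ps x) <= norm h * norm (g x)" by (simp add: abs_mult mult.commute)
 qed
 then show ?thesis by simp
qed

text \<open>A plane wave reduced to what the estimates use: a bound by 1 and a vector
  \<open>w\<close>, half a wavelength, whose translation reverses the sign.\<close>

locale cube_wave =
 fixes Q :: "(real^'d) set" and \<rho> de :: real and b e u :: "real^'d => real" and g w
 assumes open_Q: "open Q" and Q: "Q : lmeasurable" and c: "cutoff Q \<rho> de b" and de: "0 < de"
  and wg: "has_weak_gradient Q u g" and u: "sq_int (leb Q) u" and g: "sq_int (leb Q) g"
  and e: "smooth e" "!!x. \<bar>e x\<bar> <= 1" and half_wave: "!!x. e (x - w) = - e x"
begin

definition wave :: "real^'d => real^'d => real" where
 "wave h x = e (x - h) * b (x - h)"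

lemma wave_bound: "\<bar>wave h x\<bar> <= 1"
 using e(2)[of "x - h"] cutoffD(2,3)[OF c, of "x - h"] by (auto simp: wave_def abs_mult intro!: mult_le_one)

lemma wave_smooth: "smooth (wave h)"
 unfolding wave_def by (intro smooth_mult smooth_shift e cutoffD(1)[OF c])

lemma wave_translate:
 assumes "norm h1 + norm h2 <= \<rho>"
 obtains t where "0 < t" "t < 1" "(LINT x|leb Q. u x * wave (h1 + h2) x) - (LINT x|leb Q. u x * wave h1 x) =
  (LINT x|leb Q. (g x \<bullet> h2) * wave (h1 + t *\<^sub>R h2) x)"
proof -
 obtain K where K: "compact K" "!!x. x ~: K ==> b x = 0" "!!x h. x : K ==> norm h <= \<rho> ==> x + h : Q"
  using cutoffD(4)[OF c] by blast
 have 1: "wave h1 x = 0" if "x ~: (+) h1 ` K" for x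
 proof -
  have "x - h1 ~: K" by (rule not_in_translation[OF that])
  then show ?thesis using K(2) by (simp add: wave_def)
 qed
 have 2: "x + t *\<^sub>R h2 : Q" if x: "x : (+) h1 ` K" and t: "0 <= t" "t <= 1" for x t
 proof -
  obtain y where y: "y : K" "x = h1 + y" using x by auto
  have "norm (h1 + t *\<^sub>R h2) <= norm h1 + t * norm h2"
   using norm_triangle_ineq[of h1 "t *\<^sub>R h2"] t by simp
  also have "... <= norm h1 + norm h2" using t by (simp add: mult_left_le_one_le)
  finally show ?thesis using K(3)[OF y(1), of "h1 + t *\<^sub>R h2"] assms y(2) by (simp add: algebra_simps)
 qed
 obtain t where t: "0 < t" "t < 1"
  "(LINT x|leb Q. u x * wave h1 (x - h2)) - (LINT x|leb Q. u x * wave h1 x) =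
   (LINT x|leb Q. (g x \<bullet> h2) * wave h1 (x - t *\<^sub>R h2))"
  by (rule weak_gradient_translate[OF open_Q wg wave_smooth[of h1] compact_translation[OF K(1), of h1] 1, of h2])
   (use 2 in auto)
 moreover have "wave h1 (x - v) = wave (h1 + v) x" for x v by (simp add: wave_def algebra_simps)
 ultimately show thesis using that by simp
qed

lemma wave_translate_bound:
 assumes "norm h1 + norm h2 <= \<rho>"
 shows "\<bar>(LINT x|leb Q. u x * wave (h1 + h2) x) - (LINT x|leb Q. u x * wave h1 x)\<bar>
  <= norm h2 * (LINT x|leb Q. norm (g x))"
proof -
 obtain t where eq: "(LINT x|leb Q. u x * wave (h1 + h2) x) - (LINT x|leb Q. u x * wave h1 x) =
   (LINT x|leb Q. (g x \<bullet> h2) * wave (h1 + t *\<^sub>R h2) x)"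
  using wave_translate[OF assms] by blast
 show ?thesis
  unfolding eq
  by (rule integral_inner_bound[OF finite_measure_lebesgue_on[OF Q] g
    continuous_borel[OF smooth_continuous[OF wave_smooth]] wave_bound])
qed

text \<open>\<open>\<sigma>\<close> is the effect of the shift on the wave: 1 if the wave is
  constant along it, -1 if half a wavelength is included. Apart from this factor only the cutoff has
  moved, and the cutoff costs little.\<close>

lemma wave_approx:
 assumes "sq_int (leb Q) F" "norm h <= \<rho>" "!!x. e (x - h) = \<sigma> * e x"
 shows "\<bar>\<sigma> * (LINT x|leb Q. F x * e x) - (LINT x|leb Q. F x * wave h x)\<bar>
  <= \<bar>\<sigma>\<bar> * (de * ((LINT x|leb Q. (F x)\<^sup>2) + measure lebesgue Q) / 2)"
proof -
 have "(LINT x|leb Q. F x * wave h x) = \<sigma> * (LINT x|leb Q. F x * (e x * b (x - h)))"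
  by (simp add: wave_def assms(3) mult_ac flip: integral_mult_right_zero)
 then have eq: "\<sigma> * (LINT x|leb Q. F x * e x) - (LINT x|leb Q. F x * wave h x) =
   \<sigma> * ((LINT x|leb Q. F x * e x) - (LINT x|leb Q. F x * (e x * b (x - h))))"
  by (simp add: algebra_simps)
 show ?thesis
  unfolding eq abs_mult
  using cutoff_approx[OF Q c de assms(2,1) smooth_continuous[OF e(1)] e(2)]
  by (intro mult_left_mono) auto
qed

text \<open>Against the wave and against its half-wave translate, \<open>u\<close> has nearly
  opposite integrals. These also differ by no more than the length of \<open>w\<close> times the
  integral of the gradient, so both must be small.\<close>

lemma oscillation_bound:
 assumes w: "norm w <= \<rho>"
 shows "\<bar>LINT x|leb Q. u x * e x\<bar> <=
  norm w * (LINT x|leb Q. norm (g x)) + de * ((LINT x|leb Q. (u x)\<^sup>2) + measure lebesgue Q)"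
proof -
 have \<rho>: "0 <= \<rho>" using w norm_ge_zero[of w] by linarith
 let ?J = "LINT x|leb Q. u x * e x" and ?A = "%h. LINT x|leb Q. u x * wave h x"
 define M where "M = de * ((LINT x|leb Q. (u x)\<^sup>2) + measure lebesgue Q)"
 have "\<bar>?J - ?A 0\<bar> <= M / 2" using wave_approx[OF u, of 0 1] \<rho> unfolding M_def by simp
 moreover have "\<bar>- ?J - ?A w\<bar> <= M / 2" using wave_approx[OF u w, of "-1"] unfolding M_def by (simp add: half_wave)
 moreover have "\<bar>?A w - ?A 0\<bar> <= norm w * (LINT x|leb Q. norm (g x))"
  using wave_translate_bound[of 0 w] w by simp
 moreover have "0 <= norm w * (LINT x|leb Q. norm (g x))"
  by (intro mult_nonneg_nonneg integral_nonneg_AE) auto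
 ultimately show ?thesis unfolding M_def[symmetric] by linarith
qed

text \<open>Averaging along a direction in which \<open>e\<close> is constant replaces \<open>g\<close> by a difference quotient of
  \<open>u\<close> at the scale \<open>\<tau>\<close>, whose oscillation on the much smaller scale of \<open>w\<close> is controlled by \<open>g\<close> again.\<close>
lemma invariant_direction_bound:
 assumes \<tau>: "0 < \<tau>" and inv: "!!x t. e (x - t *\<^sub>R v) = e x" and w: "norm w + \<tau> * norm v <= \<rho>"
 shows "\<bar>LINT x|leb Q. (g x \<bullet> v) * e x\<bar> <=
  norm w / \<tau> * (LINT x|leb Q. norm (g x)) + de * ((LINT x|leb Q. (g x \<bullet> v)\<^sup>2) + measure lebesgue Q)"
proof -
 let ?h = "\<tau> *\<^sub>R v" and ?J = "LINT x|leb Q. (g x \<bullet> v) * e x"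
 let ?A = "%h. LINT x|leb Q. u x * wave h x"
 let ?e = "de * ((LINT x|leb Q. (g x \<bullet> v)\<^sup>2) + measure lebesgue Q) / 2"
 have nh: "norm ?h = \<tau> * norm v" using \<tau> by simp
 have nv: "0 <= \<tau> * norm v" using \<tau> by simp
 have gv: "sq_int (leb Q) (%x. g x \<bullet> v)" by (rule sq_int_inner_const[OF g])
 have inv': "e (x - t *\<^sub>R ?h) = e x" for x t using inv[of x "t * \<tau>"] by simp
 have scale: "(LINT x|leb Q. (g x \<bullet> ?h) * W x) = \<tau> * (LINT x|leb Q. (g x \<bullet> v) * W x)" for W
  by (simp add: mult.assoc)
 have n: "norm (0 :: real^'d) + norm ?h <= \<rho>" "norm w + norm ?h <= \<rho>"
  using w norm_ge_zero[of w] unfolding nh norm_zero by linarith+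
 \<comment> \<open>The difference of \<open>u\<close> over the step \<open>?h\<close> equals the
   integral of the directional derivative against a translate of the cut-off wave, once without
   (\<open>t\<close>) and once with (\<open>t'\<close>) the half-wave shift.\<close>
 obtain t where t: "0 < t" "t < 1" "?A (0 + ?h) - ?A 0 = (LINT x|leb Q. (g x \<bullet> ?h) * wave (0 + t *\<^sub>R ?h) x)"
  by (rule wave_translate[OF n(1)])
 obtain t' where t': "0 < t'" "t' < 1" "?A (w + ?h) - ?A w = (LINT x|leb Q. (g x \<bullet> ?h) * wave (w + t' *\<^sub>R ?h) x)"
  by (rule wave_translate[OF n(2)])
 note t3 = t(3)[unfolded scale add_0] and t3' = t'(3)[unfolded scale]
 have le: "t * norm ?h <= norm ?h" "t' * norm ?h <= norm ?h"
  using t(1,2) t'(1,2) by (simp_all only: mult_left_le_one_le less_imp_le norm_ge_zero)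
 have nt: "norm (t *\<^sub>R ?h) <= \<rho>" "norm (w + t' *\<^sub>R ?h) <= \<rho>"
 proof -
  have "norm (t *\<^sub>R ?h) = t * norm ?h" "norm (t' *\<^sub>R ?h) = t' * norm ?h"
   using t(1) t'(1) by (simp_all only: norm_scaleR abs_of_pos)
  then show "norm (t *\<^sub>R ?h) <= \<rho>" "norm (w + t' *\<^sub>R ?h) <= \<rho>"
   using le w norm_triangle_ineq[of w "t' *\<^sub>R ?h"] norm_ge_zero[of w] nh by linarith+
 qed
 have ew: "e (x - (w + t' *\<^sub>R ?h)) = - e x" for x
  using half_wave[of "x - t' *\<^sub>R ?h"] inv'[of x t'] by (simp add: algebra_simps)
 have a1: "\<bar>?J - (LINT x|leb Q. (g x \<bullet> v) * wave (t *\<^sub>R ?h) x)\<bar> <= ?e"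
  using wave_approx[OF gv nt(1), of 1] inv' by simp
 have a2: "\<bar>- ?J - (LINT x|leb Q. (g x \<bullet> v) * wave (w + t' *\<^sub>R ?h) x)\<bar> <= ?e"
  using wave_approx[OF gv nt(2), of "-1"] ew by simp
 have b1: "\<bar>?A (?h + w) - ?A ?h\<bar> <= norm w * (LINT x|leb Q. norm (g x))"
  by (rule wave_translate_bound) (unfold nh, use w in linarith)
 have b2: "\<bar>?A w - ?A 0\<bar> <= norm w * (LINT x|leb Q. norm (g x))"
  using w nv wave_translate_bound[of 0 w] by simp
 have "\<tau> * (2 * \<bar>?J\<bar>) <= 2 * (norm w * (LINT x|leb Q. norm (g x))) + \<tau> * (2 * ?e)"
 proof -
  let ?X = "LINT x|leb Q. (g x \<bullet> v) * wave (t *\<^sub>R ?h) x"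
  let ?Y = "LINT x|leb Q. (g x \<bullet> v) * wave (w + t' *\<^sub>R ?h) x"
  \<comment> \<open>A mixed second difference. Taken along \<open>?h\<close> first it is
    \<open>\<tau>\<close> times \<open>?X - ?Y\<close>, close to twice \<open>?J\<close>; regrouped
    along \<open>w\<close> it is bounded by two shifts of length \<open>norm w\<close>.\<close>
  have "\<tau> * \<bar>?X - ?Y\<bar> = \<bar>(?A ?h - ?A 0) - (?A (w + ?h) - ?A w)\<bar>"
   unfolding t3 t3' using \<tau> by (simp only: right_diff_distrib[symmetric] abs_mult abs_of_pos)
  also have "... <= 2 * (norm w * (LINT x|leb Q. norm (g x)))"
   using b1 b2 unfolding add.commute[of ?h w] by linarith
  finally have "\<tau> * \<bar>?X - ?Y\<bar> <= 2 * (norm w * (LINT x|leb Q. norm (g x)))" .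
  moreover have "2 * \<bar>?J\<bar> <= \<bar>?X - ?Y\<bar> + 2 * ?e" using a1 a2 by linarith
  then have "\<tau> * (2 * \<bar>?J\<bar>) <= \<tau> * (\<bar>?X - ?Y\<bar> + 2 * ?e)" using \<tau> by (intro mult_left_mono) auto
  ultimately show ?thesis by (simp only: distrib_left)
 qed
 then have "\<bar>?J\<bar> <= (norm w * (LINT x|leb Q. norm (g x))) / \<tau> + ?e"
  using \<tau> by (simp add: field_simps)
 moreover have "0 <= ?e" using a1 by linarith
 ultimately show ?thesis by simp
qed

end

section \<open>Weak limits in \<open>L\<^sup>2\<close>\<close>

lemma sq_int_lebesgue_on_subset:
 fixes f :: "real^'d => 'b::euclidean_space"
 assumes "S : sets lebesgue" "T : sets lebesgue" "T \<subseteq> S" "sq_int (leb S) f"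
 shows "sq_int (leb T) f"
proof -
 have m: "f : borel_measurable (leb T)"
  by (rule measurable_restrict_mono[OF sq_int_measurable[OF assms(4)] assms(3)])
 have "integrable lebesgue (%x. indicator T x *\<^sub>R (indicator S x *\<^sub>R (norm (f x))\<^sup>2))"
  by (rule integrable_mult_indicator[OF assms(2) sq_int_integrable[OF assms(4), unfolded integrable_lebesgue_on_iff[OF assms(1)]]])
 moreover have "indicator T x *\<^sub>R (indicator S x *\<^sub>R (norm (f x))\<^sup>2) = indicator T x *\<^sub>R (norm (f x))\<^sup>2" for x
  using assms(3) by (auto simp: indicator_def)
 ultimately have "integrable lebesgue (%x. indicator T x *\<^sub>R (norm (f x))\<^sup>2)" by (simp only:)
 then show ?thesis using m by (auto simp only: sq_int_def integrable_lebesgue_on_iff[OF assms(2)])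
qed

lemma integral_lebesgue_on_subset:
 fixes f :: "real^'d => real"
 assumes "S : sets lebesgue" "T : sets lebesgue" "T \<subseteq> S"
 shows "(LINT x|leb T. f x) = (LINT x|leb S. indicator T x * f x)"
  and "integrable (leb T) f \<longleftrightarrow> integrable (leb S) (%x. indicator T x * f x)"
proof -
 have *: "indicator S x *\<^sub>R (indicator T x * f x) = indicator T x *\<^sub>R f x" for x
  using assms(3) by (auto simp: indicator_def)
 show "(LINT x|leb T. f x) = (LINT x|leb S. indicator T x * f x)"
  unfolding integral_lebesgue_on_eq[OF assms(1)] integral_lebesgue_on_eq[OF assms(2)] * ..
 show "integrable (leb T) f \<longleftrightarrow> integrable (leb S) (%x. indicator T x * f x)"
  unfolding integrable_lebesgue_on_iff[OF assms(1)] integrable_lebesgue_on_iff[OF assms(2)] * ..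
qed

lemma indicator_sq_int:
 assumes "S : lmeasurable" "T : sets lebesgue"
 shows "sq_int (leb S) (indicator T :: real^'d => real)"
proof (rule sq_int_bounded[OF finite_measure_lebesgue_on[OF assms(1)], where c=1])
 show "(indicator T :: real^'d => real) : borel_measurable (leb S)"
  using assms(2) by (intro measurable_restrict_space1) (rule borel_measurable_indicator)
qed (auto simp: indicator_def)

lemma norm2_indicator:
 assumes "S : lmeasurable" "T : sets lebesgue" "T \<subseteq> S"
 shows "norm2 (leb S) (indicator T :: real^'d => real) = sqrt (measure lebesgue T)"
proof -
 have "(norm (indicator T x :: real))\<^sup>2 = indicator T x * 1" for x :: "real^'d" by (simp add: indicator_def)
 then have "(LINT x|leb S. (norm (indicator T x :: real))\<^sup>2) = (LINT x|leb T. 1)"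
  using integral_lebesgue_on_subset(1)[OF fmeasurableD[OF assms(1)] assms(2,3), of "%_. 1"] by (simp only:)
 then show ?thesis unfolding norm2_def using measure_lebesgue_on_integral[OF assms(2)] by metis
qed

lemma norm2_indicator_diff:
 assumes "S : lmeasurable" "A : sets lebesgue" "B : sets lebesgue" "B \<subseteq> S" "A \<subseteq> B"
 shows "norm2 (leb S) (%x. indicator A x - indicator B x :: real) = sqrt (measure lebesgue (B - A :: (real^'d) set))"
proof -
 have "(%x. indicator A x - indicator B x :: real) = (%x. - indicator (B - A) x)"
  using assms(5) by (auto simp: fun_eq_iff indicator_def)
 then show ?thesis
  using norm2_indicator[OF assms(1), of "B - A"] assms by (auto simp: norm2_minus)
qed

text \<open>Density of step functions over open sets in \<open>L\<^sup>2\<close>, as an induction rule.\<close>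
lemma L2_induct_open [consumes 3, case_names "open" add scale closed]:
 fixes a :: "real^'d => real"
 assumes a: "sq_int (leb S) a" and S: "open S" "S : lmeasurable"
  and "open": "!!U. open U ==> U \<subseteq> S ==> P (indicator U)"
  and add: "!!a b. sq_int (leb S) a ==> sq_int (leb S) b ==> P a ==> P b ==> P (%x. a x + b x)"
  and scale: "!!a c. sq_int (leb S) a ==> P a ==> P (%x. c * a x)"
  and closed: "!!a. sq_int (leb S) a ==>
   (!!e. 0 < e ==> \<exists>b. sq_int (leb S) b & P b & norm2 (leb S) (%x. a x - b x) < e) ==> P a"
 shows "P a"
proof -
 let ?M = "leb S"
 have Sl: "S : sets lebesgue" by (rule fmeasurableD[OF S(2)])
 have ind: "P (indicator A)" if A: "A : sets lebesgue" "A \<subseteq> S" for A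
 proof (rule closed[OF indicator_sq_int[OF S(2) A(1)]])
  fix e :: real assume e: "0 < e"
  obtain T where T: "open T" "A \<subseteq> T" "T - A : lmeasurable" "emeasure lebesgue (T - A) < ennreal (e\<^sup>2)"
   using sets_lebesgue_outer_open[OF A(1), of "e\<^sup>2"] e by auto
  let ?U = "T \<inter> S"
  have U: "open ?U" "?U \<subseteq> S" "A \<subseteq> ?U" using T S A by auto
  have "measure lebesgue (?U - A) <= measure lebesgue (T - A)"
   using T(3) A(1) open_in_sets_lebesgue[OF U(1)] by (intro measure_mono_fmeasurable) auto
  also have "... < e\<^sup>2" using T(4) e by (subst (asm) emeasure_eq_measure2[OF T(3)]) (simp add: ennreal_less_iff)
  finally have "sqrt (measure lebesgue (?U - A)) < sqrt (e\<^sup>2)" by (rule real_sqrt_less_mono)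
  then have "norm2 ?M (%x. indicator A x - indicator ?U x :: real) < e"
   using norm2_indicator_diff[OF S(2) A(1) open_in_sets_lebesgue[OF U(1)] U(2,3)] e by simp
  then show "\<exists>b. sq_int ?M b & P b & norm2 ?M (%x. indicator A x - b x) < e"
   using indicator_sq_int[OF S(2) open_in_sets_lebesgue[OF U(1)]] "open"[OF U(1,2)] by blast
 qed
 have sum: "P (%x. \<Sum>y\<in>Y. y * indicator (A y) x)" if "finite Y" "!!y. y : Y ==> A y : sets lebesgue & A y \<subseteq> S"
  for Y :: "real set" and A
  using that
 proof (induction Y)
  case empty
  have "P (%x. 0 * indicator S x)" by (intro scale indicator_sq_int S ind Sl) auto
  then show ?case by simp
 next
  case (insert y Y)
  have "P (%x. y * indicator (A y) x + (\<Sum>y\<in>Y. y * indicator (A y) x))"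
   using insert
   by (intro add scale ind sq_int_mult sq_int_sum indicator_sq_int S) auto
  then show ?case by (simp only: sum.insert[OF insert(1,2)])
 qed
 have simple: "P f" if f: "simple_function ?M f" "!!x. x ~: S ==> f x = 0" for f :: "real^'d => real"
 proof -
  have fin: "finite (f ` S)" using f(1) by (auto simp: simple_function_def)
  have "f = (%x. \<Sum>y\<in>f ` S. y * indicator (f -` {y} \<inter> S) x)"
  proof
   fix x
   show "f x = (\<Sum>y\<in>f ` S. y * indicator (f -` {y} \<inter> S) x)"
   proof (cases "x : S")
    case True
    have "(\<Sum>y\<in>f ` S. y * indicator (f -` {y} \<inter> S) x) = (\<Sum>y\<in>f ` S. if y = f x then y else 0)"
     using True by (intro sum.cong) (auto simp: indicator_def)
    then show ?thesis using True fin by simp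
   qed (simp add: f(2))
  qed
  moreover have "P (%x. \<Sum>y\<in>f ` S. y * indicator (f -` {y} \<inter> S) x)"
  proof (rule sum[OF fin])
   fix y assume "y : f ` S"
   then have "f -` {y} \<inter> S : sets ?M" using f(1) by (auto simp: simple_function_def)
   then show "f -` {y} \<inter> S : sets lebesgue & f -` {y} \<inter> S \<subseteq> S"
    using Sl by (auto simp: sets_restrict_space_iff)
  qed
  ultimately show ?thesis by simp
 qed
 show ?thesis
 proof (rule closed[OF a])
  fix e :: real assume e: "0 < e"
  obtain F where "\<forall>i. simple_function ?M (F i)" "\<forall>x\<in>space ?M. (%i. F i x) ~~> a x"
   "\<forall>i. \<forall>x\<in>space ?M. dist (F i x) 0 <= 2 * dist (a x) 0"
   using borel_measurable_implies_sequence_metric[OF sq_int_measurable[OF a], of 0] by blast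
  then have F: "!!i. simple_function ?M (F i)" "!!x. x : S ==> (%i. F i x) ~~> a x"
   "!!i x. x : S ==> dist (F i x) 0 <= 2 * dist (a x) 0" by auto
  \<comment> \<open>\<open>P\<close> is not known to respect equality on \<open>S\<close>, so the
    approximants are made to vanish outside, as sums of indicators of subsets of \<open>S\<close>
    do.\<close>
  define G where "G i x = indicator S x * F i x" for i x
  have Gs: "simple_function ?M (G i)" for i
   using F(1)[of i] by (rule simple_function_cong[THEN iffD1, rotated]) (simp add: G_def)
  have Gm: "G i : borel_measurable ?M" for i by (rule borel_measurable_simple_function[OF Gs])
  have Gsq: "sq_int ?M (G i)" for i
   by (rule sq_int_bound[where c=2, OF a Gm]) (use F(3)[of _ i] in \<open>auto intro!: AE_I2 simp: G_def\<close>)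
  have PG: "P (G i)" for i by (rule simple[OF Gs]) (simp add: G_def)
  have "(%i. LINT x|?M. (norm (a x - G i x))\<^sup>2) ~~> (LINT x|?M. 0)"
  proof (rule integral_dominated_convergence[where w="%x. 9 * (norm (a x))\<^sup>2"])
   show "(%x. (norm (a x - G i x))\<^sup>2) : borel_measurable ?M" for i
    by (rule borel_measurable_integrable[OF sq_int_integrable[OF sq_int_diff[OF a Gsq]]])
   show "integrable ?M (%x. 9 * (norm (a x))\<^sup>2)" using sq_int_integrable[OF a] by simp
   show "AE x in ?M. (%i. (norm (a x - G i x))\<^sup>2) ~~> 0"
   proof (rule AE_I2)
    fix x assume "x : space ?M"
    then have "x : S" by simp
    then have "(%i. (norm (a x - G i x))\<^sup>2) ~~> (norm (a x - a x))\<^sup>2"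
     unfolding G_def by (intro tendsto_intros) (simp add: F(2))
    then show "(%i. (norm (a x - G i x))\<^sup>2) ~~> 0" by simp
   qed
   show "AE x in ?M. norm ((norm (a x - G i x))\<^sup>2) <= 9 * (norm (a x))\<^sup>2" for i
   proof (rule AE_I2)
    fix x assume "x : space ?M"
    then have "norm (a x - G i x) <= 3 * norm (a x)" using F(3)[of x i] by (simp add: G_def)
    then have "(norm (a x - G i x))\<^sup>2 <= (3 * norm (a x))\<^sup>2" by (intro power_mono) auto
    then show "norm ((norm (a x - G i x))\<^sup>2) <= 9 * (norm (a x))\<^sup>2" by (simp add: power_mult_distrib)
   qed
  qed simp
  then have "(%i. norm2 ?M (%x. a x - G i x)) ~~> sqrt 0"
   unfolding norm2_def by (intro tendsto_real_sqrt) simp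
  then obtain i where "norm2 ?M (%x. a x - G i x) < e"
   using order_tendstoD(2)[of _ 0 sequentially e] e by (auto simp: eventually_sequentially)
  then show "\<exists>b. sq_int ?M b & P b & norm2 ?M (%x. a x - b x) < e" using Gsq PG by blast
 qed
qed

lemma L2_tendsto_closed:
 assumes w: "!!k. sq_int M (w k)" "!!k. norm2 M (w k) <= B" and a: "sq_int M a"
  and ex: "!!e. 0 < e ==> \<exists>b. sq_int M b & (%k. LINT x|M. w k x * b x) ~~> 0 & norm2 M (%x. a x - b x) < e"
 shows "(%k. LINT x|M. w k x * a x) ~~> (0 :: real)"
proof (rule LIMSEQ_I)
 fix e :: real assume e: "0 < e"
 have B: "0 <= B" using w(2)[of 0] norm2_nonneg[of M "w 0"] by linarith
 obtain b where b: "sq_int M b" "(%k. LINT x|M. w k x * b x) ~~> 0" "norm2 M (%x. a x - b x) < e / (2 * (B + 1))"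
  using ex[of "e / (2 * (B + 1))"] e B by (auto simp: add_nonneg_pos)
 obtain k0 where k0: "!!k. k >= k0 ==> \<bar>LINT x|M. w k x * b x\<bar> < e / 2"
  using LIMSEQ_D[OF b(2), of "e / 2"] e by auto
 have "\<bar>LINT x|M. w k x * a x\<bar> < e" if "k >= k0" for k
 proof -
  have "(LINT x|M. w k x * a x) - (LINT x|M. w k x * b x) = (LINT x|M. w k x * (a x - b x))"
   using sq_mult_int[OF w(1)[of k] a] sq_mult_int[OF w(1)[of k] b(1)]
   by (simp add: right_diff_distrib)
  moreover have "\<bar>LINT x|M. w k x * (a x - b x)\<bar> <= norm2 M (w k) * norm2 M (%x. a x - b x)"
   by (rule Cauchy_Schwarz_integral_real[OF w(1) sq_int_diff[OF a b(1)]])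
  moreover have "norm2 M (w k) * norm2 M (%x. a x - b x) <= B * (e / (2 * (B + 1)))"
   using w(2)[of k] b(3) B by (intro mult_mono) auto
  moreover have "B * (e / (2 * (B + 1))) <= e / 2"
   using B e by (simp add: field_simps)
  ultimately show ?thesis using k0[OF that] by linarith
 qed
 then show "\<exists>no. \<forall>k\<ge>no. norm ((LINT x|M. w k x * a x) - 0) < e" by auto
qed

text \<open>Weak convergence of a bounded sequence is reduced to integrals over open sets, where the
  contributions of single cubes can be added up.\<close>

lemma L2_tendsto_0_from_open:
 fixes w :: "nat => real^'d => real"
 assumes S: "open S" "S : lmeasurable"
  and w: "!!k. sq_int (leb S) (w k)" "!!k. norm2 (leb S) (w k) <= B"
  and U: "!!U. open U ==> U \<subseteq> S ==> (%k. LINT x|leb S. w k x * indicator U x) ~~> 0"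
  and a: "sq_int (leb S) a"
 shows "(%k. LINT x|leb S. w k x * a x) ~~> 0"
 using a S
proof (induction rule: L2_induct_open)
 case (add a b)
 then have "(%k. (LINT x|leb S. w k x * a x) + (LINT x|leb S. w k x * b x)) ~~> 0 + 0"
  by (intro tendsto_add)
 then show ?case
  using sq_mult_int[OF w(1) add(1)] sq_mult_int[OF w(1) add(2)]
  by (simp add: distrib_left)
next
 case (scale a c)
 then show ?case using tendsto_mult_right_zero[OF scale(2), of c] by (simp add: mult.left_commute)
next
 case (closed a)
 show ?case by (rule L2_tendsto_closed[OF w closed(1)]) (use closed(2) in blast)
qed (rule U)

text \<open>The layers decrease to the empty set, since points of an open set have positive distance
  to the complement. The complement has to be nonempty because \<open>infdist\<close> to the empty
  set is 0.\<close>

lemma measure_boundary_layer: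
 fixes U :: "(real^'d) set"
 assumes U: "open U" "U : lmeasurable" "- U ~= {}" and e: "0 < e"
 obtains d where "0 < d" "measure lebesgue {x : U. infdist x (- U) <= d} < e"
  "{x : U. infdist x (- U) <= d} : sets lebesgue"
proof -
 define A where "A j = {x : U. infdist x (- U) <= 1 / real (Suc j)}" for j
 have "closed {x. infdist x (- U) <= c}" for c by (intro closed_Collect_le continuous_intros)
 then have "U \<inter> {x. infdist x (- U) <= c} : sets lebesgue" for c
  using open_in_sets_lebesgue[OF U(1)] by (intro sets.Int) auto
 moreover have eq: "A j = U \<inter> {x. infdist x (- U) <= 1 / real (Suc j)}" for j by (auto simp: A_def)
 ultimately have A: "A j : sets lebesgue" for j by simp
 have Am: "A j : lmeasurable" for j
  by (rule fmeasurableI2[OF U(2) _ A]) (auto simp: A_def)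
 have dec: "decseq A"
 proof (rule decseq_SucI)
  fix j
  have "1 / real (Suc (Suc j)) <= 1 / real (Suc j)" by (simp add: frac_le)
  then show "A (Suc j) \<subseteq> A j" unfolding A_def by (auto simp del: of_nat_Suc)
 qed
 have "(\<Inter>j. A j) = {}"
 proof (rule ccontr)
  assume "(\<Inter>j. A j) ~= {}"
  then obtain x where x: "!!j. x : A j" by blast
  then have "x : U" by (auto simp: A_def)
  then have "infdist x (- U) > 0"
   using U(1,3) in_closed_iff_infdist_zero[of "- U" x] infdist_nonneg[of x "- U"] by (auto simp: less_le)
  then obtain j where "1 / real (Suc j) < infdist x (- U)" using nat_approx_posE by blast
  moreover have "infdist x (- U) <= 1 / real (Suc j)" using x[of j] by (simp add: A_def)
  ultimately show False by simp
 qed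
 moreover have "(%j. measure lebesgue (A j)) ~~> measure lebesgue (\<Inter>j. A j)"
  by (rule Lim_measure_decseq[OF _ dec]) (use A fmeasurableD2[OF Am] in auto)
 ultimately have "(%j. measure lebesgue (A j)) ~~> 0" by simp
 then obtain j where "measure lebesgue (A j) < e"
  using order_tendstoD(2)[of _ 0 sequentially e] e by (auto simp: eventually_sequentially)
 then show thesis using that[of "1 / real (Suc j)"] A[of j] by (simp add: A_def)
qed

section \<open>Oscillating functions on the covering\<close>

lemma matrix_vector_norm_le:
 fixes A :: "real^'n^'m"
 shows "norm (A *v x) <= real CARD('m) * real CARD('n) * norm A * norm x"
proof -
 have "\<bar>A $ i $ j\<bar> <= norm A" for i j
  using norm_nth[of "A $ i" j] norm_nth[of A i] by simp
 then have "onorm ((*v) A) <= real CARD('m) * real CARD('n) * norm A"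
  by (rule onorm_le_matrix_component)
 moreover have "norm (A *v x) <= onorm ((*v) A) * norm x"
  by (rule onorm[OF matrix_vector_mul_bounded_linear])
 ultimately show ?thesis by (meson mult_right_mono norm_ge_zero order_trans)
qed

lemma real_le_one_plus_square: "(t :: real) <= 1 + t\<^sup>2"
 using zero_le_power2[of "2 * t - 1"] by (simp add: power2_diff algebra_simps power2_eq_square)

text \<open>A locale, because the setting is instantiated twice: for the given scales and again for
  the subsequence of scales along which the gradients converge.\<close>

locale lp_setting =
 fixes Om :: "(real^'d) set" and D :: "real^'d => real^'d^'d" and r :: real
  and ep :: "nat => real" and N :: "nat => nat" and Q :: "nat => nat => (real^'d) set"
  and p q :: "nat => nat => real^'d"
 assumes open_Om: "open Om" and bounded_Om: "bounded Om"
  and invertible_D: "!!x. invertible (D x)"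
  and Lipschitz_D: "\<exists>C. C-lipschitz_on UNIV D"
  and Lipschitz_D_inv: "\<exists>C. C-lipschitz_on UNIV (%x. matrix_inv (D x))"
  and r: "0 < r" "r < 1"
  and ep_pos: "!!k. 0 < ep k" and ep_lim: "ep ~~> 0"
  and covering: "!!k. cube_covering Om (ep k powr r) (N k) (Q k)"
  and p_in: "!!k n. n : {1..N k} ==> p k n : Q k n \<inter> Om"
begin

abbreviation mu :: "(real^'d) measure" where "mu \<equiv> leb Om"

abbreviation L :: "nat => (real^'d => real^'d => real) => real^'d => real" where
 "L k \<equiv> lp_approx D (ep k) (N k) (Q k) (p k) (q k)"

definition cell_coord :: "nat => nat => real^'d => real^'d" where
 "cell_coord k n x = (1 / ep k) *\<^sub>R (matrix_inv (D (p k n)) *v (x - q k n))"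

definition osc :: "nat => real^'d => real => real^'d => real" where
 "osc k m th = L k (%x y. cos (2 * pi * (m \<bullet> y) + th))"

lemma Om_lmeasurable: "Om : lmeasurable"
 by (rule lmeasurable_open[OF bounded_Om open_Om])

lemma Om_sets: "Om : sets lebesgue"
 by (rule fmeasurableD[OF Om_lmeasurable])

lemma finite_measure_mu: "finite_measure mu"
 by (rule finite_measure_lebesgue_on[OF Om_lmeasurable])

lemma continuous_D: "continuous_on UNIV D" "continuous_on UNIV (%x. matrix_inv (D x))"
 using Lipschitz_D Lipschitz_D_inv by (auto intro: lipschitz_on_continuous_on)

lemma D_bounded:
 obtains B where "0 < B" "!!x v. x : Om ==> norm (D x *v v) <= B * norm v"
  "!!x v. x : Om ==> norm (matrix_inv (D x) *v v) <= B * norm v"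
  "!!x i j. x : Om ==> \<bar>D x $ i $ j\<bar> <= B" "!!x i j. x : Om ==> \<bar>matrix_inv (D x) $ i $ j\<bar> <= B"
proof -
 have cpt: "compact (closure Om)" using bounded_Om by simp
 have "bounded (D ` closure Om)" "bounded ((%x. matrix_inv (D x)) ` closure Om)"
  by (intro compact_imp_bounded compact_continuous_image cpt continuous_on_subset[OF continuous_D(1)]
    continuous_on_subset[OF continuous_D(2)] subset_UNIV)+
 then obtain B1 B2 where B: "0 < B1" "0 < B2" "!!x. x : closure Om ==> norm (D x) <= B1"
  "!!x. x : closure Om ==> norm (matrix_inv (D x)) <= B2"
  by (force simp: bounded_pos)
 define c where "c = real CARD('d) * real CARD('d)"
 have "1 <= CARD('d)" by (simp add: Suc_leI)
 then have c: "1 <= c" unfolding c_def by (metis mult_le_mono nat_mult_1 of_nat_1 of_nat_le_iff of_nat_mult)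
 let ?B = "c * (B1 + B2)"
 have le: "A1 <= ?B" if "A1 <= B1 + B2" "0 <= A1" for A1
  using c that mult_mono[of 1 c A1 "B1 + B2"] by simp
 have mv: "norm (A *v v) <= ?B * norm v" if "norm A <= B1 + B2" for A :: "real^'d^'d" and v
 proof -
  have "norm (A *v v) <= c * norm A * norm v" unfolding c_def by (rule matrix_vector_norm_le)
  also have "... <= c * (B1 + B2) * norm v"
   using that c by (intro mult_right_mono mult_left_mono) auto
  finally show ?thesis .
 qed
 have ent: "\<bar>A $ i $ j\<bar> <= norm A" for A :: "real^'d^'d" and i j
  using norm_nth[of "A $ i" j] norm_nth[of A i] by simp
 have n: "norm (D x) <= B1 + B2" "norm (matrix_inv (D x)) <= B1 + B2" if "x : Om" for x
  using B(1,2) B(3)[of x] B(4)[of x] that closure_subset[of Om] by force+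
 show thesis
 proof (rule that[of ?B])
  show "0 < ?B" using B(1,2) c by simp
  show "norm (D x *v v) <= ?B * norm v" "norm (matrix_inv (D x) *v v) <= ?B * norm v" if "x : Om" for x v
   by (rule mv[OF n(1)[OF that]], rule mv[OF n(2)[OF that]])
  show "\<bar>D x $ i $ j\<bar> <= ?B" if "x : Om" for x i j
   by (rule order_trans[OF ent le[OF n(1)[OF that] norm_ge_zero]])
  show "\<bar>matrix_inv (D x) $ i $ j\<bar> <= ?B" if "x : Om" for x i j
   by (rule order_trans[OF ent le[OF n(2)[OF that] norm_ge_zero]])
 qed
qed

lemma D_difference:
 obtains C where "0 < C" "!!x y v. norm (D x *v v - D y *v v) <= C * dist x y * norm v"
proof -
 obtain C where C: "C-lipschitz_on UNIV D" using Lipschitz_D by blast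
 let ?c = "real CARD('d) * real CARD('d)"
 have "norm (D x *v v - D y *v v) <= (?c * C + 1) * dist x y * norm v" for x y v
 proof -
  have "norm (D x *v v - D y *v v) = norm ((D x - D y) *v v)"
   by (simp add: matrix_vector_mult_diff_rdistrib)
  also have "... <= ?c * norm (D x - D y) * norm v" by (rule matrix_vector_norm_le)
  also have "... <= ?c * (C * dist x y) * norm v"
   using lipschitz_onD[OF C, of x y] by (intro mult_right_mono mult_left_mono) (auto simp: dist_norm)
  also have "... <= (?c * C + 1) * dist x y * norm v" by (simp add: algebra_simps)
  finally show ?thesis .
 qed
 moreover have "0 < ?c * C + 1" using lipschitz_on_nonneg[OF C] by (simp add: add_nonneg_pos)
 ultimately show thesis using that by blast
qed

lemma side_pos: "0 < ep k powr r"
 using ep_pos[of k] by simp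

lemma side_lim: "(%k. ep k powr r) ~~> 0"
 using tendsto_powr2[OF ep_lim tendsto_const[of r]] ep_pos r by (auto simp: less_imp_le)

lemma cubes:
 assumes "n : {1..N k}"
 shows "open_cube (ep k powr r) (Q k n)" "open (Q k n)" "Q k n : lmeasurable"
  "!!x y. x : closure (Q k n) ==> y : closure (Q k n) ==> dist x y <= ep k powr r * real CARD('d)"
  "negligible (frontier (Q k n))"
proof -
 show *: "open_cube (ep k powr r) (Q k n)" using covering[of k] assms by (auto simp: cube_covering_def)
 note f = open_cube_facts[OF * side_pos]
 show "open (Q k n)" "Q k n : lmeasurable" by (rule f)+
 show "dist x y <= ep k powr r * real CARD('d)" if "x : closure (Q k n)" "y : closure (Q k n)" for x y
  by (rule f(5)[OF that])
 show "negligible (frontier (Q k n))" by (rule negligible_convex_frontier[OF f(2)])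
qed

lemma cubes_disjoint: "n : {1..N k} ==> n' : {1..N k} ==> x : Q k n ==> x : Q k n' ==> n = n'"
 using covering[of k] unfolding cube_covering_def disjoint_family_on_def by blast

lemma indicator_cube:
 assumes "n : {1..N k}" "x : Q k n" "n' : {1..N k}"
 shows "indicator (Q k n') x = (if n' = n then 1 else 0 :: real)"
proof (cases "n' = n")
 case False
 then have "x ~: Q k n'" using cubes_disjoint[OF assms(1,3,2)] by blast
 with False show ?thesis by simp
qed (use assms(2) in simp)

lemma L_on_cube:
 assumes "n : {1..N k}" "x : Q k n"
 shows "L k f x = f x (cell_coord k n x)"
proof -
 have "L k f x = (\<Sum>n'=1..N k. if n' = n then f x (cell_coord k n x) else 0)"
  unfolding lp_approx_def cell_coord_def
  by (intro sum.cong refl) (simp add: indicator_cube[OF assms])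
 then show ?thesis using assms(1) by simp
qed

lemma L_off_cubes: "(!!n. n : {1..N k} ==> x ~: Q k n) ==> L k f x = 0"
 unfolding lp_approx_def by (intro sum.neutral) auto

text \<open>At a fixed point \<open>L k\<close> is either evaluation at one point of the cell or
  zero, with the same alternative for all \<open>f\<close>. Identities and bounds for
  \<open>L\<close> thereby become pointwise.\<close>

lemma L_cases:
 obtains (cube) n where "n : {1..N k}" "x : Q k n" "!!f. L k f x = f x (cell_coord k n x)"
 | (off) "!!f. L k f x = 0"
proof (cases "\<exists>n\<in>{1..N k}. x : Q k n")
 case True
 then obtain n where n: "n : {1..N k}" "x : Q k n" by blast
 show thesis by (rule cube[OF n L_on_cube[OF n]])
next
 case False
 then have "x ~: Q k n" if "n : {1..N k}" for n using that by blast
 from L_off_cubes[OF this] show thesis by (rule off)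
qed

text \<open>Only the closures cover the domain, but the frontier of a cube is null because a cube is
  convex.\<close>

lemma AE_in_cube: "AE x in mu. \<exists>n\<in>{1..N k}. x : Q k n"
proof -
 have "(\<Union>n\<in>{1..N k}. frontier (Q k n)) : null_sets lebesgue"
  using cubes(5) by (intro null_sets_UN') (auto simp: negligible_iff_null_sets)
 from AE_not_in[OF this] show ?thesis
  unfolding AE_lebesgue_on[OF Om_sets]
 proof eventually_elim
  fix x assume x: "x ~: (\<Union>n\<in>{1..N k}. frontier (Q k n))"
  show "x : Om --> (\<exists>n\<in>{1..N k}. x : Q k n)"
  proof
   assume "x : Om"
   then obtain n where n: "n : {1..N k}" "x : closure (Q k n)"
    using covering[of k] by (auto simp: cube_covering_def)
   then have "x : Q k n" using x cubes(2)[OF n(1)] by (auto simp: frontier_def interior_open)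
   then show "\<exists>n\<in>{1..N k}. x : Q k n" using n(1) by blast
  qed
 qed
qed

lemma osc_bound: "\<bar>osc k m th x\<bar> <= 1"
 by (cases rule: L_cases[of k x]) (auto simp: osc_def)

lemma cell_coord_continuous: "continuous_on UNIV (cell_coord k n)"
 unfolding cell_coord_def matrix_vector_mult_diff_distrib
 by (intro continuous_intros linear_continuous_on matrix_vector_mul_bounded_linear)

lemma L_continuous_measurable:
 assumes "continuous_on UNIV ps"
 shows "L k (%x. ps) : borel_measurable mu"
proof -
 have "(%x. ps (cell_coord k n x) * indicator (Q k n) x) : borel_measurable mu" if "n : {1..N k}" for n
 proof (intro borel_measurable_times)
  show "(%x. ps (cell_coord k n x)) : borel_measurable mu"
   by (intro continuous_borel continuous_on_compose2[OF assms cell_coord_continuous]) auto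
  show "(indicator (Q k n) :: _ => real) : borel_measurable mu"
   using fmeasurableD[OF cubes(3)[OF that]] by (intro measurable_restrict_space1) (rule borel_measurable_indicator)
 qed
 then have "(%x. \<Sum>n=1..N k. ps (cell_coord k n x) * indicator (Q k n) x) : borel_measurable mu"
  by (intro borel_measurable_sum)
 then show ?thesis by (simp add: lp_approx_def[abs_def] cell_coord_def)
qed

lemma osc_measurable: "osc k m th : borel_measurable mu"
 unfolding osc_def by (intro L_continuous_measurable continuous_intros)

lemma osc_times_sq_int:
 assumes "sq_int mu F"
 shows "sq_int mu (%x. F x * osc k m th x)" "norm2 mu (%x. F x * osc k m th x) <= norm2 mu F"
proof -
 have *: "norm (F x * osc k m th x) <= 1 * norm (F x)" for x
  using osc_bound[of k m th x] by (simp add: abs_mult mult_left_le)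
 have meas: "(%x. F x * osc k m th x) : borel_measurable mu"
  by (intro borel_measurable_times osc_measurable sq_int_measurable assms)
 show "sq_int mu (%x. F x * osc k m th x)" by (rule sq_int_bound[where c=1, OF assms meas AE_I2]) (use * in simp)
 show "norm2 mu (%x. F x * osc k m th x) <= norm2 mu F"
  by (rule norm2_mono[OF assms meas AE_I2]) (use * in simp)
qed

lemma sum_cubes_le:
 assumes G: "G \<subseteq> {1..N k}" "!!n. n : G ==> Q k n \<subseteq> Om" and h: "integrable mu h" "!!x. (0 :: real) <= h x"
 shows "(\<Sum>n\<in>G. LINT x|leb (Q k n). h x) <= (LINT x|mu. h x)"
proof -
 have fin: "finite G" using G(1) finite_subset by blast
 have Qs: "Q k n : sets lebesgue" if "n : G" for n using cubes(3) G(1) that by blast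
 have int: "integrable mu (%x. indicator (Q k n) x * h x)" if "n : G" for n
  using integrable_mult_indicator[OF _ h(1), of "Q k n"] G(2)[OF that] Qs[OF that] Om_sets
  by (auto simp: sets_restrict_space_iff)
 have "(\<Sum>n\<in>G. LINT x|leb (Q k n). h x) = (\<Sum>n\<in>G. LINT x|mu. indicator (Q k n) x * h x)"
  by (intro sum.cong refl integral_lebesgue_on_subset(1) Om_sets Qs G(2))
 also have "... = (LINT x|mu. (\<Sum>n\<in>G. indicator (Q k n) x * h x))"
  using int by (simp add: LINT_sum)
 also have "... <= (LINT x|mu. h x)"
 proof (rule LINT_mono[OF _ h(1)])
  show "integrable mu (%x. \<Sum>n\<in>G. indicator (Q k n) x * h x)" using int by (intro intble_sum)
  fix x
  show "(\<Sum>n\<in>G. indicator (Q k n) x * h x) <= h x"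
  proof (cases "\<exists>n\<in>G. x : Q k n")
   case True
   then obtain n where n: "n : G" "x : Q k n" by blast
   have "(\<Sum>n'\<in>G. indicator (Q k n') x * h x) = (\<Sum>n'\<in>G. if n' = n then h x else 0)"
    using G(1) n by (intro sum.cong refl) (simp add: indicator_cube[of n k x] subset_iff)
   also have "... = h x" using n fin by simp
   finally show ?thesis by (simp only: order_refl)
  next
   case False
   then have "(\<Sum>n\<in>G. indicator (Q k n) x * h x) = 0" by (intro sum.neutral) auto
   then show ?thesis using h(2) by simp
  qed
 qed
 finally show ?thesis .
qed

text \<open>Cubes that meet an open set without being contained in it lie in a thin layer along its boundary.\<close>
lemma open_set_from_cubes:
 fixes F W H :: "nat => real^'d => real"
 assumes F: "!!k. sq_int mu (F k)" "!!k. norm2 mu (F k) <= B"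
  and W: "!!k. W k : borel_measurable mu" "!!k x. \<bar>W k x\<bar> <= 1"
  and H: "!!k. integrable mu (H k)" "!!k x. 0 <= H k x" "!!k. (LINT x|mu. H k x) <= C"
  and cube: "!!de. 0 < de ==> \<forall>\<^sub>F k in sequentially. \<forall>n\<in>{1..N k}. Q k n \<subseteq> Om -->
   \<bar>LINT x|leb (Q k n). F k x * W k x\<bar> <= de * (LINT x|leb (Q k n). H k x + 1)"
  and U: "open U" "U \<subseteq> Om"
 shows "(%k. LINT x|mu. (F k x * W k x) * indicator U x) ~~> 0"
proof (rule LIMSEQ_I)
 interpret finite_measure mu by (rule finite_measure_mu)
 fix e :: real assume e: "0 < e"
 have B: "0 <= B" using F(2)[of 0] norm2_nonneg[of mu "F 0"] by linarith
 define V where "V = C + measure mu (space mu)"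
 have H1: "integrable mu (%x. H k x + 1)" "(LINT x|mu. H k x + 1) <= V" for k
  using H(1)[of k] H(3)[of k] by (simp_all add: V_def)
 have V: "0 <= V" using H1(2)[of 0] integral_nonneg_AE[of "%x. H 0 x + 1" mu] H(2)[of 0]
  by (smt (verit) AE_I2)
 \<comment> \<open>\<open>V\<close> bounds the integral of \<open>H k + 1\<close> over the domain,
   so the cubes inside \<open>U\<close> contribute at most \<open>e / 2\<close> in total. The
   boundary layer is then taken so thin that Cauchy-Schwarz leaves less than \<open>e / 2\<close>
   for the remainder \<open>R\<close>.\<close>
 define de where "de = e / (2 * (V + 1))"
 have de: "0 < de" "de * V <= e / 2" using e V by (simp_all add: de_def field_simps add_nonneg_pos)
 have bU: "bounded U" using U(2) bounded_Om bounded_subset by blast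
 have Ul: "U : lmeasurable" by (rule lmeasurable_open[OF bU U(1)])
 have "- U ~= {}" using bU not_bounded_UNIV[where 'a="real^'d"] by (metis Compl_empty_eq double_compl)
 then obtain d where d: "0 < d" "measure lebesgue {x : U. infdist x (- U) <= d} < (e / (2 * (B + 1)))\<^sup>2"
  "{x : U. infdist x (- U) <= d} : sets lebesgue"
  using measure_boundary_layer[OF U(1) Ul, of "(e / (2 * (B + 1)))\<^sup>2"] e B by (auto simp: add_nonneg_pos)
 have "(%k. ep k powr r * real CARD('d)) ~~> 0" using tendsto_mult_left_zero[OF side_lim] by simp
 then have "\<forall>\<^sub>F k in sequentially. ep k powr r * real CARD('d) < d" using d(1) by (rule order_tendstoD(2))
 then have "\<forall>\<^sub>F k in sequentially. \<bar>LINT x|mu. (F k x * W k x) * indicator U x\<bar> < e"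
  using cube[OF de(1)]
 proof eventually_elim
  case (elim k)
  define G where "G = {n : {1..N k}. Q k n \<subseteq> U}"
  define R where "R = U - (\<Union>n\<in>G. Q k n)"
  have G: "finite G" "!!n. n : G ==> n : {1..N k} & Q k n \<subseteq> U" by (auto simp: G_def)
  have Qs: "Q k n : sets lebesgue" if "n : {1..N k}" for n by (rule fmeasurableD[OF cubes(3)[OF that]])
  have Rs: "R : sets lebesgue"
   unfolding R_def using fmeasurableD[OF Ul] G Qs by (intro sets.Diff sets.finite_UN) auto
  have ROm: "R \<subseteq> Om" using U(2) by (auto simp: R_def)
  let ?Z = "\<Union>n\<in>{1..N k}. frontier (Q k n)"
  have Z: "?Z : null_sets lebesgue"
   using cubes(5) by (intro null_sets_UN') (auto simp: negligible_iff_null_sets)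
  have "R - ?Z \<subseteq> {x : U. infdist x (- U) <= d}"
  proof
   fix x assume x: "x : R - ?Z"
   then have xU: "x : U" by (auto simp: R_def)
   then obtain n where n: "n : {1..N k}" "x : closure (Q k n)"
    using covering[of k] U(2) by (auto simp: cube_covering_def)
   then have xQ: "x : Q k n" using x cubes(2)[OF n(1)] by (auto simp: frontier_def interior_open)
   then have "n ~: G" using x by (auto simp: R_def)
   then obtain z where z: "z : Q k n" "z ~: U" using n(1) by (auto simp: G_def)
   have "infdist x (- U) <= dist x z" using z(2) by (intro infdist_le) auto
   also have "... <= ep k powr r * real CARD('d)"
    using cubes(4)[OF n(1) n(2)] z(1) closure_subset by blast
   finally show "x : {x : U. infdist x (- U) <= d}" using xU elim(1) by simp
  qed
  then have "measure lebesgue (R - ?Z) <= measure lebesgue {x : U. infdist x (- U) <= d}"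
   using Rs Z d(3) Ul by (intro measure_mono_fmeasurable) (auto intro: fmeasurableI2)
  then have mR: "measure lebesgue R < (e / (2 * (B + 1)))\<^sup>2"
   using d(2) measure_Diff_null_set[OF Rs Z] by simp
  have FW: "sq_int mu (W k)" by (rule sq_int_bounded[OF finite_measure_axioms W(1) W(2)[unfolded real_norm_def[symmetric]]])
  have FWi: "integrable mu (%x. F k x * W k x)" by (rule sq_mult_int[OF F(1) FW])
  have ii: "integrable mu (%x. indicator A x * (F k x * W k x))" if "A : sets lebesgue" "A \<subseteq> Om" for A
   using integrable_mult_indicator[OF _ FWi, of A] that Om_sets by (auto simp: sets_restrict_space_iff)
  have split: "(F k x * W k x) * indicator U x =
    (\<Sum>n\<in>G. indicator (Q k n) x * (F k x * W k x)) + indicator R x * (F k x * W k x)" for x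
  proof (cases "\<exists>n\<in>G. x : Q k n")
   case True
   then obtain n where n: "n : G" "x : Q k n" by blast
   then have "(\<Sum>n'\<in>G. indicator (Q k n') x * (F k x * W k x)) = (\<Sum>n'\<in>G. if n' = n then F k x * W k x else 0)"
    using G(2) by (intro sum.cong refl) (simp add: indicator_cube[of n k x])
   moreover have "x : U" "x ~: R" using n G(2) by (auto simp: R_def)
   ultimately show ?thesis using n G(1) by simp
  next
   case False
   then have "(\<Sum>n\<in>G. indicator (Q k n) x * (F k x * W k x)) = 0" by (intro sum.neutral) auto
   moreover have "x : U \<longleftrightarrow> x : R" using False by (auto simp: R_def)
   ultimately show ?thesis by (auto simp: indicator_def)
  qed
  have Gi: "integrable mu (%x. indicator (Q k n) x * (F k x * W k x))" if "n : G" for n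
   using G(2)[OF that] U(2) by (intro ii Qs) auto
  have "(LINT x|mu. (F k x * W k x) * indicator U x) =
    (\<Sum>n\<in>G. LINT x|mu. indicator (Q k n) x * (F k x * W k x)) + (LINT x|mu. indicator R x * (F k x * W k x))"
   unfolding split using Gi ii[OF Rs ROm] by (simp add: LINT_sum)
  also have "(\<Sum>n\<in>G. LINT x|mu. indicator (Q k n) x * (F k x * W k x)) = (\<Sum>n\<in>G. LINT x|leb (Q k n). F k x * W k x)"
   using G(2) U(2) by (intro sum.cong refl integral_lebesgue_on_subset(1)[symmetric] Om_sets Qs) auto
  finally have eq: "(LINT x|mu. (F k x * W k x) * indicator U x) =
    (\<Sum>n\<in>G. LINT x|leb (Q k n). F k x * W k x) + (LINT x|mu. indicator R x * (F k x * W k x))" .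
  have "\<bar>\<Sum>n\<in>G. LINT x|leb (Q k n). F k x * W k x\<bar> <= (\<Sum>n\<in>G. de * (LINT x|leb (Q k n). H k x + 1))"
  proof (rule order_trans[OF sum_abs sum_mono])
   fix n assume "n : G"
   then have "n : {1..N k}" "Q k n \<subseteq> Om" using G(2) U(2) by blast+
   then show "\<bar>LINT x|leb (Q k n). F k x * W k x\<bar> <= de * (LINT x|leb (Q k n). H k x + 1)"
    using elim(2) by blast
  qed
  also have "... = de * (\<Sum>n\<in>G. LINT x|leb (Q k n). H k x + 1)" by (simp add: sum_distrib_left)
  also have "... <= de * (LINT x|mu. H k x + 1)"
   using de(1) G(2) U(2) H1(1)[of k] H(2)[of k] by (intro mult_left_mono sum_cubes_le) (auto simp: add_nonneg_nonneg)
  also have "... <= de * V" using de(1) H1(2) by (intro mult_left_mono) auto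
  finally have 1: "\<bar>\<Sum>n\<in>G. LINT x|leb (Q k n). F k x * W k x\<bar> <= e / 2" using de(2) by linarith
  have "\<bar>LINT x|mu. indicator R x * (F k x * W k x)\<bar> = \<bar>LINT x|mu. F k x * (indicator R x * W k x)\<bar>"
   by (simp add: mult_ac)
  also have "... <= norm2 mu (F k) * norm2 mu (%x. indicator R x * W k x)"
  proof (rule Cauchy_Schwarz_integral_real[OF F(1)])
   show "sq_int mu (%x. indicator R x * W k x)"
    using sq_int_bounded_times[OF FW sq_int_measurable[OF indicator_sq_int[OF Om_lmeasurable Rs]], of 1]
    by (auto simp: indicator_def)
  qed
  also have "norm2 mu (%x. indicator R x * W k x) <= norm2 mu (indicator R :: _ => real)"
  proof (rule norm2_mono[OF indicator_sq_int[OF Om_lmeasurable Rs]])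
   show "(%x. indicator R x * W k x) : borel_measurable mu"
    by (intro borel_measurable_times W(1) sq_int_measurable[OF indicator_sq_int[OF Om_lmeasurable Rs]])
  qed (use W(2) in \<open>auto simp: indicator_def\<close>)
  also have "norm2 mu (indicator R :: _ => real) <= e / (2 * (B + 1))"
   using mR real_sqrt_less_mono[OF mR] e B by (simp add: norm2_indicator[OF Om_lmeasurable Rs ROm])
  finally have "\<bar>LINT x|mu. indicator R x * (F k x * W k x)\<bar> <= norm2 mu (F k) * (e / (2 * (B + 1)))"
   by (simp add: mult_left_mono)
  also have "... <= B * (e / (2 * (B + 1)))" using F(2)[of k] e B by (intro mult_right_mono) auto
  also have "... < e / 2" using e B by (simp add: field_simps)
  finally show ?case using eq 1 by linarith
 qed
 then show "\<exists>no. \<forall>k\<ge>no. norm ((LINT x|mu. (F k x * W k x) * indicator U x) - 0) < e"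
  by (simp add: eventually_sequentially)
qed

end

section \<open>Plane waves on the cubes of the covering\<close>

lemma half_sum_le:
 fixes de X Y q :: real
 assumes "0 <= de" "0 <= X" "0 <= Y"
 shows "de / 2 * (X + q) + de / 2 * (Y + q) <= de * (X + (Y + q))"
 using mult_nonneg_nonneg[OF assms(1,2)] mult_nonneg_nonneg[OF assms(1,3)] by (simp add: field_simps)

context lp_setting
begin

text \<open>The wave seen on one cube, continued to the whole space so that it can be translated and
  differentiated.\<close>

definition cube_wv :: "nat => nat => real^'d => real => real^'d => real" where
 "cube_wv k n m th x = cos (2 * pi * (m \<bullet> cell_coord k n x) + th)"

text \<open>In cell coordinates this vector is m / (2 |m|^2), whose inner product with m is 1/2: the
  phase moves by pi.\<close>

definition half_wave :: "nat => nat => real^'d => real^'d" where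
 "half_wave k n m = (ep k / (2 * (m \<bullet> m))) *\<^sub>R (D (p k n) *v m)"

lemma osc_on_cube: "n : {1..N k} ==> x : Q k n ==> osc k m th x = cube_wv k n m th x"
 by (simp add: osc_def cube_wv_def L_on_cube)

lemma cell_coord_diff: "cell_coord k n (x - v) = cell_coord k n x - (1 / ep k) *\<^sub>R (matrix_inv (D (p k n)) *v v)"
 by (simp add: cell_coord_def matrix_vector_mult_diff_distrib scaleR_diff_right)

lemma cube_wv_smooth: "smooth (cube_wv k n m th)"
proof -
 let ?B = "matrix_inv (D (p k n))"
 have eq: "cube_wv k n m th = (%x. cos (((2 * pi / ep k) *\<^sub>R (m v* ?B)) \<bullet> x + (th - 2 * pi / ep k * (m \<bullet> (?B *v q k n)))))"
  by (rule ext) (simp add: cube_wv_def cell_coord_def dot_lmul_matrix matrix_vector_mult_diff_distrib inner_diff_right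
    right_diff_distrib algebra_simps)
 show ?thesis unfolding smooth_def eq by (intro allI C_k_cos)
qed

lemma cube_wv_half_wave:
 assumes "m ~= 0"
 shows "cube_wv k n m th (x - half_wave k n m) = - cube_wv k n m th x"
proof -
 have "m \<bullet> m ~= 0" using assms by simp
 then have "m \<bullet> ((1 / ep k) *\<^sub>R (matrix_inv (D (p k n)) *v half_wave k n m)) = 1 / 2"
  using ep_pos[of k] by (simp add: half_wave_def matrix_vector_mult_scaleR matrix_inv_cancel[OF invertible_D] field_simps)
 then have "2 * pi * (m \<bullet> cell_coord k n (x - half_wave k n m)) + th = (2 * pi * (m \<bullet> cell_coord k n x) + th) - pi"
  by (simp add: cell_coord_diff inner_diff_right algebra_simps)
 then show ?thesis unfolding cube_wv_def by (simp only: cos_diff cos_pi sin_pi)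
qed

lemma cube_wv_invariant:
 assumes "m \<bullet> et = 0"
 shows "cube_wv k n m th (x - t *\<^sub>R (D (p k n) *v et)) = cube_wv k n m th x"
 using assms by (simp add: cube_wv_def cell_coord_diff inner_diff_right matrix_vector_mult_scaleR matrix_inv_cancel[OF invertible_D])

lemma integral_osc_on_cube:
 assumes "n : {1..N k}"
 shows "(LINT x|leb (Q k n). F x * osc k m th x) = (LINT x|leb (Q k n). F x * cube_wv k n m th x)"
 using osc_on_cube[OF assms] by (intro LINT_cong) auto

lemma half_wave_le:
 obtains c where "0 < c" "!!k n. n : {1..N k} ==> norm (half_wave k n m) <= c * ep k"
proof -
 obtain B where B: "0 < B" "!!x v. x : Om ==> norm (D x *v v) <= B * norm v" using D_bounded by metis
 define c where "c = B * norm m / (2 * (m \<bullet> m)) + 1"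
 have "norm (half_wave k n m) <= c * ep k" if n: "n : {1..N k}" for k n
 proof -
  have "norm (half_wave k n m) = ep k / (2 * (m \<bullet> m)) * norm (D (p k n) *v m)"
   using ep_pos[of k] by (simp add: half_wave_def)
  also have "... <= ep k / (2 * (m \<bullet> m)) * (B * norm m)"
   using p_in[OF n] ep_pos[of k] by (intro mult_left_mono B(2)) auto
  also have "... <= c * ep k" using ep_pos[of k] by (simp add: c_def algebra_simps)
  finally show ?thesis .
 qed
 moreover have "0 < c" using B(1) by (simp add: c_def add_nonneg_pos)
 ultimately show thesis using that by blast
qed

lemma powr_scales:
 assumes "0 < a"
 shows "(%k. ep k powr a) ~~> 0"
 using tendsto_powr2[OF ep_lim tendsto_const[of a]] ep_pos assms by (auto simp: less_imp_le)

lemma cube_wave_on_cube: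
 assumes n: "n : {1..N k}" "Q k n \<subseteq> Om" and c: "cutoff (Q k n) \<rho> de b" and de: "0 < de" and m: "m ~= 0"
  and u: "has_weak_gradient Om u g" "sq_int mu u" "sq_int mu g"
 shows "cube_wave (Q k n) \<rho> de b (cube_wv k n m th) u g (half_wave k n m)"
proof
 note Qs = fmeasurableD[OF cubes(3)[OF n(1)]]
 show "open (Q k n)" "Q k n : lmeasurable" by (rule cubes[OF n(1)])+
 show "cutoff (Q k n) \<rho> de b" "0 < de" by fact+
 show "has_weak_gradient (Q k n) u g" by (rule has_weak_gradient_subset[OF cubes(2)[OF n(1)] n(2) Om_sets u(1)])
 show "sq_int (leb (Q k n)) u" "sq_int (leb (Q k n)) g"
  by (rule sq_int_lebesgue_on_subset[OF Om_sets Qs n(2) u(2)] sq_int_lebesgue_on_subset[OF Om_sets Qs n(2) u(3)])+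
 show "smooth (cube_wv k n m th)" by (rule cube_wv_smooth)
 show "\<bar>cube_wv k n m th x\<bar> <= 1" for x by (simp add: cube_wv_def)
 show "cube_wv k n m th (x - half_wave k n m) = - cube_wv k n m th x" for x by (rule cube_wv_half_wave[OF m])
qed

lemma cube_norm_le:
 assumes n: "n : {1..N k}" "Q k n \<subseteq> Om" and g: "sq_int mu g"
 shows "(LINT x|leb (Q k n). norm (g x)) <= (LINT x|leb (Q k n). (norm (g x))\<^sup>2 + 1)"
  and "0 <= (LINT x|leb (Q k n). norm (g x))"
  and "integrable (leb (Q k n)) (%x. norm (g x))"
  and "integrable (leb (Q k n)) (%x. (norm (g x))\<^sup>2 + 1)"
  and "(LINT x|leb (Q k n). (norm (g x))\<^sup>2 + 1) =
   (LINT x|leb (Q k n). (norm (g x))\<^sup>2) + measure lebesgue (Q k n)"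
proof -
 interpret finite_measure "leb (Q k n)" by (rule finite_measure_lebesgue_on[OF cubes(3)[OF n(1)]])
 note Qs = fmeasurableD[OF cubes(3)[OF n(1)]]
 note gQ = sq_int_lebesgue_on_subset[OF Om_sets Qs n(2) g]
 show i: "integrable (leb (Q k n)) (%x. norm (g x))"
  by (rule integrable_norm[OF sq_int_integrable_finite[OF finite_measure_axioms gQ]])
 show j: "integrable (leb (Q k n)) (%x. (norm (g x))\<^sup>2 + 1)" using sq_int_integrable[OF gQ] by simp
 show "(LINT x|leb (Q k n). norm (g x)) <= (LINT x|leb (Q k n). (norm (g x))\<^sup>2 + 1)"
  by (rule LINT_mono[OF i j]) (simp add: real_le_one_plus_square add.commute)
 show "0 <= (LINT x|leb (Q k n). norm (g x))" by (intro integral_nonneg_AE) auto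
 show "(LINT x|leb (Q k n). (norm (g x))\<^sup>2 + 1) =
   (LINT x|leb (Q k n). (norm (g x))\<^sup>2) + measure lebesgue (Q k n)"
  using LINT_add[OF sq_int_integrable[OF gQ] integrable_const[of "1 :: real"]]
   measure_lebesgue_on_integral[OF Qs] by simp
qed

text \<open>Sum \<open>oscillation_bound\<close> over the cubes inside an open set. Half a
  wavelength is O(eps), whereas the cutoffs leave room of order eps^r, and r < 1.\<close>

theorem osc_weak_limit:
 assumes m: "m ~= 0" and u: "!!k. has_weak_gradient Om (u k) (g k)" "!!k. sq_int mu (u k)" "!!k. sq_int mu (g k)"
  and bd: "!!k. norm2 mu (u k) <= B" "!!k. norm2 mu (g k) <= B" and a: "sq_int mu a"
 shows "(%k. LINT x|mu. (u k x * osc k m th x) * a x) ~~> 0"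
proof (rule L2_tendsto_0_from_open[OF open_Om Om_lmeasurable _ _ _ a])
 show "sq_int mu (%x. u k x * osc k m th x)" for k by (rule osc_times_sq_int(1)[OF u(2)])
 show "norm2 mu (%x. u k x * osc k m th x) <= B" for k using osc_times_sq_int(2)[OF u(2)] bd(1) order_trans by blast
 fix U assume U: "open U" "U \<subseteq> Om"
 show "(%k. LINT x|mu. (u k x * osc k m th x) * indicator U x) ~~> 0"
 proof (rule open_set_from_cubes[OF u(2) bd(1) osc_measurable osc_bound _ _ _ _ U,
    where H="%k x. (norm (g k x))\<^sup>2 + (u k x)\<^sup>2" and C="B\<^sup>2 + B\<^sup>2"])
  fix k
  have i: "integrable mu (%x. (norm (g k x))\<^sup>2)" "integrable mu (%x. (u k x)\<^sup>2)"
   using sq_int_integrable[OF u(3)] sq_int_integrable[OF u(2)] by simp_all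
  then show "integrable mu (%x. (norm (g k x))\<^sup>2 + (u k x)\<^sup>2)" by simp
  have "(norm2 mu (g k))\<^sup>2 <= B\<^sup>2" "(norm2 mu (u k))\<^sup>2 <= B\<^sup>2" using bd by (simp_all add: power_mono)
  then show "(LINT x|mu. (norm (g k x))\<^sup>2 + (u k x)\<^sup>2) <= B\<^sup>2 + B\<^sup>2"
   using i by (simp add: norm2_power2)
 next
  fix de :: real assume de: "0 < de"
  obtain ka where ka: "0 < ka" "!!s (Q :: (real^'d) set). 0 < s ==> open_cube s Q ==> \<exists>b. cutoff Q (ka * s) (de / 2) b"
   using open_cube_cutoff[of "de / 2"] de by auto
  obtain c where hw: "0 < c" "!!k n. n : {1..N k} ==> norm (half_wave k n m) <= c * ep k"
   using half_wave_le[of m] by blast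
  \<comment> \<open>The first limit makes the cost of the half-wave shift small; the second makes
    the shift fit into the margin \<open>ka\<close> times the side.\<close>
  have l: "(%k. c * ep k) ~~> 0" "(%k. c * ep k powr (1 - r)) ~~> 0"
   using tendsto_mult_right_zero[OF ep_lim] tendsto_mult_right_zero[OF powr_scales[of "1 - r"]] r by auto
  have "0 < de / 2" using de by simp
  note order_tendstoD(2)[OF l(1) this] order_tendstoD(2)[OF l(2) ka(1)]
  then show "\<forall>\<^sub>F k in sequentially. \<forall>n\<in>{1..N k}. Q k n \<subseteq> Om -->
    \<bar>LINT x|leb (Q k n). u k x * osc k m th x\<bar> <=
    de * (LINT x|leb (Q k n). ((norm (g k x))\<^sup>2 + (u k x)\<^sup>2) + 1)"
  proof eventually_elim
   case (elim k)
   show ?case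
   proof (intro ballI impI)
    fix n assume n: "n : {1..N k}" "Q k n \<subseteq> Om"
    obtain b where b: "cutoff (Q k n) (ka * ep k powr r) (de / 2) b" using ka(2)[OF side_pos cubes(1)[OF n(1)]] by blast
    have d2: "0 < de / 2" using de by simp
    note ng = cube_norm_le[OF n u(3)] and nu = cube_norm_le[OF n u(2)]
    interpret cube_wave "Q k n" "ka * ep k powr r" "de / 2" b "cube_wv k n m th" "u k" "g k" "half_wave k n m"
     by (rule cube_wave_on_cube[OF n b d2 m u])
    have "c * ep k = (c * ep k powr (1 - r)) * ep k powr r"
     using ep_pos[of k] by (simp add: powr_add[symmetric])
    also have "... <= ka * ep k powr r" using elim(2) by (intro mult_right_mono) auto
    finally have w: "norm (half_wave k n m) <= ka * ep k powr r" using hw(2)[OF n(1)] by linarith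
    let ?X = "LINT x|leb (Q k n). (norm (g k x))\<^sup>2" and ?Y = "LINT x|leb (Q k n). (u k x)\<^sup>2"
    let ?q = "measure lebesgue (Q k n)"
    have 1: "norm (half_wave k n m) * (LINT x|leb (Q k n). norm (g k x)) <= de / 2 * (?X + ?q)"
     using hw(2)[OF n(1)] elim(1) ng(1,2) de unfolding ng(5) by (intro mult_mono) auto
    have i: "integrable (leb (Q k n)) (%x. (norm (g k x))\<^sup>2)" "integrable (leb (Q k n)) (%x. (u k x)\<^sup>2 + 1)"
     using sq_int_integrable[OF g] nu(4) by simp_all
    have 2: "(LINT x|leb (Q k n). ((norm (g k x))\<^sup>2 + (u k x)\<^sup>2) + 1) = ?X + (?Y + ?q)"
     using LINT_add[OF i] nu(5) by (simp add: add.assoc)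
    have 3: "de / 2 * (?X + ?q) + de / 2 * (?Y + ?q) <= de * (?X + (?Y + ?q))"
     by (rule half_sum_le) (use d2 in \<open>auto intro: integral_nonneg_AE\<close>)
    define P where "P = de / 2 * (?X + ?q)"
    define R where "R = de / 2 * (?Y + ?q)"
    have "\<bar>LINT x|leb (Q k n). u k x * cube_wv k n m th x\<bar> <= P + R"
     using add_mono[OF 1 order_refl[of R]] oscillation_bound[OF w] unfolding P_def R_def by (rule order_trans[rotated])
    also have "... <= de * (?X + (?Y + ?q))" using 3 unfolding P_def R_def .
    finally show "\<bar>LINT x|leb (Q k n). u k x * osc k m th x\<bar> <=
      de * (LINT x|leb (Q k n). ((norm (g k x))\<^sup>2 + (u k x)\<^sup>2) + 1)"
     unfolding integral_osc_on_cube[OF n(1)] 2 .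
   qed
  qed
 qed auto
qed

text \<open>The step at scale \<open>\<tau>\<close> must satisfy \<open>\<epsilon> \<lless> \<tau> \<lless> \<epsilon>\<^sup>r\<close>; the geometric mean of the two scales is used.\<close>
theorem osc_weak_limit_direction:
 assumes m: "m ~= 0" and et: "m \<bullet> et = 0"
  and u: "!!k. has_weak_gradient Om (u k) (g k)" "!!k. sq_int mu (u k)" "!!k. sq_int mu (g k)"
  and bd: "!!k. norm2 mu (g k) <= B" and a: "sq_int mu a"
 shows "(%k. LINT x|mu. ((g k x \<bullet> (D x *v et)) * osc k m th x) * a x) ~~> 0"
proof -
 obtain M where M: "0 < M" "!!x v. x : Om ==> norm (D x *v v) <= M * norm v" using D_bounded by metis
 obtain C where C: "0 < C" "!!x y v. norm (D x *v v - D y *v v) <= C * dist x y * norm v" using D_difference by metis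
 define F where "F k x = g k x \<bullet> (D x *v et)" for k x
 have meas: "(%x. D x *v et) : borel_measurable mu"
  using continuous_D(1) unfolding matrix_vector_mult_def
  by (intro continuous_borel continuous_intros)
 have Fb: "\<bar>F k x\<bar> <= (M * norm et) * norm (g k x)" if "x : Om" for k x
 proof -
  have "\<bar>F k x\<bar> <= norm (g k x) * norm (D x *v et)" unfolding F_def by (rule Cauchy_Schwarz_ineq2)
  also have "... <= norm (g k x) * (M * norm et)" by (intro mult_left_mono M(2) that) simp
  finally show ?thesis by (simp add: mult.commute)
 qed
 have Fm: "F k : borel_measurable mu" for k
  unfolding F_def by (intro borel_measurable_inner meas sq_int_measurable u(3))
 have F: "sq_int mu (F k)" for k
  by (rule sq_int_bound[where c="M * norm et", OF u(3)[of k] Fm]) (use Fb in \<open>auto intro!: AE_I2\<close>)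
 define B' where "B' = (M * norm et) * B"
 have FB: "norm2 mu (F k) <= B'" for k
 proof -
  have "norm2 mu (F k) <= norm2 mu (%x. (M * norm et) *\<^sub>R g k x)"
   using Fb M(1) by (intro norm2_mono sq_int_scaleR u(3) Fm AE_I2) simp
  also have "... = (M * norm et) * norm2 mu (g k)" using M(1) by (simp add: norm2_scaleR abs_mult)
  also have "... <= B'" unfolding B'_def using M(1) by (intro mult_left_mono bd) auto
  finally show ?thesis .
 qed
 define K where "K = 1 + (M * norm et)\<^sup>2"
 have K: "1 <= K" by (simp add: K_def)
 have "(%k. LINT x|mu. (F k x * osc k m th x) * a x) ~~> 0"
 proof (rule L2_tendsto_0_from_open[OF open_Om Om_lmeasurable _ _ _ a])
  show "sq_int mu (%x. F k x * osc k m th x)" for k by (rule osc_times_sq_int(1)[OF F])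
  show "norm2 mu (%x. F k x * osc k m th x) <= B'" for k using osc_times_sq_int(2)[OF F] FB order_trans by blast
  fix U assume U: "open U" "U \<subseteq> Om"
  show "(%k. LINT x|mu. (F k x * osc k m th x) * indicator U x) ~~> 0"
  proof (rule open_set_from_cubes[OF F FB osc_measurable osc_bound _ _ _ _ U,
     where H="%k x. K * (norm (g k x))\<^sup>2" and C="K * B\<^sup>2"])
   fix k
   have i: "integrable mu (%x. (norm (g k x))\<^sup>2)" by (rule sq_int_integrable[OF u(3)])
   then show "integrable mu (%x. K * (norm (g k x))\<^sup>2)" by simp
   have "(norm2 mu (g k))\<^sup>2 <= B\<^sup>2" using bd by (simp add: power_mono)
   then show "(LINT x|mu. K * (norm (g k x))\<^sup>2) <= K * B\<^sup>2" using K by (simp add: norm2_power2)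
   show "0 <= K * (norm (g k x))\<^sup>2" for x using K by simp
  next
   \<comment> \<open>Thirds, for three errors: freezing D on the cube, the half-wave shift, and the
     cutoff.\<close>
   fix de :: real assume de: "0 < de"
   obtain ka where ka: "0 < ka" "!!s (Q :: (real^'d) set). 0 < s ==> open_cube s Q ==> \<exists>b. cutoff Q (ka * s) (de / 3) b"
    using open_cube_cutoff[of "de / 3"] de by auto
   obtain c where hw: "0 < c" "!!k n. n : {1..N k} ==> norm (half_wave k n m) <= c * ep k"
    using half_wave_le[of m] by blast
   define \<rho> where "\<rho> = (1 - r) / 2"
   define \<tau> where "\<tau> k = ep k powr (r + \<rho>)" for k
   have \<rho>: "0 < \<rho>" "1 - (r + \<rho>) = \<rho>" "(1 - r) = 2 * \<rho>" using r by (simp_all add: \<rho>_def field_simps)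
   \<comment> \<open>In this order: the half-wave is short compared with the step
     \<open>\<tau>\<close>; both shifts together fit into the cutoff margin; D varies little over
     one cube.\<close>
   have l: "(%k. c * ep k powr \<rho>) ~~> 0" "(%k. c * ep k powr (2 * \<rho>) + (M * norm et) * ep k powr \<rho>) ~~> 0"
    "(%k. (C * real CARD('d) * norm et) * ep k powr r) ~~> 0"
    using tendsto_mult_right_zero[OF powr_scales[OF \<rho>(1)]] tendsto_mult_right_zero[OF side_lim]
     tendsto_add_zero[OF tendsto_mult_right_zero[OF powr_scales[of "2 * \<rho>"], of c]
      tendsto_mult_right_zero[OF powr_scales[OF \<rho>(1)], of "M * norm et"]] \<rho>(1) by auto
   have "0 < de / 3" using de by simp
   note order_tendstoD(2)[OF l(1) this] order_tendstoD(2)[OF l(2) ka(1)] order_tendstoD(2)[OF l(3) this]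
   then show "\<forall>\<^sub>F k in sequentially. \<forall>n\<in>{1..N k}. Q k n \<subseteq> Om -->
     \<bar>LINT x|leb (Q k n). F k x * osc k m th x\<bar> <=
     de * (LINT x|leb (Q k n). K * (norm (g k x))\<^sup>2 + 1)"
   proof eventually_elim
    case (elim k)
    show ?case
    proof (intro ballI impI)
     fix n assume n: "n : {1..N k}" "Q k n \<subseteq> Om"
     obtain b where b: "cutoff (Q k n) (ka * ep k powr r) (de / 3) b" using ka(2)[OF side_pos cubes(1)[OF n(1)]] by blast
     have d3: "0 < de / 3" using de by simp
     note ng = cube_norm_le[OF n u(3)]
     interpret cube_wave "Q k n" "ka * ep k powr r" "de / 3" b "cube_wv k n m th" "u k" "g k" "half_wave k n m"
      by (rule cube_wave_on_cube[OF n b d3 m u])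
     interpret fm: finite_measure "leb (Q k n)" by (rule finite_measure_lebesgue_on[OF Q])
     let ?v = "D (p k n) *v et"
     have pn: "p k n : Om" "p k n : Q k n" using p_in[OF n(1)] by auto
     have nv: "norm ?v <= M * norm et" by (rule M(2)[OF pn(1)])
     have \<tau>0: "0 < \<tau> k" using ep_pos[of k] by (simp add: \<tau>_def)
     have ep\<tau>: "ep k = ep k powr \<rho> * \<tau> k" "\<tau> k = ep k powr \<rho> * ep k powr r" "ep k = ep k powr (2 * \<rho>) * ep k powr r"
      using ep_pos[of k] \<rho>(2,3) by (simp_all add: \<tau>_def powr_add[symmetric]) (simp_all add: algebra_simps)
     have "norm (half_wave k n m) + \<tau> k * norm ?v <= c * ep k + \<tau> k * (M * norm et)"
      using \<tau>0 nv hw(2)[OF n(1)] by (intro add_mono mult_left_mono) auto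
     also have "... = (c * ep k powr (2 * \<rho>) + (M * norm et) * ep k powr \<rho>) * ep k powr r"
      by (subst (1) ep\<tau>(3), subst ep\<tau>(2)) (simp add: algebra_simps)
     also have "... <= ka * ep k powr r" using elim(2) by (intro mult_right_mono) auto
     finally have w: "norm (half_wave k n m) + \<tau> k * norm ?v <= ka * ep k powr r" .
     have "norm (half_wave k n m) <= (c * ep k powr \<rho>) * \<tau> k" using hw(2)[OF n(1)] ep\<tau>(1) by (simp add: mult.assoc)
     also have "... <= de / 3 * \<tau> k" using elim(1) \<tau>0 by (intro mult_right_mono) auto
     finally have wt: "norm (half_wave k n m) / \<tau> k <= de / 3" using \<tau>0 by (simp add: divide_le_eq)
     let ?X = "LINT x|leb (Q k n). (norm (g k x))\<^sup>2" and ?G = "LINT x|leb (Q k n). norm (g k x)"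
     let ?q = "measure lebesgue (Q k n)" and ?e = "cube_wv k n m th"
     have X0: "0 <= ?X" "0 <= ?q" by (auto intro: integral_nonneg_AE)
     have gQ2: "integrable (leb (Q k n)) (%x. (norm (g k x))\<^sup>2)" by (rule sq_int_integrable[OF g])
     have gv: "sq_int (leb (Q k n)) (%x. g k x \<bullet> ?v)" by (rule sq_int_inner_const[OF g])
     have "(LINT x|leb (Q k n). (g k x \<bullet> ?v)\<^sup>2) <= (LINT x|leb (Q k n). (M * norm et)\<^sup>2 * (norm (g k x))\<^sup>2)"
     proof (rule LINT_mono)
      show "integrable (leb (Q k n)) (%x. (g k x \<bullet> ?v)\<^sup>2)" using sq_int_integrable[OF gv] by simp
      show "integrable (leb (Q k n)) (%x. (M * norm et)\<^sup>2 * (norm (g k x))\<^sup>2)" using gQ2 by simp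
      fix x
      have "\<bar>g k x \<bullet> ?v\<bar> <= norm (g k x) * norm ?v" by (rule Cauchy_Schwarz_ineq2)
      also have "... <= norm (g k x) * (M * norm et)" by (intro mult_left_mono nv) simp
      finally have "\<bar>g k x \<bullet> ?v\<bar>\<^sup>2 <= (norm (g k x) * (M * norm et))\<^sup>2" by (intro power_mono) auto
      then show "(g k x \<bullet> ?v)\<^sup>2 <= (M * norm et)\<^sup>2 * (norm (g k x))\<^sup>2" by (simp add: power_mult_distrib mult.commute)
     qed
     then have Yle: "(LINT x|leb (Q k n). (g k x \<bullet> ?v)\<^sup>2) <= (K - 1) * ?X" by (simp add: K_def)
     have FQ: "integrable (leb (Q k n)) (%x. F k x * ?e x)" "integrable (leb (Q k n)) (%x. (g k x \<bullet> ?v) * ?e x)"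
     proof -
      have es: "sq_int (leb (Q k n)) ?e"
       using e(2) by (intro sq_int_bounded[OF fm.finite_measure_axioms continuous_borel[OF smooth_continuous[OF e(1)]], where c=1]) auto
      show "integrable (leb (Q k n)) (%x. F k x * ?e x)"
       by (rule sq_mult_int[OF sq_int_lebesgue_on_subset[OF Om_sets fmeasurableD[OF Q] n(2) F] es])
      show "integrable (leb (Q k n)) (%x. (g k x \<bullet> ?v) * ?e x)"
       by (rule sq_mult_int[OF gv es])
     qed
     have diff: "\<bar>(LINT x|leb (Q k n). F k x * ?e x) - (LINT x|leb (Q k n). (g k x \<bullet> ?v) * ?e x)\<bar> <= de / 3 * ?G"
     proof -
      have "norm (LINT x|leb (Q k n). F k x * ?e x - (g k x \<bullet> ?v) * ?e x) <= (LINT x|leb (Q k n). de / 3 * norm (g k x))"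
      proof (rule order_trans[OF Bochner_Integration.integral_norm_bound LINT_mono])
       show "integrable (leb (Q k n)) (%x. norm (F k x * ?e x - (g k x \<bullet> ?v) * ?e x))"
        by (intro integrable_norm intble_diff FQ)
       show "integrable (leb (Q k n)) (%x. de / 3 * norm (g k x))" using ng(3) by simp
       fix x assume "x : space (leb (Q k n))"
       then have x: "x : Q k n" by simp
       have "dist x (p k n) <= ep k powr r * real CARD('d)"
        using cubes(4)[OF n(1)] x pn(2) closure_subset by blast
       then have "C * dist x (p k n) * norm et <= C * (ep k powr r * real CARD('d)) * norm et"
        using C(1) by (intro mult_right_mono mult_left_mono) auto
       then have dv: "norm (D x *v et - ?v) <= de / 3"
        using C(2)[of x et "p k n"] elim(3) by (simp add: mult_ac)
       have "F k x * ?e x - (g k x \<bullet> ?v) * ?e x = (g k x \<bullet> (D x *v et - ?v)) * ?e x"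
        by (simp add: F_def inner_diff_right left_diff_distrib)
       then have "norm (F k x * ?e x - (g k x \<bullet> ?v) * ?e x) = \<bar>g k x \<bullet> (D x *v et - ?v)\<bar> * \<bar>?e x\<bar>"
        by (simp add: abs_mult)
       also have "... <= (norm (g k x) * (de / 3)) * 1"
        using dv e(2) d3 by (intro mult_mono order_trans[OF Cauchy_Schwarz_ineq2] mult_left_mono) auto
       finally show "norm (F k x * ?e x - (g k x \<bullet> ?v) * ?e x) <= de / 3 * norm (g k x)" by (simp add: mult.commute)
      qed
      then show ?thesis using FQ by simp
     qed
     have 1: "de / 3 * ?G <= de / 3 * (?X + ?q)" using ng(1) de unfolding ng(5) by (intro mult_left_mono) auto
     have 2: "norm (half_wave k n m) / \<tau> k * ?G <= de / 3 * ?G" by (rule mult_right_mono[OF wt ng(2)])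
     have 3: "de / 3 * ((LINT x|leb (Q k n). (g k x \<bullet> ?v)\<^sup>2) + ?q) <= de / 3 * ((K - 1) * ?X + ?q)"
      using Yle de by (intro mult_left_mono) auto
     define Z where "Z = de / 3 * (K * ?X + ?q)"
     have "?X <= K * ?X" "(K - 1) * ?X <= K * ?X"
      using mult_right_mono[OF K X0(1)] mult_right_mono[of "K - 1" K ?X] X0(1) by simp_all
     then have Z: "de / 3 * (?X + ?q) <= Z" "de / 3 * ((K - 1) * ?X + ?q) <= Z"
      unfolding Z_def using d3 by (intro mult_left_mono; simp)+
     let ?J = "LINT x|leb (Q k n). (g k x \<bullet> ?v) * ?e x" and ?I = "LINT x|leb (Q k n). F k x * ?e x"
     have "\<bar>?J\<bar> <= Z + Z"
      by (rule order_trans[OF invariant_direction_bound[OF \<tau>0 cube_wv_invariant[OF et] w]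
         add_mono[OF order_trans[OF 2 order_trans[OF 1 Z(1)]] order_trans[OF 3 Z(2)]]])
     moreover have "\<bar>?I - ?J\<bar> <= Z" by (rule order_trans[OF diff order_trans[OF 1 Z(1)]])
     ultimately have "\<bar>?I\<bar> <= 3 * Z" by linarith
     moreover have "3 * Z = de * (LINT x|leb (Q k n). K * (norm (g k x))\<^sup>2 + 1)"
      using LINT_add[OF integrable_mult_right[OF gQ2, of K] fm.integrable_const[of "1 :: real"]]
       measure_lebesgue_on_integral[OF fmeasurableD[OF Q]] by (simp add: Z_def)
     ultimately show "\<bar>LINT x|leb (Q k n). F k x * osc k m th x\<bar> <=
       de * (LINT x|leb (Q k n). K * (norm (g k x))\<^sup>2 + 1)"
      unfolding integral_osc_on_cube[OF n(1)] by (simp only:)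
    qed
   qed
  qed
 qed
 then show ?thesis by (simp add: F_def)
qed

end

section \<open>Trigonometric polynomials\<close>

lemma borel_measurable_lebesgue_on_AE:
 fixes f g :: "real^'d => 'b::euclidean_space"
 assumes S: "S : sets lebesgue" and f: "f : borel_measurable (leb S)"
  and ae: "AE x in leb S. f x = g x"
 shows "g : borel_measurable (leb S)"
proof -
 have "AE x in lebesgue. (if x : S then f x else 0) = (if x : S then g x else 0)"
  using ae unfolding AE_lebesgue_on[OF S] by eventually_elim auto
 from borel_measurable_AE[OF borel_measurable_if_I[OF f S] this] show ?thesis
  by (rule borel_measurable_if_D)
qed

lemma borel_measurable_lebesgue_on_AE_limit:
 fixes f :: "nat => real^'d => 'b::euclidean_space"
 assumes S: "S : sets lebesgue" and f: "!!i. f i : borel_measurable (leb S)"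
  and lim: "AE x in leb S. (%i. f i x) ~~> g x"
 shows "g : borel_measurable (leb S)"
proof (rule borel_measurable_lebesgue_on_AE[OF S])
 show "(%x. lim (%i. f i x)) : borel_measurable (leb S)"
  using f by (rule borel_measurable_lim_metric)
 show "AE x in leb S. lim (%i. f i x) = g x"
  using lim by eventually_elim (rule limI)
qed

text \<open>The phase lets real cosines replace complex exponentials: phases 0 and -pi/2 give cosine
  and sine.\<close>

definition tcos :: "real^'d => real => real^'d => real" where
 "tcos m th y = cos (2 * pi * (m \<bullet> y) + th)"

lemma tcos_bound: "\<bar>tcos m th y\<bar> <= 1"
 by (simp add: tcos_def)

lemma tcos_smooth: "smooth (tcos m th)"
proof -
 have eq: "tcos m th = (%y. cos (((2 * pi) *\<^sub>R m) \<bullet> y + th))" by (simp add: tcos_def fun_eq_iff)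
 show ?thesis unfolding eq smooth_def by (intro allI C_k_cos)
qed

lemma tcos_continuous: "continuous_on S (tcos m th)"
 using smooth_continuous[OF tcos_smooth] continuous_on_subset by blast

lemma integer_vector_inner: "integer_vector m ==> integer_vector z ==> m \<bullet> z : \<int>"
 unfolding inner_vec_def by (intro Ints_sum) (simp add: integer_vector_def)

lemma cos_add_integer_period: "n : \<int> ==> cos (t + 2 * pi * n) = cos t"
 by (auto elim!: Ints_cases simp: cos_add cos_int_2pin sin_int_2pin)

lemma tcos_periodic:
 fixes m :: "real^'d"
 assumes m: "integer_vector m"
 shows "periodic (tcos m th)"
 unfolding periodic_def
proof (intro allI impI)
 fix z y :: "real^'d" assume "integer_vector z"
 from cos_add_integer_period[OF integer_vector_inner[OF m this], of "2 * pi * (m \<bullet> y) + th"]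
 show "tcos m th (y + z) = tcos m th y" by (simp add: tcos_def inner_add_right algebra_simps)
qed

lemma tcos_mult: "tcos m th y * tcos l ph y = (tcos (m + l) (th + ph) y + tcos (m - l) (th - ph) y) / 2"
proof -
 have "cos a * cos b = (cos (a + b) + cos (a - b)) / 2" for a b :: real by (simp add: cos_add cos_diff)
 from this[of "2 * pi * (m \<bullet> y) + th" "2 * pi * (l \<bullet> y) + ph"] show ?thesis
  by (simp add: tcos_def inner_add_left inner_diff_left algebra_simps)
qed

text \<open>With the phase lowered by pi/2 the derivative is a cosine with the original phase and no
  sign, which fixes the form of the potentials used later.\<close>

lemma partial_deriv_tcos: "partial_deriv i (tcos m (th - pi / 2)) y = 2 * pi * (m $ i) * tcos m th y"
proof -
 have "(tcos m (th - pi / 2) has_derivative (%h. - (2 * pi * (m \<bullet> h)) * sin (2 * pi * (m \<bullet> y) + (th - pi / 2)))) (at y)"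
  unfolding tcos_def[abs_def] by (auto intro!: derivative_eq_intros)
 moreover have "sin (t + (th - pi / 2)) = - cos (t + th)" for t
  by (simp add: sin_add cos_add sin_diff cos_diff)
 ultimately show ?thesis
  using partial_deriv_eq[of "tcos m (th - pi / 2)" _ y i] by (simp add: inner_axis tcos_def)
qed

lemma integral_borel_translate:
 fixes f :: "'a::euclidean_space => real"
 assumes m: "f : borel_measurable borel"
 shows "(LINT x|lebesgue. f (x - v)) = (LINT x|lebesgue. f x)"
proof -
 have "(LINT x|lborel. f x) = (LINT x|distr lborel borel (%x. - v + x). f x)"
  by (simp only: lborel_distr_plus)
 also have "... = (LINT x|lborel. f (- v + x))" by (rule integral_distr) (use m in auto)
 finally have "(LINT x|lborel. f x) = (LINT x|lborel. f (x - v))" by simp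
 moreover have "(%x. f (x - v)) : borel_measurable lborel" "f : borel_measurable lborel"
  using m by auto
 ultimately show ?thesis by (simp add: integral_completion)
qed

lemma unit_cell_mem: "y : unit_cell \<longleftrightarrow> (\<forall>i. 0 <= y $ i & y $ i <= 1)"
 by (simp add: unit_cell_def mem_box_cart)

lemma unit_cell_sets: "unit_cell : sets lebesgue"
 by (simp add: unit_cell_def)

abbreviation nu :: "(real^'d) measure" where
 "nu \<equiv> leb unit_cell"

lemma finite_nu: "finite_measure nu"
 by (rule finite_measure_lebesgue_on[OF unit_cell_lmeasurable])

text \<open>A shift of the cell along an axis exchanges a slab for an integer translate of it.\<close>
lemma integral_cell_shift:
 fixes f :: "real^'d => real"
 assumes f: "continuous_on UNIV f" "periodic f" and t: "0 <= t" "t <= 1"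
 shows "(LINT y|nu. f (y + t *\<^sub>R axis i 1)) = (LINT y|nu. f y)"
proof -
 let ?a = "axis i 1 :: real^'d" and ?S = "{y : unit_cell. y $ i <= t}"
 define I where "I A y = indicator A y * f y" for A y
 have cl: "closed ?S"
  unfolding unit_cell_def by (intro closed_Collect_conj closed_Collect_le continuous_intros) (auto simp: closed_cbox)
 have cY: "closed (unit_cell :: (real^'d) set)" by (simp add: unit_cell_def closed_cbox)
 have fm: "f : borel_measurable borel" by (rule borel_measurable_continuous_onI[OF f(1)])
 have Im: "I A : borel_measurable borel" if "closed A" for A
  unfolding I_def using that fm by (intro borel_measurable_times borel_measurable_indicator) (auto simp: borel_closed)
 have int: "integrable lebesgue (I A)" if "compact A" for A
  using continuous_absolutely_integrable_compact[OF f(1) that] by (simp add: set_integrable_def I_def[abs_def])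
 have cpt: "compact ?S" "compact (unit_cell :: (real^'d) set)"
 proof -
  show "compact (unit_cell :: (real^'d) set)" by (simp add: unit_cell_def)
  then have "compact (unit_cell \<inter> ?S)" using cl by (rule compact_Int_closed)
  moreover have "unit_cell \<inter> ?S = ?S" by auto
  ultimately show "compact ?S" by simp
 qed
 have per: "f (y - ?a) = f y" for y
 proof -
  have "integer_vector (- ?a)" by (simp add: integer_vector_def axis_def)
  then show ?thesis using f(2) unfolding periodic_def by (metis add_uminus_conv_diff)
 qed
 define v where "v = t *\<^sub>R ?a"
 let ?H = "%c. {y :: real^'d. y $ i = c}"
 have null: "?H c : null_sets lebesgue" for c
  using negligible_hyperplane[of ?a c] by (simp add: negligible_iff_null_sets inner_axis' axis_eq_0_iff)
 \<comment> \<open>The cell and the slabs are closed, so the identity of indicators fails on these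
   two hyperplanes, which are null.\<close>
 have key: "indicator unit_cell (y - v) * f y = I unit_cell y - I ?S y + I ?S (y - ?a)"
  if y: "y ~: ?H 1 \<union> ?H t" for y
 proof -
  have "indicator unit_cell (y - v) = (indicator unit_cell y - indicator ?S y + indicator ?S (y - ?a) :: real)"
  proof (cases "\<forall>j. j ~= i --> 0 <= y $ j & y $ j <= 1")
   case True
   have c: "y : unit_cell \<longleftrightarrow> 0 <= y $ i & y $ i <= 1" "y - v : unit_cell \<longleftrightarrow> t <= y $ i & y $ i <= 1 + t"
    "y - ?a : unit_cell \<longleftrightarrow> 1 <= y $ i & y $ i <= 2"
    using True unfolding unit_cell_mem v_def by (auto simp: axis_def)
   show ?thesis using t y unfolding indicator_def mem_Collect_eq c by (auto simp: axis_def)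
  next
   case False
   then obtain j where j: "j ~= i" "\<not> (0 <= y $ j & y $ j <= 1)" by blast
   then have "y ~: unit_cell" "y - v ~: unit_cell" "y - ?a ~: unit_cell"
    unfolding unit_cell_mem v_def by (auto simp: axis_def intro!: exI[of _ j])
   then show ?thesis by simp
  qed
  then show ?thesis by (simp only: I_def per distrib_right left_diff_distrib)
 qed
 have iS: "integrable lebesgue (%y. I ?S (y - ?a))"
 proof -
  have mem: "y : (+) ?a ` ?S \<longleftrightarrow> y - ?a : ?S" for y
  proof
   assume "y - ?a : ?S"
   then have "?a + (y - ?a) : (+) ?a ` ?S" by (rule imageI)
   then show "y : (+) ?a ` ?S" by simp
  next
   assume "y : (+) ?a ` ?S"
   then obtain z where "z : ?S" "y = ?a + z" by (rule imageE)
   then show "y - ?a : ?S" by (simp only: add_diff_cancel_left')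
  qed
  have "(%y. I ?S (y - ?a)) = I ((+) ?a ` ?S)"
   unfolding I_def indicator_def mem per ..
  then show ?thesis using int[OF compact_translation[OF cpt(1)]] by simp
 qed
 have ind: "(indicator unit_cell :: real^'d => real) : borel_measurable borel"
  by (rule borel_measurable_indicator[OF borel_closed[OF cY]])
 have tr: "(%y. y + b) : borel_measurable borel" for b :: "real^'d"
  by (rule borel_measurable_continuous_onI) (intro continuous_intros)
 have bm1: "(%y. indicator unit_cell y * f (y + v)) : borel_measurable borel"
  by (rule borel_measurable_times[OF ind measurable_compose[OF tr fm]])
 have bm2: "(%y. indicator unit_cell (y - v) * f (y - v + v)) : borel_measurable borel"
  using measurable_compose[OF tr[of "- v"] bm1] by simp
 have "(LINT y|nu. f (y + v)) = (LINT y|lebesgue. indicator unit_cell y * f (y + v))"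
  by (simp add: integral_lebesgue_on_eq unit_cell_sets)
 also have "... = (LINT y|lebesgue. indicator unit_cell (y - v) * f (y - v + v))"
  by (rule integral_borel_translate[OF bm1, symmetric])
 also have "... = (LINT y|lebesgue. I unit_cell y - I ?S y + I ?S (y - ?a))"
 proof (rule integral_cong_AE)
  have "AE y in lebesgue. y ~: ?H 1 \<union> ?H t" by (intro AE_not_in null_sets.Un null)
  then show "AE y in lebesgue. indicator unit_cell (y - v) * f (y - v + v) = I unit_cell y - I ?S y + I ?S (y - ?a)"
   by eventually_elim (simp add: key)
  show "(%y. indicator unit_cell (y - v) * f (y - v + v)) : borel_measurable lebesgue"
   by (rule measurable_completion) (use bm2 in simp)
  show "(%y. I unit_cell y - I ?S y + I ?S (y - ?a)) : borel_measurable lebesgue"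
   using borel_measurable_integrable[OF int[OF cpt(1)]] borel_measurable_integrable[OF int[OF cpt(2)]]
    borel_measurable_integrable[OF iS] by (intro borel_measurable_add borel_measurable_diff)
 qed
 also have "... = (LINT y|lebesgue. I unit_cell y) - (LINT y|lebesgue. I ?S y) + (LINT y|lebesgue. I ?S (y - ?a))"
  using int[OF cpt(1)] int[OF cpt(2)] iS by simp
 also have "(LINT y|lebesgue. I ?S (y - ?a)) = (LINT y|lebesgue. I ?S y)"
  by (rule integral_borel_translate[OF Im[OF cl]])
 finally show ?thesis by (simp add: I_def v_def integral_lebesgue_on_eq unit_cell_sets)
qed

lemma measure_nu [simp]: "measure (nu :: (real^'d) measure) unit_cell = 1"
 using measure_unit_cell[where 'd='d] by (simp add: measure_restrict_space unit_cell_sets)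

text \<open>A shift by 1 / (2 |m_i|) along an axis with m_i nonzero reverses the sign, while the
  integral over the cell is unchanged by it. The shift has length at most 1 because m_i is an
  integer.\<close>

lemma integral_tcos:
 fixes m :: "real^'d"
 assumes m: "integer_vector m"
 shows "(LINT y|nu. tcos m th y) = (if m = 0 then cos th else 0)"
proof (cases "m = 0")
 case True
 then show ?thesis by (simp add: tcos_def)
next
 case False
 then obtain i where i: "m $ i ~= 0" by (auto simp: vec_eq_iff)
 define t where "t = 1 / (2 * \<bar>m $ i\<bar>)"
 have "1 <= \<bar>m $ i\<bar>" using i m Ints_nonzero_abs_ge1 unfolding integer_vector_def by blast
 then have t: "0 <= t" "t <= 1" by (auto simp: t_def divide_le_eq)
 have mt: "m $ i * t = 1 / 2 \<or> m $ i * t = - 1 / 2" using i by (auto simp: t_def abs_if)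
 have "tcos m th (y + t *\<^sub>R axis i 1) = - tcos m th y" for y
 proof -
  define x where "x = 2 * pi * (m \<bullet> y) + th"
  have A: "2 * pi * (m \<bullet> (y + t *\<^sub>R axis i 1)) + th = x + 2 * pi * (m $ i * t)"
   by (simp add: x_def inner_add_right inner_axis algebra_simps)
  have "2 * pi * (m $ i * t) = pi \<or> 2 * pi * (m $ i * t) = - pi" using mt by auto
  then have "cos (x + 2 * pi * (m $ i * t)) = - cos x"
  proof
   assume E: "2 * pi * (m $ i * t) = pi"
   show ?thesis unfolding E by simp
  next
   assume E: "2 * pi * (m $ i * t) = - pi"
   show ?thesis unfolding E by (simp add: cos_diff)
  qed
  then show ?thesis unfolding tcos_def A by (simp only: x_def)
 qed
 then have "(LINT y|nu. tcos m th y) = - (LINT y|nu. tcos m th y)"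
  using integral_cell_shift[OF tcos_continuous tcos_periodic[OF m] t, of th i] by simp
 then show ?thesis using False by simp
qed

inductive_set trig_polys :: "(real^'d => real) set" where
 cos: "integer_vector m ==> tcos m th : trig_polys"
| add: "f : trig_polys ==> g : trig_polys ==> (%y. f y + g y) : trig_polys"
| scale: "f : trig_polys ==> (%y. c * f y) : trig_polys"

lemma integer_vector_add: "integer_vector m ==> integer_vector l ==> integer_vector (m + l)"
 and integer_vector_diff: "integer_vector m ==> integer_vector l ==> integer_vector (m - l)"
 by (auto simp: integer_vector_def)

lemma trig_polys_mult:
 assumes "f : trig_polys" "g : trig_polys"
 shows "(%y. f y * g y) : trig_polys"
 using assms(1)
proof induction
 case (cos m th)
 show ?case
  using assms(2)
 proof induction
  case (cos l ph)
  have "(%y. 1/2 * (tcos (m + l) (th + ph) y + tcos (m - l) (th - ph) y)) : trig_polys"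
   by (intro trig_polys.intros integer_vector_add integer_vector_diff cos \<open>integer_vector m\<close>)
  then show ?case by (simp add: tcos_mult)
 next
  case (add f g)
  then show ?case using trig_polys.add by (simp add: distrib_left)
 next
  case (scale f c)
  then show ?case using trig_polys.scale[OF scale(2), of c] by (simp add: mult.left_commute)
 qed
next
 case (add f g)
 then show ?case using trig_polys.add by (simp add: distrib_right)
next
 case (scale f c)
 then show ?case using trig_polys.scale[OF scale(2), of c] by (simp add: mult.assoc)
qed

lemma trig_polys_const: "(%y. c) : trig_polys"
proof -
 have "(%y. c * tcos 0 0 y) : trig_polys" by (intro trig_polys.intros) (simp add: integer_vector_def)
 then show ?thesis by (simp add: tcos_def)
qed

lemma trig_polys_C_per: "f : trig_polys ==> f : C_per"
proof (induction rule: trig_polys.induct)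
 case (cos m th)
 then show ?case by (simp add: C_per_def tcos_periodic tcos_continuous)
qed (auto simp: C_per_def periodic_def intro!: continuous_intros)

section \<open>Density of trigonometric polynomials\<close>

lemma reduce_to_unit_cell:
 fixes y :: "real^'d"
 obtains z where "integer_vector z" "y + z : unit_cell"
proof
 show "integer_vector ((\<chi> i. - real_of_int \<lfloor>y $ i\<rfloor>) :: real^'d)" by (simp add: integer_vector_def)
 have "0 <= y $ i - real_of_int \<lfloor>y $ i\<rfloor> & y $ i - real_of_int \<lfloor>y $ i\<rfloor> <= 1" for i by linarith
 then show "y + (\<chi> i. - real_of_int \<lfloor>y $ i\<rfloor>) : unit_cell" by (simp add: unit_cell_mem)
qed

lemma periodic_on_cell:
 assumes "periodic f"
 obtains y' where "y' : unit_cell" "f y = f y'"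
 using reduce_to_unit_cell[of y] assms unfolding periodic_def by metis

text \<open>Opposite faces of the cell are glued: the image is a compact model of the torus in which
  trigonometric polynomials separate points.\<close>

definition torus_embedding :: "real^'d => (real^'d) \<times> (real^'d)" where
 "torus_embedding y = ((\<chi> i. cos (2 * pi * y $ i)), (\<chi> i. sin (2 * pi * y $ i)))"

lemma torus_embedding_eq:
 assumes "torus_embedding y = torus_embedding y'"
 shows "integer_vector (y' - y)"
 unfolding integer_vector_def
proof
 fix i
 have "cos (2 * pi * y' $ i) = cos (2 * pi * y $ i)" "sin (2 * pi * y' $ i) = sin (2 * pi * y $ i)"
  using assms by (simp_all add: torus_embedding_def vec_eq_iff)
 then have "sin (2 * pi * y' $ i) = sin (2 * pi * y $ i) & cos (2 * pi * y' $ i) = cos (2 * pi * y $ i)" by simp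
 then obtain n where "2 * pi * y' $ i = 2 * pi * y $ i + 2 * pi * real_of_int n"
  unfolding sin_cos_eq_iff by auto
 then have "2 * pi * (y' $ i) = 2 * pi * (y $ i + real_of_int n)" by (simp add: algebra_simps)
 then have "(y' - y) $ i = real_of_int n" by simp
 then show "(y' - y) $ i : \<int>" by simp
qed

text \<open>Stone-Weierstrass on the image of \<open>torus_embedding\<close>, to which periodic
  functions descend. Periodicity then carries the estimate from the cell to all points.\<close>

theorem trig_polys_dense:
 fixes f :: "real^'d => real"
 assumes f: "f : C_per" and e: "0 < e"
 obtains ps where "ps : trig_polys" "!!y. \<bar>f y - ps y\<bar> < e"
proof -
 let ?T = "torus_embedding ` (unit_cell :: (real^'d) set)"
 have per: "periodic f" and cont: "continuous_on UNIV f" using f by (auto simp: C_per_def)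
 have "continuous_on UNIV (torus_embedding :: real^'d => _)"
  unfolding torus_embedding_def by (intro continuous_intros)
 then have emb: "continuous_on S torus_embedding" for S :: "(real^'d) set"
  using continuous_on_subset by blast
 have cY: "compact (unit_cell :: (real^'d) set)" by (simp add: unit_cell_def)
 have T: "compact ?T" by (rule compact_continuous_image[OF emb cY])
 \<comment> \<open>The choice of the preimage does not affect the value, as two preimages differ by
   an integer vector.\<close>
 define F where "F z = f (SOME y. y : unit_cell & torus_embedding y = z)" for z
 have F: "F (torus_embedding y) = f y" if "y : unit_cell" for y
 proof -
  define y' where "y' = (SOME y'. y' : unit_cell & torus_embedding y' = torus_embedding y)"
  have "y' : unit_cell & torus_embedding y' = torus_embedding y"
   unfolding y'_def by (rule someI[of _ y]) (use that in simp)
  then have "integer_vector (y - y')" using torus_embedding_eq by blast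
  then have "f (y' + (y - y')) = f y'" using per unfolding periodic_def by blast
  then show ?thesis by (simp add: F_def y'_def[symmetric])
 qed
 \<comment> \<open>Continuity on the quotient: preimages of closed sets are images of compact sets
   under the embedding, hence closed.\<close>
 have Fcont: "continuous_on ?T F"
  unfolding continuous_on_closed_vimage[OF compact_imp_closed[OF T]]
 proof (intro allI impI)
  fix B :: "real set" assume B: "closed B"
  have "F -` B \<inter> ?T = torus_embedding ` (unit_cell \<inter> f -` B)" using F by auto
  moreover have "closed (f -` B)" by (rule closed_vimage[OF B cont])
  then have "compact (unit_cell \<inter> f -` B)" by (rule compact_Int_closed[OF cY])
  ultimately show "closed (F -` B \<inter> ?T)"
   using compact_imp_closed[OF compact_continuous_image[OF emb]] by metis
 qed
 define R where "R = {h :: (real^'d) \<times> (real^'d) => real. continuous_on ?T h & (\<exists>ps\<in>trig_polys. \<forall>y. h (torus_embedding y) = ps y)}"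
 have coord: "(%y. cos (2 * pi * y $ i)) : trig_polys" "(%y. sin (2 * pi * y $ i)) : trig_polys" for i :: 'd
 proof -
  have ax: "integer_vector (axis i 1 :: real^'d)" by (simp add: integer_vector_def axis_def)
  have "(%y. cos (2 * pi * y $ i)) = tcos (axis i 1 :: real^'d) 0" "(%y. sin (2 * pi * y $ i)) = tcos (axis i 1 :: real^'d) (- pi / 2)"
   by (simp_all add: tcos_def fun_eq_iff inner_axis' cos_add cos_diff)
  then show "(%y. cos (2 * pi * y $ i)) : trig_polys" "(%y. sin (2 * pi * y $ i)) : trig_polys"
   using trig_polys.cos[OF ax] by metis+
 qed
 interpret function_ring_on R ?T
 proof
  show "compact ?T" by (rule T)
  show "continuous_on ?T h" if "h : R" for h using that by (simp add: R_def)
  show "(%x. g x + h x) : R" if gh: "g : R" "h : R" for g h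
  proof -
   obtain a b where "a : trig_polys" "\<forall>y. g (torus_embedding y) = a y" "b : trig_polys" "\<forall>y. h (torus_embedding y) = b y"
    using gh by (auto simp: R_def)
   then have "\<exists>ps\<in>trig_polys. \<forall>y. g (torus_embedding y) + h (torus_embedding y) = ps y"
    by (intro bexI[of _ "%y. a y + b y"] trig_polys.add) auto
   then show ?thesis using gh by (auto simp: R_def intro: continuous_on_add)
  qed
  show "(%x. g x * h x) : R" if gh: "g : R" "h : R" for g h
  proof -
   obtain a b where "a : trig_polys" "\<forall>y. g (torus_embedding y) = a y" "b : trig_polys" "\<forall>y. h (torus_embedding y) = b y"
    using gh by (auto simp: R_def)
   then have "\<exists>ps\<in>trig_polys. \<forall>y. g (torus_embedding y) * h (torus_embedding y) = ps y"
    by (intro bexI[of _ "%y. a y * b y"] trig_polys_mult) auto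
   then show ?thesis using gh by (auto simp: R_def intro: continuous_on_mult)
  qed
  show "(%_. c) : R" for c
   using trig_polys_const[of c] by (auto simp: R_def intro!: bexI[of _ "%_. c"])
  show "\<exists>h\<in>R. h z ~= h z'" if "z : ?T" "z' : ?T" "z ~= z'" for z z'
  proof -
   have F: "(%z. fst z $ i) : R" for i
    using coord(1)[of i] by (auto simp: R_def torus_embedding_def intro!: continuous_intros)
   have S: "(%z. snd z $ i) : R" for i
    using coord(2)[of i] by (auto simp: R_def torus_embedding_def intro!: continuous_intros)
   have "(\<exists>i. fst z $ i ~= fst z' $ i) \<or> (\<exists>i. snd z $ i ~= snd z' $ i)"
    using that(3) by (auto simp: prod_eq_iff vec_eq_iff)
   then show ?thesis by (elim disjE exE) (rule bexI[OF _ F], assumption, rule bexI[OF _ S], assumption)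
  qed
 qed
 obtain h where h: "h : R" "\<forall>z\<in>?T. \<bar>F z - h z\<bar> < e"
  using Stone_Weierstrass_basic[OF Fcont e] by blast
 obtain ps where ps: "ps : trig_polys" "!!y. h (torus_embedding y) = ps y" using h(1) by (auto simp: R_def)
 show thesis
 proof (rule that[OF ps(1)])
  fix y
  have "periodic (%y. f y - ps y)"
   using per trig_polys_C_per[OF ps(1)] by (auto simp: periodic_def C_per_def)
  then obtain y' where y': "y' : unit_cell" "f y - ps y = f y' - ps y'" by (rule periodic_on_cell)
  then show "\<bar>f y - ps y\<bar> < e" using h(2)[THEN bspec, OF imageI[OF y'(1)]] F[OF y'(1)] ps(2)[of y'] by simp
 qed
qed

lemma C_per_abs_le_sup_norm:
 assumes "f : C_per"
 shows "\<bar>f y\<bar> <= sup_norm f"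
proof -
 have "compact ((%y. \<bar>f y\<bar>) ` unit_cell)"
  using assms by (intro compact_continuous_image continuous_intros)
   (auto simp: C_per_def unit_cell_def intro: continuous_on_subset)
 then have "bdd_above ((%y. \<bar>f y\<bar>) ` unit_cell)"
  by (intro bounded_imp_bdd_above compact_imp_bounded)
 moreover obtain y' where "y' : unit_cell" "f y = f y'"
  using periodic_on_cell assms by (auto simp: C_per_def)
 ultimately show ?thesis unfolding sup_norm_def by (auto intro!: cSUP_upper2)
qed

lemma unit_cell_nonempty: "unit_cell ~= ({} :: (real^'d) set)"
 using unit_cell_mem[of "0 :: real^'d"] by auto

lemma sup_norm_le: "(!!y. \<bar>f y\<bar> <= c) ==> sup_norm f <= c"
 unfolding sup_norm_def by (intro cSUP_least unit_cell_nonempty)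

lemma sup_norm_nonneg: "f : C_per ==> 0 <= sup_norm f"
 using C_per_abs_le_sup_norm[of f 0] by linarith

lemma C_per_diff: "f : C_per ==> g : C_per ==> (%y. f y - g y) : C_per"
 by (auto simp: C_per_def periodic_def intro: continuous_intros)

lemma C_per_zero: "(%y. 0) : C_per"
 by (simp add: C_per_def periodic_def)

lemma sup_norm_triangle:
 assumes "f : C_per" "g : C_per" "h : C_per"
 shows "sup_norm (%y. f y - h y) <= sup_norm (%y. f y - g y) + sup_norm (%y. g y - h y)"
proof (rule sup_norm_le)
 fix y
 show "\<bar>f y - h y\<bar> <= sup_norm (%y. f y - g y) + sup_norm (%y. g y - h y)"
  using C_per_abs_le_sup_norm[OF C_per_diff[OF assms(1,2)], of y] C_per_abs_le_sup_norm[OF C_per_diff[OF assms(2,3)], of y]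
  by linarith
qed

lemma sup_norm_commute: "sup_norm (%y. f y - g y) = sup_norm (%y. g y - f y)"
 by (simp add: sup_norm_def abs_minus_commute)

lemma C_per_continuous: "f : C_per ==> continuous_on UNIV f"
 by (simp add: C_per_def)

lemma cell_integral_bound:
 assumes w: "sq_int nu w" and f: "f : borel_measurable nu" "!!y. \<bar>f y\<bar> <= c"
 shows "integrable nu (%y. w y * f y)" "\<bar>LINT y|nu. w y * f y\<bar> <= norm2 nu w * c"
proof -
 interpret finite_measure "nu :: (real^'a) measure" by (rule finite_nu)
 have fs: "sq_int nu f" by (rule sq_int_bounded[where c=c, OF finite_measure_axioms f(1)]) (use f(2) in simp)
 show "integrable nu (%y. w y * f y)" by (rule sq_mult_int[OF w fs])
 have c0: "0 <= c" using f(2)[of 0] by linarith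
 have "norm2 nu f <= norm2 nu (%y :: real^'a. c)"
  using f(2) c0 by (intro norm2_mono sq_int_const finite_measure_axioms f(1)) auto
 also have "... = c" using c0 by (simp add: norm2_def)
 finally have "norm2 nu f <= c" .
 then show "\<bar>LINT y|nu. w y * f y\<bar> <= norm2 nu w * c"
  using Cauchy_Schwarz_integral_real[OF w fs] mult_left_mono[of "norm2 nu f" c "norm2 nu w"]
  by (simp add: order_trans[OF _ mult_left_mono])
qed

section \<open>Measurability of the approximation operator and of the limit pairing\<close>

context lp_setting
begin

lemma L2_C_perE:
 assumes "f : L2_C_per Om"
 obtains s where "!!j. simple_function mu (s j)" "!!j x. x : Om ==> s j x : C_per"
  "AE x in mu. (%j. sup_norm (%y. s j x y - f x y)) ~~> 0"
  "!!x. x : Om ==> f x : C_per" "integrable mu (%x. (sup_norm (f x))\<^sup>2)"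
proof -
 have "\<forall>x\<in>Om. f x : C_per" "integrable mu (%x. (sup_norm (f x))\<^sup>2)"
  "\<exists>s. (\<forall>j. simple_function mu (s j) & (\<forall>x\<in>Om. s j x : C_per)) &
   (AE x in mu. (%j. sup_norm (%y. s j x y - f x y)) ~~> 0)"
  using assms unfolding L2_C_per_def L2_bochner_def mem_Collect_eq space_lebesgue_on by blast+
 then show thesis using that by blast
qed

lemma L2_L2E:
 assumes "w : L2_L2 Om"
 obtains s where "!!j. simple_function mu (s j)" "!!j x. x : Om ==> sq_int nu (s j x)"
  "AE x in mu. (%j. norm2 nu (%y. s j x y - w x y)) ~~> 0"
  "!!x. x : Om ==> sq_int nu (w x)" "integrable mu (%x. (norm2 nu (w x))\<^sup>2)"
proof -
 have "\<forall>x\<in>Om. sq_int nu (w x)" "integrable mu (%x. (norm2 nu (w x))\<^sup>2)"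
  "\<exists>s. (\<forall>j. simple_function mu (s j) & (\<forall>x\<in>Om. sq_int nu (s j x))) &
   (AE x in mu. (%j. norm2 nu (%y. s j x y - w x y)) ~~> 0)"
  using assms unfolding L2_L2_def L2_bochner_def mem_Collect_eq space_lebesgue_on L2_iff L2_norm_eq by blast+
 then show thesis using that by blast
qed

lemma L_simple_measurable:
 assumes s: "simple_function mu s" "!!x. x : Om ==> s x : C_per"
 shows "L k s : borel_measurable mu"
proof -
 have fin: "finite (s ` Om)" using s(1) by (auto simp: simple_function_def)
 have "(%x. indicator (s -` {c} \<inter> Om) x * L k (%x. c) x) : borel_measurable mu" if "c : s ` Om" for c
 proof (intro borel_measurable_times L_continuous_measurable)
  show "continuous_on UNIV c" using that s(2) by (auto simp: C_per_def)
  have "s -` {c} \<inter> Om : sets mu" using s(1) that by (auto simp: simple_function_def)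
  then show "(indicator (s -` {c} \<inter> Om) :: _ => real) : borel_measurable mu" by (rule borel_measurable_indicator)
 qed
 then have "(%x. \<Sum>c\<in>s ` Om. indicator (s -` {c} \<inter> Om) x * L k (%x. c) x) : borel_measurable mu"
  by (intro borel_measurable_sum)
 then show ?thesis
 proof (rule measurable_cong[THEN iffD1, rotated])
  fix x assume "x : space mu"
  then have x: "x : Om" by simp
  have "(\<Sum>c\<in>s ` Om. indicator (s -` {c} \<inter> Om) x * L k (%x. c) x) = (\<Sum>c\<in>s ` Om. if c = s x then L k (%x. c) x else 0)"
   using x by (intro sum.cong refl) (auto simp: indicator_def)
  also have "... = L k (%_. s x) x" using fin x by simp
  also have "... = L k s x" by (cases rule: L_cases[of k x]) auto
  finally show "(\<Sum>c\<in>s ` Om. indicator (s -` {c} \<inter> Om) x * L k (%x. c) x) = L k s x" .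
 qed
qed

lemma L_diff_le: "f x : C_per ==> g x : C_per ==> \<bar>L k f x - L k g x\<bar> <= sup_norm (%y. f x y - g x y)"
 by (cases rule: L_cases[of k x])
  (auto intro: C_per_abs_le_sup_norm[OF C_per_diff] sup_norm_nonneg[OF C_per_diff])

lemma L_le_sup_norm: "f x : C_per ==> \<bar>L k f x\<bar> <= sup_norm (f x)"
 by (cases rule: L_cases[of k x]) (auto intro: C_per_abs_le_sup_norm sup_norm_nonneg)

text \<open>For a simple function \<open>L\<close> acts separately on each of finitely many values.
  In general \<open>L\<close> is pointwise a contraction for the supremum norm, so the approximation
  of \<open>f\<close> carries over.\<close>

lemma L_measurable:
 assumes f: "f : L2_C_per Om"
 shows "L k f : borel_measurable mu"
proof -
 obtain s where s: "!!j. simple_function mu (s j)" "!!j x. x : Om ==> s j x : C_per"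
  "AE x in mu. (%j. sup_norm (%y. s j x y - f x y)) ~~> 0" "!!x. x : Om ==> f x : C_per"
  "integrable mu (%x. (sup_norm (f x))\<^sup>2)"
  using L2_C_perE[OF f] by blast
 show ?thesis
 proof (rule borel_measurable_lebesgue_on_AE_limit[OF Om_sets])
  show "L k (s j) : borel_measurable mu" for j by (rule L_simple_measurable[OF s(1,2)])
  show "AE x in mu. (%j. L k (s j) x) ~~> L k f x"
   using s(3) AE_space
  proof eventually_elim
   fix x assume lim: "(%j. sup_norm (%y. s j x y - f x y)) ~~> 0" and "x : space mu"
   then have x: "x : Om" by simp
   have "(%j. L k (s j) x - L k f x) ~~> 0"
   proof (rule Lim_null_comparison[OF always_eventually[OF allI] lim])
    fix j
    have "\<bar>L k (s j) x - L k f x\<bar> <= sup_norm (%y. s j x y - f x y)" by (intro L_diff_le s(2) s(4) x)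
    then show "norm (L k (s j) x - L k f x) <= sup_norm (%y. s j x y - f x y)" by simp
   qed
   then show "(%j. L k (s j) x) ~~> L k f x" by (simp add: LIM_zero_iff)
  qed
 qed
qed

lemma sq_int_L:
 assumes f: "f : L2_C_per Om"
 shows "sq_int mu (L k f)"
proof -
 have C: "!!x. x : Om ==> f x : C_per" and i: "integrable mu (%x. (sup_norm (f x))\<^sup>2)"
  by (rule L2_C_perE[OF f]; blast)+
 have "integrable mu (%x. (norm (L k f x))\<^sup>2)"
 proof (rule intble_bound[OF i])
  show "(%x. (norm (L k f x))\<^sup>2) : borel_measurable mu" using L_measurable[OF f] by measurable
  show "AE x in mu. norm ((norm (L k f x))\<^sup>2) <= norm ((sup_norm (f x))\<^sup>2)"
  proof (rule AE_I2)
   fix x assume "x : space mu"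
   then have "f x : C_per" using C by simp
   then have "\<bar>L k f x\<bar> ^ 2 <= (sup_norm (f x))\<^sup>2" by (intro power_mono L_le_sup_norm) auto
   then show "norm ((norm (L k f x))\<^sup>2) <= norm ((sup_norm (f x))\<^sup>2)" by simp
  qed
 qed
 then show ?thesis using L_measurable[OF f] by (simp add: sq_int_def)
qed

text \<open>Both factors depend on \<open>x\<close> only through strongly measurable maps. For
  simple approximations the pairing is a simple function, and the cell estimate shows that these
  pairings converge almost everywhere.\<close>

lemma weak_pairing_measurable:
 assumes w: "w : L2_L2 Om" and f: "f : L2_C_per Om"
 shows "(%x. LINT y|nu. w x y * f x y) : borel_measurable mu"
  "integrable mu (%x. LINT y|nu. w x y * f x y)"
proof -
 obtain s where s: "!!j. simple_function mu (s j)" "!!j x. x : Om ==> s j x : C_per"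
  "AE x in mu. (%j. sup_norm (%y. s j x y - f x y)) ~~> 0" "!!x. x : Om ==> f x : C_per"
  "integrable mu (%x. (sup_norm (f x))\<^sup>2)"
  using L2_C_perE[OF f] by blast
 obtain t where t: "!!j. simple_function mu (t j)" "!!j x. x : Om ==> sq_int nu (t j x)"
  "AE x in mu. (%j. norm2 nu (%y. t j x y - w x y)) ~~> 0"
  "!!x. x : Om ==> sq_int nu (w x)" "integrable mu (%x. (norm2 nu (w x))\<^sup>2)"
  using L2_L2E[OF w] by blast
 note mb = continuous_borel[OF C_per_continuous]
 show m: "(%x. LINT y|nu. w x y * f x y) : borel_measurable mu"
 proof (rule borel_measurable_lebesgue_on_AE_limit[OF Om_sets])
  show "(%x. LINT y|nu. t j x y * s j x y) : borel_measurable mu" for j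
   by (rule borel_measurable_simple_function[OF simple_function_compose2[OF t(1) s(1)]])
  show "AE x in mu. (%j. LINT y|nu. t j x y * s j x y) ~~> (LINT y|nu. w x y * f x y)"
   using s(3) t(3) AE_space
  proof eventually_elim
   fix x assume ls: "(%j. sup_norm (%y. s j x y - f x y)) ~~> 0"
    and lt: "(%j. norm2 nu (%y. t j x y - w x y)) ~~> 0" and "x : space mu"
   then have x: "x : Om" by simp
   let ?a = "%j. sup_norm (%y. s j x y - f x y)" and ?b = "%j. norm2 nu (%y. t j x y - w x y)"
   have bound: "\<bar>(LINT y|nu. t j x y * s j x y) - (LINT y|nu. w x y * f x y)\<bar> <=
     ?b j * (sup_norm (f x) + ?a j) + norm2 nu (w x) * ?a j" for j
   proof -
    note sj = s(2)[OF x, of j] and tj = t(2)[OF x, of j] and fx = s(4)[OF x] and wx = t(4)[OF x]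
    note d = C_per_diff[OF sj fx] and e = sq_int_diff[OF tj wx]
    have sb: "\<bar>s j x y\<bar> <= sup_norm (f x) + ?a j" for y
     using C_per_abs_le_sup_norm[OF d, of y] C_per_abs_le_sup_norm[OF fx, of y] by linarith
    note i1 = cell_integral_bound[OF e mb[OF sj] sb]
    note i2 = cell_integral_bound[OF wx mb[OF d] C_per_abs_le_sup_norm[OF d]]
    have "(LINT y|nu. t j x y * s j x y) - (LINT y|nu. w x y * f x y) =
      (LINT y|nu. t j x y * s j x y - w x y * f x y)"
     using cell_integral_bound(1)[OF tj mb[OF sj] C_per_abs_le_sup_norm[OF sj]]
      cell_integral_bound(1)[OF wx mb[OF fx] C_per_abs_le_sup_norm[OF fx]] by simp
    also have "... = (LINT y|nu. (t j x y - w x y) * s j x y + w x y * (s j x y - f x y))"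
     by (simp add: algebra_simps)
    also have "... = (LINT y|nu. (t j x y - w x y) * s j x y) + (LINT y|nu. w x y * (s j x y - f x y))"
     by (rule LINT_add[OF i1(1) i2(1)])
    finally show ?thesis using i1(2) i2(2) by linarith
   qed
   have "(%j. ?b j * (sup_norm (f x) + ?a j) + norm2 nu (w x) * ?a j) ~~> 0 * (sup_norm (f x) + 0) + norm2 nu (w x) * 0"
    by (intro tendsto_intros ls lt)
   then have "(%j. ?b j * (sup_norm (f x) + ?a j) + norm2 nu (w x) * ?a j) ~~> 0" by simp
   then have "(%j. (LINT y|nu. t j x y * s j x y) - (LINT y|nu. w x y * f x y)) ~~> 0"
    by (rule Lim_null_comparison[rotated]) (use bound in simp)
   then show "(%j. LINT y|nu. t j x y * s j x y) ~~> (LINT y|nu. w x y * f x y)"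
    by (simp add: LIM_zero_iff)
  qed
 qed
 show "integrable mu (%x. LINT y|nu. w x y * f x y)"
 proof (rule intble_bound[OF intble_add[OF t(5) s(5)] m], rule AE_I2)
  fix x assume "x : space mu"
  then have x: "x : Om" by simp
  have "\<bar>LINT y|nu. w x y * f x y\<bar> <= norm2 nu (w x) * sup_norm (f x)"
   by (rule cell_integral_bound(2)[OF t(4)[OF x] mb[OF s(4)[OF x]] C_per_abs_le_sup_norm[OF s(4)[OF x]]])
  also have "... <= (norm2 nu (w x))\<^sup>2 + (sup_norm (f x))\<^sup>2"
   using sum_squares_bound[of "norm2 nu (w x)" "sup_norm (f x)"] sup_norm_nonneg[OF s(4)[OF x]]
    mult_nonneg_nonneg[OF norm2_nonneg[of nu "w x"] sup_norm_nonneg[OF s(4)[OF x]]] by linarith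
  finally show "norm (LINT y|nu. w x y * f x y) <= norm ((norm2 nu (w x))\<^sup>2 + (sup_norm (f x))\<^sup>2)" by simp
 qed
qed

lemma L2_C_per_step:
 assumes ps: "ps : C_per" and a: "simple_function mu a"
 shows "(%x y. a x * ps y) : L2_C_per Om"
proof -
 have C: "(%y. c * ps y) : C_per" for c
  using ps by (auto simp: C_per_def periodic_def intro: continuous_intros)
 have sf: "simple_function mu (%x y. a x * ps y)"
  using simple_function_compose[OF a, of "%c y. c * ps y"] by (simp add: o_def)
 have z: "sup_norm (%y :: real^'d. 0) = 0" using sup_norm_le[of "%y :: real^'d. 0" 0] sup_norm_nonneg[OF C_per_zero[where 'a='d]] by simp
 have "simple_function mu (%x. (sup_norm (%y. a x * ps y))\<^sup>2)"
  using simple_function_compose[OF sf, of "%g. (sup_norm g)\<^sup>2"] by (simp add: o_def)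
 then have "integrable mu (%x. (sup_norm (%y. a x * ps y))\<^sup>2)"
  by (rule integrable_simple_function) (simp add: finite_measure.emeasure_finite[OF finite_measure_mu])
 then show ?thesis
  unfolding L2_C_per_def L2_bochner_def using C sf z by (auto intro!: exI[of _ "%_ x y. a x * ps y"])
qed

end

section \<open>Strong measurability\<close>

lemma borel_measurable_lebesgue_on_limit_diff:
 fixes f g :: "real^'d => real"
 assumes S: "S : sets lebesgue" and f: "!!i. F i : borel_measurable (leb S)"
  and lim: "AE x in leb S. (%i. d i x) ~~> 0" and d: "!!i x. x : S ==> \<bar>F i x - g x\<bar> <= d i x"
 shows "g : borel_measurable (leb S)"
proof (rule borel_measurable_lebesgue_on_AE_limit[OF S f])
 show "AE x in leb S. (%i. F i x) ~~> g x"
  using lim AE_space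
 proof eventually_elim
  fix x assume lim: "(%i. d i x) ~~> 0" and "x : space (leb S)"
  then have x: "x : S" by simp
  have "(%i. F i x - g x) ~~> 0"
   by (rule Lim_null_comparison[OF always_eventually[OF allI] lim]) (use d[OF x] in simp)
  then show "(%i. F i x) ~~> g x" by (simp add: LIM_zero_iff)
 qed
qed

text \<open>The measurability half of \<open>L2_bochner\<close>, separated from integrability so
  that it can be proved in a stronger seminorm and then transferred.\<close>

definition strongly_measurable ::
  "'a measure => ('c => real) set => (('c => real) => real) => ('a => 'c => real) => bool" where
 "strongly_measurable M V p f \<longleftrightarrow> (\<forall>x\<in>space M. f x : V) &
   (\<exists>s. (\<forall>j. simple_function M (s j) & (\<forall>x\<in>space M. s j x : V)) &
     (AE x in M. (%j. p (%y. s j x y - f x y)) ~~> 0))"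

lemma L2_bochner_iff:
 "f : L2_bochner M V p \<longleftrightarrow> strongly_measurable M V p f & integrable M (%x. (p (f x))\<^sup>2)"
 by (simp add: L2_bochner_def strongly_measurable_def conj_assoc)

text \<open>Seminorms on functions, not on classes. The instances are the cell L^2 norm, the
  periodic H^1 norm and its quotient norm.\<close>

locale seminormed_functions =
 fixes V :: "('c => real) set" and p :: "('c => real) => real"
 assumes zero: "(%y. 0) : V" and add: "!!u v. u : V ==> v : V ==> (%y. u y + v y) : V"
  and cmult: "!!u c. u : V ==> (%y. c * u y) : V"
  and nonneg: "!!u. u : V ==> 0 <= p u"
  and triangle: "!!u v. u : V ==> v : V ==> p (%y. u y + v y) <= p u + p v"
  and scale: "!!u c. u : V ==> p (%y. c * u y) = \<bar>c\<bar> * p u"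
begin

lemma diff: "u : V ==> v : V ==> (%y. u y - v y) : V"
 using add[of u "%y. -1 * v y"] cmult[of v "-1"] by simp

lemma p_zero: "p (%y. 0) = 0"
 using scale[OF zero, of 0] by simp

lemma p_commute: "u : V ==> v : V ==> p (%y. u y - v y) = p (%y. v y - u y)"
 using scale[OF diff, of u v "-1"] by simp

lemma triangle_diff:
 assumes "u : V" "v : V" "w : V"
 shows "p (%y. u y - w y) <= p (%y. u y - v y) + p (%y. v y - w y)"
 using triangle[OF diff[OF assms(1,2)] diff[OF assms(2,3)]] by simp

lemma reverse_triangle:
 assumes "u : V" "v : V"
 shows "\<bar>p u - p v\<bar> <= p (%y. u y - v y)"
 using triangle[OF diff[OF assms] assms(2)] triangle[OF diff[OF assms(2,1)] assms(1)] p_commute[OF assms]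
 by simp

lemma sum_mem: "finite I ==> (!!i. i : I ==> u i : V) ==> (%y. \<Sum>i\<in>I. u i y) : V"
 by (induction I rule: finite_induct) (auto intro: zero add)

lemma p_sum_le:
 assumes "finite I" "!!i. i : I ==> u i : V"
 shows "p (%y. \<Sum>i\<in>I. u i y) <= (\<Sum>i\<in>I. p (u i))"
 using assms
proof (induction I rule: finite_induct)
 case (insert i I)
 have "p (%y. u i y + (\<Sum>i\<in>I. u i y)) <= p (u i) + p (%y. \<Sum>i\<in>I. u i y)"
  using insert by (intro triangle sum_mem) auto
 also have "... <= p (u i) + (\<Sum>i\<in>I. p (u i))" using insert by simp
 finally show ?case using insert by simp
qed (simp add: p_zero)

lemma strongly_measurable_const: "u : V ==> strongly_measurable M V p (%x. u)"
 unfolding strongly_measurable_def by (auto simp: p_zero intro!: exI[of _ "%j x. u"])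

lemma strongly_measurable_add:
 assumes "strongly_measurable M V p f" "strongly_measurable M V p g"
 shows "strongly_measurable M V p (%x y. f x y + g x y)"
proof -
 obtain s where s: "!!j. simple_function M (s j)" "!!j x. x : space M ==> s j x : V"
  "AE x in M. (%j. p (%y. s j x y - f x y)) ~~> 0" "!!x. x : space M ==> f x : V"
  using assms(1) unfolding strongly_measurable_def by blast
 obtain t where t: "!!j. simple_function M (t j)" "!!j x. x : space M ==> t j x : V"
  "AE x in M. (%j. p (%y. t j x y - g x y)) ~~> 0" "!!x. x : space M ==> g x : V"
  using assms(2) unfolding strongly_measurable_def by blast
 have "AE x in M. (%j. p (%y. (s j x y + t j x y) - (f x y + g x y))) ~~> 0"
  using s(3) t(3) AE_space
 proof eventually_elim
  fix x assume lim: "(%j. p (%y. s j x y - f x y)) ~~> 0" "(%j. p (%y. t j x y - g x y)) ~~> 0"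
   and x: "x : space M"
  have V: "(%y. s j x y - f x y) : V" "(%y. t j x y - g x y) : V" for j
   using s(2,4) t(2,4) x by (auto intro: diff)
  have "(%j. p (%y. s j x y - f x y) + p (%y. t j x y - g x y)) ~~> 0"
   using tendsto_add[OF lim] by simp
  then show "(%j. p (%y. (s j x y + t j x y) - (f x y + g x y))) ~~> 0"
  proof (rule Lim_null_comparison[OF always_eventually[OF allI], rotated])
   fix j
   show "norm (p (%y. (s j x y + t j x y) - (f x y + g x y))) <= p (%y. s j x y - f x y) + p (%y. t j x y - g x y)"
    using triangle[OF V] nonneg[OF add[OF V]] by (simp add: algebra_simps)
  qed
 qed
 moreover have "simple_function M (%x y. s j x y + t j x y)" for j
  by (rule simple_function_compose2[OF s(1) t(1)])
 ultimately show ?thesis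
  unfolding strongly_measurable_def using s(2,4) t(2,4)
  by (intro conjI ballI exI[of _ "%j x y. s j x y + t j x y"]) (auto intro: add)
qed

lemma strongly_measurable_scale:
 assumes "strongly_measurable M V p f" and b: "b : borel_measurable M"
 shows "strongly_measurable M V p (%x y. b x * f x y)"
proof -
 obtain s where s: "!!j. simple_function M (s j)" "!!j x. x : space M ==> s j x : V"
  "AE x in M. (%j. p (%y. s j x y - f x y)) ~~> 0" "!!x. x : space M ==> f x : V"
  using assms(1) unfolding strongly_measurable_def by blast
 obtain t :: "nat => 'a => real" where t: "!!j. simple_function M (t j)" "!!x. x : space M ==> (%j. t j x) ~~> b x"
  using borel_measurable_implies_sequence_metric[OF b, of 0] by blast
 have "AE x in M. (%j. p (%y. t j x * s j x y - b x * f x y)) ~~> 0"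
  using s(3) AE_space
 proof eventually_elim
  fix x assume lim: "(%j. p (%y. s j x y - f x y)) ~~> 0" and x: "x : space M"
  have V: "(%y. s j x y - f x y) : V" for j using s(2,4) x by (auto intro: diff)
  have "(%j. \<bar>t j x\<bar> * p (%y. s j x y - f x y) + \<bar>t j x - b x\<bar> * p (f x)) ~~> \<bar>b x\<bar> * 0 + \<bar>b x - b x\<bar> * p (f x)"
   by (intro tendsto_intros lim t(2) x)
  then have "(%j. \<bar>t j x\<bar> * p (%y. s j x y - f x y) + \<bar>t j x - b x\<bar> * p (f x)) ~~> 0" by simp
  then show "(%j. p (%y. t j x * s j x y - b x * f x y)) ~~> 0"
  proof (rule Lim_null_comparison[OF always_eventually[OF allI], rotated])
   fix j
   have E: "(%y. t j x * s j x y - b x * f x y) = (%y. t j x * (s j x y - f x y) + (t j x - b x) * f x y)"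
    by (simp add: algebra_simps)
   show "norm (p (%y. t j x * s j x y - b x * f x y)) <= \<bar>t j x\<bar> * p (%y. s j x y - f x y) + \<bar>t j x - b x\<bar> * p (f x)"
    using triangle[OF cmult[OF V] cmult[OF s(4)[OF x]], of "t j x" j "t j x - b x"]
     nonneg[OF add[OF cmult[OF V] cmult[OF s(4)[OF x]]], of "t j x" j "t j x - b x"]
    unfolding E scale[OF V] scale[OF s(4)[OF x]] by simp
  qed
 qed
 moreover have "simple_function M (%x y. t j x * s j x y)" for j
  by (rule simple_function_compose2[OF t(1) s(1), of "%a u y. a * u y"])
 ultimately show ?thesis
  unfolding strongly_measurable_def using s(2,4)
  by (intro conjI ballI exI[of _ "%j x y. t j x * s j x y"]) (auto intro: cmult)
qed

lemma strongly_measurable_cong: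
 assumes "strongly_measurable M V p f" "!!x. x : space M ==> g x : V"
  and 0: "!!x. x : space M ==> p (%y. f x y - g x y) = 0"
 shows "strongly_measurable M V p g"
proof -
 obtain s where s: "!!j. simple_function M (s j)" "!!j x. x : space M ==> s j x : V"
  "AE x in M. (%j. p (%y. s j x y - f x y)) ~~> 0" "!!x. x : space M ==> f x : V"
  using assms(1) unfolding strongly_measurable_def by blast
 have "AE x in M. (%j. p (%y. s j x y - g x y)) ~~> 0"
  using s(3) AE_space
 proof eventually_elim
  fix x assume lim: "(%j. p (%y. s j x y - f x y)) ~~> 0" and x: "x : space M"
  show "(%j. p (%y. s j x y - g x y)) ~~> 0"
   by (rule Lim_null_comparison[OF always_eventually[OF allI] lim])
    (use triangle_diff[OF s(2)[OF x] s(4)[OF x] assms(2)[OF x]] nonneg[OF diff[OF s(2)[OF x] assms(2)[OF x]]] 0[OF x] in simp)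
 qed
 then show ?thesis unfolding strongly_measurable_def using s(1,2) assms(2) by blast
qed

text \<open>The coefficients are truncated at height \<open>m\<close> and rounded to a mesh that is fine
  enough for all the functions \<open>\<psi> i\<close> with \<open>i < m\<close>.\<close>
lemma strongly_measurable_series:
 assumes ps: "!!i :: nat. ps i : V" and h: "!!i. h i : borel_measurable M"
  and f: "!!x. x : space M ==> f x : V"
  and bd: "AE x in M. \<exists>B. \<forall>i. \<bar>h i x\<bar> <= B"
  and lim: "AE x in M. (%m. p (%y. (\<Sum>i<m. h i x * ps i y) - f x y)) ~~> 0"
 shows "strongly_measurable M V p f"
proof -
 \<comment> \<open>Rounding to mesh 1 / \<open>K m\<close> changes the partial sum by at most the
   sum of the seminorms divided by \<open>K m\<close>, which is at most 1 / (m + 1). The summand 1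
   keeps \<open>K m\<close> positive.\<close>
 define K where "K m = real (Suc m) * (1 + (\<Sum>i<m. p (ps i)))" for m :: nat
 have P: "0 <= (\<Sum>i<m. p (ps i))" for m by (intro sum_nonneg nonneg ps)
 then have K: "0 < K m" for m unfolding K_def by (intro mult_pos_pos add_pos_nonneg) auto
 define t where "t m i x = (if \<bar>h i x\<bar> <= real m then real_of_int \<lfloor>K m * h i x\<rfloor> / K m else 0)" for m i x
 have t: "simple_function M (t m i)" for m i
 proof (rule simple_function_borel_measurable)
  show "t m i : borel_measurable M" unfolding t_def using h by measurable
  have "t m i ` space M \<subseteq> insert 0 ((%z. real_of_int z / K m) ` {- \<lceil>K m * m\<rceil> - 1..\<lceil>K m * m\<rceil>})"
  proof
   fix y assume "y : t m i ` space M"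
   then obtain x where x: "y = t m i x" by blast
   show "y : insert 0 ((%z. real_of_int z / K m) ` {- \<lceil>K m * m\<rceil> - 1..\<lceil>K m * m\<rceil>})"
   proof (cases "\<bar>h i x\<bar> <= real m")
    case True
    then have "\<bar>K m * h i x\<bar> <= K m * m" using K[of m] by (simp add: abs_mult)
    then have "- \<lceil>K m * m\<rceil> - 1 <= \<lfloor>K m * h i x\<rfloor>" "\<lfloor>K m * h i x\<rfloor> <= \<lceil>K m * m\<rceil>" by linarith+
    then show ?thesis using True x by (auto simp: t_def)
   qed (simp add: x t_def)
  qed
  then show "finite (t m i ` space M)" by (rule finite_subset) simp
 qed
 define s where "s m x y = (\<Sum>i<m. t m i x * ps i y)" for m x y
 have part: "simple_function M (%x y. \<Sum>i<n. t m i x * ps i y)" for m n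
 proof (induction n)
  case (Suc n)
  have "simple_function M (%x y. t m n x * ps n y)"
   by (rule simple_function_compose1[OF t, of "%a y. a * ps n y"])
  then show ?case using simple_function_compose2[OF Suc, of _ "%u v y. u y + v y"] by simp
 qed simp
 have s1: "simple_function M (s m)" for m using part[where m=m and n=m] by (simp add: s_def[abs_def])
 have s2: "s m x : V" for m x unfolding s_def[abs_def] by (intro sum_mem cmult ps) auto
 have "AE x in M. (%m. p (%y. s m x y - f x y)) ~~> 0"
  using bd lim AE_space
 proof eventually_elim
  fix x assume ex: "\<exists>B. \<forall>i. \<bar>h i x\<bar> <= B" and x: "x : space M"
   and l: "(%m. p (%y. (\<Sum>i<m. h i x * ps i y) - f x y)) ~~> 0"
  obtain B where B: "!!i. \<bar>h i x\<bar> <= B" using ex by blast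
  define F where "F m y = (\<Sum>i<m. h i x * ps i y)" for m y
  have F: "F m : V" for m unfolding F_def[abs_def] by (intro sum_mem cmult ps) auto
  have "(%m. inverse (real (Suc m)) + p (%y. F m y - f x y)) ~~> 0 + 0"
   unfolding F_def by (rule tendsto_add[OF LIMSEQ_inverse_real_of_nat l])
  then have L: "(%m. inverse (real (Suc m)) + p (%y. F m y - f x y)) ~~> 0" by simp
  have "\<forall>\<^sub>F m in sequentially. norm (p (%y. s m x y - f x y)) <= inverse (real (Suc m)) + p (%y. F m y - f x y)"
   using eventually_ge_at_top[of "nat \<lceil>B\<rceil>"]
  proof eventually_elim
   case (elim m)
   \<comment> \<open>Here \<open>m\<close> exceeds the bound on all coefficients at
     \<open>x\<close>; the truncation is inactive and only rounding remains.\<close>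
   have "\<bar>t m i x - h i x\<bar> <= 1 / K m" for i
   proof -
    have "\<bar>h i x\<bar> <= real m" using B[of i] elim by linarith
    then have "\<bar>t m i x - h i x\<bar> = \<bar>real_of_int \<lfloor>K m * h i x\<rfloor> - K m * h i x\<bar> / K m"
     using K[of m] by (simp add: t_def field_simps)
    also have "... <= 1 / K m" using K[of m] by (intro divide_right_mono) linarith+
    finally show ?thesis .
   qed
   note tb = this
   have "(%y. s m x y - F m y) = (%y. \<Sum>i<m. (t m i x - h i x) * ps i y)"
    by (simp add: s_def F_def sum_subtractf left_diff_distrib)
   then have "p (%y. s m x y - F m y) <= (\<Sum>i<m. p (%y. (t m i x - h i x) * ps i y))"
    using p_sum_le[of "{..<m}" "%i y. (t m i x - h i x) * ps i y"] cmult ps by simp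
   also have "... <= (\<Sum>i<m. 1 / K m * p (ps i))"
    unfolding scale[OF ps] by (intro sum_mono mult_right_mono tb nonneg ps)
   also have "... = (\<Sum>i<m. p (ps i)) / K m" by (simp add: sum_divide_distrib)
   also have "... <= (1 + (\<Sum>i<m. p (ps i))) / K m" using K[of m] by (intro divide_right_mono) auto
   also have "... = inverse (real (Suc m))"
   proof -
    have "1 + (\<Sum>i<m. p (ps i)) ~= 0" using P[of m] by linarith
    then show ?thesis by (simp add: K_def inverse_eq_divide del: of_nat_Suc)
   qed
   finally have "p (%y. s m x y - F m y) <= inverse (real (Suc m))" .
   then show ?case
    using triangle_diff[OF s2[of m x] F[of m] f[OF x]] nonneg[OF diff[OF s2[of m x] f[OF x]]] by simp
  qed
  then show "(%m. p (%y. s m x y - f x y)) ~~> 0" by (rule Lim_null_comparison[OF _ L])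
 qed
 then show ?thesis unfolding strongly_measurable_def using s1 s2 f by blast
qed

end

lemma seminorm_measurable:
 fixes S :: "(real^'d) set"
 assumes "seminormed_functions V p" "strongly_measurable (leb S) V p f" "S : sets lebesgue"
 shows "(%x. p (f x)) : borel_measurable (leb S)"
proof -
 interpret seminormed_functions V p by fact
 obtain s where s: "!!j. simple_function (leb S) (s j)" "!!j x. x : S ==> s j x : V"
  "AE x in leb S. (%j. p (%y. s j x y - f x y)) ~~> 0" "!!x. x : S ==> f x : V"
  using assms(2) unfolding strongly_measurable_def space_lebesgue_on by blast
 show ?thesis
 proof (rule borel_measurable_lebesgue_on_limit_diff[OF assms(3) _ s(3)])
  show "(%x. p (s j x)) : borel_measurable (leb S)" for j
   by (rule borel_measurable_simple_function[OF simple_function_compose1[OF s(1)]])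
  show "\<bar>p (s j x) - p (f x)\<bar> <= p (%y. s j x y - f x y)" if "x : S" for j x
   by (rule reverse_triangle[OF s(2)[OF that] s(4)[OF that]])
 qed
qed

section \<open>The seminormed spaces on the cell\<close>

interpretation L2_cell: seminormed_functions "L2 unit_cell" "L2_norm unit_cell"
proof
 show "(%y. 0) : L2 unit_cell" unfolding L2_iff by (rule sq_int_const[OF finite_nu])
 fix u v :: "real^'a => real" and c
 assume u: "u : L2 unit_cell"
 show "(%y. c * u y) : L2 unit_cell" "L2_norm unit_cell (%y. c * u y) = \<bar>c\<bar> * L2_norm unit_cell u"
  using u sq_int_scaleR[of nu u c] norm2_scaleR[of nu c u] by (simp_all add: L2_iff L2_norm_eq)
 show "0 <= L2_norm unit_cell u" by (simp add: L2_norm_eq norm2_nonneg)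
 assume v: "v : L2 unit_cell"
 show "(%y. u y + v y) : L2 unit_cell" "L2_norm unit_cell (%y. u y + v y) <= L2_norm unit_cell u + L2_norm unit_cell v"
  using u v sq_int_add[of nu u v] norm2_triangle[of nu u v] by (simp_all add: L2_iff L2_norm_eq)
qed

lemma H1_per_iff:
 "v : H1_per \<longleftrightarrow> periodic v & sq_int nu v & (\<exists>g. has_weak_gradient UNIV v g & sq_int nu g)"
 by (simp add: H1_per_def L2_iff)

text \<open>Any weak gradient may replace the chosen one. As the L^2 norm of a pair, the H^1 norm
  inherits its laws from \<open>norm2\<close>.\<close>

lemma H1_per_norm_eq:
 assumes g: "has_weak_gradient UNIV v g" and v: "sq_int nu v" and sg: "sq_int nu g"
 shows "H1_per_norm v = norm2 nu (%y. (v y, g y))"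
proof -
 have ae: "AE y in nu. g y = weak_gradient UNIV v y"
  unfolding AE_lebesgue_on[OF unit_cell_sets] using weak_gradient_AE[OF open_UNIV g] by eventually_elim simp
 have "norm2 nu (weak_gradient UNIV v) = norm2 nu g"
  by (rule norm2_cong_AE[symmetric, OF sq_int_measurable[OF sg] borel_measurable_lebesgue_on_AE[OF unit_cell_sets sq_int_measurable[OF sg] ae] ae])
 then show ?thesis by (simp add: H1_per_norm_def L2_norm_eq norm2_Pair[OF v sg])
qed

interpretation H1_per: seminormed_functions H1_per H1_per_norm
proof
 show "(%y :: real^'a. 0) : H1_per"
  unfolding H1_per_iff using has_weak_gradient_const[of 0] sq_int_const[OF finite_nu]
  by (auto simp: periodic_def)
 fix u v :: "real^'a => real" and c
 assume u: "u : H1_per"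
 then obtain g where g: "has_weak_gradient UNIV u g" "sq_int nu g" "sq_int nu u" "periodic u"
  by (auto simp: H1_per_iff)
 note cg = has_weak_gradient_cmult[OF g(1), of c]
 have cu: "sq_int nu (%y. c * u y)" using sq_int_scaleR[OF g(3), of c] by simp
 show "(%y. c * u y) : H1_per"
  unfolding H1_per_iff using cg sq_int_scaleR[OF g(2)] cu g(4) by (auto simp: periodic_def)
 show "H1_per_norm (%y. c * u y) = \<bar>c\<bar> * H1_per_norm u"
  unfolding H1_per_norm_eq[OF cg cu sq_int_scaleR[OF g(2)]] H1_per_norm_eq[OF g(1,3,2)]
  using norm2_scaleR[of nu c "%y. (u y, g y)"] by simp
 show "0 <= H1_per_norm u" unfolding H1_per_norm_eq[OF g(1,3,2)] by (rule norm2_nonneg)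
 assume v: "v : H1_per"
 then obtain h where h: "has_weak_gradient UNIV v h" "sq_int nu h" "sq_int nu v" "periodic v"
  by (auto simp: H1_per_iff)
 note s = has_weak_gradient_add[OF open_UNIV g(1) h(1)] sq_int_add[OF g(3) h(3)] sq_int_add[OF g(2) h(2)]
 show "(%y. u y + v y) : H1_per"
  unfolding H1_per_iff using s g(4) h(4) by (auto simp: periodic_def)
 show "H1_per_norm (%y. u y + v y) <= H1_per_norm u + H1_per_norm v"
  unfolding H1_per_norm_eq[OF s] H1_per_norm_eq[OF g(1,3,2)] H1_per_norm_eq[OF h(1,3,2)]
  using norm2_triangle[of nu "%y. (u y, g y)" "%y. (v y, h y)"] g h by (simp add: sq_int_Pair)
qed

lemma H1_per_const: "(%y. c) : H1_per"
 unfolding H1_per_iff using has_weak_gradient_const[of c] sq_int_const[OF finite_nu]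
 by (auto simp: periodic_def)

lemma quotient_norm_bdd_below:
 assumes "u : H1_per"
 shows "bdd_below (range (%c. H1_per_norm (%y. u y - c)))"
 by (rule bdd_belowI[of _ 0]) (use H1_per.nonneg[OF H1_per.diff[OF assms H1_per_const]] in auto)

lemma quotient_norm_le: "u : H1_per ==> H1_per_quotient_norm u <= H1_per_norm (%y. u y - c)"
 unfolding H1_per_quotient_norm_def by (rule cINF_lower[OF quotient_norm_bdd_below UNIV_I])

lemma quotient_norm_ge: "(!!c. b <= H1_per_norm (%y. u y - c)) ==> b <= H1_per_quotient_norm u"
 unfolding H1_per_quotient_norm_def by (rule cINF_greatest) auto

interpretation H1_quotient: seminormed_functions H1_per H1_per_quotient_norm
proof
 fix u v :: "real^'a => real" and c
 assume u: "u : H1_per"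
 show "0 <= H1_per_quotient_norm u"
  by (rule quotient_norm_ge) (rule H1_per.nonneg[OF H1_per.diff[OF u H1_per_const]])
 \<comment> \<open>Constants are rescaled along with the function. The opposite inequality is the
   same one for the factor 1 / c.\<close>
 have le: "H1_per_quotient_norm (%y. c * u y) <= \<bar>c\<bar> * H1_per_quotient_norm u"
  if c: "c ~= 0" and u: "u : H1_per" for c and u :: "real^'a => real"
 proof -
  have "H1_per_quotient_norm (%y. c * u y) / \<bar>c\<bar> <= H1_per_quotient_norm u"
  proof (rule quotient_norm_ge)
   fix b
   have "H1_per_quotient_norm (%y. c * u y) <= H1_per_norm (%y. c * u y - c * b)"
    by (rule quotient_norm_le[OF H1_per.cmult[OF u]])
   also have "... = \<bar>c\<bar> * H1_per_norm (%y. u y - b)"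
    using H1_per.scale[OF H1_per.diff[OF u H1_per_const], of c b] by (simp add: right_diff_distrib)
   finally show "H1_per_quotient_norm (%y. c * u y) / \<bar>c\<bar> <= H1_per_norm (%y. u y - b)"
    using c by (simp add: divide_le_eq mult.commute)
  qed
  then show ?thesis using c by (simp add: divide_le_eq mult.commute)
 qed
 have z: "H1_per_quotient_norm (%y :: real^'a. 0) = 0"
 proof (rule antisym)
  show "H1_per_quotient_norm (%y :: real^'a. 0) <= 0"
   using quotient_norm_le[OF H1_per.zero[where 'a='a], of 0] H1_per.p_zero[where 'a='a] by simp
  show "0 <= H1_per_quotient_norm (%y :: real^'a. 0)"
   by (rule quotient_norm_ge) (rule H1_per.nonneg[OF H1_per.diff[OF H1_per_const H1_per_const]])
 qed
 show "H1_per_quotient_norm (%y. c * u y) = \<bar>c\<bar> * H1_per_quotient_norm u"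
 proof (cases "c = 0")
  case False
  have "H1_per_quotient_norm u <= \<bar>1 / c\<bar> * H1_per_quotient_norm (%y. c * u y)"
   using le[of "1 / c" "%y. c * u y"] False H1_per.cmult[OF u] by simp
  then have "\<bar>c\<bar> * H1_per_quotient_norm u <= H1_per_quotient_norm (%y. c * u y)"
   using False by (simp add: field_simps)
  then show ?thesis using le[OF False u] by simp
 qed (simp add: z)
 assume v: "v : H1_per"
 \<comment> \<open>The two infima are taken one after the other, with the constant for
   \<open>u\<close> fixed first.\<close>
 have A: "H1_per_quotient_norm (%y. u y + v y) - H1_per_norm (%y. u y - a) <= H1_per_quotient_norm v" for a
 proof (rule quotient_norm_ge)
  fix b
  have "H1_per_quotient_norm (%y. u y + v y) <= H1_per_norm (%y. u y + v y - (a + b))"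
   by (rule quotient_norm_le[OF H1_per.add[OF u v]])
  also have "... <= H1_per_norm (%y. u y - a) + H1_per_norm (%y. v y - b)"
   using H1_per.triangle[OF H1_per.diff[OF u H1_per_const] H1_per.diff[OF v H1_per_const], of a b]
   by (simp add: algebra_simps)
  finally show "H1_per_quotient_norm (%y. u y + v y) - H1_per_norm (%y. u y - a) <= H1_per_norm (%y. v y - b)"
   by simp
 qed
 have "H1_per_quotient_norm (%y. u y + v y) - H1_per_quotient_norm v <= H1_per_quotient_norm u"
 proof (rule quotient_norm_ge)
  fix a
  show "H1_per_quotient_norm (%y. u y + v y) - H1_per_quotient_norm v <= H1_per_norm (%y. u y - a)"
   using A[of a] by simp
 qed
 then show "H1_per_quotient_norm (%y. u y + v y) <= H1_per_quotient_norm u + H1_per_quotient_norm v" by simp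
qed (auto intro: H1_per.zero H1_per.add H1_per.cmult)

text \<open>Strong measurability may be checked with the larger norm of \<open>H\<^sup>1\<^sub>p\<^sub>e\<^sub>r(Y)\<close>.\<close>
lemma strongly_measurable_quotient:
 assumes "strongly_measurable M H1_per H1_per_norm f"
 shows "strongly_measurable M H1_per H1_per_quotient_norm f"
proof -
 obtain s where s: "!!j. simple_function M (s j)" "!!j x. x : space M ==> s j x : H1_per"
  "AE x in M. (%j. H1_per_norm (%y. s j x y - f x y)) ~~> 0" "!!x. x : space M ==> f x : H1_per"
  using assms(1) unfolding strongly_measurable_def by blast
 have "AE x in M. (%j. H1_per_quotient_norm (%y. s j x y - f x y)) ~~> 0"
  using s(3) AE_space
 proof eventually_elim
  fix x assume lim: "(%j. H1_per_norm (%y. s j x y - f x y)) ~~> 0" and x: "x : space M"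
  show "(%j. H1_per_quotient_norm (%y. s j x y - f x y)) ~~> 0"
   by (rule Lim_null_comparison[OF always_eventually[OF allI] lim])
    (use quotient_norm_le[OF H1_per.diff[OF s(2)[OF x] s(4)[OF x]], of _ 0]
     H1_quotient.nonneg[OF H1_per.diff[OF s(2)[OF x] s(4)[OF x]]] in simp)
 qed
 then show ?thesis unfolding strongly_measurable_def using s(1,2,4) by blast
qed

section \<open>Reduction of two-scale convergence to plane waves\<close>

context lp_setting
begin

text \<open>A simple approximation of \<open>f\<close> takes finitely many values, each a uniform
  limit of trigonometric polynomials. Almost everywhere convergence has no dominating function by
  itself, so the approximation is set to 0 where it is still far from \<open>f\<close>; the error
  there is bounded by \<open>f\<close>.\<close>

lemma L2_C_per_approx:
 assumes f: "f : L2_C_per Om" and e: "0 < e"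
 obtains Y :: "(real^'d => real) set" and a ps h where "finite Y" "!!c. c : Y ==> sq_int mu (a c)"
  "!!c. c : Y ==> ps c : trig_polys" "!!x y. x : Om ==> (f x y - (\<Sum>c\<in>Y. a c x * ps c y))\<^sup>2 <= h x"
  "integrable mu h" "(LINT x|mu. h x) < e"
proof -
 obtain s where s: "!!j. simple_function mu (s j)" "!!j x. x : Om ==> s j x : C_per"
  "AE x in mu. (%j. sup_norm (%y. s j x y - f x y)) ~~> 0" "!!x. x : Om ==> f x : C_per"
  "integrable mu (%x. (sup_norm (f x))\<^sup>2)"
  using L2_C_perE[OF f] by blast
 interpret finite_measure mu by (rule finite_measure_mu)
 define d where "d j x = sup_norm (%y. s j x y - f x y)" for j x
 have d0: "0 <= d j x" if "x : Om" for j x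
  unfolding d_def by (rule sup_norm_nonneg[OF C_per_diff[OF s(2) s(4)]]) (rule that)+
 have dm: "d j : borel_measurable mu" for j
 proof (rule borel_measurable_lebesgue_on_AE_limit[OF Om_sets])
  show "(%x. sup_norm (%y. s j x y - s i x y)) : borel_measurable mu" for i
   by (rule borel_measurable_simple_function[OF simple_function_compose2[OF s(1) s(1)]])
  show "AE x in mu. (%i. sup_norm (%y. s j x y - s i x y)) ~~> d j x"
   using s(3) AE_space
  proof eventually_elim
   fix x assume lim: "(%i. sup_norm (%y. s i x y - f x y)) ~~> 0" and "x : space mu"
   then have x: "x : Om" by simp
   have "\<bar>sup_norm (%y. s j x y - s i x y) - d j x\<bar> <= sup_norm (%y. s i x y - f x y)" for i
    using sup_norm_triangle[OF s(2)[OF x, of j] s(4)[OF x] s(2)[OF x, of i]]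
     sup_norm_triangle[OF s(2)[OF x, of j] s(2)[OF x, of i] s(4)[OF x]] sup_norm_commute[of "f x" "s i x"]
    unfolding d_def by linarith
   then have "(%i. sup_norm (%y. s j x y - s i x y) - d j x) ~~> 0"
    by (intro Lim_null_comparison[OF always_eventually[OF allI] lim]) simp
   then show "(%i. sup_norm (%y. s j x y - s i x y)) ~~> d j x" by (simp add: LIM_zero_iff)
  qed
 qed
 \<comment> \<open>On \<open>G j\<close> the squared error is at most 1, off it at most that of
   approximating \<open>f\<close> by 0. Their maximum is integrable and every point is eventually in
   \<open>G j\<close>, outside a null set.\<close>
 define G where "G j = {x : Om. d j x <= 1}" for j
 have Gs: "G j : sets mu" for j
  using borel_measurable_le[OF dm[of j] borel_measurable_const[of "1::real"]] by (simp add: G_def)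
 define h where "h j x = (if x : G j then (d j x)\<^sup>2 else (sup_norm (f x))\<^sup>2)" for j x
 have Fm: "(%x. (sup_norm (f x))\<^sup>2) : borel_measurable mu" by (rule borel_measurable_integrable[OF s(5)])
 have hm: "h j : borel_measurable mu" for j
 proof -
  have "(%x. if x : G j then (d j x)\<^sup>2 else (sup_norm (f x))\<^sup>2) : borel_measurable mu"
   by (rule measurable_If_set[OF borel_measurable_power[OF dm] Fm]) (use Gs[of j] sets.sets_into_space[OF Gs[of j]] in \<open>simp add: Int_absorb2\<close>)
  then show ?thesis by (simp add: h_def[abs_def])
 qed
 have bd: "norm (h j x) <= 1 + (sup_norm (f x))\<^sup>2" if "x : Om" for j x
 proof (cases "x : G j")
  case True
  then have "(d j x)\<^sup>2 <= 1" using d0[OF that, of j] by (simp add: G_def power_le_one)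
  then have "(d j x)\<^sup>2 <= 1 + (sup_norm (f x))\<^sup>2" by (rule order_trans) simp
  then show ?thesis using True by (simp add: h_def)
 qed (simp add: h_def)
 have ib: "integrable mu (%x. 1 + (sup_norm (f x))\<^sup>2)"
  by (rule intble_add[OF integrable_const s(5)])
 have hi: "integrable mu (h j)" for j
  by (rule intble_bound[OF ib hm]) (use bd in \<open>auto intro!: AE_I2 order_trans[OF bd]\<close>)
 have lim: "(%j. LINT x|mu. h j x) ~~> (LINT x|mu. 0)"
 proof (rule integral_dominated_convergence[OF _ hm ib])
  show "AE x in mu. (%j. h j x) ~~> 0"
   using s(3) AE_space
  proof eventually_elim
   fix x assume lim: "(%i. sup_norm (%y. s i x y - f x y)) ~~> 0" and "x : space mu"
   then have x: "x : Om" by simp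
   have l: "(%i. d i x) ~~> 0" using lim by (simp add: d_def)
   then have "\<forall>\<^sub>F i in sequentially. d i x < 1" by (rule order_tendstoD) simp
   then have "\<forall>\<^sub>F i in sequentially. (d i x)\<^sup>2 = h i x" by eventually_elim (simp add: h_def G_def x)
   moreover have "(%i. (d i x)\<^sup>2) ~~> 0" using tendsto_power[OF l, of 2] by simp
   ultimately show "(%i. h i x) ~~> 0" by (rule Lim_transform_eventually[rotated])
  qed
  show "AE x in mu. norm (h j x) <= 1 + (sup_norm (f x))\<^sup>2" for j using bd by (intro AE_I2) simp
 qed simp
 then have "(%j. LINT x|mu. h j x) ~~> 0" by simp
 then have "\<forall>\<^sub>F j in sequentially. (LINT x|mu. h j x) < e / 4" by (rule order_tendstoD) (use e in simp)
 then obtain j where j: "(LINT x|mu. h j x) < e / 4" by (auto simp: eventually_sequentially)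
 \<comment> \<open>Chosen so that the constant 2 e1^2 integrates to at most \<open>e / 4\<close>
   over the domain; the other part contributes less than \<open>e / 2\<close>.\<close>
 define e1 where "e1 = sqrt (e / (8 * (1 + measure lebesgue Om)))"
 have m0: "0 <= measure lebesgue Om" by simp
 have e1: "0 < e1" "e1\<^sup>2 = e / (8 * (1 + measure lebesgue Om))"
  using e m0 by (simp_all add: e1_def add_pos_nonneg)
 have "\<exists>ps\<in>trig_polys. \<forall>y. \<bar>c y - ps y\<bar> < e1" if c: "c : s j ` Om" for c
 proof -
  have "c : C_per" using c s(2) by blast
  then show ?thesis using trig_polys_dense[of c e1] e1(1) by (metis C_per_def mem_Collect_eq)
 qed
 then obtain ps where ps: "!!c. c : s j ` Om ==> ps c : trig_polys" "!!c y. c : s j ` Om ==> \<bar>c y - ps c y\<bar> < e1"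
  by metis
 define a where "a c = (indicator (s j -` {c} \<inter> Om \<inter> G j) :: real^'d => real)" for c
 have fin: "finite (s j ` Om)" using s(1)[of j] by (auto simp: simple_function_def)
 show thesis
 proof (rule that[of "s j ` Om" a ps "%x. 2 * h j x + 2 * e1\<^sup>2"])
  show "finite (s j ` Om)" by (rule fin)
  show "ps c : trig_polys" if "c : s j ` Om" for c by (rule ps(1)[OF that])
  show "sq_int mu (a c)" if "c : s j ` Om" for c
  proof (rule sq_int_bounded[OF finite_measure_axioms, where c=1])
   have "s j -` {c} \<inter> Om : sets mu" using s(1)[of j] that by (auto simp: simple_function_def)
   then show "a c : borel_measurable mu"
    unfolding a_def by (rule borel_measurable_indicator[OF sets.Int[OF _ Gs]])
   show "norm (a c x) <= 1" for x by (simp add: a_def indicator_def)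
  qed
  show "(f x y - (\<Sum>c\<in>s j ` Om. a c x * ps c y))\<^sup>2 <= 2 * h j x + 2 * e1\<^sup>2" if x: "x : Om" for x y
  proof (cases "x : G j")
   case True
   have "(\<Sum>c\<in>s j ` Om. a c x * ps c y) = (\<Sum>c\<in>s j ` Om. if c = s j x then ps c y else 0)"
    using x True by (intro sum.cong refl) (auto simp: a_def indicator_def)
   also have "... = ps (s j x) y" using fin x by simp
   finally have S: "(\<Sum>c\<in>s j ` Om. a c x * ps c y) = ps (s j x) y" .
   have "\<bar>s j x y - f x y\<bar> <= d j x"
    unfolding d_def by (rule C_per_abs_le_sup_norm[OF C_per_diff[OF s(2)[OF x] s(4)[OF x]]])
   moreover have "\<bar>s j x y - ps (s j x) y\<bar> <= e1" using ps(2)[of "s j x" y] x by simp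
   ultimately have "\<bar>f x y - ps (s j x) y\<bar> <= \<bar>d j x + e1\<bar>" by linarith
   then have "(f x y - ps (s j x) y)\<^sup>2 <= (d j x + e1)\<^sup>2" by (simp only: abs_le_square_iff)
   also have "... <= 2 * (d j x)\<^sup>2 + 2 * e1\<^sup>2"
    using sum_squares_bound[of "d j x" e1] by (simp add: power2_sum)
   finally show ?thesis using True by (simp add: S h_def)
  next
   case False
   then have S: "(\<Sum>c\<in>s j ` Om. a c x * ps c y) = 0" by (intro sum.neutral) (simp add: a_def)
   have "\<bar>f x y\<bar> <= \<bar>sup_norm (f x)\<bar>" using C_per_abs_le_sup_norm[OF s(4)[OF x], of y] by linarith
   then have "(f x y)\<^sup>2 <= (sup_norm (f x))\<^sup>2" by (simp only: abs_le_square_iff)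
   moreover have "h j x = (sup_norm (f x))\<^sup>2" using False by (simp add: h_def)
   moreover have "0 <= (sup_norm (f x))\<^sup>2" "0 <= e1\<^sup>2" by simp_all
   ultimately show ?thesis unfolding S diff_0_right by linarith
  qed
  show "integrable mu (%x. 2 * h j x + 2 * e1\<^sup>2)"
   by (rule intble_add[OF integrable_mult_right[OF hi] integrable_const])
  have "(LINT x|mu. 2 * h j x + 2 * e1\<^sup>2) = (LINT x|mu. 2 * h j x) + (LINT x|mu. 2 * e1\<^sup>2)"
   by (rule LINT_add[OF integrable_mult_right[OF hi] integrable_const])
  also have "(LINT x|mu. 2 * e1\<^sup>2) = 2 * e1\<^sup>2 * measure lebesgue Om"
   using Om_sets by (simp add: measure_restrict_space)
  also have "... <= e / 4"
   using e m0 by (simp add: e1(2) divide_simps mult.commute add_pos_nonneg)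
  finally show "(LINT x|mu. 2 * h j x + 2 * e1\<^sup>2) < e" using j e by simp
 qed
qed

lemma L_diff_square_le:
 assumes "!!y. (f x y - g x y)\<^sup>2 <= c"
 shows "(L k f x - L k g x)\<^sup>2 <= c"
proof (cases rule: L_cases[of k x])
 case off
 have "0 <= c" using order_trans[OF zero_le_power2 assms] .
 then show ?thesis by (simp add: off)
qed (use assms in simp)

lemma L_add: "L k (%x y. f x y + g x y) x = L k f x + L k g x"
 by (cases rule: L_cases[of k x]) auto

lemma L_cmult: "L k (%x y. a x * f x y) x = a x * L k f x"
 by (cases rule: L_cases[of k x]) auto

lemma L_sum: "L k (%x y. \<Sum>c\<in>Y. f c x y) x = (\<Sum>c\<in>Y. L k (f c) x)"
 by (cases rule: L_cases[of k x]) auto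

lemma trig_polys_sq_int:
 assumes "ps : trig_polys" "sq_int mu F"
 shows "sq_int mu (%x. F x * L k (%x. ps) x)"
proof -
 have C: "ps : C_per" by (rule trig_polys_C_per[OF assms(1)])
 have "sq_int mu (%x. L k (%x. ps) x * F x)"
 proof (rule sq_int_bounded_times[OF assms(2) L_continuous_measurable[OF C_per_continuous[OF C]]])
  fix x
  show "\<bar>L k (%x. ps) x\<bar> <= sup_norm ps"
   using L_le_sup_norm[of "%x. ps" x k] C by simp
 qed
 then show ?thesis by (simp add: mult.commute)
qed

lemma sq_int_cell_C_per: "f : C_per ==> sq_int nu f"
 by (rule sq_int_bounded[OF finite_nu continuous_borel[OF C_per_continuous]])
  (auto intro: C_per_abs_le_sup_norm)

lemma L2_C_per_const: "ps : C_per ==> (%x. ps) : L2_C_per Om"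
 using L2_C_per_step[of ps "%x. 1"] by simp

lemma pairing_trig_sq_int:
 assumes w: "w : L2_L2 Om" and ps: "ps : C_per"
 shows "sq_int mu (%x. LINT y|nu. w x y * ps y)"
proof -
 have W: "!!x. x : Om ==> sq_int nu (w x)" "integrable mu (%x. (norm2 nu (w x))\<^sup>2)"
  using L2_L2E[OF w] by blast+
 have m: "(%x. LINT y|nu. w x y * ps y) : borel_measurable mu"
  by (rule weak_pairing_measurable(1)[OF w L2_C_per_const[OF ps]])
 have "integrable mu (%x. (norm (LINT y|nu. w x y * ps y))\<^sup>2)"
 proof (rule intble_bound[OF integrable_mult_right[OF W(2), of "(sup_norm ps)\<^sup>2"]])
  show "(%x. (norm (LINT y|nu. w x y * ps y))\<^sup>2) : borel_measurable mu"
   using m by measurable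
  show "AE x in mu. norm ((norm (LINT y|nu. w x y * ps y))\<^sup>2) <= norm ((sup_norm ps)\<^sup>2 * (norm2 nu (w x))\<^sup>2)"
  proof (rule AE_I2)
   fix x assume "x : space mu"
   then have "\<bar>LINT y|nu. w x y * ps y\<bar> <= norm2 nu (w x) * sup_norm ps"
    by (intro cell_integral_bound(2) W(1) continuous_borel[OF C_per_continuous] C_per_abs_le_sup_norm ps) auto
   then have "\<bar>LINT y|nu. w x y * ps y\<bar>\<^sup>2 <= (norm2 nu (w x) * sup_norm ps)\<^sup>2"
    by (intro power_mono) auto
   then show "norm ((norm (LINT y|nu. w x y * ps y))\<^sup>2) <= norm ((sup_norm ps)\<^sup>2 * (norm2 nu (w x))\<^sup>2)"
    by (simp add: power_mult_distrib mult.commute)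
  qed
 qed
 then show ?thesis using m by (simp add: sq_int_def)
qed

text \<open>Trigonometric polynomials with square-integrable coefficients suffice as test functions.\<close>
theorem weak_limit_extend:
 assumes v: "!!k. sq_int mu (v k)" "!!k. norm2 mu (v k) <= B" and w: "w : L2_L2 Om"
  and H: "!!a m th. sq_int mu a ==> integer_vector m ==>
   (%k. LINT x|mu. (v k x * osc k m th x) * a x) ~~> (LINT x|mu. a x * (LINT y|nu. w x y * tcos m th y))"
  and f: "f : L2_C_per Om"
 shows "(%k. LINT x|mu. v k x * L k f x) ~~> (LINT x|mu. LINT y|nu. w x y * f x y)"
proof -
 have W: "!!x. x : Om ==> sq_int nu (w x)" "integrable mu (%x. (norm2 nu (w x))\<^sup>2)"
  using L2_L2E[OF w] by blast+
 have Fc: "!!x. x : Om ==> f x : C_per" using L2_C_perE[OF f] by blast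
 have B0: "0 <= B" using norm2_nonneg v(2) order_trans by blast
 have trig: "(%k. LINT x|mu. (v k x * L k (%x. ps) x) * a x) ~~> (LINT x|mu. a x * (LINT y|nu. w x y * ps y))"
  if "ps : trig_polys" "sq_int mu a" for ps a
  using that(1)
 proof induction
  case (cos m th)
  have "L k (%x. tcos m th) = osc k m th" for k by (simp add: osc_def tcos_def[abs_def])
  then show ?case using H[OF that(2) cos] by simp
 next
  case (add f g)
  note i1 = sq_mult_int[OF trig_polys_sq_int[OF add(1) v(1)] that(2)]
  note i2 = sq_mult_int[OF trig_polys_sq_int[OF add(2) v(1)] that(2)]
  note C = add(1,2)[THEN trig_polys_C_per]
  note j1 = sq_mult_int[OF that(2) pairing_trig_sq_int[OF w C(1)]]
  note j2 = sq_mult_int[OF that(2) pairing_trig_sq_int[OF w C(2)]]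
  have "(LINT x|mu. (v k x * L k (%x y. f y + g y) x) * a x) =
    (LINT x|mu. (v k x * L k (%x. f) x) * a x) + (LINT x|mu. (v k x * L k (%x. g) x) * a x)" for k
   unfolding L_add[of k "%x. f" "%x. g"] LINT_add[OF i1 i2, symmetric]
   by (simp add: algebra_simps)
  moreover have "(LINT x|mu. a x * (LINT y|nu. w x y * (f y + g y))) =
    (LINT x|mu. a x * (LINT y|nu. w x y * f y)) + (LINT x|mu. a x * (LINT y|nu. w x y * g y))"
   unfolding LINT_add[OF j1 j2, symmetric]
  proof (rule LINT_cong[OF refl])
   fix x assume "x : space mu"
   then have wx: "sq_int nu (w x)" using W(1) by simp
   show "a x * (LINT y|nu. w x y * (f y + g y)) =
     a x * (LINT y|nu. w x y * f y) + a x * (LINT y|nu. w x y * g y)"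
    unfolding distrib_left LINT_add[OF sq_mult_int[OF wx sq_int_cell_C_per[OF C(1)]] sq_mult_int[OF wx sq_int_cell_C_per[OF C(2)]]] ..
  qed
  ultimately show ?case using tendsto_add[OF add.IH] by simp
 next
  case (scale f c)
  have "(LINT x|mu. (v k x * L k (%x y. c * f y) x) * a x) = c * (LINT x|mu. (v k x * L k (%x. f) x) * a x)" for k
   unfolding L_cmult[of k "%x. c" "%x. f"] by (simp add: mult.left_commute mult.assoc flip: integral_mult_right_zero)
  moreover have "(LINT x|mu. a x * (LINT y|nu. w x y * (c * f y))) = c * (LINT x|mu. a x * (LINT y|nu. w x y * f y))"
   by (simp add: mult.left_commute flip: integral_mult_right_zero)
  ultimately show ?case using tendsto_mult_left[OF scale.IH, of c] by simp
 qed
 define l where "l = (LINT x|mu. LINT y|nu. w x y * f x y)"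
 \<comment> \<open>A common bound for the two norms that multiply the approximation error: that of
   the sequence before the limit and that of \<open>w\<close> in the limit.\<close>
 define K where "K = B + norm2 mu (%x. norm2 nu (w x)) + 1"
 have K: "0 < K" using B0 norm2_nonneg[of mu "%x. norm2 nu (w x)"] unfolding K_def by linarith
 show ?thesis
  unfolding l_def[symmetric]
 proof (rule LIMSEQ_I)
  fix e :: real assume e: "0 < e"
  define e2 where "e2 = (e / (4 * K))\<^sup>2"
  have e2: "0 < e2" "sqrt e2 = e / (4 * K)" using e K by (simp_all add: e2_def)
  obtain Y :: "(real^'d => real) set" and a ps h where Y: "finite Y" "!!c. c : Y ==> sq_int mu (a c)"
   "!!c. c : Y ==> ps c : trig_polys" "!!x y. x : Om ==> (f x y - (\<Sum>c\<in>Y. a c x * ps c y))\<^sup>2 <= h x"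
   "integrable mu h" "(LINT x|mu. h x) < e2"
   using L2_C_per_approx[OF f e2(1)] by blast
  define F where "F x y = (\<Sum>c\<in>Y. a c x * ps c y)" for x y
  define lF where "lF = (\<Sum>c\<in>Y. LINT x|mu. a c x * (LINT y|nu. w x y * ps c y))"
  have sh: "sqrt (LINT x|mu. h x) <= e / (4 * K)" using Y(6) by (simp flip: e2(2))
  have h0: "0 <= h x" if "x : Om" for x using order_trans[OF zero_le_power2 Y(4)[OF that]] .
  have LF: "L k F x = (\<Sum>c\<in>Y. L k (%x. ps c) x * a c x)" for k x
   unfolding F_def L_sum
 proof (rule sum.cong[OF refl])
  fix c
  show "L k (%x y. a c x * ps c y) x = L k (%x. ps c) x * a c x"
   unfolding L_cmult[of k "a c" "%x. ps c"] by (simp only: mult.commute[of "L k (%x. ps c) x"])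
 qed
  have vF: "integrable mu (%x. (v k x * L k (%x. ps c) x) * a c x)" if "c : Y" for k c
   by (rule sq_mult_int[OF trig_polys_sq_int[OF Y(3)[OF that] v(1)] Y(2)[OF that]])
  have vLF: "(%x. v k x * L k F x) = (%x. \<Sum>c\<in>Y. (v k x * L k (%x. ps c) x) * a c x)" for k
   by (simp add: LF sum_distrib_left mult.assoc)
  have ivF: "integrable mu (%x. v k x * L k F x)" for k
   unfolding vLF by (rule intble_sum[OF vF])
  have "(LINT x|mu. v k x * L k F x) = (\<Sum>c\<in>Y. LINT x|mu. (v k x * L k (%x. ps c) x) * a c x)" for k
   unfolding vLF by (rule LINT_sum[OF vF])
  then have "(%k. LINT x|mu. v k x * L k F x) ~~> lF"
   unfolding lF_def using tendsto_sum[of Y, OF trig[OF Y(3,2)]] by simp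
  then obtain n where n: "!!k. k >= n ==> \<bar>(LINT x|mu. v k x * L k F x) - lF\<bar> < e / 4"
   using LIMSEQ_D[of _ lF "e / 4"] e by fastforce
  have step1: "\<bar>(LINT x|mu. v k x * L k f x) - (LINT x|mu. v k x * L k F x)\<bar> <= e / 4" for k
  proof -
   have ivf: "integrable mu (%x. v k x * L k f x)" by (rule sq_mult_int[OF v(1) sq_int_L[OF f]])
   have Lm: "(%x. L k f x - L k F x) : borel_measurable mu"
    unfolding LF using Y(2,3)
    by (intro borel_measurable_diff L_measurable[OF f] borel_measurable_sum borel_measurable_times
      L_continuous_measurable C_per_continuous trig_polys_C_per) (auto simp: sq_int_measurable)
   have le: "(norm (L k f x - L k F x))\<^sup>2 <= h x" if "x : Om" for x
    using L_diff_square_le[of f x F "h x" k] Y(4)[OF that] by (simp add: F_def)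
   have sq: "sq_int mu (%x. L k f x - L k F x)"
    unfolding sq_int_def
   proof (rule conjI[OF Lm intble_bound[OF Y(5) _ AE_I2]])
    show "(%x. (norm (L k f x - L k F x))\<^sup>2) : borel_measurable mu" using Lm by measurable
   next
    fix x assume "x : space mu"
    then have "x : Om" by simp
    then show "norm ((norm (L k f x - L k F x))\<^sup>2) <= norm (h x)" using le[of x] h0[of x] by simp
   qed
   have "norm2 mu (%x. L k f x - L k F x) <= sqrt (LINT x|mu. h x)"
    unfolding norm2_def real_sqrt_le_iff
    by (rule LINT_mono[OF _ Y(5)]) (use sq le in \<open>auto simp: sq_int_def\<close>)
   then have nL: "norm2 mu (%x. L k f x - L k F x) <= e / (4 * K)" using sh by (rule order_trans)
   have D: "(LINT x|mu. v k x * L k f x) - (LINT x|mu. v k x * L k F x) = (LINT x|mu. v k x * (L k f x - L k F x))"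
    unfolding LINT_diff[OF ivf ivF, symmetric] by (simp add: right_diff_distrib)
   have "\<bar>LINT x|mu. v k x * (L k f x - L k F x)\<bar> <= norm2 mu (v k) * norm2 mu (%x. L k f x - L k F x)"
    by (rule Cauchy_Schwarz_integral_real[OF v(1) sq])
   also have "... <= K * (e / (4 * K))"
   proof (rule mult_mono[OF _ nL _ norm2_nonneg])
    show "norm2 mu (v k) <= K"
     using v(2)[of k] norm2_nonneg[of mu "%x. norm2 nu (w x)"] unfolding K_def by linarith
   qed (use K in simp)
   also have "... = e / 4" using K by simp
   finally show ?thesis unfolding D .
  qed
  \<comment> \<open>Cauchy-Schwarz twice, on the cell for fixed \<open>x\<close> and then over the
    domain.\<close>
  have step2: "\<bar>lF - l\<bar> <= e / 4"
  proof -
   have j: "integrable mu (%x. a c x * (LINT y|nu. w x y * ps c y))" if "c : Y" for c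
    by (rule sq_mult_int[OF Y(2)[OF that] pairing_trig_sq_int[OF w trig_polys_C_per[OF Y(3)[OF that]]]])
   define S where "S x = (\<Sum>c\<in>Y. a c x * (LINT y|nu. w x y * ps c y))" for x
   have iS: "integrable mu S" unfolding S_def[abs_def] by (rule intble_sum[OF j])
   have lS: "lF = (LINT x|mu. S x)"
    unfolding lF_def S_def by (rule LINT_sum[OF j, symmetric])
   have nw: "sq_int mu (%x. norm2 nu (w x))"
    unfolding sq_int_def using W(2) seminorm_measurable[OF L2_cell.seminormed_functions_axioms _ Om_sets, of w] w
    by (simp add: L2_L2_def L2_bochner_iff L2_norm_eq)
   have hs: "sq_int mu (%x. sqrt (h x))"
    unfolding sq_int_def
   proof
    show "(%x. sqrt (h x)) : borel_measurable mu" using borel_measurable_integrable[OF Y(5)] by measurable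
    show "integrable mu (%x. (norm (sqrt (h x)))\<^sup>2)"
     by (rule intble_cong[OF refl, THEN iffD2, OF _ Y(5)]) (use h0 in simp)
   qed
   have pw: "\<bar>S x - (LINT y|nu. w x y * f x y)\<bar> <= norm2 nu (w x) * sqrt (h x)" if x: "x : Om" for x
   proof -
    note wx = W(1)[OF x]
    have ic: "integrable nu (%y. w x y * ps c y)" if "c : Y" for c
     by (rule sq_mult_int[OF wx sq_int_cell_C_per[OF trig_polys_C_per[OF Y(3)[OF that]]]])
    have "S x = (\<Sum>c\<in>Y. LINT y|nu. a c x * (w x y * ps c y))" by (simp add: S_def)
    also have "... = (LINT y|nu. (\<Sum>c\<in>Y. a c x * (w x y * ps c y)))"
     by (rule LINT_sum[symmetric]) (rule integrable_mult_right[OF ic])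
    also have "... = (LINT y|nu. w x y * F x y)"
     by (simp add: F_def sum_distrib_left mult.left_commute)
    finally have SF: "S x = (LINT y|nu. w x y * F x y)" .
    have FC: "sq_int nu (F x)"
     unfolding F_def[abs_def]
    proof (rule sq_int_sum)
     fix c assume "c : Y"
     from sq_int_scaleR[OF sq_int_cell_C_per[OF trig_polys_C_per[OF Y(3)[OF this]]], of "a c x"]
     show "sq_int nu (%y. a c x * ps c y)" by simp
    qed
    note fx = sq_int_cell_C_per[OF Fc[OF x]]
    have D: "S x - (LINT y|nu. w x y * f x y) = (LINT y|nu. w x y * (F x y - f x y))"
     unfolding SF LINT_diff[OF sq_mult_int[OF wx FC] sq_mult_int[OF wx fx], symmetric]
     by (simp add: right_diff_distrib)
    have "\<bar>LINT y|nu. w x y * (F x y - f x y)\<bar> <= norm2 nu (w x) * sqrt (h x)"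
    proof (rule cell_integral_bound(2)[OF wx])
     show "(%y. F x y - f x y) : borel_measurable nu"
      by (rule sq_int_measurable[OF sq_int_diff[OF FC fx]])
     show "\<bar>F x y - f x y\<bar> <= sqrt (h x)" for y
      using Y(4)[OF x, of y] by (intro real_le_rsqrt) (simp add: F_def power2_commute)
    qed
    then show ?thesis unfolding D .
   qed
   note il = weak_pairing_measurable(2)[OF w f]
   have "\<bar>lF - l\<bar> = \<bar>LINT x|mu. S x - (LINT y|nu. w x y * f x y)\<bar>"
    unfolding lS l_def LINT_diff[OF iS il] ..
   also have "... <= (LINT x|mu. \<bar>S x - (LINT y|nu. w x y * f x y)\<bar>)"
    by (rule integral_abs_bound)
   also have "... <= (LINT x|mu. norm2 nu (w x) * sqrt (h x))"
    by (rule LINT_mono[OF integrable_abs[OF intble_diff[OF iS il]] sq_mult_int[OF nw hs]])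
     (use pw in simp)
   also have "... <= \<bar>LINT x|mu. norm2 nu (w x) * sqrt (h x)\<bar>" by (rule abs_ge_self)
   also have "... <= norm2 mu (%x. norm2 nu (w x)) * norm2 mu (%x. sqrt (h x))"
    by (rule Cauchy_Schwarz_integral_real[OF nw hs])
   also have "norm2 mu (%x. sqrt (h x)) = sqrt (LINT x|mu. h x)"
    unfolding norm2_def by (rule arg_cong[of _ _ sqrt], rule LINT_cong[OF refl]) (use h0 in simp)
   also have "norm2 mu (%x. norm2 nu (w x)) * sqrt (LINT x|mu. h x) <= K * (e / (4 * K))"
   proof (rule mult_mono[OF _ sh])
    show "0 <= sqrt (LINT x|mu. h x)"
     using integral_nonneg_AE[OF AE_I2, of mu h] h0 by simp
   qed (use K B0 in \<open>auto simp: K_def\<close>)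
   also have "... = e / 4" using K by simp
   finally show ?thesis .
  qed
  show "\<exists>n. \<forall>k\<ge>n. norm ((LINT x|mu. v k x * L k f x) - l) < e"
  proof (intro exI[of _ n] allI impI)
   fix k assume "n <= k"
   have tri: "\<bar>A - l\<bar> < e" if "\<bar>A - C\<bar> <= e / 4" "\<bar>C - lF\<bar> < e / 4" "\<bar>lF - l\<bar> <= e / 4" for A C
    using that e by linarith
   show "norm ((LINT x|mu. v k x * L k f x) - l) < e"
    unfolding real_norm_def by (rule tri[OF step1 n[OF \<open>n <= k\<close>] step2])
  qed
 qed
qed

text \<open>Substituting y = D x z turns the mean over the cell at \<open>x\<close> into an integral
  over the unit cell, the volume factors cancelling. What remains is the reduction to plane
  waves.\<close>

lemma lts_convergesI:
 assumes v: "!!k. sq_int mu (v k)" "!!k. norm2 mu (v k) <= B" and W: "(%x z. w x (D x *v z)) : L2_L2 Om"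
  and H: "!!a m th. sq_int mu a ==> integer_vector m ==>
   (%k. LINT x|mu. (v k x * osc k m th x) * a x) ~~>
    (LINT x|mu. a x * (LINT z|nu. w x (D x *v z) * tcos m th z))"
 shows "lts_converges Om D L v w"
proof -
 have inv: "matrix_inv (D x) *v (D x *v z) = z" for x z
  using matrix_inv_mult(2)[OF invertible_D[of x]] by (simp add: matrix_vector_mul_assoc)
 have inv': "D x *v (matrix_inv (D x) *v y) = y" for x y
  using matrix_inv_mult(1)[OF invertible_D[of x]] by (simp add: matrix_vector_mul_assoc)
 have Wx: "!!x. x : Om ==> sq_int nu (%z. w x (D x *v z))" using L2_L2E[OF W] by blast
 have "w : L2_L2_cells Om D"
  unfolding L2_L2_cells_def using W by (auto simp: on_cells_def inv' intro!: bexI[of _ "%x z. w x (D x *v z)"])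
 moreover have "(%k. LINT x|mu. v k x * L k f x) ~~>
   (LINT x|mu. 1 / measure lebesgue (cell D x) * (LINT y|leb (cell D x). w x y * on_cells D f x y))"
  if f: "f : L2_C_per Om" for f
 proof -
  have "1 / measure lebesgue (cell D x) * (LINT y|leb (cell D x). w x y * on_cells D f x y) =
    (LINT z|nu. w x (D x *v z) * f x z)" if x: "x : Om" for x
  proof -
   have "f x : C_per" using L2_C_perE[OF f] x by blast
   then have i: "integrable nu (%z. w x (D x *v z) * on_cells D f x (D x *v z))"
    using sq_mult_int[OF Wx[OF x] sq_int_cell_C_per] by (simp add: on_cells_def inv)
   show ?thesis
    using integral_matrix_image(2,3)[OF invertible_D[of x] unit_cell_sets i] by (simp add: cell_def on_cells_def inv)
  qed
  then have eq: "(LINT x|mu. 1 / measure lebesgue (cell D x) * (LINT y|leb (cell D x). w x y * on_cells D f x y)) =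
    (LINT x|mu. LINT z|nu. w x (D x *v z) * f x z)"
   by (intro LINT_cong) auto
  show ?thesis unfolding eq by (rule weak_limit_extend[OF v W H f])
 qed
 ultimately show ?thesis using v(1) unfolding lts_converges_def L2_iff by blast
qed

end

section \<open>Weak compactness and Bessel's inequality\<close>

lemma diagonal_convergent:
 fixes X :: "nat => nat => real"
 assumes "!!n k. \<bar>X n k\<bar> <= B n"
 obtains ph :: "nat => nat" where "strict_mono ph" "!!n. convergent (%k. X n (ph k))"
proof -
 interpret subseqs "%n s. convergent (%k. X n (s k))"
 proof
  fix n and s :: "nat => nat"
  have "bounded (range (%k. X n (s k)))"
   unfolding bounded_iff using assms[of n] by (intro exI[of _ "B n"]) auto
  then obtain l r where "strict_mono r" "((%k. X n (s k)) \<circ> r) ~~> l"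
   using bounded_imp_convergent_subsequence by blast
  then show "\<exists>r'. strict_mono r' & convergent (%k. X n ((s \<circ> r') k))"
   unfolding convergent_def o_def by blast
 qed
 have "convergent (%k. X n (diagseq k))" for n
 proof -
  \<comment> \<open>Only from index \<open>Suc n\<close> on is the diagonal sequence a subsequence
    of the n-th extracted one.\<close>
  have "convergent (%k. X n ((diagseq \<circ> ((+) (Suc n))) k))"
  proof (rule diagseq_holds)
   fix r s :: "nat => nat" and n
   assume r: "strict_mono r" and c: "convergent (%k. X n (s k))"
   then show "convergent (%k. X n ((s \<circ> r) k))"
    using convergent_subseq_convergent[OF c r] by (simp add: o_def)
  qed
  then have "convergent (%k. X n (diagseq (k + Suc n)))" by (simp add: add.commute)
  then show ?thesis by (rule convergent_ignore_initial_segment[of "%k. X n (diagseq k)" "Suc n", THEN iffD1])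
 qed
 then show thesis using that subseq_diagseq by blast
qed

lemma convergent_approx:
 fixes y :: "nat => real"
 assumes "!!e. 0 < e ==> \<exists>z. convergent z & (\<forall>k. \<bar>y k - z k\<bar> <= e)"
 shows "convergent y"
proof (rule Cauchy_convergent, rule CauchyI)
 fix e :: real assume e: "0 < e"
 obtain z where z: "convergent z" "!!k. \<bar>y k - z k\<bar> <= e / 4" using assms[of "e / 4"] e by auto
 have "Cauchy z" using z(1) by (rule convergent_Cauchy)
 then obtain M where M: "!!m n. m >= M ==> n >= M ==> norm (z m - z n) < e / 4"
  using CauchyD[of z "e / 4"] e by auto
 have "norm (y m - y n) < e" if "m >= M" "n >= M" for m n
  using M[OF that] z(2)[of m] z(2)[of n] e unfolding real_norm_def by linarith
 then show "\<exists>M. \<forall>m\<ge>M. \<forall>n\<ge>M. norm (y m - y n) < e" by blast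
qed

text \<open>Finite unions from a countable base exhaust every open set from inside. They form the
  countable stock of test sets needed for a diagonal argument.\<close>

lemma countable_open_approx:
 obtains V :: "nat => (real^'d) set" where "!!n. open (V n)"
  "!!U e. open U ==> U : lmeasurable ==> 0 < e ==> \<exists>n. V n \<subseteq> U & measure lebesgue (U - V n) < e"
proof -
 obtain B :: "nat => (real^'d) set" where B: "!!n. open (B n)" "!!S. open S ==> \<exists>k. S = \<Union>{B n |n. n : k}"
 proof -
  have "\<exists>B :: nat => (real^'d) set. (\<forall>n. open (B n)) & (\<forall>S. open S --> (\<exists>k. S = \<Union>{B n |n. n : k}))"
  proof (rule univ_second_countable_sequence[where 'a="real^'d"])
   fix B :: "nat => (real^'d) set"
   assume "!!n. open (B n)" "!!S. open S ==> \<exists>k. S = \<Union>{B n |n. n : k}"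
   then show ?thesis by (intro exI[of _ B]) simp
  qed
  then obtain B' :: "nat => (real^'d) set" where o: "\<forall>n. open (B' n)"
   and U: "\<forall>S. open S --> (\<exists>k. S = \<Union>{B' n |n. n : k})" by (elim exE conjE) (rule that)
  show thesis by (rule that[of B']) (rule o[rule_format], rule U[rule_format])
 qed
 have cf: "countable {F :: nat set. finite F}" by (rule countable_Collect_finite)
 define V where "V n = (\<Union>i\<in>from_nat_into {F. finite F} n. B i)" for n
 show thesis
 proof (rule that)
  show "open (V n)" for n unfolding V_def using B(1) by auto
  fix U :: "(real^'d) set" and e :: real assume U: "open U" "U : lmeasurable" and e: "0 < e"
  obtain k where k: "U = \<Union>{B n |n. n : k}" using B(2)[OF U(1)] by blast
  define W where "W j = (\<Union>n\<in>k \<inter> {..j}. B n)" for j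
  have Wo: "open (W j)" for j unfolding W_def using B(1) by auto
  have WU: "W j \<subseteq> U" for j unfolding W_def k by blast
  have mono: "incseq W" unfolding W_def incseq_def by (auto simp: order_trans)
  have Un: "(\<Union>j. W j) = U" unfolding W_def k by blast
  have dec: "decseq (%j. U - W j)" using mono unfolding incseq_def decseq_def by blast
  have "(%j. measure lebesgue (U - W j)) ~~> measure lebesgue (\<Inter>j. U - W j)"
  proof (rule Lim_measure_decseq[OF _ dec])
   have Us: "U : sets lebesgue" using U by simp
   show "range (%j. U - W j) \<subseteq> sets lebesgue" using Us Wo by (auto intro!: sets.Diff)
   have "emeasure lebesgue (U - W j) <= emeasure lebesgue U" for j by (rule emeasure_mono) (use Us in auto)
   then show "emeasure lebesgue (U - W j) ~= \<infinity>" for j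
    using fmeasurableD2[OF U(2)] by (metis infinity_ennreal_def neq_top_trans)
  qed
  moreover have "(\<Inter>j. U - W j) = {}" using Un by blast
  ultimately have "(%j. measure lebesgue (U - W j)) ~~> 0" by (simp only: measure_empty)
  then have "\<forall>\<^sub>F j in sequentially. measure lebesgue (U - W j) < e" by (rule order_tendstoD) (rule e)
  then obtain j where j: "measure lebesgue (U - W j) < e" by (auto simp: eventually_sequentially)
  have "k \<inter> {..j} : range (from_nat_into {F :: nat set. finite F})"
   using cf by (subst range_from_nat_into) (auto intro: exI[of _ "{}"])
  then obtain n where "from_nat_into {F :: nat set. finite F} n = k \<inter> {..j}" by auto
  then have "V n = W j" by (simp add: V_def W_def)
  then show "\<exists>n. V n \<subseteq> U & measure lebesgue (U - V n) < e" using j WU by metis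
 qed
qed

text \<open>One subsequence must serve all \<open>n\<close>, since the coefficients of all modes are
  needed together. The diagonal extraction runs over pairs of an index and a countable test set;
  density extends convergence to all test functions, and Riesz represents the limit
  functional.\<close>

theorem L2_weak_compactness:
 fixes w :: "nat => nat => real^'d => real"
 assumes S: "open S" "S : lmeasurable"
  and w: "!!n k. sq_int (leb S) (w n k)" "!!n k. norm2 (leb S) (w n k) <= B"
 obtains ph :: "nat => nat" and c where "strict_mono ph" "!!n. sq_int (leb S) (c n)"
  "!!n a. sq_int (leb S) a ==>
   (%k. LINT x|leb S. w n (ph k) x * a x) ~~> (LINT x|leb S. c n x * a x)"
proof -
 let ?M = "leb S"
 have B0: "0 <= B" using norm2_nonneg w(2) order_trans by blast
 have bd: "\<bar>LINT x|?M. w n k x * a x\<bar> <= B * norm2 ?M a" if "sq_int ?M a" for n k a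
  by (rule order_trans[OF Cauchy_Schwarz_integral_real[OF w(1) that] mult_right_mono[OF w(2) norm2_nonneg]])
 obtain V :: "nat => (real^'d) set" where V: "!!n. open (V n)"
  "!!U e. open U ==> U : lmeasurable ==> 0 < e ==> \<exists>n. V n \<subseteq> U & measure lebesgue (U - V n) < e"
  using countable_open_approx by blast
 have iV: "sq_int ?M (indicator U :: real^'d => real)" if "open U" for U
  by (rule indicator_sq_int[OF S(2) open_in_sets_lebesgue[OF that]])
 \<comment> \<open>\<open>prod_decode\<close> lists the pairs of a sequence index and a test set in
   a single sequence.\<close>
 define X where "X m k = (LINT x|?M. w (fst (prod_decode m)) k x * indicator (V (snd (prod_decode m))) x)" for m k
 obtain ph :: "nat => nat" where ph: "strict_mono ph" "!!m. convergent (%k. X m (ph k))"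
  by (rule diagonal_convergent[of X "%m. B * norm2 ?M (indicator (V (snd (prod_decode m))) :: real^'d => real)"])
   (use bd[OF iV[OF V(1)]] in \<open>auto simp: X_def\<close>)
 have approx: "convergent (%k. LINT x|?M. w n (ph k) x * a x)"
  if a: "sq_int ?M a" and ex: "!!e. 0 < e ==> \<exists>b. sq_int ?M b & convergent (%k. LINT x|?M. w n (ph k) x * b x) & norm2 ?M (%x. a x - b x) < e"
  for n a
 proof (rule convergent_approx)
  fix e :: real assume e: "0 < e"
  obtain b where b: "sq_int ?M b" "convergent (%k. LINT x|?M. w n (ph k) x * b x)" "norm2 ?M (%x. a x - b x) < e / (B + 1)"
   using ex[of "e / (B + 1)"] e B0 by auto
  have "\<bar>(LINT x|?M. w n (ph k) x * a x) - (LINT x|?M. w n (ph k) x * b x)\<bar> <= e" for k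
  proof -
   have D: "(LINT x|?M. w n (ph k) x * a x) - (LINT x|?M. w n (ph k) x * b x) = (LINT x|?M. w n (ph k) x * (a x - b x))"
    unfolding LINT_diff[OF sq_mult_int[OF w(1) a] sq_mult_int[OF w(1) b(1)], symmetric]
    by (simp add: right_diff_distrib)
   have "\<bar>LINT x|?M. w n (ph k) x * (a x - b x)\<bar> <= B * norm2 ?M (%x. a x - b x)"
    by (rule bd[OF sq_int_diff[OF a b(1)]])
   also have "... <= (B + 1) * (e / (B + 1))" using b(3) B0 by (intro mult_mono norm2_nonneg) auto
   also have "... = e" using B0 by simp
   finally show ?thesis unfolding D .
  qed
  then show "\<exists>z. convergent z & (\<forall>k. \<bar>(LINT x|?M. w n (ph k) x * a x) - z k\<bar> <= e)" using b(2) by blast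
 qed
 have conv: "convergent (%k. LINT x|?M. w n (ph k) x * a x)" if "sq_int ?M a" for n a
  using that S
 proof (induction rule: L2_induct_open)
  case ("open" U)
  have Ul: "U : lmeasurable" using S(2) "open" by (meson bounded_subset fmeasurableI2 open_in_sets_lebesgue)
  show ?case
  proof (rule approx[OF iV[OF "open"(1)]])
   fix e :: real assume e: "0 < e"
   obtain m where m: "V m \<subseteq> U" "measure lebesgue (U - V m) < e\<^sup>2" using V(2)[OF "open"(1) Ul, of "e\<^sup>2"] e by auto
   have "norm2 ?M (%x. indicator U x - indicator (V m) x :: real) = norm2 ?M (%x. indicator (V m) x - indicator U x :: real)"
    by (rule norm2_minus_commute)
   also have "... = sqrt (measure lebesgue (U - V m))"
    by (rule norm2_indicator_diff[OF S(2) open_in_sets_lebesgue[OF V(1)] open_in_sets_lebesgue[OF "open"(1)] "open"(2) m(1)])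
   also have "... < e" using m(2) e by (intro real_less_lsqrt) auto
   finally have n: "norm2 ?M (%x. indicator U x - indicator (V m) x :: real) < e" .
   have "convergent (%k. LINT x|?M. w n (ph k) x * indicator (V m) x)"
    using ph(2)[of "prod_encode (n, m)"] by (simp add: X_def)
   then show "\<exists>b. sq_int ?M b & convergent (%k. LINT x|?M. w n (ph k) x * b x) & norm2 ?M (%x. indicator U x - b x) < e"
    using iV[OF V(1)[of m]] n by blast
  qed
 next
  case (add a b)
  have "(%k. LINT x|?M. w n (ph k) x * (a x + b x)) = (%k. (LINT x|?M. w n (ph k) x * a x) + (LINT x|?M. w n (ph k) x * b x))"
   unfolding LINT_add[OF sq_mult_int[OF w(1) add(1)] sq_mult_int[OF w(1) add(2)], symmetric]
   by (simp add: distrib_left)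
  then show ?case using convergent_add[OF add(3,4)] by simp
 next
  case (scale a c)
  have "(%k. LINT x|?M. w n (ph k) x * (c * a x)) = (%k. c * (LINT x|?M. w n (ph k) x * a x))"
   by (simp add: mult.left_commute flip: integral_mult_right_zero)
  then show ?case using convergent_mult[OF convergent_const scale(2)] by simp
 next
  case (closed a)
  then show ?case by (intro approx) auto
 qed
 define l where "l n a = lim (%k. LINT x|?M. w n (ph k) x * a x)" for n a
 have l: "(%k. LINT x|?M. w n (ph k) x * a x) ~~> l n a" if "sq_int ?M a" for n a
  using conv[OF that] unfolding l_def convergent_LIMSEQ_iff .
 have "\<exists>c. sq_int ?M c & (\<forall>a. sq_int ?M a --> l n a = (LINT x|?M. c x * a x))" for n
 proof -
  obtain c where "sq_int ?M c" "!!a. sq_int ?M a ==> l n a = (LINT x|?M. c x * a x)"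
  proof (rule L2_Riesz[of ?M "l n" B])
   fix a b :: "real^'d => real" assume a: "sq_int ?M a" and b: "sq_int ?M b"
   have "(LINT x|?M. w n (ph k) x * (a x + b x)) = (LINT x|?M. w n (ph k) x * a x) + (LINT x|?M. w n (ph k) x * b x)" for k
    unfolding LINT_add[OF sq_mult_int[OF w(1) a] sq_mult_int[OF w(1) b], symmetric]
    by (simp add: distrib_left)
   then have "(%k. LINT x|?M. w n (ph k) x * (a x + b x)) ~~> l n a + l n b"
    using tendsto_add[OF l[OF a] l[OF b]] by simp
   then show "l n (%x. a x + b x) = l n a + l n b" by (rule LIMSEQ_unique[OF l[OF sq_int_add[OF a b]]])
  next
   fix a :: "real^'d => real" and c assume a: "sq_int ?M a"
   have "(LINT x|?M. w n (ph k) x * (c * a x)) = c * (LINT x|?M. w n (ph k) x * a x)" for k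
    by (simp add: mult.left_commute flip: integral_mult_right_zero)
   then have "(%k. LINT x|?M. w n (ph k) x * (c * a x)) ~~> c * l n a"
    by (simp only:) (intro tendsto_mult tendsto_const l[OF a])
   moreover have "sq_int ?M (%x. c * a x)" using sq_int_scaleR[OF a, of c] by simp
   ultimately show "l n (%x. c * a x) = c * l n a" using LIMSEQ_unique[OF l] by blast
  next
   fix a :: "real^'d => real" assume a: "sq_int ?M a"
   show "\<bar>l n a\<bar> <= B * norm2 ?M a"
    by (rule Lim_bounded[OF tendsto_rabs[OF l[OF a]], of 0]) (use bd[OF a] in simp)
  qed blast
  then show ?thesis by blast
 qed
 then obtain c where c: "!!n. sq_int ?M (c n)" "!!n a. sq_int ?M a ==> l n a = (LINT x|?M. c n x * a x)"
  by metis
 show thesis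
 proof (rule that[OF ph(1) c(1)])
  fix n and a :: "real^'d => real" assume a: "sq_int ?M a"
  show "(%k. LINT x|?M. w n (ph k) x * a x) ~~> (LINT x|?M. c n x * a x)"
   using l[OF a, of n] unfolding c(2)[OF a] .
 qed
qed

lemma sq_int_times_vector:
 fixes v :: "'b::euclidean_space"
 assumes "sq_int M (f :: 'a => real)"
 shows "sq_int M (%x. f x *\<^sub>R v)"
 by (rule sq_int_bound[OF assms, where c="norm v"])
  (use assms in \<open>auto simp: sq_int_def mult.commute intro: borel_measurable_scaleR\<close>)

lemma norm2_sum_expand:
 fixes f :: "'i => 'a => 'b::euclidean_space"
 assumes f: "!!i. sq_int M (f i)"
 shows "(norm2 M (%y. \<Sum>i\<in>I. f i y))\<^sup>2 = (\<Sum>i\<in>I. \<Sum>j\<in>I. LINT y|M. f i y \<bullet> f j y)"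
proof -
 have "(norm (\<Sum>i\<in>I. v i))\<^sup>2 = (\<Sum>i\<in>I. \<Sum>j\<in>I. v i \<bullet> v j)" for v :: "'i => 'b"
  unfolding power2_norm_eq_inner by (subst inner_sum_left) (simp only: inner_sum_right)
 then show ?thesis
  unfolding norm2_power2
  by (simp add: LINT_sum intble_sum sq_int_inner_integrable f)
qed

context lp_setting
begin

lemma osc_product: "osc k m th x * osc k l ph x = (osc k (m + l) (th + ph) x + osc k (m - l) (th - ph) x) / 2"
proof -
 have "osc k m th x * osc k l ph x = (osc k (m + l) (th + ph) x + osc k (m - l) (th - ph) x) / 2"
  using tcos_mult[of m th _ l ph] unfolding osc_def tcos_def
  by (cases rule: L_cases[of k x]) simp_all
 then show ?thesis .
qed

lemma osc_0_AE: "AE x in mu. osc k 0 th x = cos th"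
 using AE_in_cube[of k] by eventually_elim (auto simp: osc_def L_on_cube)

text \<open>For m not 0 the constant 1 is a bounded sequence in H^1, so the weak limit of
  oscillating functions applies, with \<open>a\<close> absorbed into the test function.\<close>

lemma osc_mean:
 assumes a: "sq_int mu a" and b: "sq_int mu b"
 shows "(%k. LINT x|mu. (a x * osc k m th x) * b x) ~~> (if m = 0 then cos th * (LINT x|mu. a x * b x) else 0)"
proof (cases "m = 0")
 case True
 have "(LINT x|mu. (a x * osc k 0 th x) * b x) = (LINT x|mu. cos th * (a x * b x))" for k
 proof (rule integral_cong_AE)
  show "(%x. (a x * osc k 0 th x) * b x) : borel_measurable mu" "(%x. cos th * (a x * b x)) : borel_measurable mu"
   using sq_int_measurable[OF a] sq_int_measurable[OF b] osc_measurable[of k 0 th] by measurable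
  show "AE x in mu. (a x * osc k 0 th x) * b x = cos th * (a x * b x)"
   using osc_0_AE[of k th] by eventually_elim simp
 qed
 then show ?thesis using True by simp
next
 case False
 have one: "has_weak_gradient Om (%x. 1) (%x. 0)"
  by (rule has_weak_gradient_subset[OF open_Om subset_UNIV _ has_weak_gradient_const]) simp
 have "(%k. LINT x|mu. (a x * osc k m th x) * b x) ~~> 0"
 proof (rule L2_tendsto_0_from_open[OF open_Om Om_lmeasurable _ _ _ b])
  show "sq_int mu (%x. a x * osc k m th x)" "norm2 mu (%x. a x * osc k m th x) <= norm2 mu a" for k
   by (rule osc_times_sq_int[OF a])+
  fix U :: "(real^'d) set" assume U: "open U" "U \<subseteq> Om"
  have "sq_int mu (%x. indicator U x * a x)"
   by (rule sq_int_bounded_times[OF a sq_int_measurable[OF indicator_sq_int[OF Om_lmeasurable open_in_sets_lebesgue[OF U(1)]]], where c=1])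
    (simp add: indicator_def)
  from osc_weak_limit[OF False one sq_int_const[OF finite_measure_mu] sq_int_const[OF finite_measure_mu] _ _ this,
    of "max (norm2 mu (%x :: real^'d. 1 :: real)) (norm2 mu (%x :: real^'d. 0 :: real^'d))" th]
  show "(%k. LINT x|mu. (a x * osc k m th x) * indicator U x) ~~> 0" by (simp add: ac_simps)
 qed
 then show ?thesis using False by simp
qed

text \<open>Bessel's inequality: the oscillating functions are asymptotically orthogonal.\<close>
lemma osc_Bessel:
 fixes ka :: "nat => real^'d"
 assumes G: "!!k. sq_int mu (G k)" "!!k. norm2 mu (G k) <= C" and ka: "!!n. ka n ~= 0" "!!n m. ka n + ka m ~= 0"
  "!!n m. n ~= m ==> ka n = ka m ==> cos (Th n - Th m) = 0" and e: "!!n. norm (e n :: real^'d) = 1"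
  and c: "!!n. sq_int mu (c n)" and ph: "strict_mono ph"
  and lim: "!!n a. sq_int mu a ==> (%k. LINT x|mu. (sqrt 2 * (e n \<bullet> G (ph k) x) * osc (ph k) (ka n) (Th n) x) * a x) ~~> (LINT x|mu. c n x * a x)"
 shows "(\<Sum>n<M. LINT x|mu. (c n x)\<^sup>2) <= C\<^sup>2"
proof -
 define S where "S = (\<Sum>n<M. LINT x|mu. (c n x)\<^sup>2)"
 define b where "b n k x = c n x * osc k (ka n) (Th n) x" for n k x
 \<comment> \<open>The candidate for the projection of \<open>G\<close> onto the first
   \<open>M\<close> modes. A cosine has mean square 1/2, whence the normalisation by sqrt 2.\<close>
 define Z where "Z k x = (\<Sum>n<M. (sqrt 2 * b n k x) *\<^sub>R e n)" for k x
 have C0: "0 <= C" using norm2_nonneg G(2) order_trans by blast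
 have b: "sq_int mu (b n k)" for n k unfolding b_def[abs_def] by (rule osc_times_sq_int(1)[OF c])
 have sb: "sq_int mu (%x. sqrt 2 * b n k x)" for n k using sq_int_scaleR[OF b, of "sqrt 2"] by simp
 have Z: "sq_int mu (Z k)" for k unfolding Z_def[abs_def] by (intro sq_int_sum sq_int_times_vector sb)
 have GZ: "(LINT x|mu. G k x \<bullet> Z k x) = (\<Sum>n<M. LINT x|mu. (sqrt 2 * (e n \<bullet> G k x) * osc k (ka n) (Th n) x) * c n x)" for k
 proof -
  have i: "integrable mu (%x. (sqrt 2 * (e n \<bullet> G k x) * osc k (ka n) (Th n) x) * c n x)" for n
   using sq_int_inner_integrable[OF G(1)[of k] sq_int_times_vector[OF sb[of n k], of "e n"]]
   by (simp add: b_def ac_simps inner_commute)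
  have "(%x. G k x \<bullet> Z k x) = (%x. \<Sum>n<M. (sqrt 2 * (e n \<bullet> G k x) * osc k (ka n) (Th n) x) * c n x)"
   by (simp add: Z_def inner_sum_right b_def ac_simps inner_commute)
  then show ?thesis by (simp only: LINT_sum[OF i])
 qed
 have "(%k. LINT x|mu. G (ph k) x \<bullet> Z (ph k) x) ~~> (\<Sum>n<M. LINT x|mu. c n x * c n x)"
  unfolding GZ by (rule tendsto_sum) (rule lim[OF c])
 then have L1: "(%k. LINT x|mu. G (ph k) x \<bullet> Z (ph k) x) ~~> S" by (simp add: S_def power2_eq_square)
 \<comment> \<open>By the product formula only vanishing sums or differences of wave vectors
   survive. Sums never vanish; a difference vanishes only for equal wave vectors, and then distinct
   modes have orthogonal phases.\<close>
 have bb: "(%k. LINT x|mu. b n k x * b m k x) ~~> (if n = m then (LINT x|mu. (c n x)\<^sup>2) / 2 else 0)" for n m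
 proof -
  have i: "integrable mu (%x. (c n x * osc k l th x) * c m x)" for k l th
   by (rule sq_mult_int[OF osc_times_sq_int(1)[OF c] c])
  have "(LINT x|mu. b n k x * b m k x) = ((LINT x|mu. (c n x * osc k (ka n + ka m) (Th n + Th m) x) * c m x) +
    (LINT x|mu. (c n x * osc k (ka n - ka m) (Th n - Th m) x) * c m x)) / 2" for k
  proof -
   have "b n k x * b m k x = ((c n x * osc k (ka n + ka m) (Th n + Th m) x) * c m x +
     (c n x * osc k (ka n - ka m) (Th n - Th m) x) * c m x) / 2" for x
   proof -
    have "b n k x * b m k x = (c n x * c m x) * (osc k (ka n) (Th n) x * osc k (ka m) (Th m) x)"
     by (simp add: b_def)
    then show ?thesis unfolding osc_product by (simp add: algebra_simps add_divide_distrib)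
   qed
   then have "(LINT x|mu. b n k x * b m k x) = (LINT x|mu. ((c n x * osc k (ka n + ka m) (Th n + Th m) x) * c m x +
     (c n x * osc k (ka n - ka m) (Th n - Th m) x) * c m x) / 2)"
    by (intro LINT_cong refl)
   then show ?thesis by (simp only: integral_divide_zero LINT_add[OF i i])
  qed
  moreover have "(%k. ((LINT x|mu. (c n x * osc k (ka n + ka m) (Th n + Th m) x) * c m x) +
    (LINT x|mu. (c n x * osc k (ka n - ka m) (Th n - Th m) x) * c m x)) / 2) ~~>
    ((if ka n + ka m = 0 then cos (Th n + Th m) * (LINT x|mu. c n x * c m x) else 0) +
    (if ka n - ka m = 0 then cos (Th n - Th m) * (LINT x|mu. c n x * c m x) else 0)) / 2"
   by (intro tendsto_divide tendsto_add osc_mean c tendsto_const) simp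
  moreover have "((if ka n + ka m = 0 then cos (Th n + Th m) * (LINT x|mu. c n x * c m x) else 0) +
    (if ka n - ka m = 0 then cos (Th n - Th m) * (LINT x|mu. c n x * c m x) else 0)) / 2 =
    (if n = m then (LINT x|mu. (c n x)\<^sup>2) / 2 else 0)"
   using ka(2)[of n m] ka(3)[of n m] by (auto simp: power2_eq_square)
  ultimately show ?thesis by (simp only:)
 qed
 have ZZ: "(norm2 mu (Z k))\<^sup>2 = (\<Sum>n<M. \<Sum>m<M. 2 * (e n \<bullet> e m) * (LINT x|mu. b n k x * b m k x))" for k
 proof -
  have "(sqrt 2 * s) * ((sqrt 2 * t) * z) = 2 * z * (s * t)" for s t z :: real
  proof -
   have "(sqrt 2 * s) * ((sqrt 2 * t) * z) = (sqrt 2 * sqrt 2) * (z * (s * t))" by (simp only: ac_simps)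
   then show ?thesis by simp
  qed
  then have E: "((sqrt 2 * b n k x) *\<^sub>R e n) \<bullet> ((sqrt 2 * b m k x) *\<^sub>R e m) = 2 * (e n \<bullet> e m) * (b n k x * b m k x)" for n m x
   by simp
  show ?thesis
   unfolding Z_def norm2_sum_expand[OF sq_int_times_vector[OF sb]] E integral_mult_right_zero ..
 qed
 have "(%k. (norm2 mu (Z k))\<^sup>2) ~~> (\<Sum>n<M. \<Sum>m<M. 2 * (e n \<bullet> e m) * (if n = m then (LINT x|mu. (c n x)\<^sup>2) / 2 else 0))"
  unfolding ZZ by (intro tendsto_sum tendsto_mult_left bb)
 also have "(\<Sum>n<M. \<Sum>m<M. 2 * (e n \<bullet> e m) * (if n = m then (LINT x|mu. (c n x)\<^sup>2) / 2 else 0)) = S"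
 proof -
  have "(\<Sum>m<M. 2 * (e n \<bullet> e m) * (if n = m then (LINT x|mu. (c n x)\<^sup>2) / 2 else 0)) = (LINT x|mu. (c n x)\<^sup>2)" if "n < M" for n
  proof -
   have "(\<Sum>m<M. 2 * (e n \<bullet> e m) * (if n = m then (LINT x|mu. (c n x)\<^sup>2) / 2 else 0)) =
     (\<Sum>m<M. if n = m then (LINT x|mu. (c n x)\<^sup>2) else 0)"
    using e[of n] by (intro sum.cong refl) (auto simp: norm_eq_1)
   then show ?thesis using that by simp
  qed
  then show ?thesis by (simp add: S_def)
 qed
 finally have "(%k. (norm2 mu (Z (ph k)))\<^sup>2) ~~> S"
  using LIMSEQ_subseq_LIMSEQ[OF _ ph] by (fastforce simp: o_def)
 from tendsto_real_sqrt[OF this] have L2: "(%k. norm2 mu (Z (ph k))) ~~> sqrt S" by (simp add: norm2_nonneg)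
 \<comment> \<open>The pairing of \<open>G\<close> with \<open>Z\<close> and the square of the norm
   of \<open>Z\<close> have the same limit \<open>S\<close>, so Cauchy-Schwarz gives this and then
   \<open>sqrt S <= C\<close>.\<close>
 have "S <= C * sqrt S"
 proof (rule LIMSEQ_le[OF L1 tendsto_mult_left[OF L2]], intro exI allI impI)
  fix k
  have "(LINT x|mu. G (ph k) x \<bullet> Z (ph k) x) <= norm2 mu (G (ph k)) * norm2 mu (Z (ph k))"
   using Cauchy_Schwarz_integral[OF G(1) Z, of "ph k" "ph k"] by linarith
  also have "... <= C * norm2 mu (Z (ph k))" by (rule mult_right_mono[OF G(2) norm2_nonneg])
  finally show "(LINT x|mu. G (ph k) x \<bullet> Z (ph k) x) <= C * norm2 mu (Z (ph k))" .
 qed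
 moreover have S0: "0 <= S" by (simp add: S_def sum_nonneg)
 ultimately have le: "sqrt S * sqrt S <= C * sqrt S" by simp
 have "sqrt S <= C"
 proof (cases "S = 0")
  case False
  then have "0 < sqrt S" using S0 by simp
  then show ?thesis using le by (simp only: mult_le_cancel_right_pos)
 qed (use C0 in simp)
 then have "(sqrt S)\<^sup>2 <= C\<^sup>2" using S0 by (intro power_mono) auto
 then show ?thesis using S0 by (simp add: S_def)
qed

end

section \<open>Fourier series of potentials\<close>

lemma finite_vectors:
 assumes "finite A"
 shows "finite {z :: real^'d. \<forall>i. z $ i : A}"
proof -
 have "{z :: real^'d. \<forall>i. z $ i : A} \<subseteq> (%f. \<chi> i. f i) ` (PiE UNIV (%_ :: 'd. A))"
 proof
  fix z :: "real^'d" assume "z : {z. \<forall>i. z $ i : A}"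
  then have "z = (\<chi> i. ($) z i)" "($) z : PiE UNIV (%_ :: 'd. A)" by auto
  then show "z : (%f. \<chi> i. f i) ` (PiE UNIV (%_ :: 'd. A))" by blast
 qed
 then show ?thesis by (rule finite_subset) (intro finite_imageI finite_PiE assms finite)
qed

lemma finite_cell_cover:
 fixes K :: "(real^'d) set"
 assumes "bounded K"
 obtains Z :: "(real^'d) set" where "finite Z" "!!z. z : Z ==> integer_vector z"
  "!!y. y : K ==> \<exists>z\<in>Z. y - z : unit_cell"
proof -
 obtain M where M: "!!y. y : K ==> norm y <= M" using assms by (auto simp: bounded_iff)
 define Z where "Z = {z :: real^'d. \<forall>i. z $ i : real_of_int ` {- \<lceil>M\<rceil> - 1..\<lceil>M\<rceil>}}"
 show thesis
 proof (rule that[of Z])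
  show "finite Z" unfolding Z_def by (rule finite_vectors) simp
  show "integer_vector z" if "z : Z" for z
   unfolding integer_vector_def
  proof
   fix i
   have "z $ i : real_of_int ` {- \<lceil>M\<rceil> - 1..\<lceil>M\<rceil>}" using that by (simp add: Z_def)
   then show "z $ i : \<int>" by auto
  qed
  fix y assume y: "y : K"
  define z :: "real^'d" where "z = (\<chi> i. real_of_int \<lfloor>y $ i\<rfloor>)"
  have "z : Z"
  proof -
   have "\<lfloor>y $ i\<rfloor> : {- \<lceil>M\<rceil> - 1..\<lceil>M\<rceil>}" for i
    using norm_nth[of y i] M[OF y] unfolding real_norm_def by auto linarith+
   then show ?thesis by (auto simp: Z_def z_def)
  qed
  moreover have "y - z : unit_cell" unfolding unit_cell_mem z_def by (auto simp: less_imp_le) linarith+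
  ultimately show "\<exists>z\<in>Z. y - z : unit_cell" by blast
 qed
qed

text \<open>A compact set meets finitely many integer translates of the cell, over each of which
  \<open>h\<close> has the same integral. The constant depends on \<open>K\<close> only: convergence
  on the cell becomes local convergence on the whole space, where the weak gradient is
  tested.\<close>

lemma periodic_integral_compact:
 fixes K :: "(real^'d) set"
 assumes K: "compact K"
 shows "\<exists>C\<ge>0. \<forall>h :: real^'d => real. h : borel_measurable borel --> (\<forall>y. 0 <= h y) --> periodic h -->
  integrable nu h --> integrable (leb K) h & (LINT y|leb K. h y) <= C * (LINT y|nu. h y)"
proof -
 obtain Z :: "(real^'d) set" where Z: "finite Z" "!!z. z : Z ==> integer_vector z"
  "!!y. y : K ==> \<exists>z\<in>Z. y - z : unit_cell"
  using finite_cell_cover[OF compact_imp_bounded[OF K]] by blast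
 have Kl: "K : sets lebesgue" by (rule compact_in_sets_lebesgue[OF K])
 show ?thesis
 proof (intro exI[of _ "real (card Z)"] conjI[of "0 <= real (card Z)"] allI impI)
  fix h :: "real^'d => real"
  assume h: "h : borel_measurable borel" "\<forall>y. 0 <= h y" "periodic h" "integrable nu h"
  have cb: "(unit_cell :: (real^'d) set) : sets borel" by (simp add: unit_cell_def)
  let ?F = "%y. ennreal (h y) * indicator unit_cell y"
  have Fm: "?F : borel_measurable borel" using h(1) cb by measurable
  have tm: "(+) (- z) : borel_measurable borel" for z :: "real^'d" by measurable
  have tr: "(\<integral>\<^sup>+y. ?F (- z + y) \<partial>lborel) = (\<integral>\<^sup>+y. ?F y \<partial>lborel)" for z
  proof -
   have "(\<integral>\<^sup>+y. ?F y \<partial>lborel) = (\<integral>\<^sup>+y. ?F y \<partial>distr lborel borel ((+) (- z)))"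
    by (simp only: lborel_distr_plus)
   also have "... = (\<integral>\<^sup>+y. ?F (- z + y) \<partial>lborel)"
    by (rule nn_integral_distr) (use tm Fm in simp_all)
   finally show ?thesis by simp
  qed
  have restr: "(\<integral>\<^sup>+y. ennreal (h y) \<partial>leb A) = (\<integral>\<^sup>+y. ennreal (h y) * indicator A y \<partial>lborel)" if "A : sets borel" for A
  proof -
   have "(\<integral>\<^sup>+y. ennreal (h y) \<partial>leb A) = (\<integral>\<^sup>+y. ennreal (h y) * indicator A y \<partial>lebesgue)"
    by (rule nn_integral_restrict_space) (use that in simp)
   also have "... = (\<integral>\<^sup>+y. ennreal (h y) * indicator A y \<partial>lborel)" by (rule nn_integral_completion)
   finally show ?thesis .
  qed
  have Kb: "K : sets borel" using K by (simp add: borel_compact)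
  have "(\<integral>\<^sup>+y. ennreal (h y) \<partial>leb K) = (\<integral>\<^sup>+y. ennreal (h y) * indicator K y \<partial>lborel)" by (rule restr[OF Kb])
  also have "... <= (\<integral>\<^sup>+y. (\<Sum>z\<in>Z. ?F (- z + y)) \<partial>lborel)"
  proof (rule nn_integral_mono)
   fix y
   show "ennreal (h y) * indicator K y <= (\<Sum>z\<in>Z. ?F (- z + y))"
   proof (cases "y : K")
    case True
    then obtain z where z: "z : Z" "y - z : unit_cell" using Z(3) by blast
    have "integer_vector (- z)" using Z(2)[OF z(1)] by (simp add: integer_vector_def)
    then have "h (y + - z) = h y" using h(3) unfolding periodic_def by blast
    then have "h (- z + y) = h y" by (simp only: add.commute)
    then have "ennreal (h y) * indicator K y = ?F (- z + y)" using True z(2) by simp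
    also have "... <= (\<Sum>z\<in>Z. ?F (- z + y))" by (rule member_le_sum[OF z(1) _ Z(1)]) simp
    finally show ?thesis .
   qed simp
  qed
  also have "... = (\<Sum>z\<in>Z. \<integral>\<^sup>+y. ?F (- z + y) \<partial>lborel)"
   by (rule nn_integral_sum) (use measurable_compose[OF tm Fm] in simp)
  also have "... = of_nat (card Z) * (\<integral>\<^sup>+y. ennreal (h y) \<partial>nu)" by (simp only: tr restr[OF cb] sum_constant)
  also have "(\<integral>\<^sup>+y. ennreal (h y) \<partial>nu) = ennreal (LINT y|nu. h y)"
   by (rule nn_integral_eq_integral[OF h(4)]) (simp add: h(2))
  also have "of_nat (card Z) * ennreal (LINT y|nu. h y) = ennreal (real (card Z) * (LINT y|nu. h y))"
   by (simp add: ennreal_mult'' ennreal_of_nat_eq_real_of_nat h(2))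
  finally have le: "(\<integral>\<^sup>+y. ennreal (h y) \<partial>leb K) <= ennreal (real (card Z) * (LINT y|nu. h y))" .
  have hK: "h : borel_measurable (leb K)"
   by (intro measurable_restrict_space1 measurable_completion) (use h(1) in simp)
  have int: "integrable (leb K) h"
   by (rule integrableI_nonneg[OF hK]) (use h(2) le le_less_trans[OF le ennreal_less_top] in auto)
  have "ennreal (LINT y|leb K. h y) <= ennreal (real (card Z) * (LINT y|nu. h y))"
   using le nn_integral_eq_integral[OF int] h(2) by simp
  moreover have "0 <= real (card Z) * (LINT y|nu. h y)" by (simp add: h(2))
  ultimately have "(LINT y|leb K. h y) <= real (card Z) * (LINT y|nu. h y)"
   by (simp only: ennreal_le_iff)
  then show "integrable (leb K) h & (LINT y|leb K. h y) <= real (card Z) * (LINT y|nu. h y)"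
   using int by blast
 qed simp
qed

lemma cell_integral_le_norm2:
 assumes h: "sq_int nu (h :: real^'d => real)" and F: "sq_int nu (F :: real^'d => 'b::euclidean_space)"
  and le: "!!y. \<bar>h y\<bar> <= norm (F y)"
 shows "(LINT y|nu. \<bar>h y\<bar>) <= norm2 nu F"
proof -
 have a: "sq_int nu (%y. \<bar>h y\<bar>)" using sq_int_norm[OF h] by simp
 have 1: "norm2 nu (%y :: real^'d. 1 :: real) = 1" by (simp add: norm2_def)
 have "(LINT y|nu. \<bar>h y\<bar>) <= norm2 nu (%y. \<bar>h y\<bar>) * 1"
  using Cauchy_Schwarz_integral_real[OF a sq_int_const[OF finite_nu, of 1]] unfolding 1 by simp
 also have "... <= norm2 nu F"
  unfolding mult_1_right by (rule norm2_mono[OF F sq_int_measurable[OF a]]) (simp add: le)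
 finally show ?thesis .
qed

lemma norm2_orthogonal_sum:
 fixes f :: "'i => 'a => 'b::euclidean_space"
 assumes I: "finite I" and f: "!!i. sq_int M (f i)" and 0: "!!i j. i ~= j ==> (LINT y|M. f i y \<bullet> f j y) = 0"
 shows "(norm2 M (%y. \<Sum>i\<in>I. c i *\<^sub>R f i y))\<^sup>2 = (\<Sum>i\<in>I. (c i)\<^sup>2 * (norm2 M (f i))\<^sup>2)"
proof -
 have "(norm2 M (%y. \<Sum>i\<in>I. c i *\<^sub>R f i y))\<^sup>2 = (\<Sum>i\<in>I. \<Sum>j\<in>I. c i * (c j * (LINT y|M. f i y \<bullet> f j y)))"
  unfolding norm2_sum_expand[OF sq_int_scaleR[OF f]] by (simp add: mult.left_commute)
 also have "... = (\<Sum>i\<in>I. \<Sum>j\<in>I. if i = j then (c i)\<^sup>2 * (norm2 M (f i))\<^sup>2 else 0)"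
  by (intro sum.cong refl) (auto simp: 0 norm2_power2 power2_norm_eq_inner power2_eq_square[of "c _"])
 also have "... = (\<Sum>i\<in>I. (c i)\<^sup>2 * (norm2 M (f i))\<^sup>2)" using I by simp
 finally show ?thesis .
qed

lemma integral_tcos_mult:
 assumes "integer_vector m" "integer_vector l"
 shows "(LINT y|nu. tcos m th y * tcos l ph y) =
  ((if m + l = 0 then cos (th + ph) else 0) + (if m = l then cos (th - ph) else 0)) / 2"
proof -
 have i: "integrable nu (tcos n th)" for n :: "real^'a" and th
  by (rule sq_int_integrable_finite[OF finite_nu sq_int_bounded[OF finite_nu continuous_borel[OF tcos_continuous], where c=1]])
   (simp add: tcos_bound)
 show ?thesis
  unfolding tcos_mult
  using LINT_add[OF i i] integral_tcos[OF integer_vector_add[OF assms]]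
   integral_tcos[OF integer_vector_diff[OF assms]] by simp
qed

text \<open>The orthogonality relations of a real Fourier system without constants.
  \<open>half\<close> excludes having both m and -m; \<open>phase\<close> lets a wave vector recur
  only with a phase that makes the modes orthogonal, as sine and cosine are.\<close>

locale torus_basis =
 fixes ka :: "nat => real^'d" and Th :: "nat => real"
 assumes integer: "!!n. integer_vector (ka n)" and nonzero: "!!n. ka n ~= 0" and half: "!!n m. ka n + ka m ~= 0"
  and phase: "!!n m. n ~= m ==> ka n = ka m ==> cos (Th n - Th m) = 0"
begin

definition dir :: "nat => real^'d" where "dir n = (1 / norm (ka n)) *\<^sub>R ka n"

text \<open>Normalised so that the gradients are orthonormal in \<open>L\<^sup>2(Y)\<close>.\<close>
definition potential :: "nat => real^'d => real" where
 "potential n y = sqrt 2 / (2 * pi * norm (ka n)) * tcos (ka n) (Th n - pi / 2) y"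

definition field :: "nat => real^'d => real^'d" where
 "field n y = (sqrt 2 * tcos (ka n) (Th n) y) *\<^sub>R dir n"

lemma norm_dir: "norm (dir n) = 1"
 using nonzero[of n] by (simp add: dir_def)

lemma norm_ka: "1 <= norm (ka n)"
proof -
 obtain i where i: "ka n $ i ~= 0" using nonzero[of n] by (auto simp: vec_eq_iff)
 then have "1 <= \<bar>ka n $ i\<bar>" using integer[of n] Ints_nonzero_abs_ge1 unfolding integer_vector_def by blast
 also have "... <= norm (ka n)" using norm_nth[of "ka n" i] by simp
 finally show ?thesis .
qed

lemma field_weak_gradient: "has_weak_gradient UNIV (potential n) (field n)"
proof -
 have "has_weak_gradient UNIV (tcos (ka n) (Th n - pi / 2)) (%y. \<chi> i. partial_deriv i (tcos (ka n) (Th n - pi / 2)) y)"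
  by (rule smooth_has_weak_gradient[OF tcos_smooth])
 note grad = has_weak_gradient_cmult[OF this, of "sqrt 2 / (2 * pi * norm (ka n))"]
 have F: "(%y. (sqrt 2 / (2 * pi * norm (ka n))) *\<^sub>R (\<chi> i. partial_deriv i (tcos (ka n) (Th n - pi / 2)) y)) = field n"
 proof
  fix y
  have P: "(\<chi> i. partial_deriv i (tcos (ka n) (Th n - pi / 2)) y) = (2 * pi * tcos (ka n) (Th n) y) *\<^sub>R ka n"
   unfolding partial_deriv_tcos by (simp add: vec_eq_iff)
  show "(sqrt 2 / (2 * pi * norm (ka n))) *\<^sub>R (\<chi> i. partial_deriv i (tcos (ka n) (Th n - pi / 2)) y) = field n y"
   unfolding P by (simp add: field_def dir_def)
 qed
 have P: "(%y. sqrt 2 / (2 * pi * norm (ka n)) * tcos (ka n) (Th n - pi / 2) y) = potential n"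
  by (simp add: potential_def fun_eq_iff)
 show ?thesis using grad by (simp only: F P)
qed

lemma basis_continuous: "continuous_on UNIV (potential n)" "continuous_on UNIV (field n)"
 unfolding potential_def[abs_def] field_def[abs_def] by (intro continuous_intros tcos_continuous)+

lemma basis_periodic:
 assumes "integer_vector m"
 shows "potential n (y + m) = potential n y" "field n (y + m) = field n y"
 using assms tcos_periodic[OF integer[of n]] by (simp_all add: potential_def field_def periodic_def)

lemma basis_sq_int: "sq_int nu (potential n)" "sq_int nu (field n)"
proof -
 have t: "sq_int nu (tcos (ka n) th)" for th
  by (rule sq_int_bounded[OF finite_nu continuous_borel[OF tcos_continuous], where c=1]) (simp add: tcos_bound)
 show "sq_int nu (potential n)"
  using sq_int_scaleR[OF t, of "sqrt 2 / (2 * pi * norm (ka n))" "Th n - pi / 2"] by (simp add: potential_def[abs_def])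
 have "sq_int nu (%y. sqrt 2 * tcos (ka n) (Th n) y)" using sq_int_scaleR[OF t, of "sqrt 2" "Th n"] by simp
 then have "integrable nu (%y. (norm (field n y))\<^sup>2)" by (simp add: field_def norm_dir sq_int_def)
 then show "sq_int nu (field n)"
  using continuous_borel[OF basis_continuous(2)] by (simp add: sq_int_def)
qed

text \<open>The L^2 norm of this pair is the H^1 norm of the potential, so function and gradient are
  summed in one argument.\<close>

definition pair :: "nat => real^'d => real \<times> (real^'d)" where "pair n y = (potential n y, field n y)"

lemma pair_sq_int: "sq_int nu (pair n)"
 unfolding pair_def[abs_def] using basis_sq_int by (simp add: sq_int_Pair)

lemma pair_inner:
 "(LINT y|nu. pair n y \<bullet> pair m y) =
  (if n = m then 1 / (2 * pi * norm (ka n))\<^sup>2 + 1 else 0)"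
proof -
 have f: "(LINT y|nu. tcos (ka n) (Th n - t) y * tcos (ka m) (Th m - t) y) = (if n = m then 1 / 2 else 0)" for t
  unfolding integral_tcos_mult[OF integer integer] using half[of n m] phase[of n m] by auto
 have g: "(A * s, (sqrt 2 * S) *\<^sub>R v) \<bullet> (B * t, (sqrt 2 * T) *\<^sub>R w) = (A * B) * (s * t) + (2 * (v \<bullet> w)) * (S * T)"
  for A B s t S T and v w :: "real^'d"
 proof -
  have "(sqrt 2 * S) * ((sqrt 2 * T) * (v \<bullet> w)) = (sqrt 2 * sqrt 2) * ((v \<bullet> w) * (S * T))" by (simp only: ac_simps)
  then show ?thesis by (simp add: ac_simps)
 qed
 have E: "pair n y \<bullet> pair m y = (sqrt 2 / (2 * pi * norm (ka n)) * (sqrt 2 / (2 * pi * norm (ka m)))) *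
   (tcos (ka n) (Th n - pi / 2) y * tcos (ka m) (Th m - pi / 2) y) +
   (2 * (dir n \<bullet> dir m)) * (tcos (ka n) (Th n) y * tcos (ka m) (Th m) y)" for y
  unfolding pair_def potential_def field_def by (rule g)
 have i: "integrable nu (%y. c * (tcos (ka n) th y * tcos (ka m) ph y))" for th ph c
  by (intro integrable_mult_right sq_mult_int sq_int_bounded[OF finite_nu continuous_borel[OF tcos_continuous], where c=1])
   (simp_all add: tcos_bound)
 show ?thesis
  unfolding E LINT_add[OF i i] integral_mult_right_zero f f[of 0, unfolded diff_0_right]
  using norm_dir[of n] by (auto simp: norm_eq_1 power2_eq_square)
qed

text \<open>A Poincare inequality for single modes: as |ka n| >= 1, a potential is no larger than
  its gradient, which has norm 1.\<close>

lemma pair_norm: "(norm2 nu (pair n))\<^sup>2 <= 2"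
proof -
 have "1 <= 2 * pi * norm (ka n)" using norm_ka[of n] pi_ge_two mult_mono[of 1 "2 * pi" 1 "norm (ka n)"] by simp
 then have "1 <= (2 * pi * norm (ka n))\<^sup>2" by (rule one_le_power)
 then have "1 / (2 * pi * norm (ka n))\<^sup>2 <= 1" by (simp only: divide_le_eq_1) auto
 then show ?thesis using pair_inner[of n n] by (simp add: norm2_power2 power2_norm_eq_inner)
qed

lemma pair_sum_norm:
 "finite I ==> (norm2 nu (%y. \<Sum>n\<in>I. c n *\<^sub>R pair n y))\<^sup>2 <= 2 * (\<Sum>n\<in>I. (c n)\<^sup>2)"
proof -
 assume I: "finite I"
 have "(norm2 nu (%y. \<Sum>n\<in>I. c n *\<^sub>R pair n y))\<^sup>2 = (\<Sum>n\<in>I. (c n)\<^sup>2 * (norm2 nu (pair n))\<^sup>2)"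
  by (rule norm2_orthogonal_sum[OF I pair_sq_int]) (simp add: pair_inner)
 also have "... <= (\<Sum>n\<in>I. (c n)\<^sup>2 * 2)" by (intro sum_mono mult_left_mono pair_norm) simp
 finally show ?thesis by (simp add: sum_distrib_left mult.commute)
qed

lemma partial_sum_weak_gradient:
 "has_weak_gradient UNIV (%y. \<Sum>n<m. c n * potential n y) (%y. \<Sum>n<m. c n *\<^sub>R field n y)"
proof (induction m)
 case 0
 then show ?case using has_weak_gradient_const[of 0] by simp
next
 case (Suc m)
 then show ?case
  using has_weak_gradient_add[OF open_UNIV Suc has_weak_gradient_cmult[OF field_weak_gradient]] by simp
qed

text \<open>Orthogonality makes the partial sums Cauchy in the H^1 norm of the cell. The limit is
  the pointwise \<open>lim\<close> along a subsequence, so it is Borel and exactly periodic, and the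
  convergence extends from the cell to compact sets, where it identifies the weak gradient.\<close>

theorem fourier_series:
 assumes c: "summable (%n. (c n)\<^sup>2)"
 obtains v g where "periodic v" "has_weak_gradient UNIV v g" "sq_int nu v" "sq_int nu g"
  "(%m. norm2 nu (%y. ((\<Sum>n<m. c n * potential n y) - v y, (\<Sum>n<m. c n *\<^sub>R field n y) - g y))) ~~> 0"
  "(norm2 nu (%y. (v y, g y)))\<^sup>2 <= 2 * (\<Sum>n. (c n)\<^sup>2)"
proof -
 define S where "S m y = (\<Sum>n<m. c n *\<^sub>R pair n y)" for m y
 have S: "sq_int nu (S m)" for m unfolding S_def[abs_def] by (intro sq_int_sum sq_int_scaleR pair_sq_int)
 have dist: "norm2 nu (%y. S j y - S i y) <= sqrt (2 * (\<Sum>n=i..<j. (c n)\<^sup>2))" if "i <= j" for i j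
 proof -
  have "(%y. S j y - S i y) = (%y. \<Sum>n=i..<j. c n *\<^sub>R pair n y)"
   using that by (simp add: S_def fun_eq_iff lessThan_atLeast0 sum_diff_nat_ivl)
  then show ?thesis using real_le_rsqrt[OF pair_sum_norm[of "{i..<j}" c]] by simp
 qed
 have "\<exists>N. \<forall>m\<ge>N. \<forall>n\<ge>N. norm2 nu (%y. S m y - S n y) < e" if e: "0 < e" for e
 proof -
  obtain N where N: "!!m n. m >= N ==> norm (\<Sum>i=m..<n. (c i)\<^sup>2) < e\<^sup>2 / 2"
   using c[unfolded summable_Cauchy, rule_format, of "e\<^sup>2 / 2"] e by auto
  have le: "norm2 nu (%y. S n y - S m y) < e" if "N <= m" "m <= n" for m n
  proof -
   have "sqrt (2 * (\<Sum>i=m..<n. (c i)\<^sup>2)) < e" using N[OF that(1), of n] e by (intro real_less_lsqrt) auto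
   then show ?thesis using dist[OF that(2)] by linarith
  qed
  have "norm2 nu (%y. S m y - S n y) < e" if "N <= m" "N <= n" for m n
  proof (cases "m <= n")
   case True
   then show ?thesis using le[OF that(1) True] by (simp add: norm2_minus_commute[of nu "S m"])
  qed (use le[OF that(2), of m] in simp)
  then show ?thesis by blast
 qed
 from L2_complete[OF S this] obtain ph where ph: "strict_mono ph" "sq_int nu (%y. lim (%j. S (ph j) y))"
  "(%n. norm2 nu (%y. S n y - lim (%j. S (ph j) y))) ~~> 0"
  by blast
 define F where "F y = lim (%j. S (ph j) y)" for y
 have Scont: "continuous_on UNIV (S m)" for m
  unfolding S_def[abs_def] pair_def by (intro continuous_intros basis_continuous)
 have Sper: "S m (y + z) = S m y" if "integer_vector z" for m y z
  using basis_periodic[OF that] by (simp add: S_def pair_def)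
 have Sm: "S m : borel_measurable borel" for m by (rule borel_measurable_continuous_onI[OF Scont])
 have Fm: "F : borel_measurable borel" unfolding F_def[abs_def] by (rule borel_measurable_lim_metric[OF Sm])
 have Fper: "F (y + z) = F y" if "integer_vector z" for y z unfolding F_def Sper[OF that] ..
 have F: "sq_int nu F" using ph(2) by (simp add: F_def[abs_def])
 have lim: "(%n. norm2 nu (%y. S n y - F y)) ~~> 0" using ph(3) by (simp add: F_def)
 define v where "v y = fst (F y)" for y
 define g where "g y = snd (F y)" for y
 have SD: "S m y - F y = ((\<Sum>n<m. c n * potential n y) - v y, (\<Sum>n<m. c n *\<^sub>R field n y) - g y)" for m y
  by (simp add: prod_eq_iff S_def v_def g_def pair_def fst_sum snd_sum)
 have vg: "sq_int nu v" "sq_int nu g"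
  using F sq_int_Pair[of nu v g] by (simp_all add: v_def[abs_def] g_def[abs_def])
 have vm: "v : borel_measurable borel" "g : borel_measurable borel"
  using Fm by (simp_all add: v_def[abs_def] g_def[abs_def] flip: borel_prod) measurable
 show thesis
 proof (rule that[of v g])
  show "periodic v" using Fper by (simp add: periodic_def v_def)
  show "sq_int nu v" "sq_int nu g" by fact+
  show "(%m. norm2 nu (%y. ((\<Sum>n<m. c n * potential n y) - v y, (\<Sum>n<m. c n *\<^sub>R field n y) - g y))) ~~> 0"
   using lim by (simp only: SD)
  have Fb: "norm2 nu F <= sqrt (2 * (\<Sum>n. (c n)\<^sup>2))"
  proof (rule LIMSEQ_le_const[of "%n. sqrt (2 * (\<Sum>n. (c n)\<^sup>2)) + norm2 nu (%y. S n y - F y)"])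
   show "(%n. sqrt (2 * (\<Sum>n. (c n)\<^sup>2)) + norm2 nu (%y. S n y - F y)) ~~> sqrt (2 * (\<Sum>n. (c n)\<^sup>2))"
    using tendsto_add[OF tendsto_const lim] by simp
   have "norm2 nu F <= sqrt (2 * (\<Sum>n. (c n)\<^sup>2)) + norm2 nu (%y. S n y - F y)" for n
   proof -
    have "norm2 nu (S n) <= sqrt (2 * (\<Sum>n<n. (c n)\<^sup>2))"
     using real_le_rsqrt[OF pair_sum_norm[of "{..<n}" c]] by (simp add: S_def[abs_def])
    also have "... <= sqrt (2 * (\<Sum>n. (c n)\<^sup>2))" using sum_le_suminf[OF c, of "{..<n}"] by simp
    finally show ?thesis using norm2_diff_ge[OF S F, of n] by linarith
   qed
   then show "\<exists>N. \<forall>n\<ge>N. norm2 nu F <= sqrt (2 * (\<Sum>n. (c n)\<^sup>2)) + norm2 nu (%y. S n y - F y)" by blast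
  qed
  have "(norm2 nu F)\<^sup>2 <= (sqrt (2 * (\<Sum>n. (c n)\<^sup>2)))\<^sup>2"
   by (rule power_mono[OF Fb norm2_nonneg])
  also have "... = 2 * (\<Sum>n. (c n)\<^sup>2)" using suminf_nonneg[OF c] by simp
  finally show "(norm2 nu (%y. (v y, g y)))\<^sup>2 <= 2 * (\<Sum>n. (c n)\<^sup>2)"
   by (simp add: v_def g_def)
  have gm: "(%y. norm (g y)) : borel_measurable borel" "(%y. \<bar>v y\<bar>) : borel_measurable borel" using vm by measurable
  have gi: "integrable nu (%y. norm (g y))" "integrable nu (%y. \<bar>v y\<bar>)"
   using sq_int_integrable_finite[OF finite_nu sq_int_norm[OF vg(2)]]
    sq_int_integrable_finite[OF finite_nu sq_int_norm[OF vg(1)]] by simp_all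
  have gp: "periodic (%y. norm (g y))" "periodic (%y. \<bar>v y\<bar>)" using Fper by (simp_all add: periodic_def g_def v_def)
  have restr: "f absolutely_integrable_on K \<longleftrightarrow> integrable (leb K) f" if "compact K"
   for K :: "(real^'d) set" and f :: "real^'d => 'b::euclidean_space"
   using compact_in_sets_lebesgue[OF that] by (simp add: set_integrable_def integrable_restrict_space)
  have mK: "f : borel_measurable (leb K)" if "f : borel_measurable borel"
   for K :: "(real^'d) set" and f :: "real^'d => 'b::euclidean_space"
   by (intro measurable_restrict_space1 measurable_completion) (use that in simp)
  \<comment> \<open>Periodicity of the difference bounds its integral over \<open>K\<close> by a
    multiple of that over the cell, hence by the L^2 error.\<close>
  have squeeze: "(%m. LINT y|leb K. \<bar>h m y\<bar>) ~~> 0"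
   if K: "compact K" and h: "!!m. h m : borel_measurable borel" "!!m. periodic (h m)" "!!m. sq_int nu (h m)"
    "!!m y. \<bar>h m y\<bar> <= norm (S m y - F y)" for K and h :: "nat => real^'d => real"
  proof -
   obtain C where C: "0 <= C" "\<forall>h :: real^'d => real. h : borel_measurable borel --> (\<forall>y. 0 <= h y) --> periodic h -->
     integrable nu h --> integrable (leb K) h & (LINT y|leb K. h y) <= C * (LINT y|nu. h y)"
    using periodic_integral_compact[OF K] by (elim exE conjE) (rule that)
   have le: "(LINT y|leb K. \<bar>h m y\<bar>) <= C * norm2 nu (%y. S m y - F y)" for m
   proof -
    have "(LINT y|leb K. \<bar>h m y\<bar>) <= C * (LINT y|nu. \<bar>h m y\<bar>)"
    proof (rule conjunct2[OF C(2)[rule_format]])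
     show "(%y. \<bar>h m y\<bar>) : borel_measurable borel" using h(1)[of m] by measurable
     show "periodic (%y. \<bar>h m y\<bar>)" using h(2)[of m] by (simp add: periodic_def)
     show "integrable nu (%y. \<bar>h m y\<bar>)"
      using sq_int_integrable_finite[OF finite_nu sq_int_norm[OF h(3)[of m]]] by simp
    qed simp
    also have "... <= C * norm2 nu (%y. S m y - F y)"
     by (rule mult_left_mono[OF cell_integral_le_norm2[OF h(3) sq_int_diff[OF S F] h(4)] C(1)])
    finally show ?thesis .
   qed
   have L: "(%m. C * norm2 nu (%y. S m y - F y)) ~~> 0" using tendsto_mult_left[OF lim, of C] by simp
   show ?thesis
    by (rule Lim_null_comparison[OF always_eventually[OF allI] L]) (use le in simp)
  qed
  show "has_weak_gradient UNIV v g"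
  proof (rule has_weak_gradient_limit[OF open_UNIV])
   show "has_weak_gradient UNIV (%y. \<Sum>n<m. c n * potential n y) (%y. \<Sum>n<m. c n *\<^sub>R field n y)" for m
    by (rule partial_sum_weak_gradient)
   fix K :: "(real^'d) set" assume K: "compact K"
   obtain C where "0 <= C" and C: "\<forall>h :: real^'d => real. h : borel_measurable borel --> (\<forall>y. 0 <= h y) --> periodic h -->
     integrable nu h --> integrable (leb K) h & (LINT y|leb K. h y) <= C * (LINT y|nu. h y)"
    using periodic_integral_compact[OF K] by (elim exE conjE) (rule that)
   have "integrable (leb K) (%y. \<bar>v y\<bar>)" "integrable (leb K) (%y. norm (g y))"
    using C[rule_format, OF gm(2) _ gp(2) gi(2)] C[rule_format, OF gm(1) _ gp(1) gi(1)] by simp_all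
   then have "integrable (leb K) v" "integrable (leb K) g"
    using integrable_norm_cancel[of "leb K" v] integrable_norm_cancel[of "leb K" g] mK[OF vm(1)] mK[OF vm(2)] by simp_all
   then show "v absolutely_integrable_on K" "g absolutely_integrable_on K" by (simp_all add: restr[OF K])
   show "(%m. LINT y|leb K. \<bar>(\<Sum>n<m. c n * potential n y) - v y\<bar>) ~~> 0"
   proof (rule squeeze[OF K])
    have E: "(%y. (\<Sum>n<m. c n * potential n y) - v y) = (%y. fst (S m y - F y))" for m by (simp add: SD)
    show "(%y. (\<Sum>n<m. c n * potential n y) - v y) : borel_measurable borel" for m
     by (intro borel_measurable_diff vm borel_measurable_continuous_onI continuous_intros basis_continuous)
    show "periodic (%y. (\<Sum>n<m. c n * potential n y) - v y)" for m
     unfolding E periodic_def using Fper Sper by simp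
    show "sq_int nu (%y. (\<Sum>n<m. c n * potential n y) - v y)" for m
     using sq_int_diff[OF S F, of m] unfolding SD sq_int_Pair by blast
    show "\<bar>(\<Sum>n<m. c n * potential n y) - v y\<bar> <= norm (S m y - F y)" for m y
     unfolding SD using norm_fst_le[of "(\<Sum>n<m. c n * potential n y) - v y" "(\<Sum>n<m. c n *\<^sub>R field n y) - g y"] by simp
   qed
   fix i
   show "(%m. LINT y|leb K. \<bar>(\<Sum>n<m. c n *\<^sub>R field n y) $ i - g y $ i\<bar>) ~~> 0"
   proof (rule squeeze[OF K])
    have E: "(%y. (\<Sum>n<m. c n *\<^sub>R field n y) $ i - g y $ i) = (%y. snd (S m y - F y) $ i)" for m by (simp add: SD)
    have E2: "(%y. (\<Sum>n<m. c n *\<^sub>R field n y) $ i - g y $ i) = (%y. ((\<Sum>n<m. c n *\<^sub>R field n y) - g y) \<bullet> axis i 1)" for m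
     by (simp add: inner_axis)
    have m: "(%y. (\<Sum>n<m. c n *\<^sub>R field n y) - g y) : borel_measurable borel" for m
     by (intro borel_measurable_diff vm borel_measurable_continuous_onI continuous_intros basis_continuous)
    show "(%y. (\<Sum>n<m. c n *\<^sub>R field n y) $ i - g y $ i) : borel_measurable borel" for m
     unfolding E2 by (intro borel_measurable_inner m) simp
    show "periodic (%y. (\<Sum>n<m. c n *\<^sub>R field n y) $ i - g y $ i)" for m
     unfolding E periodic_def using Fper Sper by simp
    have "sq_int nu (%y. (\<Sum>n<m. c n *\<^sub>R field n y) - g y)" for m
     using sq_int_diff[OF S F, of m] unfolding SD sq_int_Pair by blast
    then show "sq_int nu (%y. (\<Sum>n<m. c n *\<^sub>R field n y) $ i - g y $ i)" for m
     unfolding E2 by (rule sq_int_inner_const)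
    have nth: "\<bar>z $ i\<bar> <= norm z" for z :: "real^'d" using norm_nth[of z i] by simp
    show "\<bar>(\<Sum>n<m. c n *\<^sub>R field n y) $ i - g y $ i\<bar> <= norm (S m y - F y)" for m y
     unfolding SD vector_minus_component[symmetric] by (rule order_trans[OF nth norm_snd_le])
   qed
  qed
 qed
qed

end

section \<open>The corrector\<close>

lemma countable_integer_vectors: "countable {m :: real^'d. integer_vector m}"
proof -
 have "{m :: real^'d. integer_vector m} \<subseteq> (%f. \<chi> i. f i) ` (PiE UNIV (%_ :: 'd. \<int> :: real set))"
 proof
  fix m :: "real^'d" assume "m : {m. integer_vector m}"
  then have "m = (\<chi> i. ($) m i)" "($) m : PiE UNIV (%_ :: 'd. \<int> :: real set)" by (auto simp: integer_vector_def)
  then show "m : (%f. \<chi> i. f i) ` (PiE UNIV (%_ :: 'd. \<int> :: real set))" by blast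
 qed
 moreover have "countable (\<int> :: real set)" by (simp add: Ints_def)
 ultimately show ?thesis by (elim countable_subset) (intro countable_image countable_PiE, auto)
qed

text \<open>The basis uses one vector from each pair \<open>{m, - m}\<close>, with the two phases \<open>0\<close> and \<open>- \<pi> / 2\<close>.\<close>
lemma torus_basis_exists:
 obtains ka :: "nat => real^'d" and Th where "torus_basis ka Th"
  "\<forall>m th. integer_vector m --> m ~= 0 -->
   (\<exists>n n' al be. \<forall>y. tcos m th y = al * tcos (ka n) (Th n) y + be * tcos (ka n') (Th n') y)"
proof -
 \<comment> \<open>The choice is made from a set that is the same for m and -m, so it selects one
   representative of each pair.\<close>
 define c where "c m = (SOME j. j : {m, - m})" for m :: "real^'d"
 have c_minus: "c (- m) = c m" for m by (simp add: c_def insert_commute)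
 have c_in: "c m = m \<or> c m = - m" for m using someI[of "%j. j : {m, - m}" m] by (auto simp: c_def)
 define P where "P = {m :: real^'d. integer_vector m & m ~= 0 & c m = m}"
 have iv: "integer_vector (- m) \<longleftrightarrow> integer_vector m" for m :: "real^'d"
  by (simp add: integer_vector_def minus_in_Ints_iff)
 have neg: "x ~= 0 ==> x ~= - x" for x :: "real^'d" by (auto simp: vec_eq_iff)
 have P_or: "m : P \<or> - m : P" if "integer_vector m" "m ~= 0" for m
  using that c_in[of m] c_minus[of m] iv[of m] by (auto simp: P_def)
 have P_not: "- m ~: P" if "m : P" for m
  using that c_minus[of m] neg[of m] by (auto simp: P_def)
 have cP: "countable P" by (rule countable_subset[OF _ countable_integer_vectors]) (auto simp: P_def)
 have iP: "infinite P"
 proof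
  assume "finite P"
  then have fin: "finite (P \<union> uminus ` P)" by simp
  \<comment> \<open>Multiples of one arbitrary axis vector already show that the index set is
    infinite, so it can be enumerated bijectively by the naturals.\<close>
  let ?h = "%n :: nat. real (Suc n) *\<^sub>R (axis undefined 1 :: real^'d)"
  have "range ?h \<subseteq> P \<union> uminus ` P"
  proof
   fix m assume "m : range ?h"
   then obtain n where m: "m = ?h n" by blast
   have "integer_vector m" "m ~= 0" unfolding m by (auto simp: integer_vector_def axis_def vec_eq_iff)
   then have "m : P \<or> - m : P" by (rule P_or)
   then show "m : P \<union> uminus ` P" by (auto intro: rev_image_eqI)
  qed
  then have "finite (range ?h)" using fin by (rule finite_subset)
  moreover have "inj ?h" by (rule injI) (simp add: axis_eq_0_iff)
  ultimately show False using range_inj_infinite[of ?h] by blast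
 qed
 define I where "I = P \<times> {0, - pi / 2}"
 have cI: "countable I" unfolding I_def by (intro countable_SIGMA cP) auto
 have iI: "infinite I" unfolding I_def using iP by (auto dest: finite_cartesian_productD1)
 define io where "io = from_nat_into I"
 have bij: "bij_betw io UNIV I" unfolding io_def by (rule bij_betw_from_nat_into[OF cI iI])
 have mem: "fst (io n) : P" "snd (io n) = 0 \<or> snd (io n) = - pi / 2" for n
  using bij_betwE[OF bij, rule_format, of n] by (auto simp: I_def)
 show thesis
 proof (rule that[of "%n. fst (io n)" "%n. snd (io n)"])
  show "torus_basis (%n. fst (io n)) (%n. snd (io n))"
  proof
   show "integer_vector (fst (io n))" "fst (io n) ~= 0" for n using mem(1)[of n] by (auto simp: P_def)
   show "fst (io n) + fst (io m) ~= 0" for n m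
    using P_not[OF mem(1)[of n]] mem(1)[of m] by (metis minus_unique)
   show "cos (snd (io n) - snd (io m)) = 0" if "n ~= m" "fst (io n) = fst (io m)" for n m
   proof -
    have "io n ~= io m" using bij that(1) unfolding bij_betw_def inj_def by blast
    then have "snd (io n) ~= snd (io m)" using that(2) by (simp add: prod_eq_iff)
    then show ?thesis using mem(2)[of n] mem(2)[of m] by (auto simp: cos_minus)
   qed
  qed
  have ex: "\<exists>n. io n = (m, t)" if "m : P" "t = 0 \<or> t = - pi / 2" for m t
  proof -
   have "(m, t) : io ` UNIV" using bij that by (auto simp: bij_betw_def I_def)
   then show ?thesis by (metis imageE)
  qed
  have sh: "cos (x + - pi / 2) = sin x" for x :: real by (simp add: cos_diff)
  show "\<forall>m th. integer_vector m --> m ~= 0 --> (\<exists>n n' al be. \<forall>y. tcos m th y =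
    al * tcos (fst (io n)) (snd (io n)) y + be * tcos (fst (io n')) (snd (io n')) y)"
  proof (intro allI impI)
   fix m :: "real^'d" and th :: real assume m: "integer_vector m" "m ~= 0"
   from P_or[OF m] show "\<exists>n n' al be. \<forall>y. tcos m th y =
    al * tcos (fst (io n)) (snd (io n)) y + be * tcos (fst (io n')) (snd (io n')) y"
   proof
    assume mP: "m : P"
    obtain n n' where n: "io n = (m, 0)" "io n' = (m, - pi / 2)" using ex[OF mP, of 0] ex[OF mP, of "- pi / 2"] by blast
    show ?thesis
     by (rule exI[of _ n], rule exI[of _ n'], rule exI[of _ "cos th"], rule exI[of _ "- sin th"])
      (simp only: n fst_conv snd_conv tcos_def sh, simp add: cos_add)
   next
    assume mP: "- m : P"
    obtain n n' where n: "io n = (- m, 0)" "io n' = (- m, - pi / 2)" using ex[OF mP, of 0] ex[OF mP, of "- pi / 2"] by blast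
    show ?thesis
     by (rule exI[of _ n], rule exI[of _ n'], rule exI[of _ "cos th"], rule exI[of _ "sin th"])
      (simp only: n fst_conv snd_conv tcos_def sh, simp add: cos_add)
   qed
  qed
 qed
qed

text \<open>Monotone convergence: the series of squares has a finite integral and is therefore
  finite almost everywhere.\<close>

lemma AE_summable_squares:
 fixes c :: "nat => 'a => real"
 assumes c: "!!n. sq_int M (c n)" and bd: "!!m. (\<Sum>n<m. LINT x|M. (c n x)\<^sup>2) <= C"
 shows "AE x in M. summable (%n. (c n x)\<^sup>2)" "integrable M (%x. \<Sum>n. (c n x)\<^sup>2)"
proof -
 have i: "integrable M (%x. (c n x)\<^sup>2)" for n using c[of n] by (simp add: sq_int_def)
 have s: "summable (%n. LINT x|M. (c n x)\<^sup>2)" by (rule summableI_nonneg_bounded[OF _ bd]) simp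
 have m: "(%x. ennreal ((c n x)\<^sup>2)) : borel_measurable M" for n using borel_measurable_integrable[OF i[of n]] by measurable
 have "(\<integral>\<^sup>+x. (\<Sum>n. ennreal ((c n x)\<^sup>2)) \<partial>M) = (\<Sum>n. \<integral>\<^sup>+x. ennreal ((c n x)\<^sup>2) \<partial>M)"
  by (rule nn_integral_suminf[OF m])
 also have "... = (\<Sum>n. ennreal (LINT x|M. (c n x)\<^sup>2))"
  by (intro suminf_cong nn_integral_eq_integral[OF i]) simp
 also have "... = ennreal (\<Sum>n. LINT x|M. (c n x)\<^sup>2)" by (rule suminf_ennreal2[OF _ s]) simp
 finally have fin: "(\<integral>\<^sup>+x. (\<Sum>n. ennreal ((c n x)\<^sup>2)) \<partial>M) ~= \<infinity>" by simp
 have "AE x in M. (\<Sum>n. ennreal ((c n x)\<^sup>2)) ~= \<infinity>"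
  by (rule nn_integral_PInf_AE[OF borel_measurable_suminf_order[OF m] fin])
 then show ae: "AE x in M. summable (%n. (c n x)\<^sup>2)"
  by eventually_elim (rule summable_suminf_not_top, auto)
 show "integrable M (%x. \<Sum>n. (c n x)\<^sup>2)"
  by (rule integrable_suminf[OF i]) (use ae s in auto)
qed

lemma AE_matrix_vector:
 fixes A :: "real^'d^'d"
 assumes A: "invertible A" and ae: "AE y in lebesgue. P y"
 shows "AE z in lebesgue. P (A *v z)"
proof -
 obtain N where N: "{y : space lebesgue. \<not> P y} \<subseteq> N" "N : null_sets lebesgue"
  using ae by (auto simp: eventually_ae_filter)
 have "negligible N" using N(2) by (simp add: negligible_iff_null_sets)
 then have "negligible ((*v) (matrix_inv A) ` N)"
  by (intro negligible_differentiable_image_negligible) (auto intro: linear_imp_differentiable_on)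
 then have n: "(*v) (matrix_inv A) ` N : null_sets lebesgue" by (simp add: negligible_iff_null_sets)
 show ?thesis
 proof (rule AE_I'[OF n], rule subsetI)
  fix z assume "z : {z : space lebesgue. \<not> P (A *v z)}"
  then have "A *v z : N" using N(1) by auto
  moreover have "z = matrix_inv A *v (A *v z)"
   using matrix_inv_mult(2)[OF A] by (simp add: matrix_vector_mul_assoc)
  ultimately show "z : (*v) (matrix_inv A) ` N" by (rule rev_image_eqI)
 qed
qed

context lp_setting
begin

text \<open>Write the axis vector as D x applied to its preimage. This recovers a component of
  \<open>g\<close> from those of D^T g, whose limits are the ones that can be computed.\<close>

lemma D_axis:
 "g $ i = (\<Sum>j\<in>UNIV. matrix_inv (D x) $ j $ i * (g \<bullet> (D x *v axis j 1)))"
proof -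
 have "axis i 1 = D x *v (matrix_inv (D x) *v axis i 1)"
  using matrix_inv_mult(1)[OF invertible_D[of x]] by (simp add: matrix_vector_mul_assoc)
 also have "matrix_inv (D x) *v axis i 1 = (\<Sum>j\<in>UNIV. (matrix_inv (D x) $ j $ i) *\<^sub>R axis j 1)"
  unfolding matrix_vector_mult_basis
  by (simp add: column_def vec_eq_iff axis_def if_distrib[where f="%t. _ * t"] cong: if_cong)
 also have "D x *v ... = (\<Sum>j\<in>UNIV. (matrix_inv (D x) $ j $ i) *\<^sub>R (D x *v axis j 1))"
  by (simp add: linear_sum[OF matrix_vector_mul_linear] linear_cmul[OF matrix_vector_mul_linear])
 finally have "g \<bullet> axis i 1 = (\<Sum>j\<in>UNIV. matrix_inv (D x) $ j $ i * (g \<bullet> (D x *v axis j 1)))"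
  by (simp add: inner_sum_right)
 then show ?thesis by (simp add: inner_axis)
qed

lemma matrix_inv_entry_times:
 assumes "sq_int mu a"
 shows "sq_int mu (%x. matrix_inv (D x) $ j $ i * a x)"
proof -
 obtain B where B: "!!x i j. x : Om ==> \<bar>matrix_inv (D x) $ i $ j\<bar> <= B" using D_bounded by metis
 show ?thesis
  by (rule sq_int_bounded_times[OF assms, where c=B])
   (use B in \<open>auto intro!: continuous_borel continuous_intros continuous_D(2)\<close>)
qed

text \<open>\<open>g x v* D x\<close> is D^T g, the gradient in cell coordinates up to scaling. Its
  bound follows from that of D by duality.\<close>

lemma gradient_pullback_sq_int:
 assumes "sq_int mu g"
 shows "sq_int mu (%x. g x v* D x)" "\<exists>M\<ge>0. \<forall>g. sq_int mu g --> norm2 mu (%x. g x v* D x) <= M * norm2 mu g"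
proof -
 obtain M where M: "0 < M" "!!x v. x : Om ==> norm (D x *v v) <= M * norm v" using D_bounded by metis
 have le: "norm (h v* D x) <= M * norm h" if "x : Om" for h x
 proof -
  have "(norm (h v* D x))\<^sup>2 = h \<bullet> (D x *v (h v* D x))" by (simp add: power2_norm_eq_inner dot_lmul_matrix)
  also have "... <= norm h * norm (D x *v (h v* D x))" by (rule norm_cauchy_schwarz)
  also have "... <= norm h * (M * norm (h v* D x))" by (intro mult_left_mono M(2) that) simp
  finally have "norm (h v* D x) * norm (h v* D x) <= (M * norm h) * norm (h v* D x)"
   by (simp add: power2_eq_square ac_simps)
  then show ?thesis using M(1) by (cases "norm (h v* D x) = 0") (simp_all add: mult_le_cancel_right)
 qed
 have meas: "(%x. h x v* D x) : borel_measurable mu" if "sq_int mu h" for h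
 proof (rule borel_measurable_euclidean_space[THEN iffD2], rule ballI)
  fix e :: "real^'d" assume "e : Basis"
  have "(%x. D x *v e) : borel_measurable mu"
   using continuous_D(1) unfolding matrix_vector_mult_def by (intro continuous_borel continuous_intros)
  then have "(%x. h x \<bullet> (D x *v e)) : borel_measurable mu" by (intro borel_measurable_inner sq_int_measurable[OF that])
  then show "(%x. (h x v* D x) \<bullet> e) : borel_measurable mu" by (simp add: dot_lmul_matrix)
 qed
 show "sq_int mu (%x. g x v* D x)"
  by (rule sq_int_bound[OF assms meas[OF assms], where c=M]) (use le in auto)
 have "norm2 mu (%x. h x v* D x) <= M * norm2 mu h" if h: "sq_int mu h" for h
 proof -
  have "norm2 mu (%x. h x v* D x) <= norm2 mu (%x. M *\<^sub>R h x)"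
   by (rule norm2_mono[OF sq_int_scaleR[OF h] meas[OF h]]) (use le M(1) in \<open>auto intro!: AE_I2\<close>)
  then show ?thesis using M(1) by (simp add: norm2_scaleR)
 qed
 then show "\<exists>M\<ge>0. \<forall>g. sq_int mu g --> norm2 mu (%x. g x v* D x) <= M * norm2 mu g"
  using M(1) by (intro exI[of _ M]) auto
qed

text \<open>The coefficients of the corrector are the weak limits of the components of \<open>D\<^sup>T\<nabla>u\<^sup>\<epsilon>\<close> along
  the wave vectors, tested against the oscillating functions.\<close>
lemma corrector_coefficients:
 assumes "torus_basis ka Th" and g: "!!k. sq_int mu (g k)" "!!k. norm2 mu (g k) <= B"
 obtains ph :: "nat => nat" and c where "strict_mono ph" "!!n. sq_int mu (c n)"
  "!!n a. sq_int mu a ==> (%k. LINT x|mu. ((g (ph k) x \<bullet> (D x *v torus_basis.dir ka n)) * osc (ph k) (ka n) (Th n) x) * a x)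
   ~~> (LINT x|mu. c n x * a x) / sqrt 2"
  "!!x. x : Om ==> summable (%n. (c n x)\<^sup>2)" "integrable mu (%x. \<Sum>n. (c n x)\<^sup>2)"
proof -
 interpret torus_basis ka Th by fact
 define G where "G k x = g k x v* D x" for k x
 obtain M where M: "M >= 0" "!!g. sq_int mu g ==> norm2 mu (%x. g x v* D x) <= M * norm2 mu g"
  using gradient_pullback_sq_int(2)[OF g(1)] by blast
 have G: "sq_int mu (G k)" for k unfolding G_def[abs_def] by (rule gradient_pullback_sq_int(1)[OF g(1)])
 have GB: "norm2 mu (G k) <= M * B" for k
  unfolding G_def by (rule order_trans[OF M(2)[OF g(1)] mult_left_mono[OF g(2) M(1)]])
 \<comment> \<open>The components along the unit wave vectors; sqrt 2 normalises the cosines as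
   required by \<open>osc_Bessel\<close>.\<close>
 define w where "w n k x = sqrt 2 * (dir n \<bullet> G k x) * osc k (ka n) (Th n) x" for n k x
 have dG: "sq_int mu (%x. sqrt 2 * (dir n \<bullet> G k x))" for n k
  using sq_int_scaleR[OF sq_int_inner_const[OF G[of k], of "dir n"], of "sqrt 2"] by (simp add: inner_commute)
 have w: "sq_int mu (w n k)" for n k unfolding w_def[abs_def] by (rule osc_times_sq_int(1)[OF dG])
 have wB: "norm2 mu (w n k) <= sqrt 2 * (M * B)" for n k
 proof -
  have "norm2 mu (w n k) <= norm2 mu (%x. sqrt 2 * (dir n \<bullet> G k x))"
   unfolding w_def[abs_def] by (rule osc_times_sq_int(2)[OF dG])
  also have "... <= norm2 mu (%x. sqrt 2 *\<^sub>R G k x)"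
  proof (rule norm2_mono[OF sq_int_scaleR[OF G] sq_int_measurable[OF dG] AE_I2])
   fix x
   show "norm (sqrt 2 * (dir n \<bullet> G k x)) <= norm (sqrt 2 *\<^sub>R G k x)"
    using Cauchy_Schwarz_ineq2[of "dir n" "G k x"] norm_dir[of n] by (simp add: abs_mult)
  qed
  also have "... = sqrt 2 * norm2 mu (G k)" by (simp add: norm2_scaleR)
  also have "... <= sqrt 2 * (M * B)" by (rule mult_left_mono[OF GB]) simp
  finally show ?thesis .
 qed
 show thesis
 proof (rule L2_weak_compactness[OF open_Om Om_lmeasurable w wB])
  fix ph :: "nat => nat" and c :: "nat => real^'d => real"
  assume ph: "strict_mono ph" and c: "!!n. sq_int mu (c n)"
   and lim: "!!n a. sq_int mu a ==> (%k. LINT x|mu. w n (ph k) x * a x) ~~> (LINT x|mu. c n x * a x)"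
  have Bessel: "(\<Sum>n<m. LINT x|mu. (c n x)\<^sup>2) <= (M * B)\<^sup>2" for m
   by (rule osc_Bessel[where ka=ka and Th=Th and e=dir, OF G GB nonzero half phase norm_dir c ph lim[unfolded w_def]])
  \<comment> \<open>The Bessel series may diverge on a null set. Setting the coefficients to 0 there
    gives summability at every point, so that a corrector can be defined for every
    \<open>x\<close>.\<close>
  define c' where "c' n x = (if summable (%n. (c n x)\<^sup>2) then c n x else 0)" for n x
  have ae: "AE x in mu. c n x = c' n x" for n
   using AE_summable_squares(1)[OF c Bessel] by eventually_elim (simp add: c'_def)
  have cm: "c' n : borel_measurable mu" for n
   by (rule borel_measurable_lebesgue_on_AE[OF Om_sets sq_int_measurable[OF c] ae])
  have c': "sq_int mu (c' n)" for n by (rule sq_int_cong_AE[OF c cm ae])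
  have Bessel': "(\<Sum>n<m. LINT x|mu. (c' n x)\<^sup>2) <= (M * B)\<^sup>2" for m
  proof -
   have "(LINT x|mu. (c' n x)\<^sup>2) = (LINT x|mu. (c n x)\<^sup>2)" for n
   proof (rule integral_cong_AE)
    show "(%x. (c' n x)\<^sup>2) : borel_measurable mu" "(%x. (c n x)\<^sup>2) : borel_measurable mu"
     using cm[of n] sq_int_measurable[OF c[of n]] by measurable
    show "AE x in mu. (c' n x)\<^sup>2 = (c n x)\<^sup>2" using ae[of n] by eventually_elim simp
   qed
   then show ?thesis using Bessel by simp
  qed
  show thesis
  proof (rule that[OF ph c'])
   show "summable (%n. (c' n x)\<^sup>2)" for x unfolding c'_def by (cases "summable (%n. (c n x)\<^sup>2)") simp_all
   show "integrable mu (%x. \<Sum>n. (c' n x)\<^sup>2)" by (rule AE_summable_squares(2)[OF c' Bessel'])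
   fix n and a :: "real^'d => real" assume a: "sq_int mu a"
   have E: "(LINT x|mu. ((g k x \<bullet> (D x *v dir n)) * osc k (ka n) (Th n) x) * a x) = (LINT x|mu. w n k x * a x) / sqrt 2" for k
   proof -
    have "((g k x \<bullet> (D x *v dir n)) * osc k (ka n) (Th n) x) * a x = (w n k x * a x) / sqrt 2" for x
     by (simp add: w_def G_def inner_commute[of "dir n"] dot_lmul_matrix)
    then show ?thesis by simp
   qed
   have E2: "(LINT x|mu. c n x * a x) = (LINT x|mu. c' n x * a x)"
   proof (rule integral_cong_AE)
    show "(%x. c n x * a x) : borel_measurable mu" "(%x. c' n x * a x) : borel_measurable mu"
     using cm[of n] sq_int_measurable[OF c[of n]] sq_int_measurable[OF a] by measurable
    show "AE x in mu. c n x * a x = c' n x * a x" using ae[of n] by eventually_elim simp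
   qed
   show "(%k. LINT x|mu. ((g (ph k) x \<bullet> (D x *v dir n)) * osc (ph k) (ka n) (Th n) x) * a x)
    ~~> (LINT x|mu. c' n x * a x) / sqrt 2"
    unfolding E E2[symmetric] by (intro tendsto_divide lim a tendsto_const) simp
  qed
 qed
qed

text \<open>The part of the gradient orthogonal to the wave vector does not contribute to the limit.\<close>
lemma gradient_osc_limit:
 assumes "torus_basis ka Th" and ph: "strict_mono ph"
  and u: "!!k. has_weak_gradient Om (u k) (g k)" "!!k. sq_int mu (u k)" "!!k. sq_int mu (g k)" "!!k. norm2 mu (g k) <= B"
  and c: "!!n. sq_int mu (c n)"
  and lim: "!!n a. sq_int mu a ==> (%k. LINT x|mu. ((g (ph k) x \<bullet> (D x *v torus_basis.dir ka n)) * osc (ph k) (ka n) (Th n) x) * a x)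
   ~~> (LINT x|mu. c n x * a x) / sqrt 2"
  and a: "sq_int mu a"
 shows "(%k. LINT x|mu. (g (ph k) x $ i * osc (ph k) (ka n) (Th n) x) * a x) ~~>
  (LINT x|mu. a x * (\<Sum>j\<in>UNIV. matrix_inv (D x) $ j $ i * (c n x * torus_basis.dir ka n $ j / sqrt 2)))"
proof -
 interpret torus_basis ka Th by fact
 let ?b = "%j x. matrix_inv (D x) $ j $ i * a x"
 note b = matrix_inv_entry_times[OF a]
 \<comment> \<open>The part of the axis vector orthogonal to the wave vector, to which
   \<open>osc_weak_limit_direction\<close> applies.\<close>
 define et where "et j = axis j 1 - (dir n $ j) *\<^sub>R dir n" for j
 have kadir: "ka n = norm (ka n) *\<^sub>R dir n" using nonzero[of n] by (simp add: dir_def)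
 have orth: "ka n \<bullet> et j = 0" for j
 proof -
  have "dir n \<bullet> et j = 0" using norm_dir[of n] by (simp add: et_def inner_diff_right inner_axis norm_eq_1)
  then show ?thesis by (subst kadir) simp
 qed
 define A where "A j k = (LINT x|mu. ((g k x \<bullet> (D x *v dir n)) * osc k (ka n) (Th n) x) * ?b j x)" for j k
 define E where "E j k = (LINT x|mu. ((g k x \<bullet> (D x *v et j)) * osc k (ka n) (Th n) x) * ?b j x)" for j k
 have gs: "sq_int mu (%x. g k x \<bullet> (D x *v v))" for k v
  using sq_int_inner_const[OF gradient_pullback_sq_int(1)[OF u(3)[of k]], of v] by (simp add: dot_lmul_matrix)
 have int: "integrable mu (%x. ((g k x \<bullet> (D x *v v)) * osc k (ka n) (Th n) x) * ?b j x)" for k v j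
  by (rule sq_mult_int[OF osc_times_sq_int(1)[OF gs] b])
 \<comment> \<open>The component of the gradient is written through D applied to the axes, each
   split into its parts along and across the wave vector. Entries of the inverse matrix go into the
   test function.\<close>
 have dec: "(LINT x|mu. (g k x $ i * osc k (ka n) (Th n) x) * a x) = (\<Sum>j\<in>UNIV. dir n $ j * A j k + E j k)" for k
 proof -
  have ax: "D x *v axis j 1 = (dir n $ j) *\<^sub>R (D x *v dir n) + D x *v et j" for x j
   by (simp add: et_def matrix_vector_mult_diff_distrib matrix_vector_mult_scaleR)
  have "(g k x $ i * osc k (ka n) (Th n) x) * a x =
    (\<Sum>j\<in>UNIV. dir n $ j * (((g k x \<bullet> (D x *v dir n)) * osc k (ka n) (Th n) x) * ?b j x) +
     ((g k x \<bullet> (D x *v et j)) * osc k (ka n) (Th n) x) * ?b j x)" for x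
   by (subst D_axis[of "g k x" i x]) (simp add: ax inner_add_right sum_distrib_right sum_distrib_left algebra_simps)
  then have "(LINT x|mu. (g k x $ i * osc k (ka n) (Th n) x) * a x) =
    (LINT x|mu. (\<Sum>j\<in>UNIV. dir n $ j * (((g k x \<bullet> (D x *v dir n)) * osc k (ka n) (Th n) x) * ?b j x) +
     ((g k x \<bullet> (D x *v et j)) * osc k (ka n) (Th n) x) * ?b j x))" by (simp only:)
  also have "... = (\<Sum>j\<in>UNIV. LINT x|mu. dir n $ j * (((g k x \<bullet> (D x *v dir n)) * osc k (ka n) (Th n) x) * ?b j x) +
     ((g k x \<bullet> (D x *v et j)) * osc k (ka n) (Th n) x) * ?b j x)"
   by (intro LINT_sum intble_add integrable_mult_right int)
  also have "... = (\<Sum>j\<in>UNIV. dir n $ j * A j k + E j k)"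
   by (simp only: LINT_add[OF integrable_mult_right[OF int] int] integral_mult_right_zero A_def E_def)
  finally show ?thesis .
 qed
 have LA: "(%k. A j (ph k)) ~~> (LINT x|mu. c n x * ?b j x) / sqrt 2" for j
  unfolding A_def by (rule lim[OF b])
 have "(%k. E j k) ~~> 0" for j
  unfolding E_def by (rule osc_weak_limit_direction[OF nonzero orth u b])
 then have LE: "(%k. E j (ph k)) ~~> 0" for j using LIMSEQ_subseq_LIMSEQ[OF _ ph] by (fastforce simp: o_def)
 have "(%k. LINT x|mu. (g (ph k) x $ i * osc (ph k) (ka n) (Th n) x) * a x) ~~>
   (\<Sum>j\<in>UNIV. dir n $ j * ((LINT x|mu. c n x * ?b j x) / sqrt 2) + 0)"
  unfolding dec by (intro tendsto_sum tendsto_add tendsto_mult tendsto_const LA LE)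
 also have "(\<Sum>j\<in>UNIV. dir n $ j * ((LINT x|mu. c n x * ?b j x) / sqrt 2) + 0) =
   (\<Sum>j\<in>UNIV. LINT x|mu. (dir n $ j / sqrt 2) * (c n x * ?b j x))" by simp
 also have "... = (LINT x|mu. (\<Sum>j\<in>UNIV. (dir n $ j / sqrt 2) * (c n x * ?b j x)))"
  by (intro LINT_sum[symmetric] integrable_mult_right sq_mult_int[OF c b])
 also have "... = (LINT x|mu. a x * (\<Sum>j\<in>UNIV. matrix_inv (D x) $ j $ i * (c n x * dir n $ j / sqrt 2)))"
  by (simp add: sum_distrib_left ac_simps)
 finally show ?thesis .
qed

end

section \<open>The corrector as an element of the Bochner spaces, and the two-scale limit of the
  gradient\<close>

context lp_setting
begin

lemma L2_L2_iff:
 "W : L2_L2 Om \<longleftrightarrow> strongly_measurable mu (L2 unit_cell) (L2_norm unit_cell) W &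
  integrable mu (%x. (L2_norm unit_cell (W x))\<^sup>2)"
 by (simp add: L2_L2_def L2_bochner_iff)

lemma L2_L2_bound:
 assumes W: "strongly_measurable mu (L2 unit_cell) (L2_norm unit_cell) W" and h: "integrable mu h"
  and le: "!!x. x : Om ==> (L2_norm unit_cell (W x))\<^sup>2 <= h x"
 shows "W : L2_L2 Om"
proof -
 have m: "(%x. L2_norm unit_cell (W x)) : borel_measurable mu"
  by (rule seminorm_measurable[OF L2_cell.seminormed_functions_axioms W Om_sets])
 have "integrable mu (%x. (L2_norm unit_cell (W x))\<^sup>2)"
 proof (rule intble_bound[OF h _ AE_I2])
  show "(%x. (L2_norm unit_cell (W x))\<^sup>2) : borel_measurable mu" using m by measurable
  fix x assume "x : space mu"
  then have "(L2_norm unit_cell (W x))\<^sup>2 <= h x" using le by simp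
  then show "norm ((L2_norm unit_cell (W x))\<^sup>2) <= norm (h x)" by simp
 qed
 then show ?thesis using W by (simp add: L2_L2_iff)
qed

lemma L2_L2_add:
 assumes V: "V : L2_L2 Om" and W: "W : L2_L2 Om"
 shows "(%x y. V x y + W x y) : L2_L2 Om"
proof (rule L2_L2_bound)
 show "strongly_measurable mu (L2 unit_cell) (L2_norm unit_cell) (%x y. V x y + W x y)"
  using V W by (intro L2_cell.strongly_measurable_add) (simp_all add: L2_L2_iff)
 show "integrable mu (%x. 2 * (L2_norm unit_cell (V x))\<^sup>2 + 2 * (L2_norm unit_cell (W x))\<^sup>2)"
  using V W by (intro intble_add integrable_mult_right) (simp_all add: L2_L2_iff)
 fix x assume x: "x : Om"
 have VW: "V x : L2 unit_cell" "W x : L2 unit_cell" using V W x by (simp_all add: L2_L2_iff strongly_measurable_def)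
 have sq: "(a + b)\<^sup>2 <= 2 * a\<^sup>2 + 2 * b\<^sup>2" for a b :: real
  using sum_squares_bound[of a b] by (simp add: power2_sum)
 have "(L2_norm unit_cell (%y. V x y + W x y))\<^sup>2 <= (L2_norm unit_cell (V x) + L2_norm unit_cell (W x))\<^sup>2"
  by (rule power_mono[OF L2_cell.triangle[OF VW] L2_cell.nonneg[OF L2_cell.add[OF VW]]])
 also note sq
 finally show "(L2_norm unit_cell (%y. V x y + W x y))\<^sup>2 <= 2 * (L2_norm unit_cell (V x))\<^sup>2 + 2 * (L2_norm unit_cell (W x))\<^sup>2" .
qed

lemma L2_L2_mult:
 assumes W: "W : L2_L2 Om" and b: "b : borel_measurable mu" "!!x. x : Om ==> \<bar>b x\<bar> <= B"
 shows "(%x y. b x * W x y) : L2_L2 Om"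
proof (rule L2_L2_bound)
 show "strongly_measurable mu (L2 unit_cell) (L2_norm unit_cell) (%x y. b x * W x y)"
  using W by (intro L2_cell.strongly_measurable_scale b) (simp add: L2_L2_iff)
 show "integrable mu (%x. B\<^sup>2 * (L2_norm unit_cell (W x))\<^sup>2)"
  using W by (intro integrable_mult_right) (simp add: L2_L2_iff)
 fix x assume x: "x : Om"
 have Wx: "W x : L2 unit_cell" using W x by (simp add: L2_L2_iff strongly_measurable_def)
 have "\<bar>b x\<bar>\<^sup>2 <= B\<^sup>2" by (rule power_mono[OF b(2)[OF x]]) simp
 then show "(L2_norm unit_cell (%y. b x * W x y))\<^sup>2 <= B\<^sup>2 * (L2_norm unit_cell (W x))\<^sup>2"
  unfolding L2_cell.scale[OF Wx] power_mult_distrib by (rule mult_right_mono) simp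
qed

lemma L2_L2_const:
 assumes b: "sq_int mu b"
 shows "(%x y. b x) : L2_L2 Om"
proof (rule L2_L2_bound)
 have one: "(%y. 1) : L2 (unit_cell :: (real^'d) set)" unfolding L2_iff by (rule sq_int_const[OF finite_nu])
 show "strongly_measurable mu (L2 unit_cell) (L2_norm unit_cell) (%x (y :: real^'d). b x)"
  using L2_cell.strongly_measurable_scale[OF L2_cell.strongly_measurable_const[OF one] sq_int_measurable[OF b]] by simp
 show "integrable mu (%x. (norm (b x))\<^sup>2)" using b by (simp add: sq_int_def)
 show "(L2_norm unit_cell (%y. b x))\<^sup>2 <= (norm (b x))\<^sup>2" for x by (simp add: L2_norm_def)
qed

lemma L2_L2_sum:
 assumes "finite I" "!!i. i : I ==> W i : L2_L2 Om"
 shows "(%x y. \<Sum>i\<in>I. W i x y) : L2_L2 Om"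
 using assms
proof (induction I rule: finite_induct)
 case empty
 then show ?case using L2_L2_const[OF sq_int_const[OF finite_measure_mu, of 0]] by simp
next
 case (insert i I)
 then show ?case using L2_L2_add[of "W i" "%x y. \<Sum>i\<in>I. W i x y"] by simp
qed

text \<open>The limit is stated with \<open>weak_gradient\<close>, which is known only almost
  everywhere; the computations use an explicit representative.\<close>

lemma L2_L2_cong:
 assumes W: "W : L2_L2 Om" and ae: "!!x. x : Om ==> AE y in nu. W x y = V x y"
 shows "V : L2_L2 Om"
proof -
 have Wx: "sq_int nu (W x)" if "x : Om" for x
  using W that by (simp add: L2_L2_iff strongly_measurable_def L2_iff)
 have Vm: "V x : borel_measurable nu" if "x : Om" for x
  by (rule borel_measurable_lebesgue_on_AE[OF unit_cell_sets sq_int_measurable[OF Wx[OF that]] ae[OF that]])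
 have Vx: "sq_int nu (V x)" if "x : Om" for x by (rule sq_int_cong_AE[OF Wx[OF that] Vm[OF that] ae[OF that]])
 have z: "L2_norm unit_cell (%y. W x y - V x y) = 0" if "x : Om" for x
 proof -
  have "norm2 nu (%y. W x y - V x y) = norm2 nu (%y :: real^'d. 0 :: real)"
   by (rule norm2_cong_AE[OF sq_int_measurable[OF sq_int_diff[OF Wx[OF that] Vx[OF that]]] borel_measurable_const])
    (use ae[OF that] in eventually_elim, simp)
  then show ?thesis by (simp add: L2_norm_eq norm2_def)
 qed
 have n: "L2_norm unit_cell (V x) = L2_norm unit_cell (W x)" if "x : Om" for x
  unfolding L2_norm_eq
  by (rule norm2_cong_AE[symmetric, OF sq_int_measurable[OF Wx[OF that]] Vm[OF that] ae[OF that]])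
 show ?thesis
 proof (rule L2_L2_bound)
  show "strongly_measurable mu (L2 unit_cell) (L2_norm unit_cell) V"
   by (rule L2_cell.strongly_measurable_cong[of mu W]) (use W Vx z in \<open>simp_all add: L2_L2_iff L2_iff\<close>)
  show "integrable mu (%x. (L2_norm unit_cell (W x))\<^sup>2)" using W by (simp add: L2_L2_iff)
  show "(L2_norm unit_cell (V x))\<^sup>2 <= (L2_norm unit_cell (W x))\<^sup>2" if "x : Om" for x by (simp add: n[OF that])
 qed
qed

text \<open>For each \<open>x\<close> the coefficients are summed to a potential by
  \<open>fourier_series\<close>. The third conclusion, convergence against continuous periodic
  functions, is what lets the Fourier coefficients of the gradient be read off.\<close>

theorem corrector:
 assumes "torus_basis ka Th" and c: "!!n. sq_int mu (c n)"
  and sum: "\<forall>x\<in>Om. summable (%n. (c n x)\<^sup>2)" and int: "integrable mu (%x. \<Sum>n. (c n x)\<^sup>2)"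
 shows "\<exists>f G. f : L2_H1_per_quotient Om & (\<forall>x\<in>Om. has_weak_gradient UNIV (f x) (G x)) &
  (\<forall>j. (%x z. G x z $ j) : L2_L2 Om) &
  (\<forall>x\<in>Om. \<forall>j t. t : C_per --> (%m. LINT z|nu. (\<Sum>n<m. c n x *\<^sub>R torus_basis.field ka Th n z) $ j * t z) ~~>
   (LINT z|nu. G x z $ j * t z))"
proof -
 interpret torus_basis ka Th by fact
 define P where "P x F \<longleftrightarrow> periodic (fst F) & has_weak_gradient UNIV (fst F) (snd F) & sq_int nu (fst F) &
  sq_int nu (snd F) &
  (%m. norm2 nu (%y. ((\<Sum>n<m. c n x * potential n y) - fst F y, (\<Sum>n<m. c n x *\<^sub>R field n y) - snd F y))) ~~> 0 &
  (norm2 nu (%y. (fst F y, snd F y)))\<^sup>2 <= 2 * (\<Sum>n. (c n x)\<^sup>2)" for x and F :: "(real^'d => real) \<times> (real^'d => real^'d)"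
 have "\<forall>x\<in>Om. \<exists>F. P x F"
 proof
  fix x assume "x : Om"
  show "\<exists>F. P x F"
  proof (rule fourier_series[OF bspec[OF sum \<open>x : Om\<close>]])
   fix v g
   assume *: "periodic v" "has_weak_gradient UNIV v g" "sq_int nu v" "sq_int nu g"
    "(%m. norm2 nu (%y. ((\<Sum>n<m. c n x * potential n y) - v y, (\<Sum>n<m. c n x *\<^sub>R field n y) - g y))) ~~> 0"
    "(norm2 nu (%y. (v y, g y)))\<^sup>2 <= 2 * (\<Sum>n. (c n x)\<^sup>2)"
   show ?thesis by (rule exI[of _ "(v, g)"]) (simp add: P_def *)
  qed
 qed
 \<comment> \<open>The potentials are chosen for each \<open>x\<close> separately. Measurability in
   \<open>x\<close> comes from the partial sums, which converge to whatever was chosen.\<close>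
 from bchoice[OF this] obtain F where F: "\<forall>x\<in>Om. P x (F x)" by blast
 define f where "f x = fst (F x)" for x
 define G where "G x = snd (F x)" for x
 have f: "periodic (f x)" "has_weak_gradient UNIV (f x) (G x)" "sq_int nu (f x)" "sq_int nu (G x)"
  "(%m. norm2 nu (%y. ((\<Sum>n<m. c n x * potential n y) - f x y, (\<Sum>n<m. c n x *\<^sub>R field n y) - G x y))) ~~> 0"
  "(norm2 nu (%y. (f x y, G x y)))\<^sup>2 <= 2 * (\<Sum>n. (c n x)\<^sup>2)" if "x : Om" for x
  using F[rule_format, OF that] unfolding P_def f_def G_def by simp_all
 have fH: "f x : H1_per" if "x : Om" for x unfolding H1_per_iff using f[OF that] by blast
 have pH: "potential n : H1_per" for n
  unfolding H1_per_iff periodic_def using basis_periodic(1) basis_sq_int field_weak_gradient by blast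
 have cm: "c n : borel_measurable mu" for n by (rule sq_int_measurable[OF c])
 have cb: "AE x in mu. \<exists>B. \<forall>n. \<bar>c n x\<bar> <= B"
 proof (rule AE_I2)
  fix x assume "x : space mu"
  then have s: "summable (%n. (c n x)\<^sup>2)" using sum by simp
  have "\<bar>c n x\<bar> <= sqrt (\<Sum>n. (c n x)\<^sup>2)" for n
   using sum_le_suminf[OF s, of "{n}"] by (intro real_le_rsqrt) simp
  then show "\<exists>B. \<forall>n. \<bar>c n x\<bar> <= B" by blast
 qed
 have sqf: "sq_int nu (%y. \<Sum>n<m. c n x *\<^sub>R field n y)" for m x by (intro sq_int_sum sq_int_scaleR basis_sq_int)
 have sqp: "sq_int nu (%y. \<Sum>n<m. c n x * potential n y)" for m x
  using sq_int_sum[of "{..<m}" nu "%n y. c n x *\<^sub>R potential n y"] sq_int_scaleR[OF basis_sq_int(1)] by simp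
 have "strongly_measurable mu H1_per H1_per_norm f"
 proof (rule H1_per.strongly_measurable_series[of potential c, OF pH cm _ cb])
  show "f x : H1_per" if "x : space mu" for x using fH that by simp
  show "AE x in mu. (%m. H1_per_norm (%y. (\<Sum>n<m. c n x * potential n y) - f x y)) ~~> 0"
  proof (rule AE_I2)
   fix x assume "x : space mu"
   then have x: "x : Om" by simp
   have "has_weak_gradient UNIV (%y. (\<Sum>n<m. c n x * potential n y) + - 1 * f x y) (%y. (\<Sum>n<m. c n x *\<^sub>R field n y) + (- 1) *\<^sub>R G x y)" for m
    by (rule has_weak_gradient_add[OF open_UNIV partial_sum_weak_gradient has_weak_gradient_cmult[OF f(2)[OF x]]])
   then have "H1_per_norm (%y. (\<Sum>n<m. c n x * potential n y) - f x y) =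
     norm2 nu (%y. ((\<Sum>n<m. c n x * potential n y) - f x y, (\<Sum>n<m. c n x *\<^sub>R field n y) - G x y))" for m
    by (intro H1_per_norm_eq sq_int_diff sqf sqp f(3,4) x) simp
   then show "(%m. H1_per_norm (%y. (\<Sum>n<m. c n x * potential n y) - f x y)) ~~> 0" using f(5)[OF x] by simp
  qed
 qed
 then have SM: "strongly_measurable mu H1_per H1_per_quotient_norm f" by (rule strongly_measurable_quotient)
 have int2: "integrable mu (%x. 2 * (\<Sum>n. (c n x)\<^sup>2))" by (rule integrable_mult_right[OF int])
 have "integrable mu (%x. (H1_per_quotient_norm (f x))\<^sup>2)"
 proof (rule intble_bound[OF int2 _ AE_I2])
  show "(%x. (H1_per_quotient_norm (f x))\<^sup>2) : borel_measurable mu"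
   using seminorm_measurable[OF H1_quotient.seminormed_functions_axioms SM Om_sets] by measurable
  fix x assume "x : space mu"
  then have x: "x : Om" by simp
  have "H1_per_quotient_norm (f x) <= norm2 nu (%y. (f x y, G x y))"
   using quotient_norm_le[OF fH[OF x], of 0] H1_per_norm_eq[OF f(2,3,4)[OF x]] by simp
  then have "(H1_per_quotient_norm (f x))\<^sup>2 <= (norm2 nu (%y. (f x y, G x y)))\<^sup>2"
   by (rule power_mono) (rule H1_quotient.nonneg[OF fH[OF x]])
  also note f(6)[OF x]
  finally show "norm ((H1_per_quotient_norm (f x))\<^sup>2) <= norm (2 * (\<Sum>n. (c n x)\<^sup>2))" by simp
 qed
 then have fQ: "f : L2_H1_per_quotient Om" using SM by (simp add: L2_H1_per_quotient_def L2_bochner_iff)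
 have nth: "\<bar>z $ j\<bar> <= norm z" for z :: "real^'d" and j using norm_nth[of z j] by simp
 have comp: "sq_int nu (%y. h y $ j)" if "sq_int nu h" for h :: "real^'d => real^'d" and j
  using sq_int_inner_const[OF that, of "axis j 1"] by (simp add: inner_axis)
 have diffn: "norm2 nu (%y. (\<Sum>n<m. c n x *\<^sub>R field n y) $ j - G x y $ j) <=
   norm2 nu (%y. ((\<Sum>n<m. c n x * potential n y) - f x y, (\<Sum>n<m. c n x *\<^sub>R field n y) - G x y))"
  if x: "x : Om" for x m j
 proof (rule norm2_mono[OF _ _ AE_I2])
  show "sq_int nu (%y. ((\<Sum>n<m. c n x * potential n y) - f x y, (\<Sum>n<m. c n x *\<^sub>R field n y) - G x y))"
   unfolding sq_int_Pair by (intro conjI sq_int_diff sqf sqp f(3,4) x)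
  show "(%y. (\<Sum>n<m. c n x *\<^sub>R field n y) $ j - G x y $ j) : borel_measurable nu"
   by (intro sq_int_measurable sq_int_diff comp sqf f(4) x)
  fix y
  show "norm ((\<Sum>n<m. c n x *\<^sub>R field n y) $ j - G x y $ j) <=
    norm ((\<Sum>n<m. c n x * potential n y) - f x y, (\<Sum>n<m. c n x *\<^sub>R field n y) - G x y)"
   unfolding vector_minus_component[symmetric] real_norm_def by (rule order_trans[OF nth norm_snd_le])
 qed
 have lim: "(%m. norm2 nu (%y. (\<Sum>n<m. c n x *\<^sub>R field n y) $ j - G x y $ j)) ~~> 0" if x: "x : Om" for x j
  by (rule Lim_null_comparison[OF always_eventually[OF allI] f(5)[OF x]]) (use diffn[OF x] in \<open>simp add: norm2_nonneg\<close>)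
 have GW: "(%x z. G x z $ j) : L2_L2 Om" for j
 proof (rule L2_L2_bound[OF _ int2])
  show "strongly_measurable mu (L2 unit_cell) (L2_norm unit_cell) (%x z. G x z $ j)"
  proof (rule L2_cell.strongly_measurable_series[of "%n z. field n z $ j" c, OF _ cm _ cb])
   show "(%z. field n z $ j) : L2 unit_cell" for n unfolding L2_iff by (rule comp[OF basis_sq_int(2)])
   show "(%z. G x z $ j) : L2 unit_cell" if "x : space mu" for x unfolding L2_iff by (rule comp[OF f(4)]) (use that in simp)
   show "AE x in mu. (%m. L2_norm unit_cell (%y. (\<Sum>n<m. c n x * field n y $ j) - G x y $ j)) ~~> 0"
    by (rule AE_I2) (use lim in \<open>simp add: L2_norm_eq\<close>)
  qed
  fix x assume x: "x : Om"
  have "norm2 nu (%z. G x z $ j) <= norm2 nu (%y. (f x y, G x y))"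
  proof (rule norm2_mono[OF _ sq_int_measurable[OF comp[OF f(4)[OF x]]] AE_I2])
   show "sq_int nu (%y. (f x y, G x y))" unfolding sq_int_Pair using f(3,4)[OF x] by blast
   show "norm (G x y $ j) <= norm (f x y, G x y)" for y
    unfolding real_norm_def by (rule order_trans[OF nth norm_snd_le])
  qed
  then have "(norm2 nu (%z. G x z $ j))\<^sup>2 <= (norm2 nu (%y. (f x y, G x y)))\<^sup>2"
   by (rule power_mono) (rule norm2_nonneg)
  also note f(6)[OF x]
  finally show "(L2_norm unit_cell (%z. G x z $ j))\<^sup>2 <= 2 * (\<Sum>n. (c n x)\<^sup>2)" by (simp add: L2_norm_eq)
 qed
 have "(%m. LINT z|nu. (\<Sum>n<m. c n x *\<^sub>R field n z) $ j * t z) ~~> (LINT z|nu. G x z $ j * t z)"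
  if x: "x : Om" and t: "t : C_per" for x j t
 proof -
  note ts = sq_int_cell_C_per[OF t]
  have D: "(LINT z|nu. (\<Sum>n<m. c n x *\<^sub>R field n z) $ j * t z) - (LINT z|nu. G x z $ j * t z) =
    (LINT z|nu. ((\<Sum>n<m. c n x *\<^sub>R field n z) $ j - G x z $ j) * t z)" for m
   unfolding LINT_diff[OF sq_mult_int[OF comp[OF sqf] ts] sq_mult_int[OF comp[OF f(4)[OF x]] ts], symmetric]
   by (simp only: left_diff_distrib)
  have le: "\<bar>LINT z|nu. ((\<Sum>n<m. c n x *\<^sub>R field n z) $ j - G x z $ j) * t z\<bar> <=
    norm2 nu (%z. (\<Sum>n<m. c n x *\<^sub>R field n z) $ j - G x z $ j) * norm2 nu t" for m
   by (rule Cauchy_Schwarz_integral_real[OF sq_int_diff[OF comp[OF sqf] comp[OF f(4)[OF x]]] ts])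
  have L: "(%m. norm2 nu (%z. (\<Sum>n<m. c n x *\<^sub>R field n z) $ j - G x z $ j) * norm2 nu t) ~~> 0"
   using tendsto_mult_right[OF lim[OF x, of j], of "norm2 nu t"] by simp
  have "(%m. LINT z|nu. ((\<Sum>n<m. c n x *\<^sub>R field n z) $ j - G x z $ j) * t z) ~~> 0"
   by (rule Lim_null_comparison[OF always_eventually[OF allI] L]) (simp only: real_norm_def le)
  then show ?thesis unfolding D[symmetric] by (simp only: LIM_zero_iff)
 qed
 then show ?thesis using fQ f(2) GW by blast
qed

lemma osc_0_integral:
 assumes "sq_int mu v" "sq_int mu a"
 shows "(LINT x|mu. (v x * osc k 0 th x) * a x) = cos th * (LINT x|mu. v x * a x)"
proof -
 have "(LINT x|mu. (v x * osc k 0 th x) * a x) = (LINT x|mu. cos th * (v x * a x))"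
 proof (rule integral_cong_AE)
  show "(%x. (v x * osc k 0 th x) * a x) : borel_measurable mu" "(%x. cos th * (v x * a x)) : borel_measurable mu"
   using assms[THEN sq_int_measurable] osc_measurable[of k 0 th] by measurable
  show "AE x in mu. (v x * osc k 0 th x) * a x = cos th * (v x * a x)"
   using osc_0_AE[of k th] by eventually_elim simp
 qed
 then show ?thesis by simp
qed

lemma osc_combination:
 assumes "!!y. tcos m th y = al * tcos m1 th1 y + be * tcos m2 th2 y"
 shows "osc k m th x = al * osc k m1 th1 x + be * osc k m2 th2 x"
 using assms unfolding osc_def tcos_def by (cases rule: L_cases[of k x]) simp_all

lemma tcos_C_per: "integer_vector m ==> tcos m th : C_per"
 by (rule trig_polys_C_per[OF trig_polys.cos])

text \<open>Both sides are compared mode by mode. The mode 0 sees only the weak limit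
  \<open>g0\<close>, as the corrector gradient has mean 0; every other mode sees only the corrector,
  whose coefficients were defined by these limits.\<close>

theorem gradient_two_scale_limit:
 assumes u: "!!k. has_weak_gradient Om (u k) (g k)" "!!k. sq_int mu (u k)" "!!k. sq_int mu (g k)" "!!k. norm2 mu (g k) <= B"
  and g0: "sq_int mu g0"
  and weak: "!!a i. sq_int mu a ==> (%k. LINT x|mu. g k x $ i * a x) ~~> (LINT x|mu. g0 x $ i * a x)"
 shows "\<exists>ph f. strict_mono (ph :: nat => nat) & f : L2_H1_per_quotient Om &
  (\<forall>i. (%x z. g0 x $ i + weak_gradient UNIV (on_cells D f x) (D x *v z) $ i) : L2_L2 Om &
   (\<forall>a m th. sq_int mu a --> integer_vector m -->
    (%k. LINT x|mu. (g (ph k) x $ i * osc (ph k) m th x) * a x) ~~>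
    (LINT x|mu. a x * (LINT z|nu. (g0 x $ i + weak_gradient UNIV (on_cells D f x) (D x *v z) $ i) * tcos m th z))))"
proof -
 have comp: "sq_int M (%y. h y $ j)" if "sq_int M h" for M and h :: "real^'d => real^'d" and j
  using sq_int_inner_const[OF that, of "axis j 1"] by (simp add: inner_axis)
 show ?thesis
 proof (rule torus_basis_exists[where 'd='d])
  fix ka :: "nat => real^'d" and Th assume tb: "torus_basis ka Th" and complete: "\<forall>m th. integer_vector m --> m ~= 0 -->
   (\<exists>n n' al be. \<forall>y. tcos m th y = al * tcos (ka n) (Th n) y + be * tcos (ka n') (Th n') y)"
  interpret torus_basis ka Th by (rule tb)
  show ?thesis
  proof (rule corrector_coefficients[OF tb u(3,4)])
   fix ph :: "nat => nat" and c :: "nat => real^'d => real"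
   assume ph: "strict_mono ph" and c: "!!n. sq_int mu (c n)"
    and lim: "!!n a. sq_int mu a ==> (%k. LINT x|mu. ((g (ph k) x \<bullet> (D x *v dir n)) * osc (ph k) (ka n) (Th n) x) * a x)
     ~~> (LINT x|mu. c n x * a x) / sqrt 2"
    and sum: "!!x. x : Om ==> summable (%n. (c n x)\<^sup>2)" and int: "integrable mu (%x. \<Sum>n. (c n x)\<^sup>2)"
   have sum': "\<forall>x\<in>Om. summable (%n. (c n x)\<^sup>2)" using sum by blast
   obtain f G where fQ: "f : L2_H1_per_quotient Om" and fG: "\<forall>x\<in>Om. has_weak_gradient UNIV (f x) (G x)"
    and GW: "\<forall>j. (%x z. G x z $ j) : L2_L2 Om"
    and GT: "\<forall>x\<in>Om. \<forall>j t. t : C_per --> (%m. LINT z|nu. (\<Sum>n<m. c n x *\<^sub>R field n z) $ j * t z) ~~>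
     (LINT z|nu. G x z $ j * t z)"
    using corrector[OF tb c sum' int] by (elim exE conjE) (rule that)
   have Gsq: "sq_int nu (%z. G x z $ j)" if "x : Om" for x j
    using GW that by (simp add: L2_L2_iff strongly_measurable_def L2_iff)
   \<comment> \<open>The claimed limit in cell coordinates, with the chain rule for the corrector
     written out. It agrees with the \<open>weak_gradient\<close> expression almost
     everywhere.\<close>
   define Vf where "Vf i x z = g0 x $ i + (\<Sum>j\<in>UNIV. matrix_inv (D x) $ j $ i * G x z $ j)" for i x z
   have VW: "Vf i : L2_L2 Om" for i
   proof -
    obtain M where M: "!!x i j. x : Om ==> \<bar>matrix_inv (D x) $ i $ j\<bar> <= M" using D_bounded by metis
    have m: "(%x. matrix_inv (D x) $ j $ i) : borel_measurable mu" for j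
     by (intro continuous_borel continuous_intros continuous_D(2))
    show ?thesis
     unfolding Vf_def[abs_def]
     by (intro L2_L2_add L2_L2_const comp[OF g0] L2_L2_sum finite L2_L2_mult[OF GW[rule_format] m M])
   qed
   have wV: "AE z in nu. Vf i x z = g0 x $ i + weak_gradient UNIV (on_cells D f x) (D x *v z) $ i"
    if x: "x : Om" for x i
   proof -
    have wg: "has_weak_gradient UNIV (on_cells D f x) (%y. transpose (matrix_inv (D x)) *v G x (matrix_inv (D x) *v y))"
     using has_weak_gradient_linear[OF invertible_D[of x] fG[rule_format, OF x]] by (simp add: on_cells_def[abs_def])
    have "AE y in lebesgue. weak_gradient UNIV (on_cells D f x) y = transpose (matrix_inv (D x)) *v G x (matrix_inv (D x) *v y)"
     using weak_gradient_AE[OF open_UNIV wg] by simp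
    from AE_matrix_vector[OF invertible_D[of x] this]
    have "AE z in lebesgue. weak_gradient UNIV (on_cells D f x) (D x *v z) = transpose (matrix_inv (D x)) *v G x z"
     using matrix_inv_mult(2)[OF invertible_D[of x]] by (simp add: matrix_vector_mul_assoc)
    then show ?thesis
     unfolding AE_lebesgue_on[OF unit_cell_sets]
     by eventually_elim (simp add: Vf_def matrix_vector_mult_def transpose_def)
   qed
   have WW: "(%x z. g0 x $ i + weak_gradient UNIV (on_cells D f x) (D x *v z) $ i) : L2_L2 Om" for i
    by (rule L2_L2_cong[OF VW wV])
   have Vsq: "sq_int nu (Vf i x)" if "x : Om" for i x
    using VW that by (simp add: L2_L2_iff strongly_measurable_def L2_iff)
   define R where "R i m th x = (LINT z|nu. Vf i x z * tcos m th z)" for i m th x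
   have wR: "(LINT z|nu. (g0 x $ i + weak_gradient UNIV (on_cells D f x) (D x *v z) $ i) * tcos m th z) = R i m th x"
    if x: "x : Om" for i m th x
    unfolding R_def
   proof (rule integral_cong_AE[symmetric])
    have t: "tcos m th : borel_measurable nu" by (rule continuous_borel[OF tcos_continuous])
    have V: "Vf i x : borel_measurable nu" by (rule sq_int_measurable[OF Vsq[OF x]])
    show "(%z. Vf i x z * tcos m th z) : borel_measurable nu" by (rule borel_measurable_times[OF V t])
    show "(%z. (g0 x $ i + weak_gradient UNIV (on_cells D f x) (D x *v z) $ i) * tcos m th z) : borel_measurable nu"
     by (rule borel_measurable_times[OF borel_measurable_lebesgue_on_AE[OF unit_cell_sets V wV[OF x]] t])
    show "AE z in nu. Vf i x z * tcos m th z = (g0 x $ i + weak_gradient UNIV (on_cells D f x) (D x *v z) $ i) * tcos m th z"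
     using wV[OF x, of i] by eventually_elim simp
   qed
   define T where "T j m th x = (LINT z|nu. G x z $ j * tcos m th z)" for j m th x
   have Texp: "(%M. \<Sum>n<M. c n x * (sqrt 2 * dir n $ j * (LINT z|nu. tcos (ka n) (Th n) z * tcos m th z))) ~~> T j m th x"
    if x: "x : Om" and m: "integer_vector m" for x j m th
   proof -
    have i: "integrable nu (%z. tcos (ka n) (Th n) z * tcos m th z)" for n
     by (rule sq_mult_int[OF sq_int_cell_C_per[OF tcos_C_per[OF integer]] sq_int_cell_C_per[OF tcos_C_per[OF m]]])
    have "(LINT z|nu. (\<Sum>n<M. c n x *\<^sub>R field n z) $ j * tcos m th z) =
      (\<Sum>n<M. c n x * (sqrt 2 * dir n $ j * (LINT z|nu. tcos (ka n) (Th n) z * tcos m th z)))" for M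
    proof -
     have "(\<Sum>n<M. c n x *\<^sub>R field n z) $ j * tcos m th z =
       (\<Sum>n<M. (c n x * (sqrt 2 * dir n $ j)) * (tcos (ka n) (Th n) z * tcos m th z))" for z
      by (simp add: field_def sum_distrib_left sum_distrib_right ac_simps)
     then show ?thesis
      by (simp add: LINT_sum integrable_mult_right i mult.assoc)
    qed
    then show ?thesis using GT[rule_format, OF x tcos_C_per[OF m], of j th] by (simp add: T_def)
   qed
   have T0: "T j 0 th x = 0" if x: "x : Om" for j th x
   proof -
    have z: "integer_vector (0 :: real^'d)" by (simp add: integer_vector_def)
    have "(LINT z|nu. tcos (ka n) (Th n) z * tcos 0 th z) = 0" for n
     unfolding integral_tcos_mult[OF integer z] using nonzero[of n] by simp
    then show ?thesis using LIMSEQ_unique[OF Texp[OF x z, of j th], of 0] by simp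
   qed
   \<comment> \<open>Orthogonality leaves one term: the sqrt 2 of the field times the mean square
     1/2 is the 1 / sqrt 2 of the limit of the gradients.\<close>
   have T1: "T j (ka l) (Th l) x = c l x * dir l $ j / sqrt 2" if x: "x : Om" for j l x
   proof -
    have I: "(LINT z|nu. tcos (ka n) (Th n) z * tcos (ka l) (Th l) z) = (if n = l then 1 / 2 else 0)" for n
     unfolding integral_tcos_mult[OF integer integer] using half[of n l] phase[of n l] by auto
    have ev: "(\<Sum>n<M. c n x * (sqrt 2 * dir n $ j * (if n = l then 1 / 2 else 0))) = c l x * dir l $ j / sqrt 2" if "l < M" for M
    proof -
     have "(\<Sum>n<M. c n x * (sqrt 2 * dir n $ j * (if n = l then 1 / 2 else 0))) =
       (\<Sum>n<M. if n = l then c n x * dir n $ j / sqrt 2 else 0)"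
      by (intro sum.cong refl) (auto simp: field_simps)
     then show ?thesis using that by simp
    qed
    have "\<forall>\<^sub>F M in sequentially. (\<Sum>n<M. c n x * (sqrt 2 * dir n $ j * (if n = l then 1 / 2 else 0))) = c l x * dir l $ j / sqrt 2"
     by (rule eventually_mono[OF eventually_gt_at_top[of l]]) (rule ev)
    then have "(%M. \<Sum>n<M. c n x * (sqrt 2 * dir n $ j * (if n = l then 1 / 2 else 0))) ~~> c l x * dir l $ j / sqrt 2"
     by (rule tendsto_eventually)
    then show ?thesis using Texp[OF x integer, of j l "Th l"] unfolding I by (rule LIMSEQ_unique[rotated])
   qed
   have RT: "R i m th x = g0 x $ i * (if m = 0 then cos th else 0) + (\<Sum>j\<in>UNIV. matrix_inv (D x) $ j $ i * T j m th x)"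
    if x: "x : Om" and m: "integer_vector m" for i m th x
   proof -
    note ts = sq_int_cell_C_per[OF tcos_C_per[OF m]]
    have i1: "integrable nu (%z. matrix_inv (D x) $ j $ i * (G x z $ j * tcos m th z))" for j
     by (rule integrable_mult_right[OF sq_mult_int[OF Gsq[OF x] ts]])
    have i2: "integrable nu (%z. g0 x $ i * tcos m th z)"
     by (rule sq_mult_int[OF sq_int_const[OF finite_nu] ts])
    have "R i m th x = (LINT z|nu. g0 x $ i * tcos m th z + (\<Sum>j\<in>UNIV. matrix_inv (D x) $ j $ i * (G x z $ j * tcos m th z)))"
     by (simp add: R_def Vf_def distrib_right sum_distrib_right mult.assoc)
    also have "... = (LINT z|nu. g0 x $ i * tcos m th z) + (LINT z|nu. (\<Sum>j\<in>UNIV. matrix_inv (D x) $ j $ i * (G x z $ j * tcos m th z)))"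
     by (rule LINT_add[OF i2 intble_sum[OF i1]])
    also have "(LINT z|nu. (\<Sum>j\<in>UNIV. matrix_inv (D x) $ j $ i * (G x z $ j * tcos m th z))) =
      (\<Sum>j\<in>UNIV. LINT z|nu. matrix_inv (D x) $ j $ i * (G x z $ j * tcos m th z))"
     by (rule LINT_sum[OF i1])
    finally show ?thesis by (simp add: T_def integral_tcos[OF m])
   qed
   have LIM0: "(%k. LINT x|mu. (g (ph k) x $ i * osc (ph k) 0 th x) * a x) ~~> (LINT x|mu. a x * R i 0 th x)"
    if a: "sq_int mu a" for i th a
   proof -
    have z: "integer_vector (0 :: real^'d)" by (simp add: integer_vector_def)
    have "(LINT x|mu. a x * R i 0 th x) = (LINT x|mu. cos th * (g0 x $ i * a x))"
     by (rule LINT_cong[OF refl]) (use RT[OF _ z] T0 in simp)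
    moreover have "(%k. cos th * (LINT x|mu. g (ph k) x $ i * a x)) ~~> cos th * (LINT x|mu. g0 x $ i * a x)"
     using LIMSEQ_subseq_LIMSEQ[OF weak[OF a, of i] ph] by (intro tendsto_mult tendsto_const) (simp add: o_def)
    ultimately show ?thesis by (simp add: osc_0_integral[OF comp[OF u(3)] a])
   qed
   define Rb where "Rb i n x = (\<Sum>j\<in>UNIV. matrix_inv (D x) $ j $ i * (c n x * dir n $ j / sqrt 2))" for i n x
   have Rb: "R i (ka n) (Th n) x = Rb i n x" if "x : Om" for i n x
    unfolding RT[OF that integer] T1[OF that] Rb_def using nonzero[of n] by simp
   have Rbs: "sq_int mu (Rb i n)" for i n
    unfolding Rb_def[abs_def]
   proof (rule sq_int_sum)
    fix j
    have "sq_int mu (%x. (dir n $ j / sqrt 2) *\<^sub>R c n x)" by (rule sq_int_scaleR[OF c])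
    then have "sq_int mu (%x. c n x * dir n $ j / sqrt 2)" by (simp add: mult.commute)
    then show "sq_int mu (%x. matrix_inv (D x) $ j $ i * (c n x * dir n $ j / sqrt 2))" by (rule matrix_inv_entry_times)
   qed
   have LIM1: "(%k. LINT x|mu. (g (ph k) x $ i * osc (ph k) (ka n) (Th n) x) * a x) ~~> (LINT x|mu. a x * Rb i n x)"
    if a: "sq_int mu a" for i n a
    unfolding Rb_def by (rule gradient_osc_limit[OF tb ph u c lim a])
   \<comment> \<open>A wave with arbitrary phase, or with the wave vector opposite to the chosen
     representative, is a combination of two basis waves.\<close>
   have LIM: "(%k. LINT x|mu. (g (ph k) x $ i * osc (ph k) m th x) * a x) ~~> (LINT x|mu. a x * R i m th x)"
    if a: "sq_int mu a" and m: "integer_vector m" for i m th a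
   proof (cases "m = 0")
    case True
    then show ?thesis using LIM0[OF a] by simp
   next
    case False
    obtain n n' al be where t: "!!y. tcos m th y = al * tcos (ka n) (Th n) y + be * tcos (ka n') (Th n') y"
     using complete m False by blast
    have i: "integrable mu (%x. (g k x $ i * osc k (ka n) (Th n) x) * a x)" for k n
     by (rule sq_mult_int[OF osc_times_sq_int(1)[OF comp[OF u(3)]] a])
    have j: "integrable mu (%x. a x * Rb i n x)" for n by (rule sq_mult_int[OF a Rbs])
    have L: "(LINT x|mu. (g k x $ i * osc k m th x) * a x) = al * (LINT x|mu. (g k x $ i * osc k (ka n) (Th n) x) * a x) +
      be * (LINT x|mu. (g k x $ i * osc k (ka n') (Th n') x) * a x)" for k
    proof -
     have "(LINT x|mu. (g k x $ i * osc k m th x) * a x) = (LINT x|mu. al * ((g k x $ i * osc k (ka n) (Th n) x) * a x) +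
       be * ((g k x $ i * osc k (ka n') (Th n') x) * a x))"
      unfolding osc_combination[OF t] by (simp only: distrib_left distrib_right ac_simps)
     then show ?thesis
      by (simp only: LINT_add[OF integrable_mult_right[OF i] integrable_mult_right[OF i]] integral_mult_right_zero)
    qed
    have "R i m th x = al * Rb i n x + be * Rb i n' x" if x: "x : Om" for x
    proof -
     have iR: "integrable nu (%z. Vf i x z * tcos (ka n) (Th n) z)" for n
      by (rule sq_mult_int[OF Vsq[OF x] sq_int_cell_C_per[OF tcos_C_per[OF integer]]])
     have "R i m th x = (LINT z|nu. al * (Vf i x z * tcos (ka n) (Th n) z) + be * (Vf i x z * tcos (ka n') (Th n') z))"
      unfolding R_def t by (simp only: distrib_left ac_simps)
     also have "... = al * R i (ka n) (Th n) x + be * R i (ka n') (Th n') x"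
      by (simp only: R_def LINT_add[OF integrable_mult_right[OF iR] integrable_mult_right[OF iR]] integral_mult_right_zero)
     finally show ?thesis by (simp only: Rb[OF x])
    qed
    then have "(LINT x|mu. a x * R i m th x) = (LINT x|mu. al * (a x * Rb i n x) + be * (a x * Rb i n' x))"
     by (intro LINT_cong refl) (simp add: algebra_simps)
    also have "... = al * (LINT x|mu. a x * Rb i n x) + be * (LINT x|mu. a x * Rb i n' x)"
     by (simp only: LINT_add[OF integrable_mult_right[OF j] integrable_mult_right[OF j]] integral_mult_right_zero)
    finally show ?thesis
     unfolding L by (simp only:) (intro tendsto_add tendsto_mult tendsto_const LIM1 a)
   qed
   have "(LINT x|mu. a x * (LINT z|nu. (g0 x $ i + weak_gradient UNIV (on_cells D f x) (D x *v z) $ i) * tcos m th z)) =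
     (LINT x|mu. a x * R i m th x)" for a i m th
    by (rule LINT_cong[OF refl]) (simp add: wR)
   then show ?thesis
    using ph fQ WW LIM by (intro exI[of _ ph] exI[of _ f] conjI allI impI) simp_all
  qed
 qed
qed

end

section \<open>Weak convergence in the Sobolev space, and the conclusion\<close>

lemma H1D:
 assumes S: "open S" and v: "v : H1 S"
 shows "has_weak_gradient S v (weak_gradient S v)" "sq_int (leb S) v" "sq_int (leb S) (weak_gradient S v)"
  "norm2 (leb S) v <= H1_norm S v" "norm2 (leb S) (weak_gradient S v) <= H1_norm S v"
proof -
 have Sl: "S : sets lebesgue" by (rule open_in_sets_lebesgue[OF S])
 obtain g where g: "has_weak_gradient S v g" "sq_int (leb S) g" and vs: "sq_int (leb S) v"
  using v unfolding H1_def L2_iff by blast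
 show "has_weak_gradient S v (weak_gradient S v)" by (rule has_weak_gradient_weak_gradient[OF g(1)])
 show "sq_int (leb S) v" by (rule vs)
 have ae: "AE x in leb S. g x = weak_gradient S v x"
  unfolding AE_lebesgue_on[OF Sl] using weak_gradient_AE[OF S g(1)] by eventually_elim simp
 show "sq_int (leb S) (weak_gradient S v)"
  by (rule sq_int_cong_AE[OF g(2) borel_measurable_lebesgue_on_AE[OF Sl sq_int_measurable[OF g(2)] ae] ae])
 show "norm2 (leb S) v <= H1_norm S v" "norm2 (leb S) (weak_gradient S v) <= H1_norm S v"
  unfolding H1_norm_def L2_norm_eq by (rule real_sqrt_sum_squares_ge1, rule real_sqrt_sum_squares_ge2)
qed

text \<open>These functionals translate weak convergence in H^1 into weak L^2 convergence of the
  functions and of each gradient component. Linearity of the second one rests on uniqueness of weak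
  gradients, as \<open>weak_gradient\<close> itself is only a choice.\<close>

lemma pairing_H1_dual:
 assumes S: "open S" and a: "sq_int (leb S) a"
 shows "(%v. LINT x|leb S. v x * a x) : H1_dual S"
  "(%v. LINT x|leb S. weak_gradient S v x $ i * a x) : H1_dual S"
proof -
 let ?M = "leb S"
 note H = H1D[OF S]
 have Sl: "S : sets lebesgue" by (rule open_in_sets_lebesgue[OF S])
 have comp: "sq_int ?M (%y. h y $ i)" if "sq_int ?M h" for h :: "real^'a => real^'a"
  using sq_int_inner_const[OF that, of "axis i 1"] by (simp add: inner_axis)
 show "(%v. LINT x|?M. v x * a x) : H1_dual S"
  unfolding H1_dual_def mem_Collect_eq
 proof (intro conjI ballI allI exI[of _ "norm2 ?M a"])
  fix v w assume v: "v : H1 S" and w: "w : H1 S"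
  show "(LINT x|?M. (v x + w x) * a x) = (LINT x|?M. v x * a x) + (LINT x|?M. w x * a x)"
   unfolding distrib_right
   by (rule LINT_add[OF sq_mult_int[OF H(2)[OF v] a] sq_mult_int[OF H(2)[OF w] a]])
 next
  fix v and c :: real
  show "(LINT x|?M. (c * v x) * a x) = c * (LINT x|?M. v x * a x)" by (simp add: mult.assoc)
 next
  fix v assume v: "v : H1 S"
  have "\<bar>LINT x|?M. v x * a x\<bar> <= norm2 ?M v * norm2 ?M a" by (rule Cauchy_Schwarz_integral_real[OF H(2)[OF v] a])
  also have "... <= H1_norm S v * norm2 ?M a" by (rule mult_right_mono[OF H(4)[OF v] norm2_nonneg])
  finally show "\<bar>LINT x|?M. v x * a x\<bar> <= norm2 ?M a * H1_norm S v" by (simp only: mult.commute)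
 qed
 have cong: "(LINT x|?M. weak_gradient S v x $ i * a x) = (LINT x|?M. g x $ i * a x)"
  if g: "has_weak_gradient S v g" "sq_int ?M g" for v g
 proof (rule integral_cong_AE)
  have ae: "AE x in ?M. g x = weak_gradient S v x"
   unfolding AE_lebesgue_on[OF Sl] using weak_gradient_AE[OF S g(1)] by eventually_elim simp
  have ws: "sq_int ?M (weak_gradient S v)"
   by (rule sq_int_cong_AE[OF g(2) borel_measurable_lebesgue_on_AE[OF Sl sq_int_measurable[OF g(2)] ae] ae])
  show "(%x. weak_gradient S v x $ i * a x) : borel_measurable ?M" "(%x. g x $ i * a x) : borel_measurable ?M"
   by (intro borel_measurable_times sq_int_measurable comp ws g(2) a)+
  show "AE x in ?M. weak_gradient S v x $ i * a x = g x $ i * a x" using ae by eventually_elim simp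
 qed
 show "(%v. LINT x|?M. weak_gradient S v x $ i * a x) : H1_dual S"
  unfolding H1_dual_def mem_Collect_eq
 proof (intro conjI ballI allI exI[of _ "norm2 ?M a"])
  fix v w assume v: "v : H1 S" and w: "w : H1 S"
  have "(LINT x|?M. weak_gradient S (%x. v x + w x) x $ i * a x) = (LINT x|?M. (weak_gradient S v x + weak_gradient S w x) $ i * a x)"
   by (rule cong[OF has_weak_gradient_add[OF S H(1)[OF v] H(1)[OF w]] sq_int_add[OF H(3)[OF v] H(3)[OF w]]])
  also have "... = (LINT x|?M. weak_gradient S v x $ i * a x) + (LINT x|?M. weak_gradient S w x $ i * a x)"
   unfolding vector_add_component distrib_right
   by (rule LINT_add[OF sq_mult_int[OF comp[OF H(3)[OF v]] a] sq_mult_int[OF comp[OF H(3)[OF w]] a]])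
  finally show "(LINT x|?M. weak_gradient S (%x. v x + w x) x $ i * a x) =
   (LINT x|?M. weak_gradient S v x $ i * a x) + (LINT x|?M. weak_gradient S w x $ i * a x)" .
 next
  fix v and c :: real assume v: "v : H1 S"
  have "(LINT x|?M. weak_gradient S (%x. c * v x) x $ i * a x) = (LINT x|?M. (c *\<^sub>R weak_gradient S v x) $ i * a x)"
   by (rule cong[OF has_weak_gradient_cmult[OF H(1)[OF v]] sq_int_scaleR[OF H(3)[OF v]]])
  then show "(LINT x|?M. weak_gradient S (%x. c * v x) x $ i * a x) = c * (LINT x|?M. weak_gradient S v x $ i * a x)"
   by (simp add: mult.assoc)
 next
  fix v assume v: "v : H1 S"
  have "\<bar>LINT x|?M. weak_gradient S v x $ i * a x\<bar> <= norm2 ?M (%x. weak_gradient S v x $ i) * norm2 ?M a"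
   by (rule Cauchy_Schwarz_integral_real[OF comp[OF H(3)[OF v]] a])
  also have "... <= H1_norm S v * norm2 ?M a"
  proof (rule mult_right_mono[OF order_trans[OF norm2_mono[OF H(3)[OF v] sq_int_measurable[OF comp[OF H(3)[OF v]]] AE_I2] H(5)[OF v]] norm2_nonneg])
   show "norm (weak_gradient S v x $ i) <= norm (weak_gradient S v x)" for x by (rule norm_nth)
  qed
  finally show "\<bar>LINT x|?M. weak_gradient S v x $ i * a x\<bar> <= norm2 ?M a * H1_norm S v" by (simp only: mult.commute)
 qed
qed

theorem theorem3:
  fixes \<Omega> :: "(real^'d) set"
    and D :: "real^'d \<Rightarrow> real^'d^'d"
    and D1 D2 r :: real
    and \<epsilon> :: "nat \<Rightarrow> real"
    and N :: "nat \<Rightarrow> nat"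
    and Q :: "nat \<Rightarrow> nat \<Rightarrow> (real^'d) set"
    and p q :: "nat \<Rightarrow> nat \<Rightarrow> real^'d"
    and u :: "nat \<Rightarrow> real^'d \<Rightarrow> real"
    and u0 :: "real^'d \<Rightarrow> real"
  assumes "bounded_lipschitz_domain \<Omega>"
    and "\<And>x. invertible (D x)"
    and "\<exists>C. C-lipschitz_on UNIV D"
    and "\<exists>C. C-lipschitz_on UNIV (\<lambda>x. matrix_inv (D x))"
    and "0 < D1"
    and "\<And>x. x \<in> closure \<Omega> \<Longrightarrow> D1 \<le> \<bar>det (D x)\<bar> \<and> \<bar>det (D x)\<bar> \<le> D2"
    and "0 < r" and "r < 1"
    and "\<And>k. 0 < \<epsilon> k" and "\<epsilon> \<longlonglongrightarrow> 0"
    and "\<And>k. cube_covering \<Omega> (\<epsilon> k powr r) (N k) (Q k)"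
    and "\<And>k n. n \<in> {1..N k} \<Longrightarrow> p k n \<in> Q k n \<inter> \<Omega>"
    and "\<And>k n. n \<in> {1..N k} \<Longrightarrow>
           q k n \<in> Q k n \<inter> \<Omega> \<or> (\<exists>m. integer_vector m \<and> q k n = D (p k n) *v (\<epsilon> k *\<^sub>R m))"
    and "\<And>k. u k \<in> H1 \<Omega>"
    and "\<exists>B. \<forall>k. H1_norm \<Omega> (u k) \<le> B"
    and "H1_weakly_converges \<Omega> u u0"
  shows "lts_converges \<Omega> D (\<lambda>k. lp_approx D (\<epsilon> k) (N k) (Q k) (p k) (q k)) u (\<lambda>x y. u0 x)
    \<and> (\<exists>\<phi> f. strict_mono (\<phi> :: nat \<Rightarrow> nat) \<and> f \<in> L2_H1_per_quotient \<Omega> \<and>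
        (\<forall>i. lts_converges \<Omega> D
               (\<lambda>k. lp_approx D (\<epsilon> (\<phi> k)) (N (\<phi> k)) (Q (\<phi> k)) (p (\<phi> k)) (q (\<phi> k)))
               (\<lambda>k x. weak_gradient \<Omega> (u (\<phi> k)) x $ i)
               (\<lambda>x y. weak_gradient \<Omega> u0 x $ i + weak_gradient UNIV (on_cells D f x) y $ i)))"
proof -
 have op: "open \<Omega>" and bd: "bounded \<Omega>" using assms(1) by (simp_all add: bounded_lipschitz_domain_def)
 interpret lp_setting \<Omega> D r \<epsilon> N Q p q
  by (rule lp_setting.intro[OF op bd assms(2,3,4,7,8,9,10,11,12)])
 obtain B where B: "!!k. H1_norm \<Omega> (u k) <= B" using assms(15) by blast
 note H = H1D[OF op assms(14)]
 have u0: "u0 : H1 \<Omega>" and weak: "!!l. l : H1_dual \<Omega> ==> (%k. l (u k)) ~~> l u0"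
  using assms(16) unfolding H1_weakly_converges_def by blast+
 note H0 = H1D[OF op u0]
 have uB: "norm2 mu (u k) <= B" "norm2 mu (weak_gradient \<Omega> (u k)) <= B" for k
  using H(4,5)[of k] B[of k] by linarith+
 have comp: "sq_int mu (%x. h x $ i)" "norm2 mu (%x. h x $ i) <= norm2 mu h" if "sq_int mu h" for h :: "real^'d => real^'d" and i
 proof -
  show *: "sq_int mu (%x. h x $ i)" using sq_int_inner_const[OF that, of "axis i 1"] by (simp add: inner_axis)
  show "norm2 mu (%x. h x $ i) <= norm2 mu h"
   by (rule norm2_mono[OF that sq_int_measurable[OF *] AE_I2]) (rule norm_nth)
 qed
 have "lts_converges \<Omega> D L u (%x y. u0 x)"
 proof (rule lts_convergesI[OF H(2) uB(1)])
  show "(%x z. u0 x) : L2_L2 \<Omega>" by (rule L2_L2_const[OF H0(2)])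
  fix a :: "real^'d => real" and m :: "real^'d" and th :: real assume a: "sq_int mu a" and m: "integer_vector m"
  have R: "(LINT z|nu. u0 x * tcos m th z) = u0 x * (if m = 0 then cos th else 0)" for x
   by (simp add: integral_tcos[OF m])
  show "(%k. LINT x|mu. (u k x * osc k m th x) * a x) ~~> (LINT x|mu. a x * (LINT z|nu. u0 x * tcos m th z))"
  proof (cases "m = 0")
   \<comment> \<open>On the zero mode the oscillating function is almost everywhere the constant
     \<open>cos th\<close>, and plain weak convergence suffices; for all other modes both sides tend
     to 0.\<close>
   case True
   have "(LINT x|mu. a x * (LINT z|nu. u0 x * tcos m th z)) = (LINT x|mu. cos th * (u0 x * a x))"
    unfolding R using True by (simp add: ac_simps)
   moreover have "(%k. cos th * (LINT x|mu. u k x * a x)) ~~> cos th * (LINT x|mu. u0 x * a x)"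
    by (rule tendsto_mult[OF tendsto_const weak[OF pairing_H1_dual(1)[OF op a]]])
   ultimately show ?thesis using True by (simp add: osc_0_integral[OF H(2) a])
  next
   case False
   show ?thesis unfolding R using osc_weak_limit[OF False H(1,2,3) uB a] False by simp
  qed
 qed
 moreover have "\<exists>ph f. strict_mono (ph :: nat => nat) & f : L2_H1_per_quotient \<Omega> &
  (\<forall>i. (%x z. weak_gradient \<Omega> u0 x $ i + weak_gradient UNIV (on_cells D f x) (D x *v z) $ i) : L2_L2 \<Omega> &
   (\<forall>a m th. sq_int mu a --> integer_vector m -->
    (%k. LINT x|mu. (weak_gradient \<Omega> (u (ph k)) x $ i * osc (ph k) m th x) * a x) ~~>
    (LINT x|mu. a x * (LINT z|nu.
     (weak_gradient \<Omega> u0 x $ i + weak_gradient UNIV (on_cells D f x) (D x *v z) $ i) * tcos m th z))))"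
  by (rule gradient_two_scale_limit[OF H(1,2,3) uB(2) H0(3)]) (rule weak[OF pairing_H1_dual(2)[OF op]])
 then obtain ph f where ph: "strict_mono (ph :: nat => nat)" and f: "f : L2_H1_per_quotient \<Omega>"
  and W: "!!i. (%x z. weak_gradient \<Omega> u0 x $ i + weak_gradient UNIV (on_cells D f x) (D x *v z) $ i) : L2_L2 \<Omega>"
  and lim: "!!i a m th. sq_int mu a ==> integer_vector m ==>
   (%k. LINT x|mu. (weak_gradient \<Omega> (u (ph k)) x $ i * osc (ph k) m th x) * a x) ~~>
   (LINT x|mu. a x * (LINT z|nu.
    (weak_gradient \<Omega> u0 x $ i + weak_gradient UNIV (on_cells D f x) (D x *v z) $ i) * tcos m th z))"
  by blast
 have \<epsilon>ph: "(%k. \<epsilon> (ph k)) ~~> 0" using LIMSEQ_subseq_LIMSEQ[OF assms(10) ph] by (simp add: o_def)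
 \<comment> \<open>The plane-wave limits were obtained for the original scales sampled along
   \<open>ph\<close>; they are now the hypotheses of \<open>lts_convergesI\<close> for the extracted
   scales.\<close>
 interpret sub: lp_setting \<Omega> D r "%k. \<epsilon> (ph k)" "%k. N (ph k)" "%k. Q (ph k)" "%k. p (ph k)" "%k. q (ph k)"
  by (rule lp_setting.intro[OF op bd assms(2,3,4,7,8,9) \<epsilon>ph assms(11,12)])
 have osc: "sub.osc k m th = osc (ph k) m th" for k m th by (simp only: sub.osc_def osc_def)
 have "lts_converges \<Omega> D (%k. lp_approx D (\<epsilon> (ph k)) (N (ph k)) (Q (ph k)) (p (ph k)) (q (ph k)))
   (%k x. weak_gradient \<Omega> (u (ph k)) x $ i)
   (%x y. weak_gradient \<Omega> u0 x $ i + weak_gradient UNIV (on_cells D f x) y $ i)" for i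
  by (rule sub.lts_convergesI[OF comp(1)[OF H(3)] order_trans[OF comp(2)[OF H(3)] uB(2)] W])
   (unfold osc, rule lim)
 ultimately show ?thesis using ph f by blast
qed

end
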